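(* Let $(W,\mathcal{S})$ be a world sheet in $\mathbb{R}^3_1$ parametrized by a timelike embedding $\mathbf{\Gamma}:J\times I\to\mathbb{R}^3_1$ ($J,I\subset\mathbb{R}$ open intervals), with momentary curves $\mathcal{S}_t=\mathbf{\Gamma}(J\times\{t\})$, where $s\in J$ is the arc-length parameter of each $\mathcal{S}_t$. Let $G:J\times I\times\mathbb{R}^3_1\to\mathbb{R}$, $G(s,t,\boldsymbol{\lambda})=\langle\mathbf{\Gamma}(s,t)-\boldsymbol{\lambda},\mathbf{\Gamma}(s,t)-\boldsymbol{\lambda}\rangle$, be the Lorentz distance-squared function, and suppose that the graph-like Legendrian unfolding $\mathscr{L}_G(\Sigma_*(G))\subset J^1(\mathbb{R}^3_1,I)$ is $S.P^+$-Legendrian stable (at every point of $\Sigma_*(G)$). Then the total BR-caustic $C(W,\mathcal{S})$ of $(W,\mathcal{S})$ at a singular point is locally diffeomorphic to the cuspidal edge $\mathbf{CE}=\{(u,v^2,v^3)\mid(u,v)\in\mathbb{R}^2\}$ or the swallowtail $\mathbf{SW}=\{(3u^4+u^2v,4u^3+2uv,v)\mid(u,v)\in\mathbb{R}^2\}$ (at the origin).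
   Context: All maps are $C^\infty$. $\mathbb{R}^3_1$ is $\mathbb{R}^3$ with $\langle x,y\rangle=-x_0y_0+x_1y_1+x_2y_2$; a nonzero vector $x$ is spacelike, lightlike or timelike if $\langle x,x\rangle>0$, $=0$, $<0$. $\mathbf{e}_0=(1,0,0)$; a timelike vector $v$ is future directed if $\langle v,\mathbf{e}_0\rangle<0$. World sheet: an embedding $\mathbf{\Gamma}:J\times I\to\mathbb{R}^3_1$ with image $W$ such that every tangent plane $T_pW$ is timelike (its pseudo-normal is spacelike), $W$ is time-orientable, and each curve $\mathcal{S}_t=\mathbf{\Gamma}(J\times\{t\})$ is spacelike; $\mathcal{S}=\{\mathcal{S}_t\}_{t\in I}$. $\mathbf{n}^S(s,t)$ denotes a smooth unit (spacelike) pseudo-normal field of $W$, and $\mathbf{n}^T(s,t)$ the unique future directed unit timelike vector tangent to $W$ and pseudo-orthogonal to $\mathcal{S}_t$ at $\mathbf{\Gamma}(s,t)$. Put $\kappa^\pm(s,t)=-\langle\partial_s(\mathbf{n}^T\pm\mathbf{n}^S),\partial_s\mathbf{\Gamma}\rangle(s,t)$. The lightlike focal sets of $\mathcal{S}_t$ are $\mathbb{LF}^\pm_{\mathcal{S}_t}=\{\mathbf{\Gamma}(s,t)+\frac{1}{\kappa^\pm(s,t)}(\mathbf{n}^T\pm\mathbf{n}^S)(s,t)\mid s\in J,\ \kappa^\pm(s,t)\ne0\}$. The total BR-caustic is $C(W,\mathcal{S})=\bigcup_{t\in I}(\mathbb{LF}^+_{\mathcal{S}_t}\cup\mathbb{LF}^-_{\mathcal{S}_t})\subset\mathbb{R}^3_1$.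 A singular point of $C(W,\mathcal{S})$ is a point of this set near which it is not a regular surface. Locally diffeomorphic means that a diffeomorphism germ of the ambient 3-spaces carries one set germ to the other. $\Sigma_*(G)=\{(s,t,\boldsymbol{\lambda})\mid \boldsymbol{\lambda}\neq\mathbf{\Gamma}(s,t),\ G=\partial G/\partial s=0\}$, a smooth 3-manifold; on it $\partial G/\partial t\neq0$. $J^1(\mathbb{R}^3_1,I)$ has coordinates $(\boldsymbol{\lambda},t,p)$ with contact form $dt-\sum_{j=0}^2p_jd\lambda_j$. The map $\mathscr{L}_G:\Sigma_*(G)\to J^1(\mathbb{R}^3_1,I)$ is $\mathscr{L}_G(s,t,\boldsymbol{\lambda})=\left(\boldsymbol{\lambda},t,\left(-\frac{\partial G/\partial\lambda_j}{\partial G/\partial t}(s,t,\boldsymbol{\lambda})\right)_{j=0,1,2}\right)$; it is a Legendrian immersion whose image is called the graph-like Legendrian unfolding. $S.P^+$-Legendrian stability at $(s_0,t_0,\boldsymbol{\lambda}_0)\in\Sigma_*(G)$ means (using the known characterization as the definition) that $G$ is an infinitesimally $S.P^+$-$\mathcal{K}$-versal unfolding of $g(s,t)=G(s,t,\boldsymbol{\lambda}_0)$ at $(s_0,t_0)$: with $\mathcal{E}$ the ring of $C^\infty$ function germs in $(s,t)$ at $(s_0,t_0)$, $$\mathcal{E}=\left\langle\frac{\partial g}{\partial s},g\right\rangle_{\mathcal{E}}+\left\langle\frac{\partial g}{\partial t}\right\rangle_{\mathbb{R}}+\left\langle\frac{\partial G}{\partial\lambda_0}(\cdot,\cdot,\boldsymbol{\lambda}_0),\frac{\partial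 G}{\partial\lambda_1}(\cdot,\cdot,\boldsymbol{\lambda}_0),\frac{\partial G}{\partial\lambda_2}(\cdot,\cdot,\boldsymbol{\lambda}_0)\right\rangle_{\mathbb{R}}.$$
   Formalization: "The total BR-caustic at a singular point" is read as the caustic of the world sheet restricted to small parameter intervals around a parameter of that point; for the whole set the claim fails where different sheets cross, e.g. along the double curve of a swallowtail. *)

theory Defs
  imports "HOL-Analysis.Analysis"
begin

section \<open>Smooth maps, surfaces and set germs\<close>

text \<open>Derivatives are two-sided ones, so \<open>C_k_on\<close> and \<open>smooth_on\<close> are only meant for open sets.\<close>

primrec C_k_on :: "nat \<Rightarrow> 'a::euclidean_space set \<Rightarrow> ('a \<Rightarrow> 'b::euclidean_space) \<Rightarrow> bool" where
  "C_k_on 0 S f = continuous_on S f"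
| "C_k_on (Suc k) S f =
     ((\<forall>x\<in>S. f differentiable (at x)) \<and> (\<forall>v. C_k_on k S (\<lambda>x. frechet_derivative f (at x) v)))"

definition smooth_on :: "'a::euclidean_space set \<Rightarrow> ('a \<Rightarrow> 'b::euclidean_space) \<Rightarrow> bool" where
  "smooth_on S f \<longleftrightarrow> (\<forall>k. C_k_on k S f)"

definition smooth_near :: "'a::euclidean_space \<Rightarrow> ('a \<Rightarrow> 'b::euclidean_space) \<Rightarrow> bool" where
  "smooth_near x f \<longleftrightarrow> (\<exists>U. open U \<and> x \<in> U \<and> smooth_on U f)"

definition smooth_embedding :: "'a::euclidean_space set \<Rightarrow> ('a \<Rightarrow> 'b::euclidean_space) \<Rightarrow> bool" where
  "smooth_embedding U f \<longleftrightarrow>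
     smooth_on U f \<and> (\<forall>x\<in>U. inj (frechet_derivative f (at x))) \<and>
     (\<exists>g. homeomorphism U (f ` U) f g)"

definition regular_surface_near :: "(real^3) set \<Rightarrow> real^3 \<Rightarrow> bool" where
  "regular_surface_near C x \<longleftrightarrow>
     (\<exists>V (U :: (real \<times> real) set) f.
        open V \<and> x \<in> V \<and> open U \<and> smooth_embedding U f \<and> f ` U = C \<inter> V)"

definition singular_point :: "(real^3) set \<Rightarrow> real^3 \<Rightarrow> bool" where
  "singular_point C x \<longleftrightarrow> x \<in> C \<and> \<not> regular_surface_near C x"

definition locally_diffeomorphic :: "(real^3) set \<Rightarrow> real^3 \<Rightarrow> (real^3) set \<Rightarrow> real^3 \<Rightarrow> bool" where
  "locally_diffeomorphic X x Y y \<longleftrightarrow>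
     (\<exists>U V \<phi> \<psi>. open U \<and> x \<in> U \<and> open V \<and> y \<in> V \<and>
        smooth_on U \<phi> \<and> smooth_on V \<psi> \<and> \<phi> ` U = V \<and> \<psi> ` V = U \<and>
        (\<forall>z\<in>U. \<psi> (\<phi> z) = z) \<and> (\<forall>z\<in>V. \<phi> (\<psi> z) = z) \<and>
        \<phi> x = y \<and> \<phi> ` (X \<inter> U) = Y \<inter> V)"

text \<open>The index type \<open>3\<close> has exactly the elements 0, 1, 2 (with 3 = 0), so the coordinates
  of a vector \<open>x\<close> are \<open>x $ 0\<close>, \<open>x $ 1\<close>, \<open>x $ 2\<close>.\<close>

definition vec3 :: "real \<Rightarrow> real \<Rightarrow> real \<Rightarrow> real^3" where
  "vec3 a b c = (\<chi> i. if i = 0 then a else if i = 1 then b else c)"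

definition cuspidal_edge :: "(real^3) set" where
  "cuspidal_edge = {vec3 u (v^2) (v^3) | u v. True}"

definition swallowtail :: "(real^3) set" where
  "swallowtail = {vec3 (3 * u^4 + u^2 * v) (4 * u^3 + 2 * u * v) v | u v. True}"

section \<open>Lorentz-Minkowski 3-space\<close>

definition lorentz :: "real^3 \<Rightarrow> real^3 \<Rightarrow> real" where
  "lorentz x y = - (x $ 0) * (y $ 0) + (x $ 1) * (y $ 1) + (x $ 2) * (y $ 2)"

definition spacelike :: "real^3 \<Rightarrow> bool" where
  "spacelike x \<longleftrightarrow> lorentz x x > 0"

definition timelike :: "real^3 \<Rightarrow> bool" where
  "timelike x \<longleftrightarrow> lorentz x x < 0"

definition future_directed :: "real^3 \<Rightarrow> bool" where
  "future_directed v \<longleftrightarrow> timelike v \<and> lorentz v (axis 0 1) < 0"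

definition timelike_plane :: "(real^3) set \<Rightarrow> bool" where
  "timelike_plane T \<longleftrightarrow> (\<forall>v. v \<noteq> 0 \<and> (\<forall>w\<in>T. lorentz v w = 0) \<longrightarrow> spacelike v)"

section \<open>World sheets\<close>

definition partial_s :: "(real \<times> real \<Rightarrow> 'b::real_normed_vector) \<Rightarrow> real \<times> real \<Rightarrow> 'b" where
  "partial_s f = (\<lambda>(s, t). vector_derivative (\<lambda>x. f (x, t)) (at s))"

definition partial_t :: "(real \<times> real \<Rightarrow> 'b::real_normed_vector) \<Rightarrow> real \<times> real \<Rightarrow> 'b" where
  "partial_t f = (\<lambda>(s, t). vector_derivative (\<lambda>x. f (s, x)) (at t))"

definition open_interval :: "real set \<Rightarrow> bool" where
  "open_interval A \<longleftrightarrow> open A \<and> is_interval A \<and> A \<noteq> {}"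

definition tangent_plane :: "(real \<times> real \<Rightarrow> real^3) \<Rightarrow> real \<times> real \<Rightarrow> (real^3) set" where
  "tangent_plane \<Gamma> p = range (frechet_derivative \<Gamma> (at p))"

definition time_orientable :: "real set \<Rightarrow> real set \<Rightarrow> (real \<times> real \<Rightarrow> real^3) \<Rightarrow> bool" where
  "time_orientable J I \<Gamma> \<longleftrightarrow>
     (\<exists>X. smooth_on (J \<times> I) X \<and> (\<forall>p\<in>J \<times> I. X p \<in> tangent_plane \<Gamma> p \<and> timelike (X p)))"

definition world_sheet :: "real set \<Rightarrow> real set \<Rightarrow> (real \<times> real \<Rightarrow> real^3) \<Rightarrow> bool" where
  "world_sheet J I \<Gamma> \<longleftrightarrow>
     open_interval J \<and> open_interval I \<and> smooth_embedding (J \<times> I) \<Gamma> \<and>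
     (\<forall>p\<in>J \<times> I. timelike_plane (tangent_plane \<Gamma> p)) \<and>
     time_orientable J I \<Gamma> \<and>
     (\<forall>p\<in>J \<times> I. spacelike (partial_s \<Gamma> p))"

definition arc_length_parametrized :: "real set \<Rightarrow> real set \<Rightarrow> (real \<times> real \<Rightarrow> real^3) \<Rightarrow> bool" where
  "arc_length_parametrized J I \<Gamma> \<longleftrightarrow>
     (\<forall>p\<in>J \<times> I. lorentz (partial_s \<Gamma> p) (partial_s \<Gamma> p) = 1)"

definition unit_pseudo_normal_field ::
    "real set \<Rightarrow> real set \<Rightarrow> (real \<times> real \<Rightarrow> real^3) \<Rightarrow> (real \<times> real \<Rightarrow> real^3) \<Rightarrow> bool" where
  "unit_pseudo_normal_field J I \<Gamma> nS \<longleftrightarrow>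
     smooth_on (J \<times> I) nS \<and>
     (\<forall>p\<in>J \<times> I. lorentz (nS p) (nS p) = 1 \<and> (\<forall>w\<in>tangent_plane \<Gamma> p. lorentz (nS p) w = 0))"

definition nT :: "(real \<times> real \<Rightarrow> real^3) \<Rightarrow> real \<times> real \<Rightarrow> real^3" where
  "nT \<Gamma> p = (THE v. v \<in> tangent_plane \<Gamma> p \<and> lorentz v (partial_s \<Gamma> p) = 0 \<and>
                    lorentz v v = - 1 \<and> future_directed v)"

section \<open>Lightlike focal sets and the total BR-caustic\<close>

text \<open>The sign superscript of the lightlike objects is a real parameter \<open>\<epsilon>\<close>, equal to 1 or -1.\<close>

definition kappa ::
    "real \<Rightarrow> (real \<times> real \<Rightarrow> real^3) \<Rightarrow> (real \<times> real \<Rightarrow> real^3) \<Rightarrow> real \<times> real \<Rightarrow> real" where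
  "kappa \<epsilon> \<Gamma> nS p = - lorentz (partial_s (\<lambda>q. nT \<Gamma> q + \<epsilon> *\<^sub>R nS q) p) (partial_s \<Gamma> p)"

definition focal_point ::
    "real \<Rightarrow> (real \<times> real \<Rightarrow> real^3) \<Rightarrow> (real \<times> real \<Rightarrow> real^3) \<Rightarrow> real \<times> real \<Rightarrow> real^3" where
  "focal_point \<epsilon> \<Gamma> nS p = \<Gamma> p + (1 / kappa \<epsilon> \<Gamma> nS p) *\<^sub>R (nT \<Gamma> p + \<epsilon> *\<^sub>R nS p)"

definition lightlike_focal_set ::
    "real \<Rightarrow> real set \<Rightarrow> (real \<times> real \<Rightarrow> real^3) \<Rightarrow> (real \<times> real \<Rightarrow> real^3) \<Rightarrow> real \<Rightarrow> (real^3) set" where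
  "lightlike_focal_set \<epsilon> J \<Gamma> nS t =
     {focal_point \<epsilon> \<Gamma> nS (s, t) | s. s \<in> J \<and> kappa \<epsilon> \<Gamma> nS (s, t) \<noteq> 0}"

text \<open>The intervals are arguments because a singular point of the total caustic is understood at
  the level of germs: it is a point \<open>focal_point \<epsilon> \<Gamma> nS (s, t)\<close>, and the caustic at this point is
  the caustic of the world sheets obtained by restricting \<open>\<Gamma>\<close> to small \<open>J1 \<times> I1\<close> around \<open>(s, t)\<close>.
  The set \<open>total_BR_caustic J I \<Gamma> nS\<close> itself also has crossings of sheets belonging to
  different parameters (already along the double curve of a swallowtail, arbitrarily close to the
  swallowtail point); there it is not a regular surface and it is neither of the two models.\<close>

definition total_BR_caustic ::
    "real set \<Rightarrow> real set \<Rightarrow> (real \<times> real \<Rightarrow> real^3) \<Rightarrow> (real \<times> real \<Rightarrow> real^3) \<Rightarrow> (real^3) set" where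
  "total_BR_caustic J I \<Gamma> nS =
     (\<Union>t\<in>I. lightlike_focal_set 1 J \<Gamma> nS t \<union> lightlike_focal_set (- 1) J \<Gamma> nS t)"

section \<open>The Lorentz distance-squared function and Legendrian stability\<close>

definition dist_sq :: "(real \<times> real \<Rightarrow> real^3) \<Rightarrow> real \<times> real \<Rightarrow> real^3 \<Rightarrow> real" where
  "dist_sq \<Gamma> p l = lorentz (\<Gamma> p - l) (\<Gamma> p - l)"

definition Sigma_star ::
    "real set \<Rightarrow> real set \<Rightarrow> (real \<times> real \<Rightarrow> real^3) \<Rightarrow> ((real \<times> real) \<times> (real^3)) set" where
  "Sigma_star J I \<Gamma> =
     {(p, l). p \<in> J \<times> I \<and> l \<noteq> \<Gamma> p \<and> dist_sq \<Gamma> p l = 0 \<and> partial_s (\<lambda>q. dist_sq \<Gamma> q l) p = 0}"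

definition partial_lambda ::
    "(real \<times> real \<Rightarrow> real^3 \<Rightarrow> real) \<Rightarrow> 3 \<Rightarrow> real \<times> real \<Rightarrow> real^3 \<Rightarrow> real" where
  "partial_lambda G j p l = frechet_derivative (G p) (at l) (axis j 1)"

text \<open>Germs at \<open>p0\<close> are represented by functions that are smooth near \<open>p0\<close>, equality of germs
  being equality near \<open>p0\<close>.\<close>

definition inf_SPplus_K_versal ::
    "(real \<times> real \<Rightarrow> real^3 \<Rightarrow> real) \<Rightarrow> real \<times> real \<Rightarrow> real^3 \<Rightarrow> bool" where
  "inf_SPplus_K_versal G p0 l0 \<longleftrightarrow>
     (\<forall>h :: real \<times> real \<Rightarrow> real. smooth_near p0 h \<longrightarrow>
       (\<exists>a b (c :: real) (d :: real^3). smooth_near p0 a \<and> smooth_near p0 b \<and>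
         (\<forall>\<^sub>F p in nhds p0.
            h p = a p * partial_s (\<lambda>q. G q l0) p + b p * G p l0
                  + c * partial_t (\<lambda>q. G q l0) p
                  + (\<Sum>j\<in>UNIV. d $ j * partial_lambda G j p l0))))"

text \<open>Stability of the graph-like Legendrian unfolding is, by definition, versality of its
  generating family at the points of \<open>Sigma_star\<close>.\<close>

definition SPplus_Legendrian_stable ::
    "real set \<Rightarrow> real set \<Rightarrow> (real \<times> real \<Rightarrow> real^3) \<Rightarrow> bool" where
  "SPplus_Legendrian_stable J I \<Gamma> \<longleftrightarrow>
     (\<forall>(p0, l0)\<in>Sigma_star J I \<Gamma>. inf_SPplus_K_versal (dist_sq \<Gamma>) p0 l0)"

end

theory Submission
  imports Defs "HOL-Complex_Analysis.Cauchy_Integral_Formula" "HOL-Computational_Algebra.Fundamental_Theorem_Algebra"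
begin

text \<open>Near a point of the caustic the zero set of the distance-squared function \<open>G\<close> is the graph of a
  function \<open>t = \<phi> (\<lambda>, s)\<close>, and \<open>\<lambda>\<close> lies on the caustic when \<open>h = \<partial>\<phi>/\<partial>s\<close> has a multiple zero in \<open>s\<close>.
  Differentiating the versality condition along \<open>G = 0\<close> shows that \<open>h\<close> has order \<open>k \<in> {2, 3, 4}\<close> in \<open>s\<close> at
  the base point and that, once \<open>h\<close> is prepared as a unit times \<open>y\<^sup>k + \<Sum>i<k. P i \<lambda> * y\<^sup>i\<close>, the
  coefficients \<open>P 0, \<dots>, P (k - 2)\<close> have independent differentials. The caustic is therefore a diffeomorphic copy of
  the set of polynomials with a real double root (times a line or a plane): a plane, the cuspidal
  edge and the swallowtail for \<open>k = 2, 3, 4\<close>.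

  The preparation theorem for smooth functions of order at most \<open>4\<close> follows from smooth division by the
  generic quartic. The dividend is expanded into a Fourier series, and each \<open>exp (\<i> n x)\<close> is divided by Cauchy's
  formula on a rectangle of height of order \<open>1/n\<close> whose sides avoid the complex roots of the quartic. The
  height depends on the quartic; patching the choices over a lattice of mesh of order \<open>1/n\<^sup>4\<close> in the space of
  quartics costs only powers of \<open>n\<close>, which the rapidly decreasing Fourier coefficients absorb.\<close>


section \<open>Calculus of smooth maps\<close>

text \<open>Two restrictions of the stability condition shape the argument. On \<open>G = 0\<close>
  the multiple of \<open>G\<close> drops out, and at a focal point \<open>G_t\<close> is nonzero, so
  division by it turns the real multiple of \<open>G_t\<close> into a constant; one derivative along
  the curve kills that constant and leaves an identity between \<open>h\<close> and its derivatives
  in directions \<open>d i\<close> of the ambient space. As this space has only three independent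
  directions, the four monomials 1, y, y^2, y^3 cannot all be compensated if \<open>h\<close>
  vanishes to order 5. This caps the order at 4, and so a quartic divisor is enough. The coefficient
  of y^(k-1) escapes the argument, but a translation of the root variable removes it. The obstacle
  in the division theorem is that the roots of a quartic do not depend smoothly on its coefficients
  and may reach any fixed contour. The contour is therefore allowed to jump between nearby quartics.
  This does no harm, since the division identity is linear in quotient and remainder and survives
  averaging by a partition of unity. Cauchy's formula on varying contours wants entire dividends,
  which the Fourier expansion supplies.\<close>

lemma has_derivative_frechet:
  "f differentiable (at x) \<Longrightarrow> (f has_derivative frechet_derivative f (at x)) (at x)"
  using frechet_derivative_works by blast

lemma frechet_derivative_eqI:
  "(f has_derivative f') (at x) \<Longrightarrow> frechet_derivative f (at x) = f'"
  by (simp add: frechet_derivative_at[symmetric])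

section \<open>Functions of class C^k\<close>

lemma C_k_on_cong:
  assumes "open S" "\<And>x. x \<in> S \<Longrightarrow> f x = g x" "C_k_on k S f"
  shows "C_k_on k S g"
  using assms(2,3)
proof (induction k arbitrary: f g)
  case 0
  then show ?case by (metis C_k_on.simps(1) continuous_on_cong)
next
  case (Suc k)
  have der: "(g has_derivative frechet_derivative f (at x)) (at x)" if "x \<in> S" for x
  proof (rule has_derivative_transform_within_open[OF _ \<open>open S\<close> that])
    show "(f has_derivative frechet_derivative f (at x)) (at x)"
      using Suc.prems(2) that by (intro has_derivative_frechet) auto
  qed (use Suc in auto)
  have "C_k_on k S (\<lambda>x. frechet_derivative g (at x) v)" for v
  proof (rule Suc.IH)
    show "C_k_on k S (\<lambda>x. frechet_derivative f (at x) v)"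
      using Suc.prems by simp
  qed (use der frechet_derivative_eqI in metis)
  then show ?case
    using der by (auto simp: differentiable_def)
qed

lemma C_k_on_subset: "C_k_on k S f \<Longrightarrow> T \<subseteq> S \<Longrightarrow> C_k_on k T f"
  by (induction k arbitrary: f) (auto intro: continuous_on_subset)

lemma C_k_on_imp_continuous_on: "C_k_on k S f \<Longrightarrow> continuous_on S f"
  by (cases k) (auto intro!: differentiable_imp_continuous_on simp: differentiable_on_def differentiable_at_withinI)

lemma C_k_on_SucD: "C_k_on (Suc k) S f \<Longrightarrow> C_k_on k S f"
proof (induction k arbitrary: f)
  case 0
  then show ?case by (metis C_k_on.simps(1) C_k_on_imp_continuous_on)
next
  case (Suc k)
  then show ?case by (metis C_k_on.simps(2))
qed

lemma C_k_on_const [simp]: "C_k_on k S (\<lambda>x. c)"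
  by (induction k arbitrary: c) auto

text \<open>Derivatives computed by hand may be used in place of \<open>frechet_derivative\<close>,
  with which they agree on the open set \<open>S\<close>.\<close>

lemma C_k_on_DI:
  assumes "open S" "\<And>x. x \<in> S \<Longrightarrow> (f has_derivative f' x) (at x)" "\<And>v. C_k_on k S (\<lambda>x. f' x v)"
  shows "C_k_on (Suc k) S f"
proof -
  have "C_k_on k S (\<lambda>x. frechet_derivative f (at x) v)" for v
    by (rule C_k_on_cong[OF assms(1) _ assms(3)[of v]]) (use assms(2) frechet_derivative_eqI in metis)
  then show ?thesis
    using assms(2) by (auto simp: differentiable_def)
qed

lemma C_k_on_add:
  assumes "open S" "C_k_on k S f" "C_k_on k S g"
  shows "C_k_on k S (\<lambda>x. f x + g x)"
  using assms(2,3)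
proof (induction k arbitrary: f g)
  case 0
  then show ?case by (auto intro: continuous_intros)
next
  case (Suc k)
  show ?case
  proof (rule C_k_on_DI[OF assms(1)])
    show "((\<lambda>x. f x + g x) has_derivative
        (\<lambda>v. frechet_derivative f (at x) v + frechet_derivative g (at x) v)) (at x)" if "x \<in> S" for x
      using Suc.prems that by (intro has_derivative_add has_derivative_frechet) auto
  qed (use Suc in auto)
qed

lemma C_k_on_sum:
  assumes "open S" "\<And>i. i \<in> A \<Longrightarrow> C_k_on k S (f i)"
  shows "C_k_on k S (\<lambda>x. \<Sum>i\<in>A. f i x)"
  using assms(2)
proof (induction A rule: infinite_finite_induct)
  case (insert i A)
  then show ?case by (simp add: C_k_on_add assms(1))
qed auto

lemma C_k_on_bounded_bilinear:
  assumes "open S" "bounded_bilinear pr" "C_k_on k S f" "C_k_on k S g"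
  shows "C_k_on k S (\<lambda>x. pr (f x) (g x))"
  using assms(3,4)
proof (induction k arbitrary: f g)
  case 0
  then show ?case using assms(2) by (auto intro: bounded_bilinear.continuous_on)
next
  case (Suc k)
  show ?case
  proof (rule C_k_on_DI[OF assms(1)])
    show "((\<lambda>x. pr (f x) (g x)) has_derivative
        (\<lambda>v. pr (f x) (frechet_derivative g (at x) v) + pr (frechet_derivative f (at x) v) (g x))) (at x)"
      if "x \<in> S" for x
      using Suc.prems that
      by (intro bounded_bilinear.FDERIV[OF assms(2)] has_derivative_frechet) auto
    show "C_k_on k S (\<lambda>x. pr (f x) (frechet_derivative g (at x) v) + pr (frechet_derivative f (at x) v) (g x))" for v
      using Suc by (intro C_k_on_add[OF assms(1)] Suc.IH) (auto intro: C_k_on_SucD)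
  qed
qed

lemma C_k_on_bounded_linear:
  assumes "open S" "bounded_linear L" "C_k_on k S f"
  shows "C_k_on k S (\<lambda>x. L (f x))"
  using assms(3)
proof (induction k arbitrary: f)
  case 0
  then show ?case using assms(2) by (auto intro: bounded_linear.continuous_on)
next
  case (Suc k)
  show ?case
  proof (rule C_k_on_DI[OF assms(1)])
    show "((\<lambda>x. L (f x)) has_derivative (\<lambda>v. L (frechet_derivative f (at x) v))) (at x)"
      if "x \<in> S" for x
      using Suc.prems that
      by (intro bounded_linear.has_derivative[OF assms(2)] has_derivative_frechet) auto
  qed (use Suc in auto)
qed

lemma C_k_on_id: "C_k_on k S (\<lambda>x. x)"
proof (cases k)
  case (Suc j)
  have "frechet_derivative (\<lambda>x::'a. x) (at x) v = v" for x v
    by (metis frechet_derivative_eqI has_derivative_ident)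
  then show ?thesis using Suc by simp
qed (auto intro: continuous_intros)

lemma linear_Basis_expand:
  fixes L :: "'a::euclidean_space \<Rightarrow> 'b::real_vector"
  assumes "linear L"
  shows "L v = (\<Sum>b\<in>Basis. (v \<bullet> b) *\<^sub>R L b)"
proof -
  have "L v = L (\<Sum>b\<in>Basis. (v \<bullet> b) *\<^sub>R b)" by (simp add: euclidean_representation)
  also have "\<dots> = (\<Sum>b\<in>Basis. (v \<bullet> b) *\<^sub>R L b)"
    using assms by (simp add: linear_sum linear_scale)
  finally show ?thesis .
qed

text \<open>Basis directions suffice: by linearity every other direction is a fixed finite
  combination of them.\<close>

lemma C_k_on_SucI:
  fixes f :: "'a::euclidean_space \<Rightarrow> 'b::euclidean_space"
  assumes "open S" "\<And>x. x \<in> S \<Longrightarrow> (f has_derivative f' x) (at x)"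
    "\<And>b. b \<in> Basis \<Longrightarrow> C_k_on k S (\<lambda>x. f' x b)"
  shows "C_k_on (Suc k) S f"
proof (rule C_k_on_DI[OF assms(1,2)])
  fix v
  have "C_k_on k S (\<lambda>x. \<Sum>b\<in>Basis. (v \<bullet> b) *\<^sub>R f' x b)"
    using assms(1,3)
    by (intro C_k_on_sum C_k_on_bounded_linear[OF assms(1) bounded_linear_scaleR_right]) auto
  then show "C_k_on k S (\<lambda>x. f' x v)"
    by (rule C_k_on_cong[OF assms(1), rotated])
      (simp add: linear_Basis_expand[OF has_derivative_linear[OF assms(2)], of _ v])
qed

text \<open>In the chain rule the direction fed to the derivative of \<open>f\<close> varies with
  \<open>x\<close>. Expanding it over \<open>Basis\<close> leaves a finite sum of products of a
  component of the derivative of \<open>g\<close> with a fixed directional derivative of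
  \<open>f\<close> at \<open>g x\<close>, and the induction hypothesis covers the latter.\<close>

lemma C_k_on_compose:
  fixes g :: "'a::euclidean_space \<Rightarrow> 'b::euclidean_space" and f :: "'b \<Rightarrow> 'c::euclidean_space"
  assumes "open S" "open T" "g ` S \<subseteq> T" "C_k_on k T f" "C_k_on k S g"
  shows "C_k_on k S (\<lambda>x. f (g x))"
  using assms(4,5)
proof (induction k arbitrary: f)
  case 0
  then show ?case using assms(3) by (auto intro: continuous_on_compose2)
next
  case (Suc k)
  show ?case
  proof (rule C_k_on_DI[OF assms(1)])
    fix x assume "x \<in> S"
    have "(g has_derivative frechet_derivative g (at x)) (at x)"
      "(f has_derivative frechet_derivative f (at (g x))) (at (g x))"
      using Suc.prems \<open>x \<in> S\<close> assms(3) by (auto intro!: has_derivative_frechet)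
    from has_derivative_compose[OF this]
    have *: "((\<lambda>x. f (g x)) has_derivative
        (\<lambda>v. frechet_derivative f (at (g x)) (frechet_derivative g (at x) v))) (at x)" .
    have "linear (frechet_derivative f (at (g x)))"
      using Suc.prems \<open>x \<in> S\<close> assms(3) by (intro linear_frechet_derivative) auto
    then have "(\<lambda>v. frechet_derivative f (at (g x)) (frechet_derivative g (at x) v)) =
        (\<lambda>v. \<Sum>b\<in>Basis. (frechet_derivative g (at x) v \<bullet> b) *\<^sub>R frechet_derivative f (at (g x)) b)"
      using linear_Basis_expand by blast
    with * show "((\<lambda>x. f (g x)) has_derivative
        (\<lambda>v. \<Sum>b\<in>Basis. (frechet_derivative g (at x) v \<bullet> b) *\<^sub>R frechet_derivative f (at (g x)) b)) (at x)"
      by simp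
  next
    fix v
    show "C_k_on k S (\<lambda>x. \<Sum>b\<in>Basis. (frechet_derivative g (at x) v \<bullet> b) *\<^sub>R frechet_derivative f (at (g x)) b)"
    proof (intro C_k_on_sum C_k_on_bounded_bilinear[OF _ bounded_bilinear_scaleR] assms(1))
      fix b :: 'b assume "b \<in> Basis"
      show "C_k_on k S (\<lambda>x. frechet_derivative g (at x) v \<bullet> b)"
        using Suc.prems by (intro C_k_on_bounded_linear[OF assms(1) bounded_linear_inner_left]) auto
      show "C_k_on k S (\<lambda>x. frechet_derivative f (at (g x)) b)"
        using Suc.prems by (intro Suc.IH) (auto intro: C_k_on_SucD)
    qed
  qed
qed

lemma C_k_on_inverse:
  fixes f :: "'a::euclidean_space \<Rightarrow> 'b::{euclidean_space,real_normed_field}"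
  assumes "open S" "C_k_on k S f" "\<And>x. x \<in> S \<Longrightarrow> f x \<noteq> 0"
  shows "C_k_on k S (\<lambda>x. inverse (f x))"
  using assms(2)
proof (induction k)
  case 0
  then show ?case using assms(3) by (auto intro!: continuous_intros)
next
  case (Suc k)
  show ?case
  proof (rule C_k_on_DI[OF assms(1)])
    fix x assume "x \<in> S"
    have "(f has_derivative frechet_derivative f (at x)) (at x)"
      using Suc.prems \<open>x \<in> S\<close> by (auto intro!: has_derivative_frechet)
    from Deriv.has_derivative_inverse[OF assms(3)[OF \<open>x \<in> S\<close>] this]
    show "((\<lambda>x. inverse (f x)) has_derivative
        (\<lambda>v. - (inverse (f x) * frechet_derivative f (at x) v * inverse (f x)))) (at x)" .
  next
    fix v
    show "C_k_on k S (\<lambda>x. - (inverse (f x) * frechet_derivative f (at x) v * inverse (f x)))"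
      using Suc C_k_on_SucD[OF Suc.prems]
      by (intro C_k_on_bounded_linear[OF assms(1) bounded_linear_minus[OF bounded_linear_ident]]
          C_k_on_bounded_bilinear[OF assms(1) bounded_bilinear_mult]) auto
  qed
qed

section \<open>Smooth functions\<close>

lemma smooth_on_cong: "open S \<Longrightarrow> (\<And>x. x \<in> S \<Longrightarrow> f x = g x) \<Longrightarrow> smooth_on S f \<Longrightarrow> smooth_on S g"
  by (simp add: smooth_on_def C_k_on_cong[of S f g])

lemma smooth_on_subset: "smooth_on S f \<Longrightarrow> T \<subseteq> S \<Longrightarrow> smooth_on T f"
  by (simp add: smooth_on_def C_k_on_subset[of _ S])

lemma smooth_on_const [simp]: "smooth_on S (\<lambda>x. c)"
  by (simp add: smooth_on_def)

lemma smooth_on_id: "smooth_on S (\<lambda>x. x)"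
  by (simp add: smooth_on_def C_k_on_id)

lemma smooth_on_add: "open S \<Longrightarrow> smooth_on S f \<Longrightarrow> smooth_on S g \<Longrightarrow> smooth_on S (\<lambda>x. f x + g x)"
  by (simp add: smooth_on_def C_k_on_add)

lemma smooth_on_sum: "open S \<Longrightarrow> (\<And>i. i \<in> A \<Longrightarrow> smooth_on S (f i)) \<Longrightarrow> smooth_on S (\<lambda>x. \<Sum>i\<in>A. f i x)"
  by (simp add: smooth_on_def C_k_on_sum)

lemma smooth_on_bounded_bilinear:
  "bounded_bilinear pr \<Longrightarrow> open S \<Longrightarrow> smooth_on S f \<Longrightarrow> smooth_on S g \<Longrightarrow> smooth_on S (\<lambda>x. pr (f x) (g x))"
  by (simp add: smooth_on_def C_k_on_bounded_bilinear)

lemmas smooth_on_mult = smooth_on_bounded_bilinear[OF bounded_bilinear_mult]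
lemmas smooth_on_scaleR = smooth_on_bounded_bilinear[OF bounded_bilinear_scaleR]

lemma smooth_on_bounded_linear:
  "bounded_linear L \<Longrightarrow> open S \<Longrightarrow> smooth_on S f \<Longrightarrow> smooth_on S (\<lambda>x. L (f x))"
  by (simp add: smooth_on_def C_k_on_bounded_linear)

lemmas smooth_on_uminus = smooth_on_bounded_linear[OF bounded_linear_minus[OF bounded_linear_ident]]
lemmas smooth_on_fst = smooth_on_bounded_linear[OF bounded_linear_fst]
lemmas smooth_on_snd = smooth_on_bounded_linear[OF bounded_linear_snd]
lemmas smooth_on_vec_nth = smooth_on_bounded_linear[OF bounded_linear_vec_nth]
lemmas smooth_on_of_real = smooth_on_bounded_linear[OF bounded_linear_of_real]
lemmas smooth_on_Re = smooth_on_bounded_linear[OF bounded_linear_Re]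

lemma smooth_on_diff: "open S \<Longrightarrow> smooth_on S f \<Longrightarrow> smooth_on S g \<Longrightarrow> smooth_on S (\<lambda>x. f x - g x)"
  using smooth_on_add[of S f "\<lambda>x. - g x"] smooth_on_uminus[of S g] by simp

lemma smooth_on_inverse:
  fixes f :: "'a::euclidean_space \<Rightarrow> 'b::{euclidean_space,real_normed_field}"
  shows "open S \<Longrightarrow> (\<And>x. x \<in> S \<Longrightarrow> f x \<noteq> 0) \<Longrightarrow> smooth_on S f \<Longrightarrow> smooth_on S (\<lambda>x. inverse (f x))"
  by (simp add: smooth_on_def C_k_on_inverse)

lemma smooth_on_divide:
  fixes f :: "'a::euclidean_space \<Rightarrow> 'b::{euclidean_space,real_normed_field}"
  shows "open S \<Longrightarrow> (\<And>x. x \<in> S \<Longrightarrow> g x \<noteq> 0) \<Longrightarrow> smooth_on S f \<Longrightarrow> smooth_on S g \<Longrightarrow> smooth_on S (\<lambda>x. f x / g x)"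
  by (simp add: divide_inverse smooth_on_mult smooth_on_inverse)

lemma smooth_on_power:
  fixes f :: "'a::euclidean_space \<Rightarrow> 'b::{euclidean_space,real_normed_field}"
  shows "open S \<Longrightarrow> smooth_on S f \<Longrightarrow> smooth_on S (\<lambda>x. f x ^ n)"
  by (induction n) (auto intro: smooth_on_mult)

lemma smooth_on_Pair:
  assumes "open S" "smooth_on S f" "smooth_on S g"
  shows "smooth_on S (\<lambda>x. (f x, g x))"
proof -
  have "bounded_linear (\<lambda>x::'b. (x, 0::'c))" "bounded_linear (\<lambda>x::'c. (0::'b, x))"
    by (auto intro: bounded_linear_Pair bounded_linear_ident bounded_linear_zero)
  from smooth_on_bounded_linear[OF this(1) assms(1,2)] smooth_on_bounded_linear[OF this(2) assms(1,3)]
  have "smooth_on S (\<lambda>x. (f x, 0::'c))" "smooth_on S (\<lambda>x. (0::'b, g x))" .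
  from smooth_on_add[OF assms(1) this] show ?thesis by simp
qed

lemma smooth_on_compose:
  fixes g :: "'a::euclidean_space \<Rightarrow> 'b::euclidean_space" and f :: "'b \<Rightarrow> 'c::euclidean_space"
  assumes "smooth_on T f" "open S" "open T" "smooth_on S g" "\<And>x. x \<in> S \<Longrightarrow> g x \<in> T"
  shows "smooth_on S (\<lambda>x. f (g x))"
proof -
  have "g ` S \<subseteq> T" using assms(5) by blast
  then show ?thesis
    unfolding smooth_on_def
    by (intro allI) (rule C_k_on_compose[OF assms(2,3)], use assms(1,4) in \<open>simp_all add: smooth_on_def\<close>)
qed

lemma smooth_on_imp_continuous_on: "smooth_on S f \<Longrightarrow> continuous_on S f"
  unfolding smooth_on_def by (rule C_k_on_imp_continuous_on[of 0]) (rule spec)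

lemma smooth_on_differentiable: "smooth_on S f \<Longrightarrow> x \<in> S \<Longrightarrow> f differentiable (at x)"
  by (metis C_k_on.simps(2) smooth_on_def)

lemma smooth_on_has_derivative:
  "smooth_on S f \<Longrightarrow> x \<in> S \<Longrightarrow> (f has_derivative frechet_derivative f (at x)) (at x)"
  using smooth_on_differentiable has_derivative_frechet by blast

lemma smooth_on_frechet_derivative: "smooth_on S f \<Longrightarrow> smooth_on S (\<lambda>x. frechet_derivative f (at x) v)"
  by (metis C_k_on.simps(2) smooth_on_def)

text \<open>Neighbourhoods suffice because \<open>frechet_derivative\<close> at a point is two-sided
  and does not refer to the set on which the function is studied.\<close>

lemma C_k_on_local:
  assumes "\<And>x. x \<in> S \<Longrightarrow> \<exists>U. open U \<and> x \<in> U \<and> C_k_on k U f"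
  shows "C_k_on k S f"
  using assms
proof (induction k arbitrary: f)
  case 0
  have "isCont f x" if "x \<in> S" for x
    using 0[OF that] by (auto simp: continuous_on_eq_continuous_at)
  then show ?case by (simp add: continuous_at_imp_continuous_on)
next
  case (Suc k)
  have "f differentiable at x" if "x \<in> S" for x
    using Suc.prems[OF that] by auto
  moreover have "C_k_on k S (\<lambda>x. frechet_derivative f (at x) v)" for v
  proof (rule Suc.IH)
    fix x assume "x \<in> S"
    from Suc.prems[OF this] obtain U where "open U" "x \<in> U" "C_k_on (Suc k) U f" by blast
    then show "\<exists>U. open U \<and> x \<in> U \<and> C_k_on k U (\<lambda>x. frechet_derivative f (at x) v)"
      by (intro exI[of _ U]) simp
  qed
  ultimately show ?case by simp
qed

lemma smooth_on_local:
  assumes "\<And>x. x \<in> S \<Longrightarrow> \<exists>U. open U \<and> x \<in> U \<and> smooth_on U f"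
  shows "smooth_on S f"
  unfolding smooth_on_def
proof (intro allI C_k_on_local)
  fix k x assume "x \<in> S"
  from assms[OF this] obtain U where "open U" "x \<in> U" "smooth_on U f" by blast
  then show "\<exists>U. open U \<and> x \<in> U \<and> C_k_on k U f"
    by (intro exI[of _ U]) (simp add: smooth_on_def)
qed

lemma smooth_on_euclideanI:
  fixes f :: "'a::euclidean_space \<Rightarrow> 'b::euclidean_space"
  assumes "open S" "\<And>b. b \<in> Basis \<Longrightarrow> smooth_on S (\<lambda>x. f x \<bullet> b)"
  shows "smooth_on S f"
proof -
  have "smooth_on S (\<lambda>x. \<Sum>b\<in>Basis. (f x \<bullet> b) *\<^sub>R b)"
    using assms by (intro smooth_on_sum smooth_on_scaleR) auto
  then show ?thesis by (simp add: euclidean_representation)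
qed

lemma smooth_on_vecI:
  fixes f :: "'a::euclidean_space \<Rightarrow> real^'n"
  assumes "open S" "\<And>i. smooth_on S (\<lambda>x. f x $ i)"
  shows "smooth_on S f"
proof (rule smooth_on_euclideanI[OF assms(1)])
  fix b :: "real^'n" assume "b \<in> Basis"
  then obtain i where "b = axis i 1" by (auto simp: Basis_vec_def)
  then show "smooth_on S (\<lambda>x. f x \<bullet> b)"
    using assms(2)[of i] by (simp add: cart_eq_inner_axis)
qed

section \<open>Functions given with a chain of successive derivatives\<close>

lemma smooth_on_real_derivs:
  fixes F :: "nat \<Rightarrow> real \<Rightarrow> 'b::euclidean_space"
  assumes "open S" "\<And>n x. x \<in> S \<Longrightarrow> (F n has_vector_derivative F (Suc n) x) (at x)"
  shows "smooth_on S (F n)"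
proof -
  have "C_k_on k S (F n)" for k
  proof (induction k arbitrary: n)
    case 0
    show ?case
      using assms(2) by (auto intro!: continuous_at_imp_continuous_on has_vector_derivative_continuous)
  next
    case (Suc k)
    show ?case
    proof (rule C_k_on_SucI[OF assms(1)])
      show "(F n has_derivative (\<lambda>h. h *\<^sub>R F (Suc n) x)) (at x)" if "x \<in> S" for x
        using assms(2)[OF that] by (simp add: has_vector_derivative_def)
    qed (use Suc in auto)
  qed
  then show ?thesis by (simp add: smooth_on_def)
qed

lemma smooth_on_iexp: "smooth_on S (\<lambda>t::real. exp (c * of_real t) :: complex)"
proof -
  have "smooth_on UNIV (\<lambda>t::real. c ^ n * exp (c * of_real t) :: complex)" for n
    by (rule smooth_on_real_derivs)
      (auto intro!: derivative_eq_intros has_vector_derivative_real_field)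
  from this[of 0] show ?thesis by (auto intro: smooth_on_subset)
qed

section \<open>Inverse and implicit functions\<close>

text \<open>A product rule in which continuity of \<open>g\<close> is enough, because the other
  factor vanishes at \<open>a\<close>. It serves to differentiate the inverse of a family of linear
  maps at a stage where that inverse is only known to be continuous.\<close>

lemma has_derivative_scaleR_vanishing:
  fixes f :: "'a::real_normed_vector \<Rightarrow> real" and g :: "'a \<Rightarrow> 'b::real_normed_vector"
  assumes f: "(f has_derivative f') (at a)" and fa: "f a = 0" and g: "isCont g a"
  shows "((\<lambda>x. f x *\<^sub>R g x) has_derivative (\<lambda>h. f' h *\<^sub>R g a)) (at a)"
proof -
  have bl: "bounded_linear f'" using f by (rule has_derivative_bounded_linear)
  then obtain K where K: "\<And>h. norm (f' h) \<le> norm h * K"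
    using bounded_linear.bounded by blast
  \<comment> \<open>The remainder of the product is the remainder of \<open>f\<close> times
    \<open>g y\<close> plus \<open>f' (y - a)\<close> times \<open>g y - g a\<close>. After division
    by the norm, \<open>1\<close> and \<open>2\<close> send the two parts to 0.\<close>
  have 1: "((\<lambda>y. ((f y - f a - f' (y - a)) / norm (y - a)) *\<^sub>R g y) \<longlongrightarrow> 0 *\<^sub>R g a) (at a)"
    using f g
    by (intro tendsto_scaleR) (auto simp: has_derivative_within isCont_def divide_inverse mult.commute algebra_simps)
  have 2: "((\<lambda>y. (f' (y - a) / norm (y - a)) *\<^sub>R (g y - g a)) \<longlongrightarrow> 0) (at a)"
  proof (rule Lim_null_comparison)
    show "\<forall>\<^sub>F y in at a. norm ((f' (y - a) / norm (y - a)) *\<^sub>R (g y - g a)) \<le> \<bar>K\<bar> * norm (g y - g a)"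
    proof (rule always_eventually, rule allI)
      fix y
      have "\<bar>f' (y - a)\<bar> \<le> norm (y - a) * \<bar>K\<bar>"
        using K[of "y - a"] by (smt (verit) mult_left_mono norm_ge_zero real_norm_def)
      then have "\<bar>f' (y - a)\<bar> / norm (y - a) \<le> \<bar>K\<bar>"
        by (cases "y = a") (auto simp: field_simps)
      then have "\<bar>f' (y - a)\<bar> / norm (y - a) * norm (g y - g a) \<le> \<bar>K\<bar> * norm (g y - g a)"
        by (intro mult_right_mono) auto
      then show "norm ((f' (y - a) / norm (y - a)) *\<^sub>R (g y - g a)) \<le> \<bar>K\<bar> * norm (g y - g a)"
        by simp
    qed
    have "((\<lambda>y. g y - g a) \<longlongrightarrow> 0) (at a)"
      using g by (simp add: isCont_def LIM_zero)
    then show "((\<lambda>y. \<bar>K\<bar> * norm (g y - g a)) \<longlongrightarrow> 0) (at a)"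
      by (intro tendsto_mult_right_zero tendsto_norm_zero)
  qed
  have eq: "((\<lambda>y. ((f y - f a - f' (y - a)) / norm (y - a)) *\<^sub>R g y
       + (f' (y - a) / norm (y - a)) *\<^sub>R (g y - g a))) =
      (\<lambda>y. (1 / norm (y - a)) *\<^sub>R (f y *\<^sub>R g y - (f a *\<^sub>R g a + f' (y - a) *\<^sub>R g a)))"
    by (auto simp: fa algebra_simps divide_inverse)
  have "bounded_linear (\<lambda>h. f' h *\<^sub>R g a)"
    using bl by (rule bounded_linear_compose[OF bounded_linear_scaleR_left])
  then show ?thesis
    using tendsto_add[OF 1 2] unfolding eq by (simp add: has_derivative_within)
qed

lemma norm_linear_le_Basis:
  fixes L :: "'a::euclidean_space \<Rightarrow> 'b::real_normed_vector"
  assumes "linear L"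
  shows "norm (L v) \<le> norm v * (\<Sum>b\<in>Basis. norm (L b))"
proof -
  have "norm (L v) \<le> (\<Sum>b\<in>Basis. norm ((v \<bullet> b) *\<^sub>R L b))"
    by (subst linear_Basis_expand[OF assms]) (rule norm_sum)
  also have "\<dots> \<le> (\<Sum>b\<in>Basis. norm v * norm (L b))"
    by (intro sum_mono) (simp add: mult_right_mono Basis_le_norm)
  finally show ?thesis by (simp add: sum_distrib_left)
qed

text \<open>Put \<open>w = N x v - N a v\<close>. Invertibility of \<open>M a\<close> gives a
  constant \<open>K\<close> with norm of \<open>w\<close> at most \<open>K\<close> times the norm of
  \<open>M a w\<close>. Once \<open>M x\<close> is within 1/(2K) of \<open>M a\<close>, the norm of
  \<open>w\<close> is at most 2K times that of \<open>M x w\<close>, and \<open>M x w\<close> is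
  minus the value of \<open>M x - M a\<close> at \<open>N a v\<close>, which tends to 0.\<close>

lemma continuous_linear_inverse:
  fixes M N :: "'a::euclidean_space \<Rightarrow> 'b::euclidean_space \<Rightarrow> 'b"
  assumes "open S" and lin: "\<And>x. x \<in> S \<Longrightarrow> linear (M x)" "\<And>x. x \<in> S \<Longrightarrow> linear (N x)"
    and inv: "\<And>x v. x \<in> S \<Longrightarrow> N x (M x v) = v" "\<And>x v. x \<in> S \<Longrightarrow> M x (N x v) = v"
    and cont: "\<And>v. continuous_on S (\<lambda>x. M x v)"
  shows "continuous_on S (\<lambda>x. N x v)"
proof -
  have "isCont (\<lambda>x. N x v) a" if a: "a \<in> S" for a
  proof -
    define K where "K = (\<Sum>b\<in>Basis. norm (N a b)) + 1"
    have "K > 0" unfolding K_def by (smt (verit) norm_ge_zero sum_nonneg)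
    have K: "norm w \<le> K * norm (M a w)" for w
    proof -
      have "norm w \<le> norm (M a w) * (\<Sum>b\<in>Basis. norm (N a b))"
        using norm_linear_le_Basis[OF lin(2)[OF a], of "M a w"] inv(1)[OF a, of w] by simp
      also have "\<dots> \<le> K * norm (M a w)" by (simp add: K_def algebra_simps)
      finally show ?thesis .
    qed
    have Mcont: "((\<lambda>x. M x w) \<longlongrightarrow> M a w) (at a)" for w
      using cont[of w] a \<open>open S\<close> by (auto simp: continuous_on_eq_continuous_at isCont_def)
    have "((\<lambda>x. \<Sum>b\<in>Basis. norm (M x b - M a b)) \<longlongrightarrow> (\<Sum>b\<in>(Basis::'b set). norm (M a b - M a b))) (at a)"
      by (intro tendsto_intros Mcont)
    then have "((\<lambda>x. \<Sum>b\<in>Basis. norm (M x b - M a b)) \<longlongrightarrow> 0) (at a)" by simp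
    then have "\<forall>\<^sub>F x in at a. (\<Sum>b\<in>Basis. norm (M x b - M a b)) < 1 / (2 * K)"
      using \<open>K > 0\<close> by (intro order_tendstoD) auto
    moreover have "\<forall>\<^sub>F x in at a. x \<in> S"
      using a \<open>open S\<close> by (simp add: eventually_at_in_open')
    ultimately have ev: "\<forall>\<^sub>F x in at a. norm (N x v - N a v) \<le> 2 * K * norm (M x (N a v) - M a (N a v))"
    proof eventually_elim
      case (elim x)
      define w where "w = N x v - N a v"
      have "linear (\<lambda>v. M x v - M a v)"
        using lin elim(2) a by (intro linear_compose_sub) auto
      from norm_linear_le_Basis[OF this, of w]
      have "norm (M x w - M a w) \<le> norm w * (1 / (2 * K))"
        using elim(1) by (smt (verit) mult_left_mono norm_ge_zero)
      then have "norm (M a w) \<le> norm (M x w) + norm w / (2 * K)"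
        using norm_triangle_sub[of "M a w" "M x w"] norm_minus_commute[of "M a w" "M x w"] by simp
      then have "K * norm (M a w) \<le> K * norm (M x w) + norm w / 2"
        using \<open>K > 0\<close> by (simp add: field_simps)
      then have "norm w \<le> 2 * K * norm (M x w)" using K[of w] by simp
      also have "M x w = - (M x (N a v) - M a (N a v))"
        using inv elim(2) a lin(1)[OF elim(2)] by (simp add: w_def linear_diff)
      finally show ?case by (simp add: w_def norm_minus_commute)
    qed
    have "((\<lambda>x. N x v - N a v) \<longlongrightarrow> 0) (at a)"
    proof (rule Lim_null_comparison[OF ev])
      have "((\<lambda>x. M x (N a v) - M a (N a v)) \<longlongrightarrow> 0) (at a)"
        using Mcont by (rule LIM_zero)
      then show "((\<lambda>x. 2 * K * norm (M x (N a v) - M a (N a v))) \<longlongrightarrow> 0) (at a)"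
        by (intro tendsto_mult_right_zero tendsto_norm_zero)
    qed
    then show ?thesis by (simp add: isCont_def LIM_zero_iff)
  qed
  then show ?thesis by (simp add: continuous_at_imp_continuous_on)
qed

text \<open>The derivative of the inverse is - N (DM) N. It involves one derivative of
  \<open>M\<close> but only values of \<open>N\<close>, so each order of smoothness of
  \<open>N\<close> follows from the preceding one.\<close>

lemma C_k_on_linear_inverse:
  fixes M N :: "'a::euclidean_space \<Rightarrow> 'b::euclidean_space \<Rightarrow> 'b"
  assumes "open S" and lin: "\<And>x. x \<in> S \<Longrightarrow> linear (M x)" "\<And>x. x \<in> S \<Longrightarrow> linear (N x)"
    and inv: "\<And>x v. x \<in> S \<Longrightarrow> N x (M x v) = v" "\<And>x v. x \<in> S \<Longrightarrow> M x (N x v) = v"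
    and "\<And>v. C_k_on k S (\<lambda>x. M x v)"
  shows "C_k_on k S (\<lambda>x. N x v)"
  using assms(6)
proof (induction k arbitrary: v)
  case 0
  then show ?case using continuous_linear_inverse[OF assms(1-5)] by simp
next
  case (Suc k)
  have Nk: "C_k_on k S (\<lambda>x. N x v)" for v
    using Suc C_k_on_SucD by blast
  have Ncont: "continuous_on S (\<lambda>x. N x v)" for v
    using Nk C_k_on_imp_continuous_on by blast
  define D where "D x u w = (\<Sum>c\<in>Basis. (w \<bullet> c) *\<^sub>R frechet_derivative (\<lambda>z. M z c) (at x) u)" for x u w
  have M': "((\<lambda>z. M z w) has_derivative (\<lambda>u. D x u w)) (at x)" if "x \<in> S" for x w
  proof (rule has_derivative_transform_within_open[OF _ assms(1) that])
    have "((\<lambda>z. M z c) has_derivative frechet_derivative (\<lambda>z. M z c) (at x)) (at x)" for c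
      using Suc.prems[of c] that by (intro has_derivative_frechet) simp
    then show "((\<lambda>z. \<Sum>c\<in>Basis. (w \<bullet> c) *\<^sub>R M z c) has_derivative (\<lambda>u. D x u w)) (at x)"
      unfolding D_def by (intro has_derivative_sum has_derivative_scaleR_right)
  qed (simp add: linear_Basis_expand[OF lin(1), of _ w])
  show ?case
  proof (rule C_k_on_DI[OF assms(1)])
    fix a assume a: "a \<in> S"
    define w where "w = N a v"
    \<comment> \<open>For \<open>x\<close> in \<open>S\<close> the function is \<open>N x v\<close>,
      because \<open>N x v = N a v - N x (M x w - M a w)\<close>. The factor
      \<open>M x w - M a w\<close> vanishes at \<open>x = a\<close>, which is the situation of
      \<open>has_derivative_scaleR_vanishing\<close>.\<close>
    have "((\<lambda>x. N a v - (\<Sum>b\<in>Basis. ((M x w - M a w) \<bullet> b) *\<^sub>R N x b)) has_derivative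
        (\<lambda>u. 0 - (\<Sum>b\<in>Basis. ((D a u w - 0) \<bullet> b) *\<^sub>R N a b))) (at a)"
    proof (intro has_derivative_diff has_derivative_const has_derivative_sum has_derivative_scaleR_vanishing)
      fix b :: 'b assume "b \<in> Basis"
      show "((\<lambda>x. (M x w - M a w) \<bullet> b) has_derivative (\<lambda>u. (D a u w - 0) \<bullet> b)) (at a)"
        using M'[OF a] by (intro has_derivative_inner_left has_derivative_diff has_derivative_const)
      show "isCont (\<lambda>x. N x b) a"
        using Ncont a assms(1) by (simp add: continuous_on_eq_continuous_at)
    qed simp
    moreover have "N a v - (\<Sum>b\<in>Basis. ((M x w - M a w) \<bullet> b) *\<^sub>R N x b) = N x v" if x: "x \<in> S" for x
    proof -
      have "(\<Sum>b\<in>Basis. ((M x w - M a w) \<bullet> b) *\<^sub>R N x b) = N x (M x w - M a w)"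
        by (rule linear_Basis_expand[OF lin(2)[OF x], symmetric])
      also have "\<dots> = N a v - N x v"
        using inv x a by (simp add: w_def linear_diff[OF lin(2)])
      finally show ?thesis by simp
    qed
    ultimately show "((\<lambda>x. N x v) has_derivative (\<lambda>u. - (\<Sum>b\<in>Basis. (D a u (N a v) \<bullet> b) *\<^sub>R N a b))) (at a)"
      unfolding w_def
      by (auto intro: has_derivative_transform_within_open[OF _ assms(1) a])
  next
    fix u
    have D: "C_k_on k S (\<lambda>x. frechet_derivative (\<lambda>z. M z c) (at x) u)" for c
      using Suc.prems[of c] by simp
    show "C_k_on k S (\<lambda>a. - (\<Sum>b\<in>Basis. (D a u (N a v) \<bullet> b) *\<^sub>R N a b))"
      unfolding D_def
      by (intro C_k_on_bounded_linear[OF assms(1) bounded_linear_minus[OF bounded_linear_ident]]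
          C_k_on_sum assms(1) Nk D C_k_on_bounded_bilinear[OF assms(1) bounded_bilinear_scaleR]
          C_k_on_bounded_linear[OF assms(1) bounded_linear_inner_left])
  qed
qed

text \<open>A bootstrap. The C^1 theorem gives an inverse \<open>g\<close> whose derivative at
  \<open>y\<close> is the inverse of the derivative of \<open>f\<close> at \<open>g y\<close>. If
  \<open>g\<close> is C^k, so is this derivative, and then \<open>g\<close> is C^(k+1).\<close>

theorem smooth_inverse_function:
  fixes f :: "'a::euclidean_space \<Rightarrow> 'a"
  assumes "open U" "smooth_on U f" "x0 \<in> U" "inj (frechet_derivative f (at x0))"
  obtains U' V g where "open U'" "U' \<subseteq> U" "x0 \<in> U'" "open V" "f x0 \<in> V"
    "homeomorphism U' V f g" "smooth_on V g"
proof -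
  define f' where "f' x = Blinfun (frechet_derivative f (at x))" for x
  have bl: "bounded_linear (frechet_derivative f (at x))" if "x \<in> U" for x
    using smooth_on_has_derivative[OF assms(2) that] has_derivative_bounded_linear by blast
  have f'_apply: "blinfun_apply (f' x) = frechet_derivative f (at x)" if "x \<in> U" for x
    using bl[OF that] by (simp add: f'_def bounded_linear_Blinfun_apply)
  have der: "(f has_derivative blinfun_apply (f' x)) (at x)" if "x \<in> U" for x
    using smooth_on_has_derivative[OF assms(2) that] f'_apply[OF that] by simp
  have cont: "continuous_on U f'"
  proof (rule continuous_on_blinfun_componentwise)
    fix i :: 'a
    have "continuous_on U (\<lambda>x. frechet_derivative f (at x) i)"
      using assms(2) smooth_on_frechet_derivative smooth_on_imp_continuous_on by blast
    then show "continuous_on U (\<lambda>x. blinfun_apply (f' x) i)"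
      using f'_apply by (simp cong: continuous_on_cong)
  qed
  obtain h where h: "linear h" "h \<circ> frechet_derivative f (at x0) = id"
    using linear_injective_left_inverse[OF _ assms(4)] bl[OF assms(3)] bounded_linear.linear by blast
  have "Blinfun h o\<^sub>L f' x0 = id_blinfun"
    using h by (intro blinfun_eqI)
      (simp add: f'_apply[OF assms(3)] bounded_linear_Blinfun_apply linear_conv_bounded_linear pointfree_idE)
  from inverse_function_theorem[OF assms(1) der cont assms(3) this]
  obtain U' V g g' where *: "open U'" "U' \<subseteq> U" "x0 \<in> U'" "open V" "f x0 \<in> V" "homeomorphism U' V f g"
    and g: "\<And>y. y \<in> V \<Longrightarrow> (g has_derivative (g' y)) (at y)"
      "\<And>y. y \<in> V \<Longrightarrow> g' y = inv (blinfun_apply (f' (g y)))"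
      "\<And>y. y \<in> V \<Longrightarrow> bij (blinfun_apply (f' (g y)))"
    by blast
  have gU: "g y \<in> U" if "y \<in> V" for y
    using *(2,6) that by (auto simp: homeomorphism_def)
  have "C_k_on k V g" for k
  proof (induction k)
    case 0
    then show ?case using *(6) by (simp add: homeomorphism_def)
  next
    case (Suc k)
    show ?case
    proof (rule C_k_on_DI[OF *(4) g(1)])
      fix v
      show "C_k_on k V (\<lambda>y. g' y v)"
      proof (rule C_k_on_linear_inverse[where M = "\<lambda>y. frechet_derivative f (at (g y))", OF *(4)])
        show "linear (frechet_derivative f (at (g y)))" if "y \<in> V" for y
          using bl[OF gU[OF that]] bounded_linear.linear by blast
        show "linear (g' y)" if "y \<in> V" for y
          using g(1)[OF that] has_derivative_linear by blast
        show "g' y (frechet_derivative f (at (g y)) w) = w" if "y \<in> V" for y w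
          using g(2,3)[OF that] f'_apply[OF gU[OF that]] by (simp add: bij_def inv_f_f)
        show "frechet_derivative f (at (g y)) (g' y w) = w" if "y \<in> V" for y w
          using g(2,3)[OF that] f'_apply[OF gU[OF that]] by (simp add: bij_def surj_f_inv_f)
        show "C_k_on k V (\<lambda>y. frechet_derivative f (at (g y)) w)" for w
        proof (rule C_k_on_compose[OF *(4) assms(1) _ _ Suc])
          show "g ` V \<subseteq> U" using gU by blast
          show "C_k_on k U (\<lambda>z. frechet_derivative f (at z) w)"
            using smooth_on_frechet_derivative[OF assms(2)] by (simp add: smooth_on_def)
        qed
      qed
    qed
  qed
  then have "smooth_on V g" by (simp add: smooth_on_def)
  then show ?thesis using that * by blast
qed

theorem smooth_implicit_function:
  fixes F :: "'c::euclidean_space \<times> 'd::euclidean_space \<Rightarrow> 'd"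
  assumes "open W" "smooth_on W F" "(c0, d0) \<in> W" "F (c0, d0) = 0"
    and inj: "\<And>v. frechet_derivative F (at (c0, d0)) (0, v) = 0 \<Longrightarrow> v = 0"
  obtains U V \<phi> where "open U" "c0 \<in> U" "open V" "d0 \<in> V" "U \<times> V \<subseteq> W" "smooth_on U \<phi>"
    "\<And>c. c \<in> U \<Longrightarrow> \<phi> c \<in> V" "\<And>c d. c \<in> U \<Longrightarrow> d \<in> V \<Longrightarrow> F (c, d) = 0 \<longleftrightarrow> d = \<phi> c"
proof -
  \<comment> \<open>Keeping the parameter as a coordinate reduces the claim to the inverse function
    theorem; \<open>\<phi> c\<close> is the second component of the preimage of
    \<open>(c, 0)\<close>.\<close>
  define \<Psi> where "\<Psi> z = (fst z, F z)" for z
  have sm: "smooth_on W \<Psi>"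
    unfolding \<Psi>_def using assms(1,2) by (intro smooth_on_Pair smooth_on_fst smooth_on_id)
  have F': "(F has_derivative frechet_derivative F (at (c0, d0))) (at (c0, d0))"
    using smooth_on_has_derivative[OF assms(2,3)] .
  have "(\<Psi> has_derivative (\<lambda>h. (fst h, frechet_derivative F (at (c0, d0)) h))) (at (c0, d0))"
    unfolding \<Psi>_def using F' by (intro has_derivative_Pair has_derivative_fst has_derivative_ident)
  then have \<Psi>': "frechet_derivative \<Psi> (at (c0, d0)) = (\<lambda>h. (fst h, frechet_derivative F (at (c0, d0)) h))"
    by (rule frechet_derivative_eqI)
  have "linear (frechet_derivative \<Psi> (at (c0, d0)))"
    using smooth_on_has_derivative[OF sm assms(3)] has_derivative_linear by blast
  then have "inj (frechet_derivative \<Psi> (at (c0, d0)))"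
    by (subst linear_injective_0) (auto simp: \<Psi>' zero_prod_def dest: inj)
  from smooth_inverse_function[OF assms(1) sm assms(3) this]
  obtain U' V' g where g: "open U'" "U' \<subseteq> W" "(c0, d0) \<in> U'" "open V'" "\<Psi> (c0, d0) \<in> V'"
    "homeomorphism U' V' \<Psi> g" "smooth_on V' g" by blast
  obtain A B where AB: "open A" "open B" "c0 \<in> A" "d0 \<in> B" "A \<times> B \<subseteq> U'"
    using g(1,3) open_prod_elim by (metis mem_Sigma_iff)
  define T where "T = {c. (c, 0) \<in> V'}"
  have "open T"
  proof -
    have "T = (\<lambda>c. (c, 0)) -` V'" by (auto simp: T_def)
    moreover have "continuous_on UNIV (\<lambda>c::'c. (c, 0::'d))" by (intro continuous_intros)
    ultimately show ?thesis using g(4) by (simp add: open_vimage)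
  qed
  have "c0 \<in> T" using g(5) assms(4) by (simp add: T_def \<Psi>_def)
  define \<phi> where "\<phi> c = snd (g (c, 0))" for c
  have sm\<phi>: "smooth_on T \<phi>"
    unfolding \<phi>_def using \<open>open T\<close>
    by (intro smooth_on_snd smooth_on_compose[OF g(7) _ g(4)] smooth_on_Pair smooth_on_id smooth_on_const)
      (auto simp: T_def)
  have gc: "g (c, 0) = (c, \<phi> c)" "(c, \<phi> c) \<in> U'" "F (c, \<phi> c) = 0" if "c \<in> T" for c
  proof -
    have m: "g (c, 0) \<in> U'" "\<Psi> (g (c, 0)) = (c, 0)"
      using g(6) that by (auto simp: homeomorphism_def T_def)
    then have "fst (g (c, 0)) = c" by (simp add: \<Psi>_def)
    then show 1: "g (c, 0) = (c, \<phi> c)" by (simp add: \<phi>_def prod_eq_iff)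
    show "(c, \<phi> c) \<in> U'" "F (c, \<phi> c) = 0" using m unfolding 1 by (auto simp: \<Psi>_def)
  qed
  have "\<phi> c0 = d0"
  proof -
    have "g (\<Psi> (c0, d0)) = (c0, d0)" using g(3,6) by (auto simp: homeomorphism_def)
    then show ?thesis using assms(4) by (simp add: \<Psi>_def \<phi>_def)
  qed
  define U where "U = A \<inter> (T \<inter> \<phi> -` B)"
  have "open (T \<inter> \<phi> -` B)"
    using continuous_open_preimage[OF smooth_on_imp_continuous_on[OF sm\<phi>] \<open>open T\<close> AB(2)] .
  then have "open U" using AB(1) by (auto simp: U_def)
  show ?thesis
  proof (rule that[of U B \<phi>])
    show "c0 \<in> U" using AB \<open>c0 \<in> T\<close> \<open>\<phi> c0 = d0\<close> by (simp add: U_def)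
    show "U \<times> B \<subseteq> W" using AB g(2) by (auto simp: U_def)
    show "smooth_on U \<phi>" using sm\<phi> by (rule smooth_on_subset) (auto simp: U_def)
    show "F (c, d) = 0 \<longleftrightarrow> d = \<phi> c" if "c \<in> U" "d \<in> B" for c d
    proof
      assume "F (c, d) = 0"
      then have "\<Psi> (c, d) = (c, 0)" by (simp add: \<Psi>_def)
      moreover have "(c, d) \<in> U'" using that AB by (auto simp: U_def)
      ultimately have "g (c, 0) = (c, d)" using g(6) by (metis homeomorphism_apply1)
      then show "d = \<phi> c" by (simp add: \<phi>_def)
    next
      assume "d = \<phi> c"
      then show "F (c, d) = 0" using gc(3)[of c] that by (simp add: U_def)
    qed
  qed (use AB \<open>open U\<close> in \<open>auto simp: U_def\<close>)
qed

text \<open>The second difference over a small parallelogram with sides in the directions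
  \<open>u\<close> and \<open>v\<close> is \<open>r * r\<close> times a mixed derivative at a nearby
  point, in either order of differentiation, by two uses of the mean value theorem. Continuity of
  both mixed derivatives forces them to agree at \<open>x\<close>.\<close>

lemma smooth_on_second_derivative_symmetric:
  fixes f :: "'a::euclidean_space \<Rightarrow> real"
  assumes "open S" "smooth_on S f" "x \<in> S"
  shows "frechet_derivative (\<lambda>x. frechet_derivative f (at x) u) (at x) v =
    frechet_derivative (\<lambda>x. frechet_derivative f (at x) v) (at x) u"
proof -
  define D where "D w z = frechet_derivative f (at z) w" for w z
  define DD where "DD w w' z = frechet_derivative (D w) (at z) w'" for w w' z
  have smD: "smooth_on S (D w)" for w
    using smooth_on_frechet_derivative[OF assms(2)] by (simp add: D_def[abs_def])
  have cDD: "isCont (DD w w') x" for w w'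
  proof -
    have "smooth_on S (DD w w')"
      unfolding DD_def[abs_def] by (rule smooth_on_frechet_derivative[OF smD])
    then have "continuous_on S (DD w w')" by (rule smooth_on_imp_continuous_on)
    then show ?thesis using assms(1,3) by (simp add: continuous_on_eq_continuous_at)
  qed
  obtain e where e: "e > 0" "ball x e \<subseteq> S" using assms(1,3) open_contains_ball by blast
  define N where "N = norm u + norm v + 1"
  have "N > 0" by (simp add: N_def add_nonneg_pos)
  have line: "((\<lambda>t. h (z + t *\<^sub>R w)) has_real_derivative frechet_derivative h (at (z + t *\<^sub>R w)) w) (at t)"
    if "smooth_on S h" "z + t *\<^sub>R w \<in> S" for h :: "'a \<Rightarrow> real" and z w t
  proof -
    have "((\<lambda>t. z + t *\<^sub>R w) has_derivative (\<lambda>t. t *\<^sub>R w)) (at t)"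
      by (auto intro!: derivative_eq_intros)
    from has_derivative_compose[OF this smooth_on_has_derivative[OF that]]
    have "((\<lambda>t. h (z + t *\<^sub>R w)) has_derivative (\<lambda>s. frechet_derivative h (at (z + t *\<^sub>R w)) (s *\<^sub>R w))) (at t)" .
    moreover have "linear (frechet_derivative h (at (z + t *\<^sub>R w)))"
      using linear_frechet_derivative[OF smooth_on_differentiable[OF that]] .
    ultimately show ?thesis
      by (simp add: has_field_derivative_def linear_scale mult_commute_abs)
  qed
  have inb: "x + s *\<^sub>R w + t *\<^sub>R w' \<in> ball x d"
    if "d > 0" "0 \<le> s" "0 \<le> t" "s \<le> r" "t \<le> r" "r * N < d" "{w, w'} = {u, v}" for s t w w' r d
  proof -
    have "norm (s *\<^sub>R w + t *\<^sub>R w') \<le> s * norm w + t * norm w'"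
      using that by (metis abs_of_nonneg norm_scaleR norm_triangle_ineq)
    also have "\<dots> \<le> r * norm w + r * norm w'"
      using that by (intro add_mono mult_right_mono) auto
    also have "\<dots> \<le> r * N"
      using that by (auto simp: doubleton_eq_iff N_def algebra_simps)
    also have "\<dots> < d" by fact
    moreover have "dist x (x + s *\<^sub>R w + t *\<^sub>R w') = norm (s *\<^sub>R w + t *\<^sub>R w')"
      by (metis add.assoc add_diff_cancel_left' dist_commute dist_norm)
    ultimately show ?thesis by simp
  qed
  define \<Delta> where "\<Delta> r = f (x + r *\<^sub>R u + r *\<^sub>R v) - f (x + r *\<^sub>R u) - f (x + r *\<^sub>R v) + f x" for r
  \<comment> \<open>Giving the directions as the set \<open>{w, w'} = {u, v}\<close> lets one proof
    serve both orders, as \<open>\<Delta>\<close> is symmetric in them.\<close>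
  have step: "\<exists>p\<in>ball x d. \<Delta> r = r * r * DD w w' p"
    if d: "0 < d" "d \<le> e" and r: "0 < r" "r * N < d" and w: "{w, w'} = {u, v}" for r d w w'
  proof -
    have S: "x + s *\<^sub>R w + t *\<^sub>R w' \<in> S" if "0 \<le> s" "0 \<le> t" "s \<le> r" "t \<le> r" for s t
      using inb[OF d(1) that r(2) w] d(2) e(2) by (auto simp: subset_iff)
    define \<phi> where "\<phi> t = f (x + r *\<^sub>R w' + t *\<^sub>R w) - f (x + t *\<^sub>R w)" for t
    have der1: "(\<phi> has_real_derivative (D w (x + r *\<^sub>R w' + t *\<^sub>R w) - D w (x + t *\<^sub>R w))) (at t)"
      if "0 \<le> t" "t \<le> r" for t
    proof -
      have a: "x + r *\<^sub>R w' + t *\<^sub>R w \<in> S"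
        unfolding add.assoc add.commute[of "r *\<^sub>R w'"] unfolding add.assoc[symmetric]
        using S[of t r] that r by simp
      have b: "x + t *\<^sub>R w \<in> S" using S[of t 0] that r by simp
      show ?thesis
        unfolding \<phi>_def D_def by (rule DERIV_diff[OF line[OF assms(2) a] line[OF assms(2) b]])
    qed
    then obtain \<xi> where \<xi>: "0 < \<xi>" "\<xi> < r" "\<phi> r - \<phi> 0 = (r - 0) * (D w (x + r *\<^sub>R w' + \<xi> *\<^sub>R w) - D w (x + \<xi> *\<^sub>R w))"
      using MVT2[of 0 r \<phi> "\<lambda>t. D w (x + r *\<^sub>R w' + t *\<^sub>R w) - D w (x + t *\<^sub>R w)", OF r(1) der1] by auto
    have der2: "((\<lambda>t. D w (x + \<xi> *\<^sub>R w + t *\<^sub>R w')) has_real_derivative DD w w' (x + \<xi> *\<^sub>R w + t *\<^sub>R w')) (at t)"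
      if "0 \<le> t" "t \<le> r" for t
    proof -
      have "x + \<xi> *\<^sub>R w + t *\<^sub>R w' \<in> S" using S[of \<xi> t] that \<xi> by simp
      from line[OF smD this] show ?thesis unfolding DD_def .
    qed
    then obtain \<eta> where \<eta>: "0 < \<eta>" "\<eta> < r"
      "D w (x + \<xi> *\<^sub>R w + r *\<^sub>R w') - D w (x + \<xi> *\<^sub>R w + 0 *\<^sub>R w') = (r - 0) * DD w w' (x + \<xi> *\<^sub>R w + \<eta> *\<^sub>R w')"
      using MVT2[of 0 r "\<lambda>t. D w (x + \<xi> *\<^sub>R w + t *\<^sub>R w')" "\<lambda>t. DD w w' (x + \<xi> *\<^sub>R w + t *\<^sub>R w')", OF r(1) der2]
      by auto
    have swap: "x + r *\<^sub>R w' + s *\<^sub>R w = x + s *\<^sub>R w + r *\<^sub>R w'" for s by simp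
    have "w = u \<and> w' = v \<or> w = v \<and> w' = u" using w by (auto simp: doubleton_eq_iff)
    then have "\<Delta> r = \<phi> r - \<phi> 0"
    proof (elim disjE)
      assume a: "w = u \<and> w' = v"
      have sw: "x + r *\<^sub>R u + r *\<^sub>R v = x + r *\<^sub>R v + r *\<^sub>R u" by simp
      show ?thesis using a by (simp add: \<Delta>_def \<phi>_def sw)
    qed (simp add: \<Delta>_def \<phi>_def)
    also have "\<dots> = r * r * DD w w' (x + \<xi> *\<^sub>R w + \<eta> *\<^sub>R w')"
      using \<xi>(3) \<eta>(3) by (simp add: swap)
    finally have "\<Delta> r = r * r * DD w w' (x + \<xi> *\<^sub>R w + \<eta> *\<^sub>R w')" .
    moreover have "x + \<xi> *\<^sub>R w + \<eta> *\<^sub>R w' \<in> ball x d"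
      using inb[OF d(1) _ _ _ _ r(2) w, of \<xi> \<eta>] \<xi> \<eta> by simp
    ultimately show ?thesis by blast
  qed
  have "DD u v x = DD v u x"
  proof (rule ccontr)
    assume ne: "DD u v x \<noteq> DD v u x"
    define \<delta> where "\<delta> = \<bar>DD u v x - DD v u x\<bar> / 2"
    have "\<delta> > 0" using ne by (simp add: \<delta>_def)
    have near: "\<exists>d>0. \<forall>y. dist y x < d \<longrightarrow> dist (DD w w' y) (DD w w' x) < \<delta>" for w w'
      using cDD[of w w'] \<open>\<delta> > 0\<close> unfolding continuous_at_eps_delta by blast
    obtain d1 where d1: "d1 > 0" "\<And>y. dist y x < d1 \<Longrightarrow> dist (DD u v y) (DD u v x) < \<delta>"
      using near by blast
    obtain d2 where d2: "d2 > 0" "\<And>y. dist y x < d2 \<Longrightarrow> dist (DD v u y) (DD v u x) < \<delta>"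
      using near by blast
    define d where "d = min e (min d1 d2)"
    have d: "0 < d" "d \<le> e" using d1 d2 e by (auto simp: d_def)
    define r where "r = d / (2 * N)"
    have r: "0 < r" "r * N < d" using d \<open>N > 0\<close> by (auto simp: r_def)
    obtain p where p: "p \<in> ball x d" "\<Delta> r = r * r * DD u v p"
      using step[OF d r refl] by blast
    obtain q where q: "q \<in> ball x d" "\<Delta> r = r * r * DD v u q"
      using step[OF d r insert_commute] by blast
    have "DD u v p = DD v u q" using r p q by simp
    moreover have "dist (DD u v p) (DD u v x) < \<delta>" "dist (DD v u q) (DD v u x) < \<delta>"
      using d1(2)[of p] d2(2)[of q] p q by (auto simp: d_def dist_commute)
    ultimately show False unfolding \<delta>_def dist_real_def by (auto simp: abs_real_def split: if_splits)
  qed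
  then show ?thesis by (simp add: DD_def D_def[abs_def])
qed

section \<open>Quantitative bounds on derivatives\<close>

text \<open>A bound on a C^k norm, stated as a predicate so that no supremum has to exist.
  Differentiability is built in because \<open>frechet_derivative\<close> is arbitrary where a
  function is not differentiable.\<close>

primrec ck_bounded ::
    "nat \<Rightarrow> 'a::euclidean_space set \<Rightarrow> ('a \<Rightarrow> 'b::euclidean_space) \<Rightarrow> real \<Rightarrow> bool" where
  "ck_bounded 0 S f M = (\<forall>x\<in>S. norm (f x) \<le> M)"
| "ck_bounded (Suc k) S f M =
     ((\<forall>x\<in>S. norm (f x) \<le> M) \<and> (\<forall>x\<in>S. f differentiable (at x)) \<and>
      (\<forall>b\<in>Basis. ck_bounded k S (\<lambda>x. frechet_derivative f (at x) b) M))"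

lemma ck_bounded_norm_le: "ck_bounded k S f M \<Longrightarrow> x \<in> S \<Longrightarrow> norm (f x) \<le> M"
  by (cases k) auto

lemma ck_bounded_SucD: "ck_bounded (Suc k) S f M \<Longrightarrow> ck_bounded k S f M"
proof (induction k arbitrary: f)
  case (Suc k)
  then show ?case by (subst ck_bounded.simps) (simp del: ck_bounded.simps add: ck_bounded.simps(2)[of "Suc k"])
qed auto

lemma ck_bounded_mono: "ck_bounded k S f M \<Longrightarrow> M \<le> M' \<Longrightarrow> ck_bounded k S f M'"
  by (induction k arbitrary: f) force+

lemma ck_bounded_subset: "ck_bounded k S f M \<Longrightarrow> T \<subseteq> S \<Longrightarrow> ck_bounded k T f M"
  by (induction k arbitrary: f) auto

lemma ck_bounded_cong:
  assumes "open S" "\<And>x. x \<in> S \<Longrightarrow> f x = g x" "ck_bounded k S f M"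
  shows "ck_bounded k S g M"
  using assms(2,3)
proof (induction k arbitrary: f g)
  case (Suc k)
  have der: "(g has_derivative frechet_derivative f (at x)) (at x)" if "x \<in> S" for x
  proof (rule has_derivative_transform_within_open[OF _ \<open>open S\<close> that])
    show "(f has_derivative frechet_derivative f (at x)) (at x)"
      using Suc.prems(2) that by (intro has_derivative_frechet) auto
  qed (use Suc in auto)
  have "ck_bounded k S (\<lambda>x. frechet_derivative g (at x) b) M" if "b \<in> Basis" for b
  proof (rule Suc.IH)
    show "ck_bounded k S (\<lambda>x. frechet_derivative f (at x) b) M"
      using Suc.prems that by simp
    show "frechet_derivative f (at x) b = frechet_derivative g (at x) b" if "x \<in> S" for x
      using frechet_derivative_eqI[OF der[OF that]] by simp
  qed
  moreover have "norm (g x) \<le> M" if "x \<in> S" for x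
    using Suc.prems that ck_bounded_norm_le by metis
  ultimately show ?case
    using der by (auto simp: differentiable_def)
qed auto

lemma ck_bounded_SucI:
  assumes "open S" "\<And>x. x \<in> S \<Longrightarrow> norm (f x) \<le> M"
    "\<And>x. x \<in> S \<Longrightarrow> (f has_derivative f' x) (at x)"
    "\<And>b. b \<in> Basis \<Longrightarrow> ck_bounded k S (\<lambda>x. f' x b) M"
  shows "ck_bounded (Suc k) S f M"
proof -
  have "ck_bounded k S (\<lambda>x. frechet_derivative f (at x) b) M" if "b \<in> Basis" for b
    by (rule ck_bounded_cong[OF assms(1) _ assms(4)[OF that]])
      (simp add: frechet_derivative_eqI[OF assms(3)])
  then show ?thesis
    using assms(2,3) by (auto simp: differentiable_def)
qed

lemma ck_bounded_has_derivative:
  "ck_bounded (Suc k) S f M \<Longrightarrow> x \<in> S \<Longrightarrow> (f has_derivative frechet_derivative f (at x)) (at x)"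
  by (intro has_derivative_frechet) simp

text \<open>One order is lost: a bound on the derivatives of top order does not make them
  continuous, but their existence makes those of one order less continuous.\<close>

lemma ck_bounded_imp_C_k_on:
  assumes "open S" "ck_bounded (Suc k) S f M"
  shows "C_k_on k S f"
  using assms(2)
proof (induction k arbitrary: f)
  case 0
  then show ?case
    by (auto intro!: differentiable_imp_continuous_on simp: differentiable_on_def differentiable_at_withinI)
next
  case (Suc k)
  show ?case
    by (rule C_k_on_SucI[OF assms(1) ck_bounded_has_derivative[OF Suc.prems]])
      (use Suc in auto)
qed

lemma smooth_on_ck_boundedI:
  "open S \<Longrightarrow> (\<And>k. \<exists>M. ck_bounded k S f M) \<Longrightarrow> smooth_on S f"
  unfolding smooth_on_def using ck_bounded_imp_C_k_on by blast

lemma ck_bounded_const: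
  fixes c :: "'b::euclidean_space"
  shows "norm c \<le> M \<Longrightarrow> ck_bounded k S (\<lambda>x. c) M"
proof (induction k arbitrary: c)
  case (Suc k)
  from order_trans[OF norm_ge_zero Suc.prems] have "ck_bounded k S (\<lambda>x. 0::'b) M"
    using Suc.IH[of 0] by simp
  with Suc show ?case by simp
qed auto

lemma ck_bounded_add:
  assumes "open S" "ck_bounded k S f M" "ck_bounded k S g N"
  shows "ck_bounded k S (\<lambda>x. f x + g x) (M + N)"
  using assms(2,3)
proof (induction k arbitrary: f g)
  case 0
  then show ?case by (auto intro: norm_triangle_mono)
next
  case (Suc k)
  show ?case
  proof (rule ck_bounded_SucI[OF assms(1)])
    show "((\<lambda>x. f x + g x) has_derivative
        (\<lambda>v. frechet_derivative f (at x) v + frechet_derivative g (at x) v)) (at x)" if "x \<in> S" for x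
      using Suc.prems that by (intro has_derivative_add has_derivative_frechet) auto
  qed (use Suc in \<open>auto intro: norm_triangle_mono\<close>)
qed

lemma ck_bounded_sum:
  fixes M :: real
  assumes "open S" "\<And>i. i \<in> A \<Longrightarrow> ck_bounded k S (f i) M" "finite A"
  shows "ck_bounded k S (\<lambda>x. \<Sum>i\<in>A. f i x) (real (card A) * M)"
  using assms(3,2)
proof (induction A rule: finite_induct)
  case (insert i A)
  have "ck_bounded k S (\<lambda>x. f i x + (\<Sum>i\<in>A. f i x)) (M + real (card A) * M)"
    using insert by (intro ck_bounded_add assms(1)) auto
  then show ?case using insert by (simp add: algebra_simps)
qed (simp add: ck_bounded_const)

lemma ck_bounded_bounded_linear:
  assumes "open S" "bounded_linear L" "\<And>x. norm (L x) \<le> K * norm x" "0 \<le> K" "ck_bounded k S f M"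
  shows "ck_bounded k S (\<lambda>x. L (f x)) (K * M)"
  using assms(5)
proof (induction k arbitrary: f)
  case 0
  then show ?case using assms(3,4) by simp (meson mult_left_mono order_trans)
next
  case (Suc k)
  show ?case
  proof (rule ck_bounded_SucI[OF assms(1)])
    show "((\<lambda>x. L (f x)) has_derivative (\<lambda>v. L (frechet_derivative f (at x) v))) (at x)" if "x \<in> S" for x
      using Suc.prems that
      by (intro bounded_linear.has_derivative[OF assms(2)] has_derivative_frechet) auto
    show "norm (L (f x)) \<le> K * M" if "x \<in> S" for x
      using assms(3,4) Suc.prems that by (meson ck_bounded_norm_le mult_left_mono order_trans)
  qed (use Suc in auto)
qed

text \<open>Each differentiation turns a product into two products, whence the factor
  \<open>2^k\<close>.\<close>

lemma ck_bounded_bilinear: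
  assumes "open S" "bounded_bilinear pr" "\<And>x y. norm (pr x y) \<le> norm x * norm y"
    "ck_bounded k S f M" "ck_bounded k S g N" "0 \<le> M" "0 \<le> N"
  shows "ck_bounded k S (\<lambda>x. pr (f x) (g x)) (2^k * M * N)"
  using assms(4,5)
proof (induction k arbitrary: f g)
  case 0
  have "norm (pr (f x) (g x)) \<le> M * N" if "x \<in> S" for x
    using 0 that assms(3)[of "f x" "g x"] mult_mono[of "norm (f x)" M "norm (g x)" N] assms(6) by force
  then show ?case by simp
next
  case (Suc k)
  show ?case
  proof (rule ck_bounded_SucI[OF assms(1)])
    fix x assume "x \<in> S"
    have "norm (pr (f x) (g x)) \<le> M * N"
      using Suc.prems \<open>x \<in> S\<close> assms(3)[of "f x" "g x"] mult_mono[of "norm (f x)" M "norm (g x)" N] assms(6) by force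
    also have "\<dots> \<le> 2 ^ Suc k * (M * N)"
      using mult_right_mono[of 1 "2 ^ Suc k" "M * N"] assms(6,7) one_le_power[of "2::real" "Suc k"] by simp
    finally show "norm (pr (f x) (g x)) \<le> 2 ^ Suc k * M * N" by (simp add: mult.assoc)
    show "((\<lambda>x. pr (f x) (g x)) has_derivative
        (\<lambda>v. pr (f x) (frechet_derivative g (at x) v) + pr (frechet_derivative f (at x) v) (g x))) (at x)"
      using Suc.prems \<open>x \<in> S\<close>
      by (intro bounded_bilinear.FDERIV[OF assms(2)] has_derivative_frechet) auto
  next
    fix b :: 'a assume "b \<in> Basis"
    have "ck_bounded k S (\<lambda>x. pr (f x) (frechet_derivative g (at x) b) + pr (frechet_derivative f (at x) b) (g x))
        (2^k * M * N + 2^k * M * N)"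
      using Suc.prems \<open>b \<in> Basis\<close> ck_bounded_SucD[OF Suc.prems(1)] ck_bounded_SucD[OF Suc.prems(2)]
      by (intro ck_bounded_add[OF assms(1)] Suc.IH) auto
    moreover have "2^k * M * N + 2^k * M * N = 2^Suc k * M * N" by simp
    ultimately show "ck_bounded k S (\<lambda>x. pr (f x) (frechet_derivative g (at x) b) + pr (frechet_derivative f (at x) b) (g x))
        (2^Suc k * M * N)" by (simp only:)
  qed
qed

lemmas ck_bounded_mult =
  ck_bounded_bilinear[OF _ bounded_bilinear_mult norm_mult_ineq]

lemma ck_bounded_Un: "ck_bounded k A f M \<Longrightarrow> ck_bounded k B f M \<Longrightarrow> ck_bounded k (A \<union> B) f M"
  by (induction k arbitrary: f) auto

text \<open>\<open>g\<close> is controlled only inside \<open>B\<close>. The open sets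
  \<open>S \<inter> B\<close>, where the function is the product, and \<open>S - K\<close>, where it
  is 0, cover \<open>S\<close>, and bounds on two sets combine to a bound on their union.\<close>

lemma ck_bounded_cutoff:
  fixes \<rho> :: "'a::euclidean_space \<Rightarrow> real" and g :: "'a \<Rightarrow> 'b::euclidean_space"
  assumes "open S" "open B" "closed K" "K \<subseteq> B"
    and "ck_bounded k S \<rho> M" "\<And>x. x \<in> S - K \<Longrightarrow> \<rho> x = 0" "ck_bounded k (S \<inter> B) g N" "0 \<le> M" "0 \<le> N"
  shows "ck_bounded k S (\<lambda>x. if x \<in> B then \<rho> x *\<^sub>R g x else 0) (2 ^ k * M * N)"
proof -
  have "ck_bounded k (S \<inter> B) (\<lambda>x. \<rho> x *\<^sub>R g x) (2 ^ k * M * N)"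
    using assms ck_bounded_subset[OF assms(5), of "S \<inter> B"]
    by (intro ck_bounded_bilinear[OF _ bounded_bilinear_scaleR]) auto
  then have 1: "ck_bounded k (S \<inter> B) (\<lambda>x. if x \<in> B then \<rho> x *\<^sub>R g x else 0) (2 ^ k * M * N)"
    by (rule ck_bounded_cong[rotated 2]) (use assms(1,2) in auto)
  have "ck_bounded k (S - K) (\<lambda>x. 0 :: 'b) (2 ^ k * M * N)"
    using assms(8,9) by (intro ck_bounded_const) simp
  then have 2: "ck_bounded k (S - K) (\<lambda>x. if x \<in> B then \<rho> x *\<^sub>R g x else 0) (2 ^ k * M * N)"
    by (rule ck_bounded_cong[rotated 2]) (use assms(1,3,6) in auto)
  have "S = (S \<inter> B) \<union> (S - K)" using assms(4) by auto
  then show ?thesis using ck_bounded_Un[OF 1 2] by metis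
qed

text \<open>\<open>D\<close> lists the successive derivatives of a function of one variable. Every
  derivative of the composite pulls out a factor \<open>l b\<close>, of size at most
  \<open>L\<close>; since \<open>L\<close> is at least 1, the power \<open>L ^ k\<close> also covers
  the lower orders.\<close>

lemma ck_bounded_affine:
  fixes D :: "nat \<Rightarrow> real \<Rightarrow> real"
  assumes "open S" "bounded_linear l" "\<And>b. b \<in> Basis \<Longrightarrow> \<bar>l b\<bar> \<le> L" "1 \<le> L" "0 \<le> M"
    "\<And>i t. i \<le> j + k \<Longrightarrow> \<bar>D i t\<bar> \<le> M" "\<And>i t. (D i has_real_derivative D (Suc i) t) (at t)"
  shows "ck_bounded k S (\<lambda>x. D j (l x + c)) (L ^ k * M)"
  using assms(6)
proof (induction k arbitrary: j)
  case 0
  then show ?case by simp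
next
  case (Suc k)
  show ?case
  proof (rule ck_bounded_SucI[OF assms(1)])
    have "1 * M \<le> L ^ Suc k * M"
      using assms(4,5) by (intro mult_right_mono one_le_power)
    then show "norm (D j (l x + c)) \<le> L ^ Suc k * M" for x
      using Suc.prems[of j "l x + c"] by simp
    show "((\<lambda>x. D j (l x + c)) has_derivative (\<lambda>h. D (Suc j) (l x + c) * l h)) (at x)" for x
    proof -
      have "((\<lambda>x. l x + c) has_derivative (\<lambda>h. l h)) (at x)"
        using bounded_linear_imp_has_derivative[OF assms(2)] by (auto intro!: derivative_eq_intros)
      from has_derivative_compose[OF this assms(7)[unfolded has_field_derivative_def]]
      show ?thesis .
    qed
    show "ck_bounded k S (\<lambda>x. D (Suc j) (l x + c) * l b) (L ^ Suc k * M)" if "b \<in> Basis" for b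
    proof -
      have *: "ck_bounded k S (\<lambda>x. D (Suc j) (l x + c)) (L ^ k * M)"
        by (rule Suc.IH) (use Suc.prems in auto)
      have "ck_bounded k S (\<lambda>x. D (Suc j) (l x + c) * l b) (L * (L ^ k * M))"
      proof (rule ck_bounded_bounded_linear[OF assms(1) bounded_linear_mult_left _ _ *])
        show "norm (x * l b) \<le> L * norm x" for x
          using mult_left_mono[OF assms(3)[OF that], of "\<bar>x\<bar>"] by (simp add: abs_mult mult.commute)
      qed (use assms(4) in simp)
      then show ?thesis by (simp add: mult.assoc)
    qed
  qed
qed

lemma ck_bounded_compact:
  assumes "smooth_on U f" "compact K" "K \<subseteq> U"
  shows "\<exists>M\<ge>0. ck_bounded k K f M"
  using assms(1)
proof (induction k arbitrary: f)
  case 0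
  have "compact (f ` K)"
    using smooth_on_imp_continuous_on[OF 0] assms(2,3) by (metis compact_continuous_image continuous_on_subset)
  then obtain B where "\<forall>x\<in>K. norm (f x) \<le> B"
    using bounded_iff compact_imp_bounded by (metis imageI)
  then show ?case by (intro exI[of _ "max 0 B"]) auto
next
  case (Suc k)
  from Suc.IH[OF Suc.prems] obtain M0 where M0: "M0 \<ge> 0" "ck_bounded k K f M0" by blast
  have "\<exists>M\<ge>0. ck_bounded k K (\<lambda>x. frechet_derivative f (at x) b) M" for b
    by (rule Suc.IH[OF smooth_on_frechet_derivative[OF Suc.prems]])
  then obtain M where M: "\<And>b. M b \<ge> 0" "\<And>b. ck_bounded k K (\<lambda>x. frechet_derivative f (at x) b) (M b)"
    by metis
  define N where "N = M0 + (\<Sum>b\<in>Basis. M b)"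
  have "M b \<le> N" if "b \<in> Basis" for b
    using member_le_sum[of b Basis M] that M(1) M0 by (simp add: N_def add_increasing)
  then have "\<forall>b\<in>Basis. ck_bounded k K (\<lambda>x. frechet_derivative f (at x) b) N"
    using M(2) ck_bounded_mono by blast
  moreover have "M0 \<le> N" "0 \<le> N" using M(1) M0 by (auto simp: N_def sum_nonneg add_nonneg_nonneg)
  moreover have "\<forall>x\<in>K. f differentiable at x"
    using smooth_on_differentiable[OF Suc.prems] assms(3) by blast
  moreover have "\<forall>x\<in>K. norm (f x) \<le> N"
    using M0 ck_bounded_norm_le \<open>M0 \<le> N\<close> by (meson order_trans)
  ultimately show ?case by auto
qed

section \<open>Slices, parameter integrals and series\<close>

lemma has_derivative_slice:
  fixes F :: "'a::real_normed_vector \<times> 'c::real_normed_vector \<Rightarrow> 'b::real_normed_vector"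
  assumes "(F has_derivative F') (at (x, t))"
  shows "((\<lambda>x. F (x, t)) has_derivative (\<lambda>h. F' (h, 0))) (at x)"
proof -
  have "((\<lambda>x. (x, t)) has_derivative (\<lambda>h. (h, 0))) (at x)"
    by (auto intro!: derivative_eq_intros)
  from has_derivative_compose[OF this assms] show ?thesis .
qed

lemma ck_bounded_slice:
  fixes F :: "'a::euclidean_space \<times> 'c::euclidean_space \<Rightarrow> 'b::euclidean_space"
  assumes "open A" "t \<in> T" "ck_bounded k (A \<times> T) F M"
  shows "ck_bounded k A (\<lambda>x. F (x, t)) M"
  using assms(3)
proof (induction k arbitrary: F)
  case 0
  then show ?case using assms(2) by auto
next
  case (Suc k)
  show ?case
  proof (rule ck_bounded_SucI[OF assms(1)])
    fix x assume "x \<in> A"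
    with assms(2) have m: "(x, t) \<in> A \<times> T" by simp
    show "norm (F (x, t)) \<le> M" using Suc.prems m ck_bounded_norm_le by blast
    show "((\<lambda>x. F (x, t)) has_derivative (\<lambda>h. frechet_derivative F (at (x, t)) (h, 0))) (at x)"
      by (rule has_derivative_slice[OF ck_bounded_has_derivative[OF Suc.prems m]])
  next
    fix b :: 'a assume "b \<in> Basis"
    then have "(b, 0 :: 'c) \<in> Basis" by (simp add: Basis_prod_def)
    then show "ck_bounded k A (\<lambda>x. frechet_derivative F (at (x, t)) (b, 0)) M"
      using Suc.IH[of "\<lambda>z. frechet_derivative F (at z) (b, 0)"] Suc.prems by simp
  qed
qed

lemma has_derivative_integral:
  fixes F :: "'a::euclidean_space \<times> real \<Rightarrow> 'b::euclidean_space"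
  assumes "open S" "open V" "S \<times> {a..b} \<subseteq> V" "smooth_on V F" "x \<in> S"
  shows "((\<lambda>x. integral {a..b} (\<lambda>t. F (x, t))) has_derivative
    (\<lambda>h. integral {a..b} (\<lambda>t. frechet_derivative F (at (x, t)) (h, 0)))) (at x)"
proof -
  obtain e where e: "e > 0" "ball x e \<subseteq> S" using assms(1,5) open_contains_ball by blast
  \<comment> \<open>The Leibniz rule wants the derivative as a continuous map into the bounded
    linear functions, so it is repackaged as a \<open>Blinfun\<close>; continuity is then checked
    component by component.\<close>
  define fx where "fx x t = Blinfun (\<lambda>h. frechet_derivative F (at (x, t)) (h, 0))" for x t
  have der: "((\<lambda>x. F (x, t)) has_derivative (\<lambda>h. frechet_derivative F (at (x, t)) (h, 0))) (at x)"
    if "(x, t) \<in> V" for x t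
    by (rule has_derivative_slice[OF smooth_on_has_derivative[OF assms(4) that]])
  have fx: "blinfun_apply (fx x t) = (\<lambda>h. frechet_derivative F (at (x, t)) (h, 0))" if "(x, t) \<in> V" for x t
    unfolding fx_def using has_derivative_bounded_linear[OF der[OF that]] by (rule bounded_linear_Blinfun_apply)
  have sub: "ball x e \<times> cbox a b \<subseteq> V" using e assms(3) by (auto simp: subset_iff)
  have cF: "continuous_on V F" "continuous_on V (\<lambda>z. frechet_derivative F (at z) v)" for v
    using assms(4) smooth_on_imp_continuous_on smooth_on_frechet_derivative by blast+
  have pr: "continuous_on (cbox a b) (\<lambda>t. g (y, t))" if "continuous_on V g" "y \<in> ball x e" for g :: "'a \<times> real \<Rightarrow> 'b" and y
    by (rule continuous_on_compose2[OF that(1)]) (use sub that in \<open>auto intro!: continuous_intros\<close>)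
  have cfx: "continuous_on (ball x e \<times> cbox a b) (\<lambda>(x, t). fx x t)"
  proof (rule continuous_on_blinfun_componentwise)
    fix i :: 'a
    have "continuous_on (ball x e \<times> cbox a b) (\<lambda>z. frechet_derivative F (at z) (i, 0))"
      using cF(2) sub continuous_on_subset by blast
    then show "continuous_on (ball x e \<times> cbox a b) (\<lambda>z. blinfun_apply (case z of (x, t) \<Rightarrow> fx x t) i)"
      by (rule continuous_on_eq) (use sub fx in \<open>auto simp: subset_iff\<close>)
  qed
  have "((\<lambda>x. integral (cbox a b) (\<lambda>t. F (x, t))) has_derivative blinfun_apply (integral (cbox a b) (fx x)))
     (at x within ball x e)"
  proof (rule leibniz_rule[OF _ _ cfx])
    show "((\<lambda>x. F (x, t)) has_derivative blinfun_apply (fx y t)) (at y within ball x e)"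
      if "y \<in> ball x e" "t \<in> cbox a b" for y t
    proof -
      have "(y, t) \<in> V" using that sub by blast
      then show ?thesis using der[of y t] fx[of y t] by (simp add: has_derivative_at_withinI)
    qed
    show "(\<lambda>t. F (y, t)) integrable_on cbox a b" if "y \<in> ball x e" for y
      using pr[OF cF(1) that] by (rule integrable_continuous)
  qed (use e in auto)
  moreover have "blinfun_apply (integral (cbox a b) (fx x)) =
      (\<lambda>h. integral {a..b} (\<lambda>t. frechet_derivative F (at (x, t)) (h, 0)))"
  proof
    fix h
    have "continuous_on (cbox a b) (fx x)"
    proof -
      have "continuous_on (cbox a b) (\<lambda>t. case (x, t) of (x, t) \<Rightarrow> fx x t)"
        by (rule continuous_on_compose2[OF cfx]) (use e in \<open>auto intro!: continuous_intros\<close>)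
      then show ?thesis by simp
    qed
    then have "blinfun_apply (integral (cbox a b) (fx x)) h = integral (cbox a b) (\<lambda>t. blinfun_apply (fx x t) h)"
      by (intro blinfun_apply_integral integrable_continuous)
    also have "\<dots> = integral (cbox a b) (\<lambda>t. frechet_derivative F (at (x, t)) (h, 0))"
      by (rule integral_cong) (use fx assms(3,5) in \<open>auto simp: subset_iff\<close>)
    finally show "blinfun_apply (integral (cbox a b) (fx x)) h =
        integral {a..b} (\<lambda>t. frechet_derivative F (at (x, t)) (h, 0))" by simp
  qed
  moreover have "at x within ball x e = at x" using at_within_open[of x "ball x e"] e(1) by simp
  ultimately show ?thesis by simp
qed

lemma ck_bounded_integral:
  fixes F :: "'a::euclidean_space \<times> real \<Rightarrow> 'b::euclidean_space"
  assumes "open S" "open V" "S \<times> {a..b} \<subseteq> V" "smooth_on V F" "a \<le> b"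
    "\<And>t. t \<in> {a..b} \<Longrightarrow> ck_bounded k S (\<lambda>x. F (x, t)) M"
  shows "ck_bounded k S (\<lambda>x. integral {a..b} (\<lambda>t. F (x, t))) (M * (b - a))"
  using assms(4,6)
proof (induction k arbitrary: F)
  case (0 F)
  show ?case
  proof (simp, intro ballI)
    fix x assume "x \<in> S"
    have "continuous_on {a..b} (\<lambda>t. F (x, t))"
      by (rule continuous_on_compose2[OF smooth_on_imp_continuous_on[OF 0(1)]])
        (use assms(3) \<open>x \<in> S\<close> in \<open>auto intro!: continuous_intros\<close>)
    moreover have "norm (F (x, t)) \<le> M" if "t \<in> {a..b}" for t using 0(2)[OF that] \<open>x \<in> S\<close> by simp
    ultimately show "norm (integral {a..b} (\<lambda>t. F (x, t))) \<le> M * (b - a)"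
      using assms(5) integral_bound by blast
  qed
next
  case (Suc k F)
  have der: "((\<lambda>x. F (x, t)) has_derivative (\<lambda>h. frechet_derivative F (at (x, t)) (h, 0))) (at x)"
    if "x \<in> S" "t \<in> {a..b}" for x t
    by (rule has_derivative_slice[OF smooth_on_has_derivative[OF Suc.prems(1)]]) (use that assms(3) in auto)
  show ?case
  proof (rule ck_bounded_SucI[OF assms(1)])
    have "ck_bounded k S (\<lambda>x. integral {a..b} (\<lambda>t. F (x, t))) (M * (b - a))"
      using Suc.prems(1) ck_bounded_SucD[OF Suc.prems(2)] by (rule Suc.IH)
    then show "norm (integral {a..b} (\<lambda>t. F (x, t))) \<le> M * (b - a)" if "x \<in> S" for x
      using ck_bounded_norm_le that by blast
    show "((\<lambda>x. integral {a..b} (\<lambda>t. F (x, t))) has_derivative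
        (\<lambda>h. integral {a..b} (\<lambda>t. frechet_derivative F (at (x, t)) (h, 0)))) (at x)" if "x \<in> S" for x
      by (rule has_derivative_integral[OF assms(1-3) Suc.prems(1) that])
    fix v :: 'a assume v: "v \<in> Basis"
    show "ck_bounded k S (\<lambda>x. integral {a..b} (\<lambda>t. frechet_derivative F (at (x, t)) (v, 0))) (M * (b - a))"
    proof (rule Suc.IH[of "\<lambda>z. frechet_derivative F (at z) (v, 0)"])
      show "smooth_on V (\<lambda>z. frechet_derivative F (at z) (v, 0))"
        using Suc.prems(1) by (rule smooth_on_frechet_derivative)
      fix t assume t: "t \<in> {a..b}"
      have "ck_bounded k S (\<lambda>x. frechet_derivative (\<lambda>x. F (x, t)) (at x) v) M"
        using Suc.prems(2)[OF t] v by simp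
      then show "ck_bounded k S (\<lambda>x. frechet_derivative F (at (x, t)) (v, 0)) M"
        by (rule ck_bounded_cong[OF assms(1), rotated]) (simp add: frechet_derivative_eqI[OF der[OF _ t]])
    qed
  qed
qed

text \<open>Termwise differentiation: summability of the bounds of order 1 makes the series of first
  derivatives converge uniformly. The induction then treats that series with the shifted bounds
  \<open>M (Suc j)\<close>, so bounds of every order are carried along.\<close>

lemma ck_bounded_series:
  fixes f :: "nat \<Rightarrow> 'a::euclidean_space \<Rightarrow> 'b::euclidean_space"
  assumes "open S" "convex S" "\<And>k n. ck_bounded k S (f n) (M k n)" "\<And>k. summable (M k)"
  shows "ck_bounded k S (\<lambda>x. \<Sum>n. f n x) (suminf (M k))"
  using assms(3,4)
proof (induction k arbitrary: f M)
  case (0 f M)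
  have "norm (\<Sum>n. f n x) \<le> suminf (M 0)" if "x \<in> S" for x
    using 0(1)[of 0] that by (intro norm_suminf_le 0(2)) simp
  then show ?case by simp
next
  case (Suc k f M)
  have bd: "norm (f n x) \<le> M j n" if "x \<in> S" for n x j
    using ck_bounded_norm_le[OF Suc.prems(1) that] .
  have sm: "summable (\<lambda>n. f n x)" if "x \<in> S" for x
    using Suc.prems(2)[of 0] bd[OF that] by (rule summable_comparison_test'[where N = 0])
  define f' where "f' n x h = frechet_derivative (f n) (at x) h" for n x h
  have f': "((f n) has_derivative f' n x) (at x)" if "x \<in> S" for n x
    unfolding f'_def using ck_bounded_has_derivative[OF Suc.prems(1) that] by simp
  \<comment> \<open>The bounds concern basis directions; summing over the basis turns them into a
    bound on the derivative as a linear map, at the cost of the dimension.\<close>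
  define d where "d = real (DIM('a))"
  have bd': "norm (f' n x h) \<le> M 1 n * d * norm h" if "x \<in> S" for n x h
  proof -
    have "norm (f' n x b) \<le> M 1 n" if "b \<in> Basis" for b
      using Suc.prems(1)[of 1 n] that \<open>x \<in> S\<close> by (auto simp: f'_def)
    then have sum: "(\<Sum>b\<in>Basis. norm (f' n x b)) \<le> d * M 1 n"
      using sum_bounded_above[of "Basis::'a set" "\<lambda>b. norm (f' n x b)" "M 1 n"] by (simp add: d_def)
    show ?thesis
    proof -
      have "norm (f' n x h) \<le> norm h * (\<Sum>b\<in>Basis. norm (f' n x b))"
        by (rule norm_linear_le_Basis[OF has_derivative_linear[OF f'[OF that]]])
      also have "\<dots> \<le> norm h * (d * M 1 n)" using sum by (intro mult_left_mono) auto
      finally show ?thesis by (simp add: mult.commute)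
    qed
  qed
  have smM: "summable (\<lambda>n. M 1 n * c)" for c using Suc.prems(2) by (rule summable_mult2)
  have sm': "summable (\<lambda>n. f' n x h)" if "x \<in> S" for x h
    using smM bd'[OF that, of _ h, unfolded mult.assoc] by (rule summable_comparison_test'[where N = 0])
  have uni: "\<forall>\<^sub>F n in sequentially. \<forall>x\<in>S. \<forall>h. norm ((\<Sum>i<n. f' i x h) - (\<Sum>i. f' i x h)) \<le> e * norm h"
    if "e > 0" for e
  proof -
    from suminf_exist_split[OF that smM[of d]] obtain N
      where N: "\<And>n. n \<ge> N \<Longrightarrow> norm (\<Sum>i. M 1 (i + n) * d) < e" by blast
    have "norm ((\<Sum>i<n. f' i x h) - (\<Sum>i. f' i x h)) \<le> e * norm h" if "n \<ge> N" "x \<in> S" for n x h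
    proof -
      have "(\<Sum>i<n. f' i x h) - (\<Sum>i. f' i x h) = - (\<Sum>i. f' (i + n) x h)"
        using suminf_split_initial_segment[OF sm'[OF that(2)], of h n] by simp
      then have "norm ((\<Sum>i<n. f' i x h) - (\<Sum>i. f' i x h)) = norm (\<Sum>i. f' (i + n) x h)" by simp
      also have "\<dots> \<le> (\<Sum>i. M 1 (i + n) * d * norm h)"
      proof (rule norm_suminf_le)
        show "summable (\<lambda>i. M 1 (i + n) * d * norm h)"
          using smM[of "d * norm h"] summable_iff_shift[of "\<lambda>i. M 1 i * d * norm h" n] by (simp add: mult.assoc)
      qed (rule bd'[OF that(2)])
      also have "\<dots> = (\<Sum>i. M 1 (i + n) * d) * norm h"
        using smM[of d] summable_iff_shift[of "\<lambda>i. M 1 i * d" n] by (simp add: suminf_mult2)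
      also have "\<dots> \<le> e * norm h"
        using N[OF that(1)] by (intro mult_right_mono) auto
      finally show ?thesis .
    qed
    then show ?thesis unfolding eventually_sequentially by blast
  qed
  have der: "((\<lambda>x. \<Sum>n. f n x) has_derivative (\<lambda>h. \<Sum>n. f' n x h)) (at x)" if x: "x \<in> S" for x
  proof -
    have "\<exists>g. \<forall>x\<in>S. (\<lambda>n. f n x) sums g x \<and> (g has_derivative (\<lambda>h. \<Sum>n. f' n x h)) (at x within S)"
      by (rule has_derivative_series[where f = f and f' = f' and g' = "\<lambda>x h. \<Sum>n. f' n x h",
            OF assms(2) has_derivative_at_withinI[OF f'] uni x summable_sums[OF sm[OF x]]])
    then obtain g where g: "\<And>x. x \<in> S \<Longrightarrow> (\<lambda>n. f n x) sums g x"
        "\<And>x. x \<in> S \<Longrightarrow> (g has_derivative (\<lambda>h. \<Sum>n. f' n x h)) (at x within S)" by blast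
    show ?thesis
    proof (rule has_derivative_transform_within_open[OF _ assms(1) x])
      show "(g has_derivative (\<lambda>h. \<Sum>n. f' n x h)) (at x)"
        using g(2)[OF x] at_within_open[OF x assms(1)] by simp
      show "g y = (\<Sum>n. f n y)" if "y \<in> S" for y using g(1)[OF that] by (rule sums_unique)
    qed
  qed
  show ?case
  proof (rule ck_bounded_SucI[OF assms(1) _ der])
    show "norm (\<Sum>n. f n x) \<le> suminf (M (Suc k))" if "x \<in> S" for x
      using Suc.prems(2) bd[OF that] by (rule norm_suminf_le[rotated])
    show "ck_bounded k S (\<lambda>x. \<Sum>n. f' n x b) (suminf (M (Suc k)))" if "b \<in> Basis" for b
    proof (rule Suc.IH[of "\<lambda>n x. f' n x b" "\<lambda>j. M (Suc j)"])
      show "ck_bounded j S (\<lambda>x. f' n x b) (M (Suc j) n)" for j n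
        using Suc.prems(1)[of "Suc j" n] that by (simp add: f'_def)
    qed (rule Suc.prems(2))
  qed
qed

section \<open>Families of polynomial growth and smooth bump functions\<close>

text \<open>\<open>poly_growth k f\<close> will say that the C^k norms of the \<open>f i\<close> on
  their domains are at most one fixed polynomial in the weights \<open>w i\<close>. Closure under
  sums, products and reciprocals then takes the place of explicit constants. In the interpretations
  the index is a cell, a point on the contour of a cell, or a lattice index, and the weight is
  always \<open>n + 1\<close>.\<close>

locale growth_family =
  fixes I :: "'i set" and S :: "'i \<Rightarrow> 'a::euclidean_space set" and w :: "'i \<Rightarrow> real"
  assumes open_S: "i \<in> I \<Longrightarrow> open (S i)" and w_ge_1: "i \<in> I \<Longrightarrow> 1 \<le> w i"
begin

definition poly_growth :: "nat \<Rightarrow> ('i \<Rightarrow> 'a \<Rightarrow> 'b::euclidean_space) \<Rightarrow> bool" where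
  "poly_growth k f \<longleftrightarrow> (\<exists>C N. 0 \<le> C \<and> (\<forall>i\<in>I. ck_bounded k (S i) (f i) (C * w i ^ N)))"

lemma poly_growthI: "0 \<le> C \<Longrightarrow> (\<And>i. i \<in> I \<Longrightarrow> ck_bounded k (S i) (f i) (C * w i ^ N)) \<Longrightarrow> poly_growth k f"
  unfolding poly_growth_def by blast

lemma poly_growthE:
  assumes "poly_growth k f"
  obtains C N where "0 \<le> C" "\<And>i. i \<in> I \<Longrightarrow> ck_bounded k (S i) (f i) (C * w i ^ N)"
  using assms unfolding poly_growth_def by blast

lemma growth_mono:
  assumes "i \<in> I" "0 \<le> C" "C \<le> C'" "N \<le> N'"
  shows "C * w i ^ N \<le> C' * w i ^ N'"
  using w_ge_1[OF assms(1)] assms by (intro mult_mono power_increasing) auto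

lemma poly_growth_SucD: "poly_growth (Suc k) f \<Longrightarrow> poly_growth k f"
  unfolding poly_growth_def using ck_bounded_SucD by blast

lemma poly_growth_const:
  assumes "0 \<le> C" "\<And>i. i \<in> I \<Longrightarrow> norm (c i) \<le> C * w i ^ N"
  shows "poly_growth k (\<lambda>i x. c i)"
  using assms by (intro poly_growthI[of C k _ N] ck_bounded_const)

lemma poly_growth_add:
  assumes "poly_growth k f" "poly_growth k g"
  shows "poly_growth k (\<lambda>i x. f i x + g i x)"
  using assms(1)
proof (rule poly_growthE)
  fix C N assume f: "0 \<le> C" "\<And>i. i \<in> I \<Longrightarrow> ck_bounded k (S i) (f i) (C * w i ^ N)"
  from assms(2) show ?thesis
  proof (rule poly_growthE)
    fix C' N' assume g: "0 \<le> C'" "\<And>i. i \<in> I \<Longrightarrow> ck_bounded k (S i) (g i) (C' * w i ^ N')"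
    show ?thesis
    proof (rule poly_growthI)
      show "0 \<le> C + C'" using f g by simp
      fix i assume i: "i \<in> I"
      have "C * w i ^ N + C' * w i ^ N' \<le> C * w i ^ (N + N') + C' * w i ^ (N + N')"
        using f(1) g(1) i by (intro add_mono growth_mono) auto
      then have "C * w i ^ N + C' * w i ^ N' \<le> (C + C') * w i ^ (N + N')"
        by (simp add: distrib_right)
      then show "ck_bounded k (S i) (\<lambda>x. f i x + g i x) ((C + C') * w i ^ (N + N'))"
        using ck_bounded_add[OF open_S[OF i] f(2)[OF i] g(2)[OF i]] ck_bounded_mono by blast
    qed
  qed
qed

lemma poly_growth_bilinear:
  assumes "bounded_bilinear pr" "\<And>x y. norm (pr x y) \<le> norm x * norm y" "poly_growth k f" "poly_growth k g"
  shows "poly_growth k (\<lambda>i x. pr (f i x) (g i x))"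
  using assms(3)
proof (rule poly_growthE)
  fix C N assume f: "0 \<le> C" "\<And>i. i \<in> I \<Longrightarrow> ck_bounded k (S i) (f i) (C * w i ^ N)"
  from assms(4) show ?thesis
  proof (rule poly_growthE)
    fix C' N' assume g: "0 \<le> C'" "\<And>i. i \<in> I \<Longrightarrow> ck_bounded k (S i) (g i) (C' * w i ^ N')"
    show ?thesis
    proof (rule poly_growthI)
      show "0 \<le> 2 ^ k * C * C'" using f g by simp
      fix i assume i: "i \<in> I"
      have "0 \<le> w i" using w_ge_1[OF i] by simp
      then have "ck_bounded k (S i) (\<lambda>x. pr (f i x) (g i x)) (2 ^ k * (C * w i ^ N) * (C' * w i ^ N'))"
        using f(1) g(1) by (intro ck_bounded_bilinear[OF open_S[OF i] assms(1,2) f(2)[OF i] g(2)[OF i]]) auto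
      then show "ck_bounded k (S i) (\<lambda>x. pr (f i x) (g i x)) (2 ^ k * C * C' * w i ^ (N + N'))"
        by (simp add: power_add mult_ac)
    qed
  qed
qed

lemmas poly_growth_mult = poly_growth_bilinear[OF bounded_bilinear_mult norm_mult_ineq]

lemma poly_growth_bounded_linear:
  assumes "bounded_linear L" "poly_growth k f"
  shows "poly_growth k (\<lambda>i x. L (f i x))"
  using assms(2)
proof (rule poly_growthE)
  obtain K where K: "K > 0" "\<And>x. norm (L x) \<le> norm x * K"
    using bounded_linear.pos_bounded[OF assms(1)] by blast
  fix C N assume f: "0 \<le> C" "\<And>i. i \<in> I \<Longrightarrow> ck_bounded k (S i) (f i) (C * w i ^ N)"
  show ?thesis
  proof (rule poly_growthI)
    show "0 \<le> K * C" using f K by simp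
    fix i assume i: "i \<in> I"
    have "ck_bounded k (S i) (\<lambda>x. L (f i x)) (K * (C * w i ^ N))"
      using K by (intro ck_bounded_bounded_linear[OF open_S[OF i] assms(1) _ _ f(2)[OF i]]) (auto simp: mult.commute)
    then show "ck_bounded k (S i) (\<lambda>x. L (f i x)) (K * C * w i ^ N)" by (simp add: mult.assoc)
  qed
qed

lemma poly_growth_SucI:
  fixes f :: "'i \<Rightarrow> 'a \<Rightarrow> 'b::euclidean_space"
  assumes "poly_growth 0 f" "\<And>i x. i \<in> I \<Longrightarrow> x \<in> S i \<Longrightarrow> (f i has_derivative f' i x) (at x)"
    "\<And>b. b \<in> Basis \<Longrightarrow> poly_growth k (\<lambda>i x. f' i x b)"
  shows "poly_growth (Suc k) f"
  using assms(1)
proof (rule poly_growthE)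
  fix C0 N0 assume f: "0 \<le> C0" "\<And>i. i \<in> I \<Longrightarrow> ck_bounded 0 (S i) (f i) (C0 * w i ^ N0)"
  have "\<forall>b\<in>Basis. \<exists>C N. 0 \<le> C \<and> (\<forall>i\<in>I. ck_bounded k (S i) (\<lambda>x. f' i x b) (C * w i ^ N))"
    using assms(3) unfolding poly_growth_def by blast
  then obtain C N where C: "\<And>b. b \<in> Basis \<Longrightarrow> 0 \<le> C b"
    "\<And>b i. b \<in> Basis \<Longrightarrow> i \<in> I \<Longrightarrow> ck_bounded k (S i) (\<lambda>x. f' i x b) (C b * w i ^ N b)"
    by metis
  define C' where "C' = C0 + (\<Sum>b\<in>Basis. C b)"
  define N' where "N' = N0 + (\<Sum>b\<in>Basis. N b)"
  have CN: "C b \<le> C'" "N b \<le> N'" if "b \<in> Basis" for b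
    using member_le_sum[of b Basis C] member_le_sum[of b Basis N] that C(1) f(1)
    by (auto simp: C'_def N'_def)
  have C0: "C0 \<le> C'" "N0 \<le> N'" using C(1) by (auto simp: C'_def N'_def sum_nonneg)
  show ?thesis
  proof (rule poly_growthI)
    show "0 \<le> C'" using C0 f by simp
    fix i assume i: "i \<in> I"
    show "ck_bounded (Suc k) (S i) (f i) (C' * w i ^ N')"
    proof (rule ck_bounded_SucI[OF open_S[OF i] _ assms(2)[OF i]])
      show "norm (f i x) \<le> C' * w i ^ N'" if "x \<in> S i" for x
        using f(2)[OF i] that growth_mono[OF i f(1) C0] by force
      show "ck_bounded k (S i) (\<lambda>x. f' i x b) (C' * w i ^ N')" if "b \<in> Basis" for b
        using C(2)[OF that i] growth_mono[OF i C(1)[OF that] CN[OF that]] by (rule ck_bounded_mono)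
    qed
  qed
qed

text \<open>A lower bound by an inverse power of the weight is what keeps a reciprocal of polynomial
  growth. Its derivatives follow from D(1/f) = - (1/f) Df (1/f) and closure under products.\<close>

lemma poly_growth_inverse:
  fixes f :: "'i \<Rightarrow> 'a \<Rightarrow> 'b::{euclidean_space,real_normed_field}"
  assumes "poly_growth k f" "0 < c" "\<And>i x. i \<in> I \<Longrightarrow> x \<in> S i \<Longrightarrow> c \<le> norm (f i x) * w i ^ N"
  shows "poly_growth k (\<lambda>i x. inverse (f i x))"
  using assms(1)
proof (induction k)
  case 0
  show ?case
  proof (rule poly_growthI)
    show "0 \<le> inverse c" using assms(2) by simp
    fix i assume i: "i \<in> I"
    have "norm (inverse (f i x)) \<le> inverse c * w i ^ N" if "x \<in> S i" for x
    proof -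
      have "0 < norm (f i x)" using assms(3)[OF i that] assms(2) by (cases "f i x = 0") auto
      then have "inverse (norm (f i x)) \<le> inverse c * w i ^ N"
        using assms(3)[OF i that] assms(2) by (simp add: field_simps)
      then show ?thesis by (simp only: norm_inverse)
    qed
    then show "ck_bounded 0 (S i) (\<lambda>x. inverse (f i x)) (inverse c * w i ^ N)" by simp
  qed
next
  case (Suc k)
  have k: "poly_growth k f" "poly_growth k (\<lambda>i x. inverse (f i x))"
    using Suc poly_growth_SucD by blast+
  have 0: "poly_growth 0 (\<lambda>i x. inverse (f i x))"
    using k(2) by (auto elim!: poly_growthE intro!: poly_growthI dest!: ck_bounded_norm_le)
  have d: "(f i has_derivative frechet_derivative (f i) (at x)) (at x)" if "i \<in> I" "x \<in> S i" for i x
    using Suc.prems that by (elim poly_growthE) (blast intro: ck_bounded_has_derivative)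
  show ?case
  proof (rule poly_growth_SucI[OF 0])
    fix i x assume i: "i \<in> I" "x \<in> S i"
    have "f i x \<noteq> 0" using assms(3)[OF i] assms(2) by auto
    from Deriv.has_derivative_inverse[OF this d[OF i]]
    show "((\<lambda>x. inverse (f i x)) has_derivative
        (\<lambda>v. - (inverse (f i x) * frechet_derivative (f i) (at x) v * inverse (f i x)))) (at x)" .
  next
    fix b :: 'a assume b: "b \<in> Basis"
    have "poly_growth k (\<lambda>i x. frechet_derivative (f i) (at x) b)"
      using Suc.prems b by (elim poly_growthE) (auto intro!: poly_growthI)
    then show "poly_growth k (\<lambda>i x. - (inverse (f i x) * frechet_derivative (f i) (at x) b * inverse (f i x)))"
      by (intro poly_growth_bounded_linear[OF bounded_linear_minus[OF bounded_linear_ident]] poly_growth_mult k(2))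
  qed
qed

lemma poly_growth_linear_var:
  assumes "bounded_linear L" "\<And>i x. i \<in> I \<Longrightarrow> x \<in> S i \<Longrightarrow> norm (L x) \<le> R" "0 \<le> R"
  shows "poly_growth k (\<lambda>i x. L x)"
proof -
  have 0: "poly_growth 0 (\<lambda>i x. L x)"
    using assms(2,3) by (intro poly_growthI[of R _ _ 0]) auto
  show ?thesis
  proof (cases k)
    case (Suc j)
    show ?thesis
      unfolding Suc
    proof (rule poly_growth_SucI[OF 0])
      show "(L has_derivative L) (at x)" for x
        using assms(1) by (rule bounded_linear_imp_has_derivative)
      show "poly_growth j (\<lambda>i x. L b)" for b
        by (rule poly_growth_const[of "norm (L b)" _ 0]) auto
    qed
  qed (use 0 in simp)
qed

end

section \<open>Flat functions, steps and bumps\<close>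

lemma flat_exp_tendsto: "((\<lambda>x::real. inverse x ^ m * exp (- inverse x)) \<longlongrightarrow> 0) (at_right 0)"
proof -
  have "((\<lambda>y::real. y ^ m / exp y) \<longlongrightarrow> 0) at_top" by (rule tendsto_power_div_exp_0)
  from filterlim_compose[OF this filterlim_inverse_at_top_right]
  show ?thesis by (simp add: exp_minus divide_inverse)
qed

definition flat_exp :: "nat \<Rightarrow> real \<Rightarrow> real" where
  "flat_exp m x = (if x > 0 then inverse x ^ m * exp (- inverse x) else 0)"

text \<open>The powers of \<open>inverse x\<close> close the family under differentiation. At 0 the
  difference quotient from the right is the member with index \<open>m + 1\<close>, which tends to
  0.\<close>

lemma flat_exp_has_derivative:
  "(flat_exp m has_real_derivative flat_exp (m + 2) x - m * flat_exp (m + 1) x) (at x)"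
proof -
  consider "x > 0" | "x < 0" | "x = 0" by linarith
  then show ?thesis
  proof cases
    case 1
    have inv: "(inverse has_real_derivative - (inverse x ^ Suc (Suc 0))) (at x)"
      using 1 by (intro DERIV_inverse) simp
    have "((\<lambda>x. inverse x ^ m * exp (- inverse x)) has_real_derivative
        flat_exp (m + 2) x - m * flat_exp (m + 1) x) (at x)"
      by (rule DERIV_cong[OF DERIV_mult[OF DERIV_power[OF inv] DERIV_chain2[OF DERIV_exp DERIV_minus[OF inv]]]])
        (use 1 in \<open>cases m; simp add: flat_exp_def algebra_simps power_add power2_eq_square\<close>)
    then show ?thesis
      by (rule has_field_derivative_transform_within_open[OF _ open_greaterThan[of 0]])
        (use 1 in \<open>auto simp: flat_exp_def\<close>)
  next
    case 2
    have "((\<lambda>x. 0) has_real_derivative flat_exp (m + 2) x - m * flat_exp (m + 1) x) (at x)"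
      using 2 by (simp add: flat_exp_def)
    then show ?thesis
      by (rule has_field_derivative_transform_within_open[OF _ open_lessThan[of 0]])
        (use 2 in \<open>auto simp: flat_exp_def\<close>)
  next
    case 3
    have "((\<lambda>y. flat_exp m y / y) \<longlongrightarrow> 0) (at_right 0)"
    proof (rule Lim_transform_eventually[OF flat_exp_tendsto[of "Suc m"]])
      show "\<forall>\<^sub>F x in at_right 0. inverse x ^ Suc m * exp (- inverse x) = flat_exp m x / x"
        by (auto simp: eventually_at_filter flat_exp_def divide_inverse)
    qed
    moreover have "((\<lambda>y. flat_exp m y / y) \<longlongrightarrow> 0) (at_left 0)"
    proof (rule Lim_transform_eventually[OF tendsto_const])
      show "\<forall>\<^sub>F x in at_left 0. 0 = flat_exp m x / x"
        by (auto simp: eventually_at_filter flat_exp_def)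
    qed
    ultimately have "((\<lambda>y. flat_exp m y / y) \<longlongrightarrow> 0) (at 0)"
      by (simp add: filterlim_split_at)
    then show ?thesis
      using 3 by (simp add: has_field_derivative_iff flat_exp_def)
  qed
qed

lemma smooth_on_flat_exp: "smooth_on UNIV (flat_exp m)"
proof -
  have "C_k_on k UNIV (flat_exp m)" for k
  proof (induction k arbitrary: m)
    case 0
    show ?case
      using flat_exp_has_derivative[of m] DERIV_isCont
      by (auto simp: continuous_on_eq_continuous_at)
  next
    case (Suc k)
    show ?case
    proof (rule C_k_on_SucI[OF open_UNIV])
      show "(flat_exp m has_derivative (\<lambda>h. (flat_exp (m + 2) x - m * flat_exp (m + 1) x) * h)) (at x)" for x
        using flat_exp_has_derivative[of m x] by (simp add: has_field_derivative_def)
      have "C_k_on k UNIV (\<lambda>x. (flat_exp (m + 2) x + (- real m) * flat_exp (m + 1) x) * b)" for b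
        by (intro C_k_on_bounded_linear[OF open_UNIV bounded_linear_mult_left] C_k_on_add open_UNIV
            C_k_on_bounded_linear[OF open_UNIV bounded_linear_mult_right] Suc)
      then show "C_k_on k UNIV (\<lambda>x. (flat_exp (m + 2) x - m * flat_exp (m + 1) x) * b)" for b
        by simp
    qed
  qed
  then show ?thesis by (simp add: smooth_on_def)
qed

text \<open>The quotient g(x) / (g(x) + g(1 - x)) with \<open>g\<close> flat at 0 does it; the
  denominator is positive because \<open>x\<close> or \<open>1 - x\<close> is.\<close>

lemma smooth_step_exists:
  obtains \<sigma> :: "real \<Rightarrow> real" where "smooth_on UNIV \<sigma>" "\<And>x. x \<le> 0 \<Longrightarrow> \<sigma> x = 0" "\<And>x. 1 \<le> x \<Longrightarrow> \<sigma> x = 1"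
proof -
  define g where "g = flat_exp 0"
  have g: "smooth_on UNIV g" "\<And>x. x \<le> 0 \<Longrightarrow> g x = 0" "\<And>x. 0 < x \<Longrightarrow> 0 < g x"
    using smooth_on_flat_exp[of 0] by (auto simp: g_def flat_exp_def)
  have "0 \<le> g x" for x using g(2)[of x] g(3)[of x] by linarith
  then have pos: "g x + g (1 - x) > 0" for x
    using g(3)[of x] g(3)[of "1 - x"] by (cases "x > 0") (auto intro: add_pos_nonneg add_nonneg_pos)
  have "smooth_on UNIV (\<lambda>x. g (1 - x))"
    by (rule smooth_on_compose[OF g(1)]) (auto intro: smooth_on_diff smooth_on_id)
  then have "smooth_on UNIV (\<lambda>x. g x / (g x + g (1 - x)))"
    using pos by (intro smooth_on_divide smooth_on_add g(1)) (auto simp: less_imp_neq[symmetric])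
  moreover have "g x / (g x + g (1 - x)) = 1" if "1 \<le> x" for x
    using g(2)[of "1 - x"] g(3)[of x] that by simp
  ultimately show ?thesis using that[of "\<lambda>x. g x / (g x + g (1 - x))"] g(2) by simp
qed

lemma smooth_on_deriv_funpow:
  fixes f :: "real \<Rightarrow> real"
  assumes "smooth_on S f" "open S"
  shows "smooth_on S ((deriv ^^ n) f)"
    and "x \<in> S \<Longrightarrow> ((deriv ^^ n) f has_real_derivative (deriv ^^ Suc n) f x) (at x)"
proof -
  have *: "smooth_on S (deriv g) \<and> (\<forall>x\<in>S. (g has_real_derivative deriv g x) (at x))"
    if g: "smooth_on S g" for g
  proof -
    have d: "(g has_real_derivative frechet_derivative g (at x) 1) (at x)" if "x \<in> S" for x
    proof -
      have lin: "linear (frechet_derivative g (at x))"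
        using linear_frechet_derivative[OF smooth_on_differentiable[OF g that]] .
      have "frechet_derivative g (at x) = (\<lambda>h. frechet_derivative g (at x) 1 * h)"
      proof
        fix h show "frechet_derivative g (at x) h = frechet_derivative g (at x) 1 * h"
          using linear_scale[OF lin, of h 1] by simp
      qed
      then show ?thesis
        using smooth_on_has_derivative[OF g that] by (simp add: has_field_derivative_def)
    qed
    then have e: "deriv g x = frechet_derivative g (at x) 1" if "x \<in> S" for x
      using DERIV_imp_deriv that by blast
    have "smooth_on S (deriv g)"
      by (rule smooth_on_cong[OF assms(2) e[symmetric] smooth_on_frechet_derivative[OF g]])
    then show ?thesis using d e by simp
  qed
  show 1: "smooth_on S ((deriv ^^ n) f)"
    by (induction n) (use assms(1) * in auto)
  show "((deriv ^^ n) f has_real_derivative (deriv ^^ Suc n) f x) (at x)" if "x \<in> S"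
    using * [OF 1] that by simp
qed

lemma smooth_bump_exists:
  obtains b :: "real \<Rightarrow> real" where "smooth_on UNIV b" "\<And>x. 1 < \<bar>x\<bar> \<Longrightarrow> b x = 0"
    "\<And>x (N::int). \<bar>x\<bar> \<le> of_int N \<Longrightarrow> (\<Sum>j\<in>{-N-1..N+1}. b (x - of_int j)) = 1"
    "\<And>k. \<exists>M. \<forall>i\<le>k. \<forall>t. \<bar>(deriv ^^ i) b t\<bar> \<le> M"
proof -
  obtain \<sigma> :: "real \<Rightarrow> real" where \<sigma>: "smooth_on UNIV \<sigma>" "\<And>x. x \<le> 0 \<Longrightarrow> \<sigma> x = 0" "\<And>x. 1 \<le> x \<Longrightarrow> \<sigma> x = 1"
    using smooth_step_exists by blast
  \<comment> \<open>A difference of two shifted steps vanishes for |x| > 1, and its integer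
    translates telescope to 1.\<close>
  define b where "b x = \<sigma> (x + 1) - \<sigma> x" for x
  have sm: "smooth_on UNIV b"
    unfolding b_def
    by (intro smooth_on_diff smooth_on_compose[OF \<sigma>(1)] smooth_on_add \<sigma>(1)) (auto intro: smooth_on_id)
  have b0: "b x = 0" if "1 < \<bar>x\<bar>" for x
    using that \<sigma>(2)[of x] \<sigma>(2)[of "x + 1"] \<sigma>(3)[of x] \<sigma>(3)[of "x + 1"] by (auto simp: b_def abs_if split: if_splits)
  have tel: "(\<Sum>j\<in>{a..a + int n}. b (x - of_int j)) = \<sigma> (x - of_int a + 1) - \<sigma> (x - of_int (a + int n))" for x a n
  proof (induction n)
    case (Suc n)
    have "{a..a + int (Suc n)} = insert (a + int n + 1) {a..a + int n}" by auto
    then show ?case using Suc by (simp add: b_def algebra_simps)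
  qed (simp add: b_def algebra_simps)
  have sum: "(\<Sum>j\<in>{-N-1..N+1}. b (x - of_int j)) = 1" if "\<bar>x\<bar> \<le> of_int N" for x and N :: int
  proof -
    have "0 \<le> N" using that by (metis abs_ge_zero of_int_0_le_iff order_trans)
    then have "-N-1 + int (nat (2 * N + 2)) = N + 1" by simp
    from tel[of x "-N-1" "nat (2 * N + 2)", unfolded this]
    show ?thesis using \<sigma>(2)[of "x - of_int (N + 1)"] \<sigma>(3)[of "x - of_int (-N-1) + 1"] that by simp
  qed
  have bd: "\<exists>M. \<forall>t. \<bar>(deriv ^^ i) b t\<bar> \<le> M" for i
  proof -
    \<comment> \<open>All derivatives vanish off [-1, 1] too, so compactness of this interval bounds
      each of them on the whole line.\<close>
    have z: "\<forall>t. 1 < \<bar>t\<bar> \<longrightarrow> (deriv ^^ i) b t = 0"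
    proof (induction i)
      case (Suc i)
      show ?case
      proof (intro allI impI)
        fix t :: real assume t: "1 < \<bar>t\<bar>"
        have "open {t::real. 1 < \<bar>t\<bar>}" by (intro open_Collect_less continuous_intros)
        from has_field_derivative_transform_within_open[OF DERIV_const this, of t 0 "(deriv ^^ i) b"]
        have "((deriv ^^ i) b has_real_derivative 0) (at t)"
          using t Suc by simp
        then show "(deriv ^^ Suc i) b t = 0" by (simp add: DERIV_imp_deriv)
      qed
    qed (use b0 in simp)
    have "continuous_on {-1..1} ((deriv ^^ i) b)"
      using smooth_on_imp_continuous_on[OF smooth_on_deriv_funpow(1)[OF sm open_UNIV]] continuous_on_subset by blast
    then have "compact ((deriv ^^ i) b ` {-1..1})" by (intro compact_continuous_image) auto
    then have "bounded ((deriv ^^ i) b ` {-1..1})" by (rule compact_imp_bounded)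
    then obtain M where "\<forall>y\<in>(deriv ^^ i) b ` {-1..1}. norm y \<le> M"
      unfolding bounded_iff by blast
    then have M: "\<bar>(deriv ^^ i) b t\<bar> \<le> M" if "t \<in> {-1..1}" for t
      using that by auto
    have "\<bar>(deriv ^^ i) b t\<bar> \<le> max 0 M" for t
    proof (cases "1 < \<bar>t\<bar>")
      case False
      then have "t \<in> {-1..1}" by auto
      from M[OF this] show ?thesis by simp
    qed (use z in simp)
    then show ?thesis by blast
  qed
  then obtain M where M: "\<And>i t. \<bar>(deriv ^^ i) b t\<bar> \<le> M i" by metis
  have "\<exists>M. \<forall>i\<le>k. \<forall>t. \<bar>(deriv ^^ i) b t\<bar> \<le> M" for k
  proof (intro exI allI impI)
    fix i t assume "i \<le> k"
    have "\<bar>(deriv ^^ i) b t\<bar> \<le> M i" by (rule M)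
    also have "M i \<le> (\<Sum>i\<le>k. M i)"
      using \<open>i \<le> k\<close> M by (intro member_le_sum) (auto intro: order_trans[OF abs_ge_zero])
    finally show "\<bar>(deriv ^^ i) b t\<bar> \<le> (\<Sum>i\<le>k. M i)" .
  qed
  then show ?thesis using that[OF sm b0 sum] by blast
qed

section \<open>Division of exponentials by quartic polynomials\<close>

text \<open>The vector holds only the lower coefficients of a monic polynomial. The field is
  arbitrary so that the same polynomial can be evaluated at a real \<open>x\<close> and along a
  complex contour.\<close>

definition quartic :: "real^4 \<Rightarrow> 'a::real_normed_field \<Rightarrow> 'a" where
  "quartic p w = w ^ 4 + of_real (p $ 3) * w ^ 3 + of_real (p $ 2) * w\<^sup>2 + of_real (p $ 1) * w + of_real (p $ 0)"

lemma quartic_of_real: "quartic p (of_real x) = of_real (quartic p x)"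
  by (simp add: quartic_def)

lemma norm_quartic_diff_le:
  fixes w :: "'a::real_normed_field" and p a :: "real^4"
  assumes "norm w \<le> 1" "\<And>j. \<bar>p $ j - a $ j\<bar> \<le> e"
  shows "norm (quartic p w - quartic a w) \<le> 4 * e"
proof -
  have t: "norm (of_real (p $ j - a $ j) * w ^ k) \<le> e" for j k
  proof -
    have "norm (of_real (p $ j - a $ j) * w ^ k) = \<bar>p $ j - a $ j\<bar> * norm w ^ k"
      by (simp only: norm_mult norm_power norm_of_real)
    also have "\<dots> \<le> e * 1"
      using assms by (intro mult_mono power_le_one) (auto intro: order_trans[OF abs_ge_zero])
    finally show ?thesis by simp
  qed
  have "quartic p w - quartic a w = of_real (p $ 3 - a $ 3) * w ^ 3 + of_real (p $ 2 - a $ 2) * w ^ 2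
      + of_real (p $ 1 - a $ 1) * w ^ 1 + of_real (p $ 0 - a $ 0) * w ^ 0"
    by (simp add: quartic_def algebra_simps)
  also have "norm \<dots> \<le> e + e + e + e"
    by (intro norm_triangle_le add_mono t order_trans[OF norm_triangle_ineq])
  finally show ?thesis by simp
qed

lemma norm_poly_prod_mset_ge:
  fixes w :: complex
  assumes "\<And>z. z \<in># A \<Longrightarrow> c \<le> norm (w - z)" "0 \<le> c"
  shows "c ^ size A \<le> norm (poly (\<Prod>z\<in>#A. [:- z, 1:]) w)"
  using assms(1)
proof (induction A)
  case (add z A)
  have "c * c ^ size A \<le> norm (w - z) * norm (poly (\<Prod>z\<in>#A. [:- z, 1:]) w)"
    using add assms(2) by (intro mult_mono) auto
  then show ?case by (simp add: norm_mult[symmetric] algebra_simps)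
qed simp

text \<open>Each of the at most four roots is close to at most one of the five pairs of lines.\<close>

lemma quartic_line_avoiding_roots:
  fixes p :: "real^4" and d :: real
  assumes "0 < d"
  obtains m :: nat where "1 \<le> m" "m \<le> 5"
    "\<And>w :: complex. \<bar>Im w\<bar> = m * d \<Longrightarrow> (d / 2) ^ 4 \<le> norm (quartic p w)"
proof -
  define P :: "complex poly" where
    "P = [:of_real (p $ 0), of_real (p $ 1), of_real (p $ 2), of_real (p $ 3), 1:]"
  have P: "degree P = 4" "lead_coeff P = 1" "P \<noteq> 0" "poly P w = quartic p w" for w
    by (simp_all add: P_def quartic_def algebra_simps power_numeral_reduce)
  from alg_closed_imp_factorization[OF P(3)] obtain A
    where "size A = degree P" "P = smult (lead_coeff P) (\<Prod>x\<in>#A. [:- x, 1:])"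
    by blast
  then have A: "size A = 4" "P = (\<Prod>x\<in>#A. [:- x, 1:])"
    using P(1,2) by (metis, metis smult_1_left)
  \<comment> \<open>A number \<open>m\<close> is bad for \<open>z\<close> if one of the lines at
    heights \<open>m * d\<close> and \<open>- m * d\<close> comes within \<open>d / 2\<close> of
    \<open>z\<close>; the inner absolute value treats both lines at once. The spacing
    \<open>d\<close> allows at most one bad \<open>m\<close> per root.\<close>
  define bad where "bad z = {m \<in> {1..5::nat}. \<bar>\<bar>Im z\<bar> - m * d\<bar> < d / 2}" for z :: complex
  have "card (bad z) \<le> 1" for z
  proof -
    have "m = m'" if "m \<in> bad z" "m' \<in> bad z" for m m'
    proof -
      have "\<bar>\<bar>Im z\<bar> - m * d\<bar> < d / 2" "\<bar>\<bar>Im z\<bar> - m' * d\<bar> < d / 2"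
        using that by (auto simp: bad_def)
      then have "\<bar>m * d - m' * d\<bar> < d" by linarith
      then have "\<bar>real m - real m'\<bar> * d < 1 * d" using assms by (simp add: abs_mult left_diff_distrib[symmetric])
      then have "\<bar>real m - real m'\<bar> < 1" using assms by (simp only: mult_less_cancel_right_pos)
      then show ?thesis by linarith
    qed
    then have "card (bad z) \<le> card {()}" by (intro card_inj_on_le[where f = "\<lambda>_. ()"]) (auto intro: inj_onI)
    then show ?thesis by simp
  qed
  then have "card (\<Union>z\<in>set_mset A. bad z) \<le> (\<Sum>z\<in>set_mset A. 1)"
    by (intro order_trans[OF card_UN_le] sum_mono) auto
  also have "\<dots> \<le> 4"
  proof -
    have "card (set_mset A) \<le> size A"
      by (metis mset_set_set_mset_msubset size_mset_mono size_mset_set)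
    then show ?thesis using A by simp
  qed
  finally have "card (\<Union>z\<in>set_mset A. bad z) < card {1..5::nat}" by simp
  then have "\<not> {1..5::nat} \<subseteq> (\<Union>z\<in>set_mset A. bad z)"
    using card_mono[of "\<Union>z\<in>set_mset A. bad z" "{1..5}"] by (auto simp: bad_def)
  then obtain m where m: "m \<in> {1..5}" "\<And>z. z \<in># A \<Longrightarrow> m \<notin> bad z" by blast
  show ?thesis
  proof (rule that)
    fix w :: complex assume w: "\<bar>Im w\<bar> = m * d"
    have "d / 2 \<le> norm (w - z)" if "z \<in># A" for z
    proof -
      have "d / 2 \<le> \<bar>\<bar>Im w\<bar> - \<bar>Im z\<bar>\<bar>"
        using m(2)[OF that] m(1) w by (auto simp: bad_def abs_minus_commute)
      also have "\<dots> \<le> \<bar>Im (w - z)\<bar>" by simp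
      also have "\<dots> \<le> norm (w - z)" by (rule abs_Im_le_cmod)
      finally show ?thesis .
    qed
    then have "(d / 2) ^ size A \<le> norm (poly P w)"
      using norm_poly_prod_mset_ge[of A "d / 2" w] assms A(2) by simp
    then show "(d / 2) ^ 4 \<le> norm (quartic p w)"
      using A(1) P(4) by simp
  qed (use m in auto)
qed

text \<open>Counterclockwise from the lower left corner. Index 4 repeats corner 0, so that side 3
  closes the rectangle.\<close>

definition corner :: "real \<Rightarrow> nat \<Rightarrow> complex" where
  "corner \<delta> j = (if j = 0 then Complex (-1/2) (-\<delta>) else if j = 1 then Complex (1/2) (-\<delta>)
    else if j = 2 then Complex (1/2) \<delta> else if j = 3 then Complex (-1/2) \<delta> else Complex (-1/2) (-\<delta>))"

definition side :: "real \<Rightarrow> nat \<Rightarrow> real \<Rightarrow> complex" where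
  "side \<delta> j t = corner \<delta> j + of_real t * (corner \<delta> (Suc j) - corner \<delta> j)"

text \<open>The contour integral divided by 2 pi i, spelled out as integrals over
  \<open>{0..1}\<close> so that derivatives in further parameters can be taken under the integral
  sign.\<close>

definition rect_integral :: "real \<Rightarrow> (complex \<Rightarrow> complex) \<Rightarrow> complex" where
  "rect_integral \<delta> h = (\<Sum>j<4. integral {0..1} (\<lambda>t. h (side \<delta> j t) * (corner \<delta> (Suc j) - corner \<delta> j))) / (2 * pi * \<i>)"

lemma side_linepath: "side \<delta> j t = linepath (corner \<delta> j) (corner \<delta> (Suc j)) t"
  by (simp add: side_def linepath_def scaleR_conv_of_real algebra_simps)

lemma side_cases:
  assumes "j < 4" "t \<in> {0..1}" "0 \<le> \<delta>"
  shows "\<bar>Re (side \<delta> j t)\<bar> \<le> 1/2" "\<bar>Im (side \<delta> j t)\<bar> \<le> \<delta>"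
    "\<bar>Re (side \<delta> j t)\<bar> = 1/2 \<or> \<bar>Im (side \<delta> j t)\<bar> = \<delta>"
proof -
  have t: "0 \<le> t" "t \<le> 1" "0 \<le> t * \<delta>" "t * \<delta> \<le> \<delta>"
    using assms mult_right_mono[of t 1 \<delta>] by auto
  consider "j = 0" | "j = 1" | "j = 2" | "j = 3" using assms by linarith
  then have "(\<bar>Re (side \<delta> j t)\<bar> \<le> 1/2 \<and> \<bar>Im (side \<delta> j t)\<bar> \<le> \<delta>) \<and>
    (\<bar>Re (side \<delta> j t)\<bar> = 1/2 \<or> \<bar>Im (side \<delta> j t)\<bar> = \<delta>)"
  proof cases
    case 1
    have "side \<delta> j t = Complex (t - 1/2) (-\<delta>)" by (simp add: 1 side_def corner_def complex_eq_iff)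
    moreover have "\<bar>t - 1/2\<bar> \<le> 1/2" "\<bar>1/2 - t\<bar> \<le> 1/2"
      "\<bar>2 * (t * \<delta>) - \<delta>\<bar> \<le> \<delta>" "\<bar>\<delta> - 2 * (t * \<delta>)\<bar> \<le> \<delta>" using t by linarith+
    ultimately show ?thesis using assms(3) by simp
  next
    case 2
    have "side \<delta> j t = Complex (1/2) (2 * (t * \<delta>) - \<delta>)" by (simp add: 2 side_def corner_def complex_eq_iff)
    moreover have "\<bar>t - 1/2\<bar> \<le> 1/2" "\<bar>1/2 - t\<bar> \<le> 1/2"
      "\<bar>2 * (t * \<delta>) - \<delta>\<bar> \<le> \<delta>" "\<bar>\<delta> - 2 * (t * \<delta>)\<bar> \<le> \<delta>" using t by linarith+
    ultimately show ?thesis using assms(3) by simp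
  next
    case 3
    have "side \<delta> j t = Complex (1/2 - t) \<delta>" by (simp add: 3 side_def corner_def complex_eq_iff)
    moreover have "\<bar>t - 1/2\<bar> \<le> 1/2" "\<bar>1/2 - t\<bar> \<le> 1/2"
      "\<bar>2 * (t * \<delta>) - \<delta>\<bar> \<le> \<delta>" "\<bar>\<delta> - 2 * (t * \<delta>)\<bar> \<le> \<delta>" using t by linarith+
    ultimately show ?thesis using assms(3) by simp
  next
    case 4
    have "side \<delta> j t = Complex (-1/2) (\<delta> - 2 * (t * \<delta>))" by (simp add: 4 side_def corner_def complex_eq_iff)
    moreover have "\<bar>t - 1/2\<bar> \<le> 1/2" "\<bar>1/2 - t\<bar> \<le> 1/2"
      "\<bar>2 * (t * \<delta>) - \<delta>\<bar> \<le> \<delta>" "\<bar>\<delta> - 2 * (t * \<delta>)\<bar> \<le> \<delta>" using t by linarith+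
    ultimately show ?thesis using assms(3) by simp
  qed
  then show "\<bar>Re (side \<delta> j t)\<bar> \<le> 1/2" "\<bar>Im (side \<delta> j t)\<bar> \<le> \<delta>"
    "\<bar>Re (side \<delta> j t)\<bar> = 1/2 \<or> \<bar>Im (side \<delta> j t)\<bar> = \<delta>" by auto
qed

text \<open>The four sides together form \<open>rectpath\<close>, whose winding number about the
  interior point \<open>x\<close> is 1.\<close>

lemma rect_integral_Cauchy:
  assumes "f holomorphic_on UNIV" "0 < \<delta>" "\<bar>x\<bar> < 1/2"
  shows "rect_integral \<delta> (\<lambda>w. f w * inverse (w - of_real x)) = f (of_real x)"
proof -
  define g where "g = rectpath (corner \<delta> 0) (corner \<delta> 2)"
  define h where "h w = f w / (w - of_real x)" for w
  have box: "of_real x \<in> box (corner \<delta> 0) (corner \<delta> 2)"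
    using assms by (auto simp: corner_def in_box_complex_iff)
  have "(h has_contour_integral (2*pi * \<i> * winding_number g (of_real x) * f (of_real x))) g"
    unfolding h_def
  proof (rule Cauchy_integral_formula_convex_simple[OF convex_UNIV assms(1)])
    show "path_image g \<subseteq> UNIV - {of_real x}"
      using box path_image_rectpath_inter_box[of "corner \<delta> 0" "corner \<delta> 2"] assms
      by (auto simp: g_def corner_def)
  qed (auto simp: g_def)
  moreover have "winding_number g (of_real x) = 1"
    unfolding g_def by (rule winding_number_rectpath[OF box])
  ultimately have 1: "(h has_contour_integral (2*pi * \<i> * f (of_real x))) g" by simp
  have gj: "g = linepath (corner \<delta> 0) (corner \<delta> 1) +++ linepath (corner \<delta> 1) (corner \<delta> 2) +++
      linepath (corner \<delta> 2) (corner \<delta> 3) +++ linepath (corner \<delta> 3) (corner \<delta> 4)"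
    by (simp add: g_def rectpath_def corner_def Let_def)
  define J where "J j = integral {0..1} (\<lambda>t. h (side \<delta> j t) * (corner \<delta> (Suc j) - corner \<delta> j))" for j
  have 2: "(h has_contour_integral J j) (linepath (corner \<delta> j) (corner \<delta> (Suc j)))" if "j < 4" for j
  proof -
    have ne: "side \<delta> j t \<noteq> of_real x" if "t \<in> {0..1}" for t
      using side_cases(3)[OF \<open>j < 4\<close> that, of \<delta>] assms by (auto simp: complex_eq_iff)
    have "continuous_on UNIV f" using assms(1) by (rule holomorphic_on_imp_continuous_on)
    then have "continuous_on {0..1} (\<lambda>t. f (side \<delta> j t))"
      by (rule continuous_on_compose2) (auto simp: side_def intro!: continuous_intros)
    then have "continuous_on {0..1} (\<lambda>t. h (side \<delta> j t) * (corner \<delta> (Suc j) - corner \<delta> j))"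
      unfolding h_def using ne by (intro continuous_intros) (auto simp: side_def intro!: continuous_intros)
    then show ?thesis
      unfolding has_contour_integral_linepath J_def side_linepath[symmetric]
      by (intro integrable_integral integrable_continuous_interval)
  qed
  have "(h has_contour_integral (J 0 + (J 1 + (J 2 + J 3)))) g"
    unfolding gj using 2[of 0] 2[of 1] 2[of 2] 2[of 3]
    by (intro has_contour_integral_join) (auto simp: numeral_eq_Suc)
  with 1 have "2*pi * \<i> * f (of_real x) = J 0 + (J 1 + (J 2 + J 3))"
    using has_contour_integral_unique by blast
  moreover have "(\<Sum>j<4. J j) = J 0 + (J 1 + (J 2 + J 3))"
    by (simp add: eval_nat_numeral add.assoc)
  moreover have "rect_integral \<delta> (\<lambda>w. f w * inverse (w - of_real x)) = (\<Sum>j<4. J j) / (2 * pi * \<i>)"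
    by (simp only: rect_integral_def J_def h_def divide_inverse)
  ultimately have "rect_integral \<delta> (\<lambda>w. f w * inverse (w - of_real x)) = (2*pi * \<i> * f (of_real x)) / (2 * pi * \<i>)"
    by (simp only:)
  then show ?thesis by simp
qed

lemma rect_integral_lincomb:
  fixes h :: "'i \<Rightarrow> complex \<Rightarrow> complex"
  assumes "finite A" "\<And>i j. i \<in> A \<Longrightarrow> j < 4 \<Longrightarrow> continuous_on {0..1} (\<lambda>t. h i (side \<delta> j t))"
  shows "rect_integral \<delta> (\<lambda>w. \<Sum>i\<in>A. c i * h i w) = (\<Sum>i\<in>A. c i * rect_integral \<delta> (h i))"
proof -
  define e where "e j = corner \<delta> (Suc j) - corner \<delta> j" for j
  have "integral {0..1} (\<lambda>t. (\<Sum>i\<in>A. c i * h i (side \<delta> j t)) * e j) =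
      (\<Sum>i\<in>A. c i * integral {0..1} (\<lambda>t. h i (side \<delta> j t) * e j))" if "j < 4" for j
  proof -
    have int: "(\<lambda>t. h i (side \<delta> j t) * e j) integrable_on {0..1}" if "i \<in> A" for i
      using assms(2)[OF that \<open>j < 4\<close>] by (intro integrable_continuous_interval continuous_intros)
    have "integral {0..1} (\<lambda>t. (\<Sum>i\<in>A. c i * h i (side \<delta> j t)) * e j) =
        integral {0..1} (\<lambda>t. \<Sum>i\<in>A. c i * (h i (side \<delta> j t) * e j))"
      by (simp add: sum_distrib_right mult.assoc)
    also have "\<dots> = (\<Sum>i\<in>A. integral {0..1} (\<lambda>t. c i * (h i (side \<delta> j t) * e j)))"
      using int by (intro integral_sum assms(1) integrable_on_mult_right) auto
    finally show ?thesis by simp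
  qed
  then have "rect_integral \<delta> (\<lambda>w. \<Sum>i\<in>A. c i * h i w) =
      (\<Sum>j<4. \<Sum>i\<in>A. c i * integral {0..1} (\<lambda>t. h i (side \<delta> j t) * e j)) / (2 * pi * \<i>)"
    by (simp add: rect_integral_def e_def)
  also have "\<dots> = (\<Sum>i\<in>A. \<Sum>j<4. c i * integral {0..1} (\<lambda>t. h i (side \<delta> j t) * e j)) / (2 * pi * \<i>)"
    by (subst sum.swap) rule
  finally show ?thesis
    by (simp add: rect_integral_def e_def sum_distrib_left sum_divide_distrib)
qed

text \<open>The coefficients of \<open>(quartic p w - quartic p x) / (w - x)\<close> as a polynomial in \<open>x\<close>.\<close>

definition quartic_quot :: "nat \<Rightarrow> real^4 \<Rightarrow> complex \<Rightarrow> complex" where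
  "quartic_quot j p w = (if j = 0 then w ^ 3 + of_real (p $ 3) * w\<^sup>2 + of_real (p $ 2) * w + of_real (p $ 1)
    else if j = 1 then w\<^sup>2 + of_real (p $ 3) * w + of_real (p $ 2)
    else if j = 2 then w + of_real (p $ 3) else 1)"

lemma quartic_quot:
  "quartic p w - quartic p x = (w - x) * (\<Sum>j<4. x ^ j * quartic_quot j p w)"
  by (simp add: quartic_def quartic_quot_def eval_nat_numeral algebra_simps)

text \<open>Write P for the quartic. By \<open>quartic_quot\<close>, 1/(w - x) is P(x) / (P(w) (w -
  x)) plus the sum of x^j \<open>quartic_quot j p w\<close> / P(w). Multiply by \<open>f\<close> and
  integrate: Cauchy's formula turns the left side into f(x). The integrals that form the remainder
  do not involve \<open>x\<close>.\<close>

lemma quartic_division_rect: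
  assumes "f holomorphic_on UNIV" "0 < \<delta>" "\<bar>x\<bar> < 1/2"
    and nz: "\<And>j t. j < 4 \<Longrightarrow> t \<in> {0..1} \<Longrightarrow> quartic p (side \<delta> j t) \<noteq> 0"
  shows "f (of_real x) =
    quartic p (of_real x) * rect_integral \<delta> (\<lambda>w. f w * inverse (quartic p w) * inverse (w - of_real x)) +
    (\<Sum>j<4. of_real x ^ j * rect_integral \<delta> (\<lambda>w. f w * quartic_quot j p w * inverse (quartic p w)))"
proof -
  \<comment> \<open>Indices 0 to 3 are the remainder terms and index 4 is the quotient, so that one
    finite sum is integrated.\<close>
  define h where "h i w = (if i = 4 then f w * inverse (quartic p w) * inverse (w - of_real x)
      else f w * quartic_quot i p w * inverse (quartic p w))" for i w
  define c :: "nat \<Rightarrow> complex" where "c i = (if i = 4 then quartic p (of_real x) else of_real x ^ i)" for i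
  have ne: "side \<delta> j t \<noteq> of_real x" if "j < 4" "t \<in> {0..1}" for j t
    using side_cases(3)[OF that, of \<delta>] assms by (auto simp: complex_eq_iff)
  have cf: "continuous_on {0..1} (\<lambda>t. f (side \<delta> j t))" for j
    by (rule continuous_on_compose2[OF holomorphic_on_imp_continuous_on[OF assms(1)]])
      (auto simp: side_def intro!: continuous_intros)
  have cs: "continuous_on {0..1} (\<lambda>t. side \<delta> j t)" for j
    unfolding side_def by (intro continuous_intros)
  have "f w * inverse (w - of_real x) = (\<Sum>i<5. c i * h i w)" if "w \<noteq> of_real x" "quartic p w \<noteq> 0" for w
  proof -
    have "(\<Sum>i<5. c i * h i w) = (f w * inverse (quartic p w) * inverse (w - of_real x)) *
       (quartic p (of_real x) + (w - of_real x) * (\<Sum>j<4. of_real x ^ j * quartic_quot j p w))"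
      using that by (simp add: c_def h_def eval_nat_numeral) (simp add: field_simps)
    also have "\<dots> = f w * inverse (w - of_real x)"
      unfolding quartic_quot[symmetric] using that by simp
    finally show ?thesis by simp
  qed
  then have "f (side \<delta> j t) * inverse (side \<delta> j t - of_real x) = (\<Sum>i<5. c i * h i (side \<delta> j t))"
    if "j < 4" "t \<in> {0..1}" for j t
    using ne[OF that] nz[OF that] by simp
  then have "rect_integral \<delta> (\<lambda>w. f w * inverse (w - of_real x)) = rect_integral \<delta> (\<lambda>w. \<Sum>i<5. c i * h i w)"
    unfolding rect_integral_def by (intro arg_cong[where f = "\<lambda>z. z / (2 * pi * \<i>)"] sum.cong refl integral_cong) auto
  also have "\<dots> = (\<Sum>i<5. c i * rect_integral \<delta> (h i))"
  proof (rule rect_integral_lincomb)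
    fix i j :: nat assume "j < 4"
    have cq: "continuous_on {0..1} (\<lambda>t. quartic p (side \<delta> j t))" "continuous_on {0..1} (\<lambda>t. quartic_quot i p (side \<delta> j t))"
      unfolding quartic_def quartic_quot_def using cs[of j]
      by (auto intro!: continuous_intros)[1]
        (cases "i = 0"; cases "i = 1"; cases "i = 2"; simp; intro continuous_intros cs)
    show "continuous_on {0..1} (\<lambda>t. h i (side \<delta> j t))"
      unfolding h_def using nz[OF \<open>j < 4\<close>] ne[OF \<open>j < 4\<close>]
      by (cases "i = 4") (auto intro!: continuous_intros cf cs cq)
  qed simp
  also have "\<dots> = quartic p (of_real x) * rect_integral \<delta> (h 4) + (\<Sum>j<4. of_real x ^ j * rect_integral \<delta> (h j))"
    by (simp add: c_def eval_nat_numeral)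
  also have "h 4 = (\<lambda>w. f w * inverse (quartic p w) * inverse (w - of_real x))" by (simp add: h_def[abs_def])
  also have "(\<Sum>j<4. of_real x ^ j * rect_integral \<delta> (h j)) =
      (\<Sum>j<4. of_real x ^ j * rect_integral \<delta> (\<lambda>w. f w * quartic_quot j p w * inverse (quartic p w)))"
    by (intro sum.cong) (auto simp: h_def[abs_def])
  finally show ?thesis using rect_integral_Cauchy[OF assms(1-3)] by simp
qed

text \<open>The constants fit the vertical sides of the rectangle. There |w| is at least 1/2, so w^4
  has norm at least 1/16, while coefficients below 1/256 contribute at most 1/64; and |x| < 1/4
  keeps \<open>x\<close> at distance at least 1/4.\<close>

definition quartic_dom :: "((real^4) \<times> real) set" where
  "quartic_dom = {(p, x). \<bar>x\<bar> < 1/4 \<and> (\<forall>j. \<bar>p $ j\<bar> < 1/256)}"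

text \<open>A cell \<open>(n, \<delta>, a)\<close> provides a rectangle of half-height \<open>\<delta>\<close> of order \<open>1/n\<close>, so that \<open>exp (\<i> n w)\<close>
  stays bounded on it, whose horizontal sides stay away from the roots of \<open>quartic a\<close>. The mesh is small enough for
  them to stay away from the roots of \<open>quartic p\<close> for every \<open>p\<close> in the box around \<open>a\<close>.\<close>

definition mesh :: "nat \<Rightarrow> real" where
  "mesh n = 1 / (8 * (32 * (real n + 1)) ^ 4)"

definition cell_box :: "nat \<Rightarrow> real^4 \<Rightarrow> ((real^4) \<times> real) set" where
  "cell_box n a = {(p, x). \<forall>j. \<bar>p $ j - a $ j\<bar> < mesh n}"

definition cells :: "(nat \<times> real \<times> (real^4)) set" where
  "cells = {(n, \<delta>, a). 1 / (16 * (real n + 1)) \<le> \<delta> \<and> \<delta> \<le> 5 / (16 * (real n + 1)) \<and>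
     (\<forall>w::complex. \<bar>Im w\<bar> = \<delta> \<longrightarrow> (1 / (32 * (real n + 1))) ^ 4 \<le> norm (quartic a w))}"

text \<open>The parameter \<open>t\<close> is part of the index, so growth over this family means
  bounds uniform along the contour, which integration over \<open>t\<close> preserves.\<close>

definition edges :: "((nat \<times> real \<times> (real^4)) \<times> nat \<times> real) set" where
  "edges = {(c, j, t). c \<in> cells \<and> j < 4 \<and> t \<in> {0..1}}"

definition cell_set :: "nat \<times> real \<times> (real^4) \<Rightarrow> ((real^4) \<times> real) set" where
  "cell_set c = quartic_dom \<inter> cell_box (fst c) (snd (snd c))"

section \<open>Estimates on cells and contours\<close>

lemma quartic_dom_eq: "quartic_dom = (snd -` ball 0 (1/4)) \<inter> (\<Inter>j\<in>UNIV. (\<lambda>v. fst v $ j) -` ball 0 (1/256))"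
  by (auto simp: quartic_dom_def dist_real_def)

lemma open_quartic_dom: "open quartic_dom"
  unfolding quartic_dom_eq by (intro open_Int open_INT ballI finite open_vimage open_ball continuous_intros)

lemma convex_quartic_dom: "convex quartic_dom"
proof -
  have "linear (\<lambda>v::(real^4) \<times> real. fst v $ j)" for j
    by (rule linearI) auto
  then show ?thesis
    unfolding quartic_dom_eq by (intro convex_Int convex_INT convex_linear_vimage linear_snd convex_ball)
qed

lemma open_cell_box: "open (cell_box n a)"
proof -
  have "cell_box n a = (\<Inter>j\<in>UNIV. {v. \<bar>fst v $ j - a $ j\<bar> < mesh n})"
    by (auto simp: cell_box_def)
  then show ?thesis by (auto intro!: open_INT open_Collect_less continuous_intros)
qed

interpretation cell: growth_family cells cell_set "\<lambda>c. real (fst c) + 1"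
  by standard (auto simp: cell_set_def open_quartic_dom open_cell_box)

interpretation edge: growth_family edges "\<lambda>i. cell_set (fst i)"
    "\<lambda>i. real (fst (fst i)) + 1"
  by standard (auto simp: cell_set_def open_quartic_dom open_cell_box)

abbreviation edge_point :: "(nat \<times> real \<times> (real^4)) \<times> nat \<times> real \<Rightarrow> complex" where
  "edge_point i \<equiv> side (fst (snd (fst i))) (fst (snd i)) (snd (snd i))"

lemma edge_point:
  assumes "(n, \<delta>, a) \<in> cells" "j < 4" "t \<in> {0..1}"
  shows "norm (side \<delta> j t) \<le> 1" "\<bar>Im (side \<delta> j t)\<bar> * (real n + 1) \<le> 1"
    "(p, x) \<in> cell_set (n, \<delta>, a) \<Longrightarrow> (1 / 32) ^ 4 / 2 \<le> norm (quartic p (side \<delta> j t)) * (real n + 1) ^ 4"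
    "(p, x) \<in> cell_set (n, \<delta>, a) \<Longrightarrow> 1 / 16 \<le> norm (side \<delta> j t - of_real x) * (real n + 1)"
proof -
  define w where "w = side \<delta> j t"
  define m where "m = real n + 1"
  have m: "1 \<le> m" by (simp add: m_def)
  have \<delta>: "1 / (16 * m) \<le> \<delta>" "\<delta> \<le> 5 / (16 * m)"
    and low: "\<And>w::complex. \<bar>Im w\<bar> = \<delta> \<Longrightarrow> (1 / (32 * m)) ^ 4 \<le> norm (quartic a w)"
    using assms(1) by (auto simp: cells_def m_def)
  have \<delta>': "0 < \<delta>" "\<delta> \<le> 5 / 16" "\<delta> * m \<le> 1" "1/16 \<le> \<delta> * m"
  proof -
    have "0 < 1 / (16 * m)" using m by simp
    then show "0 < \<delta>" using \<delta> by linarith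
    have "5 / (16 * m) \<le> 5 / 16" using m by (simp add: field_simps)
    then show "\<delta> \<le> 5 / 16" using \<delta> by linarith
    show "\<delta> * m \<le> 1" "1/16 \<le> \<delta> * m" using \<delta> m by (auto simp: field_simps)
  qed
  have w: "\<bar>Re w\<bar> \<le> 1/2" "\<bar>Im w\<bar> \<le> \<delta>" "\<bar>Re w\<bar> = 1/2 \<or> \<bar>Im w\<bar> = \<delta>"
    using side_cases[OF assms(2,3), of \<delta>] \<delta>' by (auto simp: w_def)
  have "norm w \<le> \<bar>Re w\<bar> + \<bar>Im w\<bar>" by (rule cmod_le)
  then have n1: "norm w \<le> 1" using w \<delta>' by linarith
  then show "norm (side \<delta> j t) \<le> 1" by (simp add: w_def)
  have "\<bar>Im w\<bar> * m \<le> \<delta> * m" using w m by (intro mult_right_mono) auto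
  then have "\<bar>Im w\<bar> * m \<le> 1" using \<delta>'(3) by linarith
  then show "\<bar>Im (side \<delta> j t)\<bar> * (real n + 1) \<le> 1" by (simp add: w_def m_def)
  assume px: "(p, x) \<in> cell_set (n, \<delta>, a)"
  then have p: "\<bar>x\<bar> < 1/4" "\<And>j. \<bar>p $ j\<bar> < 1/256" "\<And>j. \<bar>p $ j - a $ j\<bar> < mesh n"
    by (auto simp: cell_set_def quartic_dom_def cell_box_def)
  have m4: "1 \<le> m ^ 4" using m by (rule one_le_power)
  from w(3) have "(1 / 32) ^ 4 / 2 \<le> norm (quartic p w) * m ^ 4"
  proof
    \<comment> \<open>On a vertical side the quartic is compared with \<open>quartic 0 w\<close>,
      that is with \<open>w ^ 4\<close>.\<close>
    assume "\<bar>Re w\<bar> = 1/2"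
    then have "1/2 \<le> norm w" using abs_Re_le_cmod[of w] by simp
    then have "(1/2) ^ 4 \<le> norm w ^ 4" by (intro power_mono) auto
    then have "(1/2) ^ 4 \<le> norm (w ^ 4)" by (simp only: norm_power)
    moreover have "norm (quartic p w - w ^ 4) \<le> 4 * (1/256)"
    proof -
      have "norm (quartic p w - quartic 0 w) \<le> 4 * (1/256)"
        using n1 p(2) by (intro norm_quartic_diff_le) (auto intro: less_imp_le)
      moreover have "quartic 0 w = w ^ 4" by (simp add: quartic_def)
      ultimately show ?thesis by simp
    qed
    ultimately have "(1/2) ^ 4 - 4/256 \<le> norm (quartic p w)"
      using norm_triangle_ineq2[of "w ^ 4" "quartic p w"] norm_minus_commute[of "w ^ 4" "quartic p w"]
      by linarith
    then have "(1 / 32) ^ 4 / 2 \<le> norm (quartic p w)" by (simp add: power4_eq_xxxx)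
    also have "\<dots> \<le> norm (quartic p w) * m ^ 4" using m4 by (simp add: mult_le_cancel_left1)
    finally show ?thesis .
  next
    assume "\<bar>Im w\<bar> = \<delta>"
    then have "(1 / (32 * m)) ^ 4 \<le> norm (quartic a w)" by (rule low)
    moreover have "norm (quartic p w - quartic a w) \<le> 4 * mesh n"
      using n1 p(3) by (intro norm_quartic_diff_le) (auto intro: less_imp_le)
    \<comment> \<open>This equality is the origin of the constant in \<open>mesh\<close>: passing
      from \<open>a\<close> to \<open>p\<close> costs at most half of the lower bound on
      \<open>quartic a w\<close>.\<close>
    moreover have "4 * mesh n = (1 / (32 * m)) ^ 4 / 2"
      by (simp add: mesh_def m_def power_one_over)
    ultimately have "(1 / (32 * m)) ^ 4 / 2 \<le> norm (quartic p w)"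
      using norm_triangle_ineq2[of "quartic a w" "quartic p w"] norm_minus_commute[of "quartic a w" "quartic p w"]
      by linarith
    then have "(1 / (32 * m)) ^ 4 / 2 * m ^ 4 \<le> norm (quartic p w) * m ^ 4"
      by (intro mult_right_mono) auto
    moreover have "(1 / (32 * m)) ^ 4 / 2 * m ^ 4 = (1 / 32) ^ 4 / 2"
      using m by (simp add: power_divide power_mult_distrib)
    ultimately show ?thesis by simp
  qed
  then show "(1 / 32) ^ 4 / 2 \<le> norm (quartic p (side \<delta> j t)) * (real n + 1) ^ 4"
    by (simp add: w_def m_def)
  from w(3) have "1 / 16 \<le> norm (w - of_real x) * m"
  proof
    assume "\<bar>Re w\<bar> = 1/2"
    moreover have "Re (w - of_real x) = Re w - x" by simp
    ultimately have "1/4 \<le> \<bar>Re (w - of_real x)\<bar>" using p(1) by linarith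
    also have "\<dots> \<le> norm (w - of_real x)" by (rule abs_Re_le_cmod)
    finally have "1/4 \<le> norm (w - of_real x)" .
    then have "1/4 * 1 \<le> norm (w - of_real x) * m" using m by (intro mult_mono) auto
    then show ?thesis by simp
  next
    assume "\<bar>Im w\<bar> = \<delta>"
    then have "\<delta> \<le> norm (w - of_real x)" using abs_Im_le_cmod[of "w - of_real x"] by simp
    then have "\<delta> * m \<le> norm (w - of_real x) * m" using m by (intro mult_right_mono) auto
    then show ?thesis using \<delta>' by linarith
  qed
  then show "1 / 16 \<le> norm (side \<delta> j t - of_real x) * (real n + 1)"
    by (simp add: w_def m_def)
qed

lemma edge_lower:
  assumes "i \<in> edges" "v \<in> cell_set (fst i)"
  shows "(1 / 32) ^ 4 / 2 \<le> norm (quartic (fst v) (edge_point i)) * (real (fst (fst i)) + 1) ^ 4"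
    and "1 / 16 \<le> norm (edge_point i - of_real (snd v)) * (real (fst (fst i)) + 1) ^ 1"
proof -
  obtain n \<delta> a j t where i: "i = ((n, \<delta>, a), j, t)" by (metis prod.exhaust)
  obtain p x where v: "v = (p, x)" by (cases v)
  have h: "(n, \<delta>, a) \<in> cells" "j < 4" "t \<in> {0..1}" "(p, x) \<in> cell_set (n, \<delta>, a)"
    using assms by (auto simp: i v edges_def)
  show "(1 / 32) ^ 4 / 2 \<le> norm (quartic (fst v) (edge_point i)) * (real (fst (fst i)) + 1) ^ 4"
    "1 / 16 \<le> norm (edge_point i - of_real (snd v)) * (real (fst (fst i)) + 1) ^ 1"
    unfolding i v fst_conv snd_conv power_one_right by (rule edge_point(3,4)[OF h])+
qed

lemma edge_norm: "i \<in> edges \<Longrightarrow> norm (edge_point i) \<le> 1"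
  using edge_point(1) by (cases i) (force simp: edges_def)

text \<open>These are the factors of all integrands. The exponential is bounded by e because n |Im
  w| is at most 1 on the contour; the two reciprocals are controlled by
  \<open>edge_lower\<close>.\<close>

lemma edge_growth:
  shows "edge.poly_growth k (\<lambda>i v. exp (\<i> * of_nat (fst (fst i)) * edge_point i))"
    and "edge.poly_growth k (\<lambda>i v. inverse (quartic (fst v) (edge_point i)))"
    and "edge.poly_growth k (\<lambda>i v. inverse (edge_point i - of_real (snd v)))"
    and "edge.poly_growth k (\<lambda>i v. quartic_quot j (fst v) (edge_point i))"
    and "edge.poly_growth k (\<lambda>i v. corner (fst (snd (fst i))) (Suc (fst (snd i))) - corner (fst (snd (fst i))) (fst (snd i)))"
proof -
  have \<delta>1: "\<bar>\<delta>\<bar> \<le> 1" if "(n, \<delta>, a) \<in> cells" for n \<delta> a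
  proof -
    have "0 \<le> 1 / (16 * (real n + 1))" "5 / (16 * (real n + 1)) \<le> 1" by (auto simp: field_simps)
    moreover have "1 / (16 * (real n + 1)) \<le> \<delta>" "\<delta> \<le> 5 / (16 * (real n + 1))"
      using that by (auto simp: cells_def)
    ultimately show ?thesis by linarith
  qed
  have pc: "edge.poly_growth k (\<lambda>i v. complex_of_real (fst v $ m))" for m
  proof (rule edge.poly_growth_linear_var[where R = 1])
    show "bounded_linear (\<lambda>v::(real^4) \<times> real. complex_of_real (fst v $ m))"
      by (rule bounded_linear_compose[OF bounded_linear_of_real
            bounded_linear_compose[OF bounded_linear_vec_nth bounded_linear_fst]])
    fix i v assume "v \<in> cell_set (fst i)"
    then have "\<bar>fst v $ m\<bar> < 1/256" by (auto simp: cell_set_def quartic_dom_def split: prod.splits)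
    then have "\<bar>fst v $ m\<bar> \<le> 1" by linarith
    then show "norm (complex_of_real (fst v $ m)) \<le> 1" by simp
  qed simp
  have px: "edge.poly_growth k (\<lambda>i v. complex_of_real (snd v))"
  proof (rule edge.poly_growth_linear_var[where R = 1])
    show "bounded_linear (\<lambda>v::(real^4) \<times> real. complex_of_real (snd v))"
      by (rule bounded_linear_compose[OF bounded_linear_of_real bounded_linear_snd])
    fix i v assume "v \<in> cell_set (fst i)"
    then have "\<bar>snd v\<bar> < 1/4" by (auto simp: cell_set_def quartic_dom_def split: prod.splits)
    then have "\<bar>snd v\<bar> \<le> 1" by linarith
    then show "norm (complex_of_real (snd v)) \<le> 1" by simp
  qed simp
  have pw: "edge.poly_growth k (\<lambda>i v. edge_point i ^ m)" for m
    by (rule edge.poly_growth_const[of 1 _ 0]) (simp_all add: norm_power power_le_one edge_norm)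
  have p1: "edge.poly_growth k (\<lambda>i v. edge_point i)" using pw[of 1] by simp
  have pq: "edge.poly_growth k (\<lambda>i v. quartic (fst v) (edge_point i))"
    unfolding quartic_def by (intro edge.poly_growth_add edge.poly_growth_mult pc pw p1)
  show "edge.poly_growth k (\<lambda>i v. quartic_quot j (fst v) (edge_point i))"
  proof -
    have one: "edge.poly_growth k (\<lambda>i v. 1 :: complex)" by (rule edge.poly_growth_const[of 1 _ 0]) auto
    show ?thesis
      unfolding quartic_quot_def
      by (cases "j = 0"; cases "j = 1"; cases "j = 2"; simp; intro edge.poly_growth_add edge.poly_growth_mult pc pw p1 one)
  qed
  show "edge.poly_growth k (\<lambda>i v. inverse (quartic (fst v) (edge_point i)))"
    by (rule edge.poly_growth_inverse[OF pq _ edge_lower(1)]) simp_all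
  have "edge.poly_growth k (\<lambda>i v. edge_point i + (- of_real (snd v)))"
    by (intro edge.poly_growth_add p1 edge.poly_growth_bounded_linear[OF bounded_linear_minus[OF bounded_linear_ident]] px)
  then have "edge.poly_growth k (\<lambda>i v. edge_point i - of_real (snd v))" by simp
  then show "edge.poly_growth k (\<lambda>i v. inverse (edge_point i - of_real (snd v)))"
    by (rule edge.poly_growth_inverse[OF _ _ edge_lower(2)]) simp_all
  show "edge.poly_growth k (\<lambda>i v. exp (\<i> * of_nat (fst (fst i)) * edge_point i))"
  proof (rule edge.poly_growth_const[of "exp 1" _ 0])
    fix i assume "i \<in> edges"
    then obtain n \<delta> a j t where i: "i = ((n, \<delta>, a), j, t)" "(n, \<delta>, a) \<in> cells" "j < 4" "t \<in> {0..1}"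
      by (cases i) (auto simp: edges_def)
    have "- (real n * Im (side \<delta> j t)) \<le> real n * \<bar>Im (side \<delta> j t)\<bar>"
      using mult_left_mono[of "- Im (side \<delta> j t)" "\<bar>Im (side \<delta> j t)\<bar>" "real n"] by simp
    also have "\<dots> \<le> \<bar>Im (side \<delta> j t)\<bar> * (real n + 1)" by (simp add: algebra_simps)
    also have "\<dots> \<le> 1" by (rule edge_point(2)[OF i(2-4)])
    finally show "norm (exp (\<i> * of_nat (fst (fst i)) * edge_point i)) \<le> exp 1 * (real (fst (fst i)) + 1) ^ 0"
      by (simp add: i(1))
  qed simp
  show "edge.poly_growth k (\<lambda>i v. corner (fst (snd (fst i))) (Suc (fst (snd i))) - corner (fst (snd (fst i))) (fst (snd i)))"
  proof (rule edge.poly_growth_const[of 4 _ 0])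
    fix i assume "i \<in> edges"
    then obtain n \<delta> a j t where i: "i = ((n, \<delta>, a), j, t)" "(n, \<delta>, a) \<in> cells" "j < 4" "t \<in> {0..1}"
      by (cases i) (auto simp: edges_def)
    have c: "norm (corner \<delta> l) \<le> 2" for l
    proof -
      have "norm (corner \<delta> l) \<le> \<bar>Re (corner \<delta> l)\<bar> + \<bar>Im (corner \<delta> l)\<bar>" by (rule cmod_le)
      also have "\<dots> \<le> 2" using \<delta>1[OF i(2)] by (auto simp: corner_def)
      finally show ?thesis .
    qed
    have "norm (corner \<delta> (Suc j) - corner \<delta> j) \<le> 4"
      using norm_triangle_ineq4[of "corner \<delta> (Suc j)" "corner \<delta> j"] c[of "Suc j"] c[of j] by linarith
    then show "norm (corner (fst (snd (fst i))) (Suc (fst (snd i))) - corner (fst (snd (fst i))) (fst (snd i)))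
        \<le> 4 * (real (fst (fst i)) + 1) ^ 0" by (simp add: i(1))
  qed simp
qed

lemma smooth_edge:
  fixes V :: "(((real^4) \<times> real) \<times> real) set"
  assumes "open V"
  shows "smooth_on V (\<lambda>z. side \<delta> j (snd z))"
    and "smooth_on V (\<lambda>z. exp (\<i> * of_nat n * side \<delta> j (snd z)))"
    and "smooth_on V (\<lambda>z. quartic (fst (fst z)) (side \<delta> j (snd z)))"
    and "smooth_on V (\<lambda>z. quartic_quot l (fst (fst z)) (side \<delta> j (snd z)))"
    and "smooth_on V (\<lambda>z. complex_of_real (snd (fst z)))"
proof -
  have t: "smooth_on V (\<lambda>z. complex_of_real (snd z))" and px: "smooth_on V (\<lambda>z. complex_of_real (snd (fst z)))"
    and pc: "smooth_on V (\<lambda>z. complex_of_real (fst (fst z) $ m))" for m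
    by (intro smooth_on_of_real smooth_on_snd smooth_on_fst smooth_on_vec_nth smooth_on_id assms)+
  show "smooth_on V (\<lambda>z. complex_of_real (snd (fst z)))" by (rule px)
  show s: "smooth_on V (\<lambda>z. side \<delta> j (snd z))"
    unfolding side_def by (intro smooth_on_add smooth_on_mult smooth_on_const assms t)
  \<comment> \<open>The exponent is affine in the edge parameter; splitting off its constant part
    leaves the form treated by \<open>smooth_on_iexp\<close>.\<close>
  have "smooth_on V (\<lambda>z. exp (\<i> * of_nat n * corner \<delta> j) *
      exp (\<i> * of_nat n * (corner \<delta> (Suc j) - corner \<delta> j) * of_real (snd z)))"
    by (intro smooth_on_mult smooth_on_const assms smooth_on_compose[OF smooth_on_iexp[of UNIV]]
        smooth_on_snd smooth_on_id) auto
  moreover have "exp (\<i> * of_nat n * corner \<delta> j) *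
      exp (\<i> * of_nat n * (corner \<delta> (Suc j) - corner \<delta> j) * of_real t) = exp (\<i> * of_nat n * side \<delta> j t)" for t
    unfolding exp_add[symmetric] by (simp add: side_def algebra_simps)
  ultimately show "smooth_on V (\<lambda>z. exp (\<i> * of_nat n * side \<delta> j (snd z)))" by simp
  show "smooth_on V (\<lambda>z. quartic (fst (fst z)) (side \<delta> j (snd z)))"
    unfolding quartic_def by (intro smooth_on_add smooth_on_mult smooth_on_power pc s assms)
  show "smooth_on V (\<lambda>z. quartic_quot l (fst (fst z)) (side \<delta> j (snd z)))"
    unfolding quartic_quot_def
    by (cases "l = 0"; cases "l = 1"; cases "l = 2"; simp;
        intro smooth_on_add smooth_on_mult smooth_on_power pc s assms)
qed

text \<open>An open set on which the integrands are jointly smooth. It contains a cell times the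
  closed interval \<open>{0..1}\<close>, as differentiation under the integral requires.\<close>

definition edge_regular :: "real \<Rightarrow> nat \<Rightarrow> (((real^4) \<times> real) \<times> real) set" where
  "edge_regular \<delta> j = {z. quartic (fst (fst z)) (side \<delta> j (snd z)) \<noteq> 0 \<and> side \<delta> j (snd z) \<noteq> of_real (snd (fst z))}"

lemma open_edge_regular: "open (edge_regular \<delta> j)"
  unfolding edge_regular_def quartic_def side_def
  by (intro open_Collect_conj open_Collect_neq continuous_intros)

text \<open>The bounds on the integrand hold uniformly in the edge parameter, hence survive
  integration over a side. The factor 4 counts the sides, and division by 2 pi i does not increase
  norms.\<close>

lemma rect_integral_growth:
  fixes H :: "nat \<Rightarrow> (real^4) \<times> real \<Rightarrow> complex \<Rightarrow> complex"
  assumes poly_growth: "edge.poly_growth k (\<lambda>i v. H (fst (fst i)) v (edge_point i))"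
    and sm: "\<And>n \<delta> j. smooth_on (edge_regular \<delta> j) (\<lambda>z. H n (fst z) (side \<delta> j (snd z)))"
  shows "cell.poly_growth k (\<lambda>c v. rect_integral (fst (snd c)) (H (fst c) v))"
proof -
  have "edge.poly_growth k (\<lambda>i v. H (fst (fst i)) v (edge_point i) *
      (corner (fst (snd (fst i))) (Suc (fst (snd i))) - corner (fst (snd (fst i))) (fst (snd i))))"
    by (intro edge.poly_growth_mult poly_growth edge_growth)
  then obtain C N where C: "0 \<le> C" "\<And>i. i \<in> edges \<Longrightarrow>
     ck_bounded k (cell_set (fst i)) (\<lambda>v. H (fst (fst i)) v (edge_point i) *
      (corner (fst (snd (fst i))) (Suc (fst (snd i))) - corner (fst (snd (fst i))) (fst (snd i))))
      (C * (real (fst (fst i)) + 1) ^ N)"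
    by (rule edge.poly_growthE) blast
  have int: "ck_bounded k (cell_set c) (\<lambda>v. integral {0..1} (\<lambda>t. H n v (side \<delta> j t) * (corner \<delta> (Suc j) - corner \<delta> j)))
      (C * (real n + 1) ^ N)" if c: "c = (n, \<delta>, a)" "c \<in> cells" and j: "j < 4" for c n \<delta> a j
  proof -
    have "ck_bounded k (cell_set c) (\<lambda>v. integral {0..1}
        (\<lambda>t. (\<lambda>z. H n (fst z) (side \<delta> j (snd z)) * (corner \<delta> (Suc j) - corner \<delta> j)) (v, t)))
        (C * (real n + 1) ^ N * (1 - 0))"
    proof (rule ck_bounded_integral)
      show "open (cell_set c)" using cell.open_S[OF c(2)] .
      show "open (edge_regular \<delta> j)" by (rule open_edge_regular)
      show "smooth_on (edge_regular \<delta> j) (\<lambda>z. H n (fst z) (side \<delta> j (snd z)) * (corner \<delta> (Suc j) - corner \<delta> j))"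
        by (intro smooth_on_mult sm smooth_on_const open_edge_regular)
      show "cell_set c \<times> {0..1} \<subseteq> edge_regular \<delta> j"
      proof
        fix z assume "z \<in> cell_set c \<times> {0..1::real}"
        moreover obtain p x t where "z = ((p, x), t)" by (metis prod.exhaust)
        ultimately have z: "z = ((p, x), t)" "(p, x) \<in> cell_set (n, \<delta>, a)" "t \<in> {0..1}"
          using c(1) by auto
        show "z \<in> edge_regular \<delta> j"
          using edge_point(3,4)[OF c(2)[unfolded c(1)] j z(3) z(2)] by (auto simp: edge_regular_def z(1))
      qed
      show "ck_bounded k (cell_set c) (\<lambda>v. (\<lambda>z. H n (fst z) (side \<delta> j (snd z)) * (corner \<delta> (Suc j) - corner \<delta> j)) (v, t))
          (C * (real n + 1) ^ N)" if "t \<in> {0..1}" for t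
        using C(2)[of "(c, j, t)"] c j that by (simp add: edges_def)
    qed simp
    then show ?thesis by simp
  qed
  show ?thesis
  proof (rule cell.poly_growthI)
    show "0 \<le> 4 * C" using C by simp
    fix c assume c: "c \<in> cells"
    obtain n \<delta> a where c': "c = (n, \<delta>, a)" by (cases c)
    have S: "ck_bounded k (cell_set c) (\<lambda>v. \<Sum>j<4. integral {0..1} (\<lambda>t. H n v (side \<delta> j t) * (corner \<delta> (Suc j) - corner \<delta> j)))
        (real (card {..<4::nat}) * (C * (real n + 1) ^ N))"
      by (rule ck_bounded_sum[OF cell.open_S[OF c]]) (use int[OF c' c] in auto)
    have D: "norm (x / (complex_of_real (2 * pi) * \<i>)) \<le> 1 * norm x" for x :: complex
    proof -
      have "1 \<le> 2 * pi" using pi_gt3 by linarith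
      then have "norm x * 1 \<le> norm x * (2 * pi)" by (intro mult_left_mono) auto
      then show ?thesis using pi_gt_zero by (simp add: norm_divide norm_mult divide_le_eq)
    qed
    have "ck_bounded k (cell_set c) (\<lambda>v. (\<Sum>j<4. integral {0..1} (\<lambda>t. H n v (side \<delta> j t) *
        (corner \<delta> (Suc j) - corner \<delta> j))) / (complex_of_real (2 * pi) * \<i>)) (1 * (real (card {..<4::nat}) * (C * (real n + 1) ^ N)))"
      by (rule ck_bounded_bounded_linear[OF cell.open_S[OF c] bounded_linear_divide D _ S]) simp
    then have "ck_bounded k (cell_set c) (\<lambda>v. rect_integral \<delta> (H n v)) (real (card {..<4::nat}) * (C * (real n + 1) ^ N))"
      by (simp add: rect_integral_def)
    then show "ck_bounded k (cell_set c) (\<lambda>v. rect_integral (fst (snd c)) (H (fst c) v)) (4 * C * (real (fst c) + 1) ^ N)"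
      by (simp add: c' mult.assoc)
  qed
qed

section \<open>Gluing the divisions over a lattice of quartics\<close>

interpretation lattice: growth_family "UNIV :: (nat \<times> (4 \<Rightarrow> int)) set" "\<lambda>_. quartic_dom" "\<lambda>i. real (fst i) + 1"
  by standard (auto simp: open_quartic_dom)

lemma (in growth_family) poly_growth_prod:
  fixes f :: "'j \<Rightarrow> 'i \<Rightarrow> 'a \<Rightarrow> real"
  assumes "finite A" "\<And>j. j \<in> A \<Longrightarrow> poly_growth k (f j)"
  shows "poly_growth k (\<lambda>i x. \<Prod>j\<in>A. f j i x)"
  using assms
proof (induction A rule: finite_induct)
  case empty
  have "poly_growth k (\<lambda>i x. 1 :: real)" by (rule poly_growth_const[of 1 _ 0]) auto
  then show ?case by simp
next
  case (insert j A)
  have "poly_growth k (\<lambda>i x. f j i x * (\<Prod>j\<in>A. f j i x))" by (intro poly_growth_mult insert) (use insert in auto)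
  then show ?case using insert by simp
qed

text \<open>An integer whose reciprocal, the lattice spacing, is half of \<open>mesh n\<close>. A
  bump that reaches one spacing away from its lattice point then stays strictly inside the cell box
  around that point.\<close>

definition mesh_inv :: "nat \<Rightarrow> nat" where
  "mesh_inv n = 16 * (32 * (n + 1)) ^ 4"

lemma mesh_inv: "0 < mesh_inv n" "mesh n = 2 / mesh_inv n" "real (mesh_inv n) = 16 * 32 ^ 4 * (real n + 1) ^ 4"
proof -
  have A: "real (mesh_inv n) = 16 * (32 * (real n + 1)) ^ 4"
    by (simp only: mesh_inv_def of_nat_mult of_nat_power of_nat_add of_nat_numeral of_nat_1)
  show "mesh n = 2 / mesh_inv n" unfolding A mesh_def by simp
  show "real (mesh_inv n) = 16 * 32 ^ 4 * (real n + 1) ^ 4"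
    unfolding A power_mult_distrib by (simp only: mult.assoc)
  show "0 < mesh_inv n" by (simp add: mesh_inv_def)
qed

definition lattice_point :: "nat \<Rightarrow> (4 \<Rightarrow> int) \<Rightarrow> real^4" where
  "lattice_point n \<beta> = (\<chi> j. of_int (\<beta> j) / mesh_inv n)"

lemma cell_exists: "\<exists>\<delta>. (n, \<delta>, a) \<in> cells"
proof -
  \<comment> \<open>With this \<open>d\<close>, the heights \<open>m * d\<close> for
    \<open>m\<close> from 1 to 5 and the bound \<open>(d / 2) ^ 4\<close> are exactly those demanded
    in \<open>cells\<close>.\<close>
  define d where "d = 1 / (16 * (real n + 1))"
  have "0 < d" by (simp add: d_def)
  from quartic_line_avoiding_roots[OF this] obtain m :: nat where m: "1 \<le> m" "m \<le> 5"
    "\<And>w :: complex. \<bar>Im w\<bar> = m * d \<Longrightarrow> (d / 2) ^ 4 \<le> norm (quartic a w)" by blast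
  have "1 * d \<le> m * d" "m * d \<le> 5 * d" using m \<open>0 < d\<close> by (auto intro!: mult_right_mono)
  moreover have "d / 2 = 1 / (32 * (real n + 1))" by (simp add: d_def)
  ultimately have "(n, m * d, a) \<in> cells"
    using m(3) by (auto simp: cells_def d_def)
  then show ?thesis by blast
qed

text \<open>The number of lattice points, the bumps and the local functions all grow polynomially in
  \<open>n\<close>, hence so does the glued sum. The closed supports inside the open boxes make each
  summand an instance of \<open>ck_bounded_cutoff\<close>.\<close>

lemma glue_growth:
  fixes E :: "nat \<times> real \<times> (real^4) \<Rightarrow> (real^4) \<times> real \<Rightarrow> complex"
  assumes E: "cell.poly_growth k E" and \<rho>: "lattice.poly_growth k (\<lambda>i. \<rho> (fst i) (snd i))"
    and supp: "\<And>n \<beta> v. v \<notin> K n \<beta> \<Longrightarrow> \<rho> n \<beta> v = (0::real)" "\<And>n \<beta>. closed (K n \<beta>)" "\<And>n \<beta>. K n \<beta> \<subseteq> cell_box n (a n \<beta>)"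
    and cell: "\<And>n \<beta>. (n, \<delta> n \<beta>, a n \<beta>) \<in> cells"
    and B: "\<And>n. finite (B n)" "\<And>n. real (card (B n)) \<le> C0 * (real n + 1) ^ N0"
  shows "\<exists>C N. 0 \<le> C \<and> (\<forall>n. ck_bounded k quartic_dom (\<lambda>v. \<Sum>\<beta>\<in>B n. if v \<in> cell_box n (a n \<beta>)
     then \<rho> n \<beta> v *\<^sub>R E (n, \<delta> n \<beta>, a n \<beta>) v else 0) (C * (real n + 1) ^ N))"
proof -
  from E obtain C1 N1 where 1: "0 \<le> C1" "\<And>c. c \<in> cells \<Longrightarrow> ck_bounded k (cell_set c) (E c) (C1 * (real (fst c) + 1) ^ N1)"
    by (rule cell.poly_growthE) blast
  from \<rho> obtain C2 N2 where 2: "0 \<le> C2" "\<And>i. ck_bounded k quartic_dom (\<rho> (fst i) (snd i)) (C2 * (real (fst i) + 1) ^ N2)"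
    by (rule lattice.poly_growthE) auto
  have C0: "0 \<le> C0"
    using order_trans[OF of_nat_0_le_iff B(2)[of 0]] by simp
  show ?thesis
  proof (intro exI conjI allI)
    show "0 \<le> C0 * (2 ^ k * C2 * C1)" using C0 1 2 by simp
    fix n
    define m where "m = real n + 1"
    have m: "0 \<le> m" by (simp add: m_def)
    have "ck_bounded k quartic_dom (\<lambda>v. if v \<in> cell_box n (a n \<beta>) then \<rho> n \<beta> v *\<^sub>R E (n, \<delta> n \<beta>, a n \<beta>) v else 0)
        (2 ^ k * (C2 * m ^ N2) * (C1 * m ^ N1))" for \<beta>
    proof (rule ck_bounded_cutoff[OF open_quartic_dom open_cell_box supp(2) supp(3)])
      show "ck_bounded k quartic_dom (\<rho> n \<beta>) (C2 * m ^ N2)" using 2(2)[of "(n, \<beta>)"] by (simp add: m_def)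
      show "ck_bounded k (quartic_dom \<inter> cell_box n (a n \<beta>)) (E (n, \<delta> n \<beta>, a n \<beta>)) (C1 * m ^ N1)"
        using 1(2)[OF cell[of n \<beta>]] by (simp add: m_def cell_set_def)
    qed (use supp(1) 1 2 m in auto)
    from ck_bounded_sum[OF open_quartic_dom this B(1)]
    have bd: "ck_bounded k quartic_dom (\<lambda>v. \<Sum>\<beta>\<in>B n. if v \<in> cell_box n (a n \<beta>)
     then \<rho> n \<beta> v *\<^sub>R E (n, \<delta> n \<beta>, a n \<beta>) v else 0) (real (card (B n)) * (2 ^ k * (C2 * m ^ N2) * (C1 * m ^ N1)))" .
    have le: "real (card (B n)) * (2 ^ k * (C2 * m ^ N2) * (C1 * m ^ N1)) \<le>
        (C0 * m ^ N0) * (2 ^ k * (C2 * m ^ N2) * (C1 * m ^ N1))"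
      using B(2)[of n] 1 2 m by (intro mult_right_mono) (auto simp: m_def)
    have eq: "(C0 * m ^ N0) * (2 ^ k * (C2 * m ^ N2) * (C1 * m ^ N1)) =
        C0 * (2 ^ k * C2 * C1) * m ^ (N0 + N1 + N2)"
      by (simp add: power_add)
    show "ck_bounded k quartic_dom (\<lambda>v. \<Sum>\<beta>\<in>B n. if v \<in> cell_box n (a n \<beta>)
     then \<rho> n \<beta> v *\<^sub>R E (n, \<delta> n \<beta>, a n \<beta>) v else 0) (C0 * (2 ^ k * C2 * C1) * (real n + 1) ^ (N0 + N1 + N2))"
      using ck_bounded_mono[OF bd le] unfolding eq by (simp only: m_def)
  qed
qed

text \<open>Each cell yields an exact division on its box, and a partition of unity averages these
  divisions into one defined for all quartics considered. The bumps depend on \<open>p\<close> only,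
  so the remainder coefficients stay independent of \<open>x\<close>.\<close>

theorem exp_division:
  obtains q :: "nat \<Rightarrow> (real^4) \<times> real \<Rightarrow> complex" and r :: "nat \<Rightarrow> nat \<Rightarrow> (real^4) \<times> real \<Rightarrow> complex"
  where "\<And>k. \<exists>C N. 0 \<le> C \<and> (\<forall>n. ck_bounded k quartic_dom (q n) (C * (real n + 1) ^ N))"
    and "\<And>k j. \<exists>C N. 0 \<le> C \<and> (\<forall>n. ck_bounded k quartic_dom (r n j) (C * (real n + 1) ^ N))"
    and "\<And>n j p x. r n j (p, x) = r n j (p, 0)"
    and "\<And>n p x. (p, x) \<in> quartic_dom \<Longrightarrow> exp (\<i> * of_nat n * of_real x) =
       of_real (quartic p x) * q n (p, x) + (\<Sum>j<4. of_real x ^ j * r n j (p, x))"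
proof -
  obtain b :: "real \<Rightarrow> real" where b: "smooth_on UNIV b" "\<And>x. 1 < \<bar>x\<bar> \<Longrightarrow> b x = 0"
    "\<And>x (N::int). \<bar>x\<bar> \<le> of_int N \<Longrightarrow> (\<Sum>j\<in>{-N-1..N+1}. b (x - of_int j)) = 1"
    "\<And>k. \<exists>M. \<forall>i\<le>k. \<forall>t. \<bar>(deriv ^^ i) b t\<bar> \<le> M"
    by (rule smooth_bump_exists) blast
  define \<rho> where "\<rho> n \<beta> v = (\<Prod>j\<in>UNIV. b (mesh_inv n * fst v $ j - of_int (\<beta> j)))"
    for n and \<beta> :: "4 \<Rightarrow> int" and v :: "(real^4) \<times> real"
  define K where "K n \<beta> = {v :: (real^4) \<times> real. \<forall>j. \<bar>mesh_inv n * fst v $ j - of_int (\<beta> j)\<bar> \<le> 1}"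
    for n and \<beta> :: "4 \<Rightarrow> int"
  \<comment> \<open>On \<open>quartic_dom\<close> the scaled coefficients have size at most
    \<open>mesh_inv n\<close>; one more index at either end makes the bumps sum to 1.\<close>
  define B :: "nat \<Rightarrow> (4 \<Rightarrow> int) set" where
    "B n = (UNIV \<rightarrow>\<^sub>E {-int (mesh_inv n)-1..int (mesh_inv n)+1})" for n
  \<comment> \<open>The heights at different lattice points are unrelated; smoothness in
    \<open>p\<close> comes from the bumps and from the integrals within one cell.\<close>
  define \<delta> where "\<delta> n \<beta> = (SOME d. (n, d, lattice_point n \<beta>) \<in> cells)" for n \<beta>
  have \<delta>: "(n, \<delta> n \<beta>, lattice_point n \<beta>) \<in> cells" for n \<beta>
    unfolding \<delta>_def by (rule someI_ex) (rule cell_exists)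
  have \<rho>poly_growth: "lattice.poly_growth k (\<lambda>i. \<rho> (fst i) (snd i))" for k
    unfolding \<rho>_def
  proof (intro lattice.poly_growth_prod finite)
    fix j :: 4
    from b(4) obtain M where M: "\<forall>i\<le>k. \<forall>t. \<bar>(deriv ^^ i) b t\<bar> \<le> M" by blast
    have "0 \<le> M" using M by (meson abs_ge_zero le0 order_trans)
    show "lattice.poly_growth k (\<lambda>i v. b (real (mesh_inv (fst i)) * fst v $ j - of_int (snd i j)))"
    proof (rule lattice.poly_growthI)
      show "0 \<le> (16 * 32 ^ 4) ^ k * M" using \<open>0 \<le> M\<close> by simp
      fix i :: "nat \<times> (4 \<Rightarrow> int)"
      define L where "L = real (mesh_inv (fst i))"
      have "ck_bounded k quartic_dom (\<lambda>v. (deriv ^^ 0) b (L * fst v $ j + (- of_int (snd i j)))) (L ^ k * M)"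
      proof (rule ck_bounded_affine[OF open_quartic_dom])
        show "bounded_linear (\<lambda>v::(real^4) \<times> real. L * fst v $ j)"
          by (rule bounded_linear_compose[OF bounded_linear_mult_right
                bounded_linear_compose[OF bounded_linear_vec_nth bounded_linear_fst]])
        show "1 \<le> L" using mesh_inv(1)[of "fst i"] by (simp add: L_def)
        show "\<bar>L * fst v $ j\<bar> \<le> L" if "v \<in> Basis" for v :: "(real^4) \<times> real"
        proof -
          have "\<bar>fst v $ j\<bar> \<le> norm (fst v)" by (rule component_le_norm_cart)
          also have "\<dots> \<le> norm v" by (metis norm_fst_le prod.collapse)
          finally have "\<bar>fst v $ j\<bar> \<le> 1" using that by simp
          then have "L * \<bar>fst v $ j\<bar> \<le> L * 1" by (intro mult_left_mono) (auto simp: L_def)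
          then show ?thesis by (simp add: abs_mult L_def)
        qed
        show "((deriv ^^ m) b has_real_derivative (deriv ^^ Suc m) b t) (at t)" for m t
          using smooth_on_deriv_funpow(2)[OF b(1) open_UNIV] by blast
      qed (use M \<open>0 \<le> M\<close> in auto)
      \<comment> \<open>\<open>L\<close> is a constant times the fourth power of the weight, whence
        the exponent \<open>4 * k\<close>.\<close>
      moreover have "L ^ k * M = (16 * 32 ^ 4) ^ k * M * (real (fst i) + 1) ^ (4 * k)"
        unfolding L_def mesh_inv(3) by (simp only: power_mult_distrib power_mult) (simp only: ac_simps)
      moreover have "(\<lambda>v :: (real^4) \<times> real. (deriv ^^ 0) b (L * fst v $ j + (- of_int (snd i j)))) =
          (\<lambda>v. b (real (mesh_inv (fst i)) * fst v $ j - of_int (snd i j)))"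
        by (simp add: L_def)
      ultimately show "ck_bounded k quartic_dom (\<lambda>v. b (real (mesh_inv (fst i)) * fst v $ j - of_int (snd i j)))
          ((16 * 32 ^ 4) ^ k * M * (real (fst i) + 1) ^ (4 * k))"
        by (simp only:)
    qed
  qed
  have \<rho>0: "\<rho> n \<beta> v = 0" if v: "v \<notin> K n \<beta>" for n \<beta> v
  proof -
    obtain j where "1 < \<bar>mesh_inv n * fst v $ j - of_int (\<beta> j)\<bar>"
      using v by (auto simp: K_def not_le)
    from b(2)[OF this] show ?thesis unfolding \<rho>_def by (intro prod_zero) auto
  qed
  have K_closed: "closed (K n \<beta>)" for n \<beta>
  proof -
    have "K n \<beta> = (\<Inter>j. {v. \<bar>mesh_inv n * fst v $ j - of_int (\<beta> j)\<bar> \<le> 1})" by (auto simp: K_def)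
    then show ?thesis by (auto intro!: closed_INT closed_Collect_le continuous_intros)
  qed
  have K_sub: "K n \<beta> \<subseteq> cell_box n (lattice_point n \<beta>)" for n \<beta>
  proof
    fix v assume v: "v \<in> K n \<beta>"
    have "\<bar>fst v $ j - lattice_point n \<beta> $ j\<bar> < mesh n" for j
    proof -
      define N where "N = real (mesh_inv n)"
      have N: "0 < N" using mesh_inv(1) by (simp add: N_def)
      have "fst v $ j - lattice_point n \<beta> $ j = (N * fst v $ j - of_int (\<beta> j)) / N"
        using N by (simp add: lattice_point_def N_def field_simps)
      then have "\<bar>fst v $ j - lattice_point n \<beta> $ j\<bar> = \<bar>N * fst v $ j - of_int (\<beta> j)\<bar> / N"
        using N by simp
      also have "\<dots> \<le> 1 / N" using v N by (intro divide_right_mono) (auto simp: K_def N_def)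
      also have "\<dots> < 2 / N" using N by (simp add: divide_strict_right_mono)
      finally show ?thesis by (simp add: mesh_inv(2) N_def)
    qed
    then show "v \<in> cell_box n (lattice_point n \<beta>)" by (auto simp: cell_box_def split: prod.splits)
  qed
  have B_fin: "finite (B n)" for n
    unfolding B_def by (intro finite_PiE) auto
  \<comment> \<open>Four coordinates with a number of choices of order (n + 1)^4 each give the
    exponent 16.\<close>
  have B_card: "real (card (B n)) \<le> (5 * (16 * 32 ^ 4)) ^ 4 * (real n + 1) ^ 16" for n
  proof -
    have "card {-int (mesh_inv n)-1..int (mesh_inv n)+1} = 2 * mesh_inv n + 3" by simp
    then have "card (B n) = (2 * mesh_inv n + 3) ^ 4"
      unfolding B_def by (subst card_PiE) simp_all
    then have "real (card (B n)) = (2 * real (mesh_inv n) + 3) ^ 4" by simp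
    also have "\<dots> \<le> (5 * real (mesh_inv n)) ^ 4"
      using mesh_inv(1)[of n] by (intro power_mono) auto
    also have "\<dots> = (5 * (16 * 32 ^ 4)) ^ 4 * (real n + 1) ^ 16"
      by (simp add: mesh_inv(3) power_mult_distrib flip: power_mult)
    finally show ?thesis .
  qed
  have \<rho>sum: "(\<Sum>\<beta>\<in>B n. \<rho> n \<beta> v) = 1" if "v \<in> quartic_dom" for n v
  proof -
    have "(\<Sum>\<beta>\<in>B n. \<rho> n \<beta> v) =
        (\<Prod>j\<in>UNIV. \<Sum>t\<in>{-int (mesh_inv n)-1..int (mesh_inv n)+1}. b (mesh_inv n * fst v $ j - of_int t))"
      unfolding \<rho>_def B_def by (subst prod_sum_PiE) auto
    also have "\<dots> = (\<Prod>j\<in>(UNIV :: 4 set). 1)"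
    proof (rule prod.cong[OF refl])
      fix j :: 4
      have "\<bar>fst v $ j\<bar> < 1/256" using that by (auto simp: quartic_dom_def split: prod.splits)
      then have "real (mesh_inv n) * \<bar>fst v $ j\<bar> \<le> real (mesh_inv n) * 1" by (intro mult_left_mono) auto
      then have "\<bar>mesh_inv n * fst v $ j\<bar> \<le> of_int (int (mesh_inv n))" by (simp add: abs_mult)
      from b(3)[OF this] show "(\<Sum>t\<in>{-int (mesh_inv n)-1..int (mesh_inv n)+1}. b (mesh_inv n * fst v $ j - of_int t)) = 1" .
    qed
    finally show ?thesis by simp
  qed
  define ex where "ex n w = exp (\<i> * of_nat n * w)" for n w
  define EQ where "EQ c v = rect_integral (fst (snd c))
      (\<lambda>w. ex (fst c) w * inverse (quartic (fst v) w) * inverse (w - of_real (snd v)))"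
    for c :: "nat \<times> real \<times> (real^4)" and v :: "(real^4) \<times> real"
  define ER where "ER j c v = rect_integral (fst (snd c))
      (\<lambda>w. ex (fst c) w * quartic_quot j (fst v) w * inverse (quartic (fst v) w))"
    for j and c :: "nat \<times> real \<times> (real^4)" and v :: "(real^4) \<times> real"
  have EQ: "cell.poly_growth k EQ" for k
    unfolding EQ_def ex_def
  proof (rule rect_integral_growth)
    show "edge.poly_growth k (\<lambda>i v. exp (\<i> * of_nat (fst (fst i)) * edge_point i) *
        inverse (quartic (fst v) (edge_point i)) * inverse (edge_point i - of_real (snd v)))"
      by (intro edge.poly_growth_mult edge_growth)
    show "smooth_on (edge_regular \<delta> j) (\<lambda>z. exp (\<i> * of_nat n * side \<delta> j (snd z)) *
        inverse (quartic (fst (fst z)) (side \<delta> j (snd z))) * inverse (side \<delta> j (snd z) - of_real (snd (fst z))))" for n \<delta> j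
      by (intro smooth_on_mult smooth_on_inverse smooth_on_diff smooth_edge open_edge_regular)
        (auto simp: edge_regular_def)
  qed
  have ER: "cell.poly_growth k (ER j)" for k j
    unfolding ER_def ex_def
  proof (rule rect_integral_growth)
    show "edge.poly_growth k (\<lambda>i v. exp (\<i> * of_nat (fst (fst i)) * edge_point i) *
        quartic_quot j (fst v) (edge_point i) * inverse (quartic (fst v) (edge_point i)))"
      by (intro edge.poly_growth_mult edge_growth)
    show "smooth_on (edge_regular \<delta> l) (\<lambda>z. exp (\<i> * of_nat n * side \<delta> l (snd z)) *
        quartic_quot j (fst (fst z)) (side \<delta> l (snd z)) * inverse (quartic (fst (fst z)) (side \<delta> l (snd z))))" for n \<delta> l
      by (intro smooth_on_mult smooth_on_inverse smooth_edge open_edge_regular) (auto simp: edge_regular_def)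
  qed
  define glue where "glue E n v = (\<Sum>\<beta>\<in>B n. if v \<in> cell_box n (lattice_point n \<beta>)
     then \<rho> n \<beta> v *\<^sub>R E (n, \<delta> n \<beta>, lattice_point n \<beta>) v else 0)"
    for E :: "nat \<times> real \<times> (real^4) \<Rightarrow> (real^4) \<times> real \<Rightarrow> complex" and n v
  have glue: "\<exists>C N. 0 \<le> C \<and> (\<forall>n. ck_bounded k quartic_dom (glue E n) (C * (real n + 1) ^ N))"
    if "cell.poly_growth k E" for E k
    unfolding glue_def by (rule glue_growth[OF that \<rho>poly_growth \<rho>0 K_closed K_sub \<delta> B_fin B_card])
  show ?thesis
  proof (rule that)
    show "\<exists>C N. 0 \<le> C \<and> (\<forall>n. ck_bounded k quartic_dom (glue EQ n) (C * (real n + 1) ^ N))" for k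
      by (rule glue[OF EQ])
    show "\<exists>C N. 0 \<le> C \<and> (\<forall>n. ck_bounded k quartic_dom ((\<lambda>n j. glue (ER j) n) n j) (C * (real n + 1) ^ N))" for k j
      using glue[OF ER] by simp
    show "(\<lambda>n j. glue (ER j) n) n j (p, x) = (\<lambda>n j. glue (ER j) n) n j (p, 0)" for n j p x
      by (simp add: glue_def ER_def \<rho>_def cell_box_def cong: if_cong)
    fix n p x assume v: "(p, x) \<in> quartic_dom"
    let ?e = "exp (\<i> * of_nat n * of_real x)"
    define S where "S c = of_real (quartic p x) * EQ c (p, x) + (\<Sum>j<4. of_real x ^ j * ER j c (p, x))" for c
    have hol: "(\<lambda>w. ex n w) holomorphic_on UNIV" unfolding ex_def by (intro holomorphic_intros)
    have S: "S (n, \<delta> n \<beta>, lattice_point n \<beta>) = ?e" if "(p, x) \<in> cell_box n (lattice_point n \<beta>)" for \<beta>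
    proof -
      have c: "(p, x) \<in> cell_set (n, \<delta> n \<beta>, lattice_point n \<beta>)" using v that by (simp add: cell_set_def)
      have "1 / (16 * (real n + 1)) \<le> \<delta> n \<beta>" using \<delta>[of n \<beta>] by (simp add: cells_def)
      moreover have "0 < 1 / (16 * (real n + 1))" by simp
      ultimately have "0 < \<delta> n \<beta>" by linarith
      moreover have "\<bar>x\<bar> < 1/2" using v by (auto simp: quartic_dom_def)
      moreover have "quartic p (side (\<delta> n \<beta>) j t) \<noteq> 0" if "j < 4" "t \<in> {0..1}" for j t
        using edge_point(3)[OF \<delta> that c] by auto
      ultimately have "ex n (of_real x) = quartic p (of_real x) * EQ (n, \<delta> n \<beta>, lattice_point n \<beta>) (p, x) +
          (\<Sum>j<4. of_real x ^ j * ER j (n, \<delta> n \<beta>, lattice_point n \<beta>) (p, x))"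
        unfolding EQ_def ER_def fst_conv snd_conv by (rule quartic_division_rect[OF hol])
      then show ?thesis by (simp add: S_def quartic_of_real ex_def)
    qed
    \<comment> \<open>Sort the terms by lattice point. On a box containing \<open>(p, x)\<close> the
      bracket \<open>S\<close> is the exponential itself; at the other lattice points the bump
      vanishes.\<close>
    have "of_real (quartic p x) * glue EQ n (p, x) + (\<Sum>j<4. of_real x ^ j * glue (ER j) n (p, x)) =
        (\<Sum>\<beta>\<in>B n. if (p, x) \<in> cell_box n (lattice_point n \<beta>)
          then \<rho> n \<beta> (p, x) *\<^sub>R S (n, \<delta> n \<beta>, lattice_point n \<beta>) else 0)"
    proof -
      have "(\<Sum>j<4. of_real x ^ j * glue (ER j) n (p, x)) =
          (\<Sum>\<beta>\<in>B n. \<Sum>j<4. of_real x ^ j * (if (p, x) \<in> cell_box n (lattice_point n \<beta>)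
          then \<rho> n \<beta> (p, x) *\<^sub>R ER j (n, \<delta> n \<beta>, lattice_point n \<beta>) (p, x) else 0))"
        unfolding glue_def sum_distrib_left by (rule sum.swap)
      moreover have "of_real (quartic p x) * glue EQ n (p, x) =
          (\<Sum>\<beta>\<in>B n. of_real (quartic p x) * (if (p, x) \<in> cell_box n (lattice_point n \<beta>)
          then \<rho> n \<beta> (p, x) *\<^sub>R EQ (n, \<delta> n \<beta>, lattice_point n \<beta>) (p, x) else 0))"
        unfolding glue_def by (rule sum_distrib_left)
      ultimately show ?thesis
        unfolding sum.distrib[symmetric]
        by (simp only: sum.distrib[symmetric])
          (rule sum.cong[OF refl], auto simp: S_def scaleR_conv_of_real sum_distrib_left algebra_simps)
    qed
    also have "\<dots> = (\<Sum>\<beta>\<in>B n. \<rho> n \<beta> (p, x) *\<^sub>R ?e)"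
    proof (rule sum.cong[OF refl])
      fix \<beta>
      show "(if (p, x) \<in> cell_box n (lattice_point n \<beta>)
          then \<rho> n \<beta> (p, x) *\<^sub>R S (n, \<delta> n \<beta>, lattice_point n \<beta>) else 0) = \<rho> n \<beta> (p, x) *\<^sub>R ?e"
        using S[of \<beta>] \<rho>0[of "(p, x)" n \<beta>] K_sub[of n \<beta>] by auto
    qed
    also have "\<dots> = ?e" using \<rho>sum[OF v, of n] by (simp add: scaleR_sum_left[symmetric])
    finally show "?e = of_real (quartic p x) * glue EQ n (p, x) +
        (\<Sum>j<4. of_real x ^ j * (\<lambda>n j. glue (ER j) n) n j (p, x))" by simp
  qed
qed

section \<open>Fourier series and Hadamard quotients\<close>

lemma smooth_on_integral:
  fixes F :: "'a::euclidean_space \<times> real \<Rightarrow> 'b::euclidean_space"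
  assumes "open S" "open V" "S \<times> {a..b} \<subseteq> V" "smooth_on V F"
  shows "smooth_on S (\<lambda>x. integral {a..b} (\<lambda>t. F (x, t)))"
proof -
  have "C_k_on k S (\<lambda>x. integral {a..b} (\<lambda>t. F (x, t)))" for k
    using assms(4)
  proof (induction k arbitrary: F)
    case (0 F)
    show ?case
      using has_derivative_continuous[OF has_derivative_integral[OF assms(1-3) 0]]
      by (simp add: continuous_at_imp_continuous_on)
  next
    case (Suc k F)
    show ?case
    proof (rule C_k_on_DI[OF assms(1) has_derivative_integral[OF assms(1-3) Suc.prems]])
      show "C_k_on k S (\<lambda>x. integral {a..b} (\<lambda>t. frechet_derivative F (at (x, t)) (v, 0)))" for v
        by (rule Suc.IH[OF smooth_on_frechet_derivative[OF Suc.prems]])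
    qed
  qed
  then show ?thesis by (simp add: smooth_on_def)
qed

lemma smooth_on_vector_derivative:
  fixes g :: "real \<Rightarrow> 'b::euclidean_space"
  assumes "open S" "smooth_on S g"
  shows "smooth_on S (\<lambda>x. frechet_derivative g (at x) 1)"
    and "x \<in> S \<Longrightarrow> (g has_vector_derivative frechet_derivative g (at x) 1) (at x)"
proof -
  show "smooth_on S (\<lambda>x. frechet_derivative g (at x) 1)"
    by (rule smooth_on_frechet_derivative[OF assms(2)])
  assume x: "x \<in> S"
  have lin: "linear (frechet_derivative g (at x))"
    using linear_frechet_derivative[OF smooth_on_differentiable[OF assms(2) x]] .
  have "frechet_derivative g (at x) = (\<lambda>h. h *\<^sub>R frechet_derivative g (at x) 1)"
  proof
    fix h show "frechet_derivative g (at x) h = h *\<^sub>R frechet_derivative g (at x) 1"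
      using linear_scale[OF lin, of h 1] by simp
  qed
  then show "(g has_vector_derivative frechet_derivative g (at x) 1) (at x)"
    using smooth_on_has_derivative[OF assms(2) x] by (simp add: has_vector_derivative_def)
qed

text \<open>The quotient is the mean of the derivative over the segment from \<open>x0\<close> to
  \<open>x\<close>, hence smooth at \<open>x0\<close> as well.\<close>

lemma Hadamard_quotient:
  fixes g :: "real \<Rightarrow> 'b::euclidean_space"
  assumes "open S" "convex S" "x0 \<in> S" "smooth_on S g"
  obtains k where "smooth_on S k" "\<And>x. x \<in> S \<Longrightarrow> g x - g x0 = (x - x0) *\<^sub>R k x"
    "k x0 = frechet_derivative g (at x0) 1"
proof -
  define g' where "g' x = frechet_derivative g (at x) 1" for x
  have g': "smooth_on S g'" "\<And>x. x \<in> S \<Longrightarrow> (g has_vector_derivative g' x) (at x)"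
    using smooth_on_vector_derivative[OF assms(1,4)] by (simp_all add: g'_def[abs_def])
  define V where "V = {z :: real \<times> real. x0 + snd z * (fst z - x0) \<in> S}"
  have V: "open V"
  proof -
    have "V = (\<lambda>z. x0 + snd z * (fst z - x0)) -` S" by (auto simp: V_def)
    then show ?thesis by (simp add: open_vimage assms(1) continuous_intros)
  qed
  have seg: "x0 + t * (x - x0) \<in> S" if "x \<in> S" "t \<in> {0..1}" for x t
  proof -
    have "(1 - t) *\<^sub>R x0 + t *\<^sub>R x \<in> S" using that by (intro convexD[OF assms(2,3)]) auto
    then show ?thesis by (simp add: algebra_simps)
  qed
  define k where "k x = integral {0..1} (\<lambda>t. (\<lambda>z. g' (x0 + snd z * (fst z - x0))) (x, t))" for x
  have "smooth_on V (\<lambda>z. g' (x0 + snd z * (fst z - x0)))"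
    by (intro smooth_on_compose[OF g'(1)] smooth_on_add smooth_on_mult smooth_on_diff smooth_on_fst
        smooth_on_snd smooth_on_id smooth_on_const V assms(1)) (auto simp: V_def)
  then have "smooth_on S k"
    unfolding k_def by (intro smooth_on_integral[OF assms(1) V]) (auto simp: V_def seg)
  moreover have "g x - g x0 = (x - x0) *\<^sub>R k x" if x: "x \<in> S" for x
  proof -
    have "((\<lambda>t. (x - x0) *\<^sub>R g' (x0 + t * (x - x0))) has_integral
        (g (x0 + 1 * (x - x0)) - g (x0 + 0 * (x - x0)))) {0..1}"
    proof (rule fundamental_theorem_of_calculus)
      fix t :: real assume t: "t \<in> {0..1}"
      have "((\<lambda>t. x0 + t * (x - x0)) has_vector_derivative (x - x0)) (at t)"
        by (auto intro!: derivative_eq_intros)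
      from vector_diff_chain_at[OF this g'(2)[OF seg[OF x t]]]
      show "((\<lambda>t. g (x0 + t * (x - x0))) has_vector_derivative (x - x0) *\<^sub>R g' (x0 + t * (x - x0))) (at t within {0..1})"
        by (simp add: o_def has_vector_derivative_at_within)
    qed simp
    then have "((\<lambda>t. (x - x0) *\<^sub>R g' (x0 + t * (x - x0))) has_integral (g x - g x0)) {0..1}" by simp
    from integral_unique[OF this] show ?thesis by (simp add: k_def)
  qed
  moreover have "k x0 = frechet_derivative g (at x0) 1" by (simp add: k_def g'_def)
  ultimately show ?thesis using that by blast
qed

text \<open>The phase is centred at \<open>c\<close> so that one formula serves the decay of Fourier
  coefficients (with \<open>c = 0\<close>), the integral over a period and the Riemann-Lebesgue
  lemma around \<open>x0\<close>.\<close>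

lemma integral_exp_parts:
  fixes h :: "real \<Rightarrow> complex" and m :: real
  assumes "a \<le> b" "\<And>x. x \<in> {a..b} \<Longrightarrow> (h has_vector_derivative h' x) (at x)" "continuous_on {a..b} h'"
  shows "\<i> * m * integral {a..b} (\<lambda>x. h x * exp (- (\<i> * m * of_real (x - c)))) =
    integral {a..b} (\<lambda>x. h' x * exp (- (\<i> * m * of_real (x - c))))
    - (h b * exp (- (\<i> * m * of_real (b - c))) - h a * exp (- (\<i> * m * of_real (a - c))))"
proof -
  define e where "e x = exp (- (\<i> * m * of_real (x - c)))" for x
  have e': "(e has_vector_derivative - (\<i> * m) * e x) (at x)" for x
    unfolding e_def by (auto intro!: derivative_eq_intros has_vector_derivative_real_field simp: algebra_simps)
  have ce: "continuous_on {a..b} e" unfolding e_def by (intro continuous_intros)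
  have ch: "continuous_on {a..b} h"
    using has_vector_derivative_continuous[OF assms(2)] by (intro continuous_at_imp_continuous_on) blast
  have i: "(\<lambda>x. h x * e x) integrable_on {a..b}" "(\<lambda>x. h' x * e x) integrable_on {a..b}"
    by (intro integrable_continuous_interval continuous_intros ch ce assms(3))+
  have "((\<lambda>x. - (\<i> * m) * (h x * e x) + h' x * e x) has_integral (h b * e b - h a * e a)) {a..b}"
  proof (rule fundamental_theorem_of_calculus[OF assms(1)])
    fix x assume x: "x \<in> {a..b}"
    have "((\<lambda>x. h x * e x) has_vector_derivative (h x * (- (\<i> * m) * e x) + h' x * e x)) (at x within {a..b})"
      by (rule has_vector_derivative_mult[OF has_vector_derivative_at_within[OF assms(2)[OF x]]
            has_vector_derivative_at_within[OF e']])
    then show "((\<lambda>x. h x * e x) has_vector_derivative (- (\<i> * m) * (h x * e x) + h' x * e x)) (at x within {a..b})"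
      by (simp add: mult.left_commute)
  qed
  moreover have "((\<lambda>x. - (\<i> * m) * (h x * e x) + h' x * e x) has_integral
      (- (\<i> * m) * integral {a..b} (\<lambda>x. h x * e x) + integral {a..b} (\<lambda>x. h' x * e x))) {a..b}"
    using i by (intro has_integral_add has_integral_mult_right integrable_integral)
  ultimately have "h b * e b - h a * e a =
      - (\<i> * m) * integral {a..b} (\<lambda>x. h x * e x) + integral {a..b} (\<lambda>x. h' x * e x)"
    by (rule has_integral_unique)
  then have "\<i> * m * integral {a..b} (\<lambda>x. h x * e x) = integral {a..b} (\<lambda>x. h' x * e x) - (h b * e b - h a * e a)"
    by (simp only: minus_mult_left[symmetric]) (simp add: algebra_simps)
  then show ?thesis by (simp only: e_def)
qed

lemma Riemann_Lebesgue_smooth: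
  fixes h :: "real \<Rightarrow> complex"
  assumes "a \<le> b" "\<And>x. x \<in> {a..b} \<Longrightarrow> (h has_vector_derivative h' x) (at x)" "continuous_on {a..b} h'"
  shows "(\<lambda>m. integral {a..b} (\<lambda>x. h x * exp (- (\<i> * of_nat m * of_real (x - c))))) \<longlonglongrightarrow> 0"
proof -
  have "compact (h' ` {a..b})" using assms(3) by (intro compact_continuous_image) auto
  then have "bounded (h' ` {a..b})" by (rule compact_imp_bounded)
  then obtain M where M: "\<forall>y\<in>h' ` {a..b}. norm y \<le> M" unfolding bounded_iff by blast
  define C where "C = M * (b - a) + norm (h b) + norm (h a)"
  define I where "I m = integral {a..b} (\<lambda>x. h x * exp (- (\<i> * of_real m * of_real (x - c))))" for m
  have "norm (I (real m)) \<le> C * inverse (real m)" if "0 < m" for m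
  proof -
    define e where "e x = exp (- (\<i> * of_real (real m) * of_real (x - c)))" for x
    have e: "norm (e x) = 1" for x by (simp add: e_def)
    have "norm (integral {a..b} (\<lambda>x. h' x * e x)) \<le> M * (b - a)"
      using assms(1,3) M e by (intro integral_bound) (auto simp: norm_mult e_def intro!: continuous_intros)
    moreover have "\<i> * real m * I (real m) = integral {a..b} (\<lambda>x. h' x * e x) - (h b * e b - h a * e a)"
      unfolding I_def e_def by (rule integral_exp_parts[OF assms])
    ultimately have "norm (\<i> * real m * I (real m)) \<le> C"
      unfolding C_def using norm_triangle_ineq4[of "integral {a..b} (\<lambda>x. h' x * e x)" "h b * e b - h a * e a"]
        norm_triangle_ineq4[of "h b * e b" "h a * e a"] by (simp add: norm_mult e)
    then show ?thesis using that by (simp add: norm_mult field_simps)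
  qed
  then have "\<forall>\<^sub>F m in sequentially. norm (I (real m)) \<le> C * inverse (real m)"
    by (auto simp: eventually_sequentially intro!: exI[of _ 1])
  then have "(\<lambda>m. I (real m)) \<longlonglongrightarrow> 0"
    by (rule Lim_null_comparison) (intro tendsto_mult_right_zero lim_inverse_n)
  then show ?thesis by (simp add: I_def)
qed

lemma integral_exp_period:
  "integral {c - pi..c + pi} (\<lambda>x. exp (- (\<i> * of_nat m * of_real (x - c)))) = (if m = 0 then 2 * pi else 0)"
proof (cases "m = 0")
  case False
  have "\<i> * of_real (real m) * integral {c - pi..c + pi} (\<lambda>x. 1 * exp (- (\<i> * of_real (real m) * of_real (x - c)))) =
    integral {c - pi..c + pi} (\<lambda>x. 0 * exp (- (\<i> * of_real (real m) * of_real (x - c))))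
    - (1 * exp (- (\<i> * of_real (real m) * of_real (c + pi - c))) - 1 * exp (- (\<i> * of_real (real m) * of_real (c - pi - c))))"
    by (rule integral_exp_parts) auto
  moreover have "exp (- (\<i> * of_real (real m) * of_real (c + pi - c))) = exp (- (\<i> * of_real (real m) * of_real (c - pi - c)))"
    by (rule exp_eq[THEN iffD2]) (rule exI[of _ "- int m"], simp add: algebra_simps)
  ultimately show ?thesis using False by simp
qed (simp add: scaleR_conv_of_real)

text \<open>Chernoff's argument: the quotient \<open>h = (g - g x0) / (exp (\<i> (x - x0)) - 1)\<close> is smooth, and the
  partial sums of the Fourier series telescope in terms of the coefficients of \<open>h\<close>.\<close>

lemma Fourier_series_half:
  fixes g :: "real \<Rightarrow> real" and x0 :: real
  assumes g: "smooth_on UNIV g" and supp: "\<And>x. 1 < \<bar>x\<bar> \<Longrightarrow> g x = 0" and x0: "\<bar>x0\<bar> \<le> 1"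
  defines "a \<equiv> \<lambda>n. integral {-2..2} (\<lambda>x. of_real (g x) * exp (- (\<i> * of_nat n * of_real x)))"
  shows "(\<lambda>M. Re (\<Sum>n\<le>M. (if n = 0 then 1 else 2) * a n * exp (\<i> * of_nat n * of_real x0))) \<longlonglongrightarrow> 2 * pi * g x0"
proof -
  obtain k where k: "smooth_on UNIV k" "\<And>x. g x - g x0 = (x - x0) *\<^sub>R k x"
    by (rule Hadamard_quotient[OF open_UNIV convex_UNIV UNIV_I[of x0] g]) simp
  have sme: "smooth_on UNIV (\<lambda>x::real. exp (\<i> * of_real (x - x0)))"
    by (rule smooth_on_compose[OF smooth_on_iexp[of UNIV \<i>]]) (auto intro: smooth_on_diff smooth_on_id)
  obtain m where m: "smooth_on UNIV m" "\<And>x. exp (\<i> * of_real (x - x0)) - exp (\<i> * of_real (x0 - x0)) = (x - x0) *\<^sub>R m x"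
    "m x0 = frechet_derivative (\<lambda>x::real. exp (\<i> * of_real (x - x0))) (at x0) 1"
    by (rule Hadamard_quotient[OF open_UNIV convex_UNIV UNIV_I[of x0] sme]) simp
  have "((\<lambda>x::real. exp (\<i> * of_real (x - x0))) has_vector_derivative \<i>) (at x0)"
    by (auto intro!: derivative_eq_intros has_vector_derivative_real_field)
  then have mx0: "m x0 = \<i>"
    using frechet_derivative_eqI unfolding has_vector_derivative_def m(3) by fastforce
  \<comment> \<open>In this interval the exponential takes the value 1 only at \<open>x0\<close>,
    where \<open>m\<close> equals \<open>\<i>\<close>. Hence \<open>m\<close> has no zero and
    \<open>h\<close>, the quotient of two Hadamard quotients, is smooth.\<close>
  define V where "V = {x0 - 2 * pi<..<x0 + 2 * pi}"
  have mnz: "m x \<noteq> 0" if "x \<in> V" for x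
  proof
    assume "m x = 0"
    then have "exp (\<i> * of_real (x - x0)) = 1" using m(2)[of x] by simp
    then obtain n :: int where n: "x - x0 = of_int (2 * n) * pi"
      by (auto simp: exp_eq_1)
    have "\<bar>x - x0\<bar> < 2 * pi" using that by (auto simp: V_def)
    then have "\<bar>of_int n\<bar> * (2 * pi) < 1 * (2 * pi)" unfolding n by (simp add: abs_mult)
    then have "\<bar>of_int n\<bar> < (1 :: real)" by (rule mult_right_less_imp_less) simp
    then have "n = 0" by linarith
    then have "x = x0" using n by simp
    then show False using \<open>m x = 0\<close> mx0 by simp
  qed
  define h where "h x = of_real (k x) / m x" for x
  have smh: "smooth_on V h"
    unfolding h_def using mnz smooth_on_subset[OF k(1)] smooth_on_subset[OF m(1)]
    by (intro smooth_on_divide smooth_on_of_real) (auto simp: V_def)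
  define P where "P = {x0 - pi..x0 + pi}"
  have PV: "P \<subseteq> V"
  proof
    fix x assume "x \<in> P"
    then have "x0 - pi \<le> x" "x \<le> x0 + pi" by (auto simp: P_def)
    then show "x \<in> V" unfolding V_def greaterThanLessThan_iff using pi_gt_zero by linarith
  qed
  have oV: "open V" by (simp add: V_def)
  define e where "e n x = exp (- (\<i> * of_nat n * of_real (x - x0)))" for n x
  have h: "of_real (g x - g x0) = h x * (exp (\<i> * of_real (x - x0)) - 1)" if "x \<in> V" for x
    using k(2)[of x] m(2)[of x] mnz[OF that] by (simp add: h_def scaleR_conv_of_real)
  have ch: "continuous_on P h" using smooth_on_imp_continuous_on[OF smh] PV continuous_on_subset by blast
  have ce: "continuous_on P (e n)" for n unfolding e_def by (intro continuous_intros)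
  have cE: "continuous_on P (\<lambda>x. exp (\<i> * of_real (x - x0)))" by (intro continuous_intros)
  have cg: "continuous_on P (\<lambda>x. of_real (g x) :: complex)"
    using smooth_on_imp_continuous_on[OF g] continuous_on_subset by (intro continuous_intros) blast
  define H where "H n = integral P (\<lambda>x. h x * e n x)" for n
  define H' where "H' = integral P (\<lambda>x. h x * exp (\<i> * of_real (x - x0)))"
  define A where "A n = a n * exp (\<i> * of_nat n * of_real x0)" for n
  \<comment> \<open>The support of \<open>g\<close> lies in [-1, 1], hence both in
    \<open>{-2..2}\<close> and in the period \<open>P\<close> centred at \<open>x0\<close>; either
    interval gives the same coefficient.\<close>
  have A: "A n = integral P (\<lambda>x. of_real (g x) * e n x)" for n
  proof -
    define f where "f x = of_real (g x) * e n x" for x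
    have f0: "f x = 0" if "1 < \<bar>x\<bar>" for x using supp[OF that] by (simp add: f_def)
    have "continuous_on UNIV f"
      unfolding f_def e_def using smooth_on_imp_continuous_on[OF g] by (intro continuous_intros)
    then have "f integrable_on {-1..1}"
      using continuous_on_subset by (intro integrable_continuous_interval) blast
    then have I: "(f has_integral integral {-1..1} f) {-1..1}" by (rule integrable_integral)
    have "(f has_integral integral {-1..1} f) {-2..2}"
      by (rule has_integral_on_superset[OF I]) (auto intro!: f0)
    moreover have "(f has_integral integral {-1..1} f) P"
      by (rule has_integral_on_superset[OF I]) (use x0 pi_gt3 in \<open>auto intro!: f0 simp: P_def\<close>)
    ultimately have "integral {-2..2} f = integral P f" by (simp add: integral_unique)
    moreover have "A n = integral {-2..2} f"
    proof -
      have "A n = integral {-2..2} (\<lambda>x. of_real (g x) * exp (- (\<i> * of_nat n * of_real x)) * exp (\<i> * of_nat n * of_real x0))"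
        unfolding A_def a_def by (rule integral_mult_left[symmetric])
      also have "\<dots> = integral {-2..2} f"
        by (rule integral_cong) (simp add: f_def e_def mult.assoc exp_add[symmetric] algebra_simps)
      finally show ?thesis .
    qed
    ultimately show ?thesis by (simp add: f_def[abs_def])
  qed
  have split: "A n = integral P (\<lambda>x. h x * (exp (\<i> * of_real (x - x0)) * e n x)) - H n + of_real (g x0) * (if n = 0 then 2 * pi else 0)" for n
  proof -
    have "A n = integral P (\<lambda>x. (h x * (exp (\<i> * of_real (x - x0)) * e n x) - h x * e n x) + of_real (g x0) * e n x)"
      unfolding A
    proof (rule integral_cong)
      fix x assume "x \<in> P"
      with PV have "x \<in> V" by blast
      from h[OF this] have eq: "of_real (g x) = h x * (exp (\<i> * of_real (x - x0)) - 1) + of_real (g x0)"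
        by (simp only: of_real_diff diff_eq_eq)
      show "of_real (g x) * e n x =
          (h x * (exp (\<i> * of_real (x - x0)) * e n x) - h x * e n x) + of_real (g x0) * e n x"
        unfolding eq by (simp add: algebra_simps)
    qed
    also have "\<dots> = integral P (\<lambda>x. h x * (exp (\<i> * of_real (x - x0)) * e n x)) - H n + integral P (\<lambda>x. of_real (g x0) * e n x)"
    proof -
      have i: "(\<lambda>x. h x * (exp (\<i> * of_real (x - x0)) * e n x)) integrable_on P"
        "(\<lambda>x. h x * e n x) integrable_on P" "(\<lambda>x. of_real (g x0) * e n x) integrable_on P"
        unfolding P_def
        by (intro integrable_continuous_interval continuous_intros ch[unfolded P_def] ce[unfolded P_def])+
      show ?thesis
        using integral_add[OF integrable_diff[OF i(1,2)] i(3)] integral_diff[OF i(1,2)] by (simp only: H_def)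
    qed
    also have "integral P (\<lambda>x. of_real (g x0) * e n x) = of_real (g x0) * integral P (\<lambda>x. e n x)"
      by (rule integral_mult_right)
    also have "integral P (\<lambda>x. e n x) = (if n = 0 then 2 * pi else 0)"
      unfolding e_def P_def by (rule integral_exp_period)
    finally show ?thesis by simp
  qed
  have A0: "A 0 = H' - H 0 + of_real (2 * pi * g x0)"
    using split[of 0] by (simp add: H'_def e_def)
  \<comment> \<open>Multiplication by exp(i (x - x0)) lowers the index of \<open>e\<close> by one,
    which makes the sum telescope.\<close>
  have AS: "A (Suc n) = H n - H (Suc n)" for n
  proof -
    have "exp (\<i> * of_real (x - x0)) * e (Suc n) x = e n x" for x
      by (simp add: e_def exp_add[symmetric] algebra_simps)
    then show ?thesis using split[of "Suc n"] by (simp add: H_def)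
  qed
  \<comment> \<open>Here \<open>g\<close> is real. Conjugating the real number h(x) (E - 1), with
    |E| = 1, gives cnj h = - h E away from \<open>x0\<close>; so the real parts of \<open>H'\<close>
    and \<open>H 0\<close> cancel in the end.\<close>
  have HH: "H' = - cnj (H 0)"
  proof -
    have "cnj (h x) = - (h x * exp (\<i> * of_real (x - x0)))" if x: "x \<in> P" "x \<noteq> x0" for x
    proof -
      define E where "E = exp (\<i> * of_real (x - x0))"
      have E: "cnj E * E = 1" unfolding E_def by (simp add: exp_cnj exp_add[symmetric])
      have hx: "of_real (g x - g x0) = h x * (E - 1)" using h PV x by (auto simp: E_def)
      have E1: "E \<noteq> 1"
        using m(2)[of x] mnz[of x] x PV by (auto simp: E_def)
      have "cnj (h x) * (cnj E - 1) = h x * (E - 1)"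
        using arg_cong[OF hx, of cnj] hx by simp
      then have "cnj (h x) * (cnj E - 1) * E = h x * (E - 1) * E" by simp
      then have "cnj (h x) * (cnj E * E - E) = h x * E * (E - 1)" by (simp add: algebra_simps)
      then have "cnj (h x) * (1 - E) = h x * E * (E - 1)" unfolding E .
      moreover have "(cnj (h x) + h x * E) * (E - 1) = h x * E * (E - 1) - cnj (h x) * (1 - E)"
        by (simp add: algebra_simps)
      ultimately have "(cnj (h x) + h x * E) * (E - 1) = 0" by simp
      then show ?thesis using E1 by (simp add: E_def add_eq_0_iff)
    qed
    then have "integral P (\<lambda>x. cnj (h x)) = integral P (\<lambda>x. - (h x * exp (\<i> * of_real (x - x0))))"
      by (intro integral_spike[of "{x0}"]) auto
    then show ?thesis by (simp add: H_def H'_def e_def integral_cnj)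
  qed
  have tel: "(\<Sum>n\<le>M. A n) = H' + of_real (2 * pi * g x0) - H M" for M
    by (induction M) (simp_all add: A0 AS)
  \<comment> \<open>Doubling the positive frequencies and taking real parts stands for the symmetric
    sum over positive and negative frequencies.\<close>
  have "Re (\<Sum>n\<le>M. (if n = 0 then 1 else 2) * a n * exp (\<i> * of_nat n * of_real x0)) = 2 * pi * g x0 - 2 * Re (H M)" for M
  proof -
    have "(\<Sum>n\<le>M. (if n = 0 then 1 else 2) * a n * exp (\<i> * of_nat n * of_real x0)) = 2 * (\<Sum>n\<le>M. A n) - A 0"
      by (induction M) (simp_all add: A_def algebra_simps)
    also have "Re \<dots> = 2 * pi * g x0 - 2 * Re (H M) + (Re H' + Re (H 0))"
      unfolding tel by (simp add: A0)
    also have "Re H' + Re (H 0) = 0" by (simp add: HH)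
    finally show ?thesis by simp
  qed
  moreover have "H \<longlonglongrightarrow> 0"
    unfolding H_def e_def P_def
  proof (rule Riemann_Lebesgue_smooth)
    show "(h has_vector_derivative frechet_derivative h (at x) 1) (at x)" if "x \<in> {x0 - pi..x0 + pi}" for x
      by (rule smooth_on_vector_derivative(2)[OF oV smh]) (use that PV in \<open>auto simp: P_def\<close>)
    show "continuous_on {x0 - pi..x0 + pi} (\<lambda>x. frechet_derivative h (at x) 1)"
      using smooth_on_imp_continuous_on[OF smooth_on_vector_derivative(1)[OF oV smh]] PV
      unfolding P_def by (rule continuous_on_subset)
  qed simp
  then have "(\<lambda>M. 2 * pi * g x0 - 2 * Re (H M)) \<longlonglongrightarrow> 2 * pi * g x0 - 2 * Re 0"
    by (intro tendsto_intros)
  ultimately show ?thesis by simp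
qed

section \<open>The preparation theorem for functions of order at most four\<close>

lemma ck_bounded_fst:
  fixes f :: "'a::euclidean_space \<Rightarrow> 'b::euclidean_space"
  assumes "open A" "open T" "0 \<le> M" "ck_bounded k A f M"
  shows "ck_bounded k (A \<times> (T :: 'c::euclidean_space set)) (\<lambda>z. f (fst z)) M"
  using assms(4)
proof (induction k arbitrary: f)
  case (Suc k)
  show ?case
  proof (rule ck_bounded_SucI[OF open_Times[OF assms(1,2)]])
    fix z assume "z \<in> A \<times> T"
    then have z: "fst z \<in> A" by auto
    show "norm (f (fst z)) \<le> M" using Suc.prems z ck_bounded_norm_le by blast
    show "((\<lambda>z. f (fst z)) has_derivative (\<lambda>h. frechet_derivative f (at (fst z)) (fst h))) (at z)"
      by (rule has_derivative_compose[OF has_derivative_fst[OF has_derivative_ident] ck_bounded_has_derivative[OF Suc.prems z]])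
  next
    fix b :: "'a \<times> 'c" assume "b \<in> Basis"
    then consider "fst b \<in> Basis" | "fst b = 0" by (auto simp: Basis_prod_def)
    then show "ck_bounded k (A \<times> T) (\<lambda>z. frechet_derivative f (at (fst z)) (fst b)) M"
    proof cases
      case 1
      then show ?thesis using Suc.IH[of "\<lambda>x. frechet_derivative f (at x) (fst b)"] Suc.prems by simp
    next
      case 2
      have "ck_bounded k (A \<times> T) (\<lambda>z. 0 :: 'b) M" using assms(3) by (intro ck_bounded_const) simp
      then show ?thesis
      proof (rule ck_bounded_cong[OF open_Times[OF assms(1,2)], rotated])
        fix z assume "z \<in> A \<times> T"
        then have "linear (frechet_derivative f (at (fst z)))"
          using has_derivative_linear[OF ck_bounded_has_derivative[OF Suc.prems]] by auto
        then show "0 = frechet_derivative f (at (fst z)) (fst b)" using 2 by (simp add: linear_0)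
      qed
    qed
  qed
qed auto

lemma ck_bounded_snd:
  fixes f :: "'a::euclidean_space \<Rightarrow> 'b::euclidean_space"
  assumes "open A" "open T" "0 \<le> M" "ck_bounded k A f M"
  shows "ck_bounded k ((T :: 'c::euclidean_space set) \<times> A) (\<lambda>z. f (snd z)) M"
  using assms(4)
proof (induction k arbitrary: f)
  case (Suc k)
  show ?case
  proof (rule ck_bounded_SucI[OF open_Times[OF assms(2,1)]])
    fix z assume "z \<in> T \<times> A"
    then have z: "snd z \<in> A" by auto
    show "norm (f (snd z)) \<le> M" using Suc.prems z ck_bounded_norm_le by blast
    show "((\<lambda>z. f (snd z)) has_derivative (\<lambda>h. frechet_derivative f (at (snd z)) (snd h))) (at z)"
      by (rule has_derivative_compose[OF has_derivative_snd[OF has_derivative_ident] ck_bounded_has_derivative[OF Suc.prems z]])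
  next
    fix b :: "'c \<times> 'a" assume "b \<in> Basis"
    then consider "snd b \<in> Basis" | "snd b = 0" by (auto simp: Basis_prod_def)
    then show "ck_bounded k (T \<times> A) (\<lambda>z. frechet_derivative f (at (snd z)) (snd b)) M"
    proof cases
      case 1
      then show ?thesis using Suc.IH[of "\<lambda>x. frechet_derivative f (at x) (snd b)"] Suc.prems by simp
    next
      case 2
      have "ck_bounded k (T \<times> A) (\<lambda>z. 0 :: 'b) M" using assms(3) by (intro ck_bounded_const) simp
      then show ?thesis
      proof (rule ck_bounded_cong[OF open_Times[OF assms(2,1)], rotated])
        fix z assume "z \<in> T \<times> A"
        then have "linear (frechet_derivative f (at (snd z)))"
          using has_derivative_linear[OF ck_bounded_has_derivative[OF Suc.prems]] by auto
        then show "0 = frechet_derivative f (at (snd z)) (snd b)" using 2 by (simp add: linear_0)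
      qed
    qed
  qed
qed auto

lemma has_vector_derivative_slice_snd:
  fixes g :: "'c::real_normed_vector \<times> real \<Rightarrow> 'b::real_normed_vector"
  assumes "(g has_derivative g') (at (l, x))"
  shows "((\<lambda>x. g (l, x)) has_vector_derivative g' (0, 1)) (at x)"
proof -
  have "((\<lambda>x. (l, x)) has_derivative (\<lambda>h. (0, h))) (at x)"
    by (auto intro!: derivative_eq_intros)
  from has_derivative_compose[OF this assms]
  have d: "((\<lambda>x. g (l, x)) has_derivative (\<lambda>h. g' (0, h))) (at x)" .
  have lin: "linear g'" using has_derivative_linear[OF assms] .
  have "g' (0, h) = h *\<^sub>R g' (0, 1)" for h
    using linear_scale[OF lin, of h "(0, 1)"] by simp
  then have "(\<lambda>h. g' (0, h)) = (\<lambda>h. h *\<^sub>R g' (0, 1))" by (intro ext)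
  then show ?thesis using d unfolding has_vector_derivative_def by (simp only:)
qed

text \<open>Integrate by parts \<open>N\<close> times in \<open>x\<close>; the boundary terms vanish
  because \<open>f\<close> and its derivatives are 0 at -2 and 2. Derivatives in \<open>l\<close>
  pass under the integral, so the decay holds for C^k bounds and not only for values.\<close>

lemma Fourier_coefficient_decay:
  fixes f :: "'c::euclidean_space \<times> real \<Rightarrow> real"
  assumes "open U" "smooth_on (U \<times> UNIV) f" "\<And>l x. l \<in> U \<Longrightarrow> 1 < \<bar>x\<bar> \<Longrightarrow> f (l, x) = 0"
    and "0 < \<epsilon>" "cball l0 \<epsilon> \<subseteq> U"
  shows "\<exists>B\<ge>0. \<forall>n. ck_bounded k (ball l0 \<epsilon>)
    (\<lambda>l. integral {-2..2} (\<lambda>x. of_real (f (l, x)) * exp (- (\<i> * of_nat n * of_real x)))) (B * inverse ((real n + 1) ^ N))"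
proof -
  define D where "D g z = frechet_derivative g (at z) (0, 1)" for g :: "'c \<times> real \<Rightarrow> real" and z
  define g where "g N = (D ^^ N) f" for N
  have oU: "open (U \<times> (UNIV :: real set))" using assms(1) by (simp add: open_Times)
  have gS: "g (Suc N) z = D (g N) z" for N z by (simp add: g_def)
  have smg: "smooth_on (U \<times> UNIV) (g N)" for N
  proof (induction N)
    case (Suc N)
    then show ?case using smooth_on_frechet_derivative[OF Suc] by (simp add: g_def D_def[abs_def])
  qed (simp add: g_def assms(2))
  have g0: "g N (l, x) = 0" if "l \<in> U" "1 < \<bar>x\<bar>" for N l x
    using that
  proof (induction N arbitrary: l x)
    case (Suc N)
    have o: "open (U \<times> {x::real. 1 < \<bar>x\<bar>})" by (intro open_Times assms(1) open_Collect_less continuous_intros)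
    have "(g N has_derivative (\<lambda>h. 0)) (at (l, x))"
      by (rule has_derivative_transform_within_open[OF has_derivative_const o]) (use Suc in auto)
    then show ?case unfolding gS D_def by (simp add: frechet_derivative_eqI)
  qed (simp add: g_def assms(3))
  define J where "J N n l = integral {-2..2} (\<lambda>x. of_real (g N (l, x)) * exp (- (\<i> * of_nat n * of_real x)))" for N n l
  have dg: "((\<lambda>x. complex_of_real (g N (l, x))) has_vector_derivative of_real (g (Suc N) (l, x))) (at x)"
    if "l \<in> U" for N l x
  proof -
    have "((\<lambda>x. g N (l, x)) has_vector_derivative g (Suc N) (l, x)) (at x)"
      unfolding gS D_def
      by (rule has_vector_derivative_slice_snd[OF smooth_on_has_derivative[OF smg]]) (use that in auto)
    from bounded_linear.has_vector_derivative[OF bounded_linear_of_real this] show ?thesis .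
  qed
  have cg: "continuous_on A (\<lambda>x. complex_of_real (g N (l, x)))" if "l \<in> U" for N l A
    using dg[OF that] has_vector_derivative_continuous by (blast intro: continuous_at_imp_continuous_on)
  have J: "(\<i> * of_nat n) ^ N * J 0 n l = J N n l" if "l \<in> U" for N n l
  proof (induction N)
    case (Suc N)
    have "\<i> * of_real (real n) * integral {-2..2} (\<lambda>x. of_real (g N (l, x)) * exp (- (\<i> * of_real (real n) * of_real (x - 0)))) =
      integral {-2..2} (\<lambda>x. of_real (g (Suc N) (l, x)) * exp (- (\<i> * of_real (real n) * of_real (x - 0))))
      - (of_real (g N (l, 2)) * exp (- (\<i> * of_real (real n) * of_real (2 - 0)))
         - of_real (g N (l, -2)) * exp (- (\<i> * of_real (real n) * of_real (-2 - 0))))"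
      using dg[OF that] cg[OF that] by (intro integral_exp_parts) auto
    then have "\<i> * of_nat n * J N n l = J (Suc N) n l"
      using g0[OF that, of 2 N] g0[OF that, of "-2" N] by (simp add: J_def)
    then show ?case using Suc by (simp add: mult.assoc)
  qed simp
  have bd: "\<exists>M\<ge>0. \<forall>n. ck_bounded k (ball l0 \<epsilon>) (J N n) (M * 4)" for N
  proof -
    have "compact (cball l0 \<epsilon> \<times> {-2..2::real})" by (intro compact_Times) auto
    from ck_bounded_compact[OF smg this, of k N]
    obtain M where M: "M \<ge> 0" "ck_bounded k (cball l0 \<epsilon> \<times> {-2..2}) (g N) M" using assms(5) by auto
    have "ck_bounded k (ball l0 \<epsilon>) (J N n) (M * 4)" for n
    proof -
      have "ck_bounded k (ball l0 \<epsilon>) (\<lambda>l. integral {-2..2} (\<lambda>x. (\<lambda>z. of_real (g N z) * exp (- (\<i> * of_nat n * of_real (snd z)))) (l, x)))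
          (M * (2 - (-2)))"
      proof (rule ck_bounded_integral[OF open_ball oU])
        show "ball l0 \<epsilon> \<times> {-2..2} \<subseteq> U \<times> UNIV" using assms(5) by auto
        have "smooth_on (U \<times> UNIV) (\<lambda>z. exp ((- (\<i> * of_nat n)) * complex_of_real (snd z)))"
          by (intro smooth_on_compose[OF smooth_on_iexp[of UNIV]] smooth_on_snd smooth_on_id oU) auto
        then have "smooth_on (U \<times> UNIV) (\<lambda>z. exp (- (\<i> * of_nat n * complex_of_real (snd z))))" by simp
        then show "smooth_on (U \<times> UNIV) (\<lambda>z. of_real (g N z) * exp (- (\<i> * of_nat n * of_real (snd z))))"
          by (intro smooth_on_mult smooth_on_of_real smg oU)
        fix t :: real assume t: "t \<in> {-2..2}"
        define E where "E = exp (- (\<i> * of_nat n * of_real t))"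
        have "norm E = 1" by (simp add: E_def)
        have 1: "ck_bounded k (ball l0 \<epsilon>) (\<lambda>l. g N (l, t)) M"
          by (rule ck_bounded_slice[OF open_ball t ck_bounded_subset[OF M(2)]]) auto
        have "ck_bounded k (ball l0 \<epsilon>) (\<lambda>l. of_real (g N (l, t)) * E) (1 * M)"
          by (rule ck_bounded_bounded_linear[OF open_ball
                bounded_linear_compose[OF bounded_linear_mult_left bounded_linear_of_real] _ _ 1])
            (simp_all add: norm_mult \<open>norm E = 1\<close>)
        then show "ck_bounded k (ball l0 \<epsilon>) (\<lambda>l. (\<lambda>z. of_real (g N z) * exp (- (\<i> * of_nat n * of_real (snd z)))) (l, t)) M"
          by (simp add: E_def)
      qed simp
      then show ?thesis by (simp add: J_def[abs_def])
    qed
    then show ?thesis using M(1) by blast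
  qed
  obtain M where M: "M \<ge> 0" "\<And>n. ck_bounded k (ball l0 \<epsilon>) (J N n) (M * 4)" using bd by blast
  obtain M0 where M0: "M0 \<ge> 0" "\<And>n. ck_bounded k (ball l0 \<epsilon>) (J 0 n) (M0 * 4)" using bd by blast
  \<comment> \<open>The first term serves \<open>n > 0\<close>, where replacing \<open>n\<close> by
    \<open>n + 1\<close> costs \<open>2 ^ N\<close>; the second serves \<open>n = 0\<close>, where
    no division by \<open>n\<close> is possible.\<close>
  define B where "B = 2 ^ N * (M * 4) + M0 * 4"
  have "ck_bounded k (ball l0 \<epsilon>) (J 0 n) (B * inverse ((real n + 1) ^ N))" for n
  proof (cases "n = 0")
    case True
    have "M0 * 4 \<le> B" using M by (simp add: B_def)
    then show ?thesis using ck_bounded_mono[OF M0(2)[of n]] True by simp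
  next
    case False
    have "ck_bounded k (ball l0 \<epsilon>) (\<lambda>l. inverse ((\<i> * of_nat n) ^ N) * J N n l) (inverse (real n ^ N) * (M * 4))"
      by (rule ck_bounded_bounded_linear[OF open_ball bounded_linear_mult_right _ _ M(2)])
        (simp_all add: norm_mult norm_inverse norm_power)
    moreover have "inverse (real n ^ N) * (M * 4) \<le> B * inverse ((real n + 1) ^ N)"
    proof -
      have "(real n + 1) ^ N \<le> (2 * real n) ^ N" using False by (intro power_mono) auto
      then have "inverse (real n ^ N) \<le> 2 ^ N * inverse ((real n + 1) ^ N)"
        using False by (simp add: power_mult_distrib field_simps)
      then have "inverse (real n ^ N) * (M * 4) \<le> 2 ^ N * inverse ((real n + 1) ^ N) * (M * 4)"
        using M(1) by (intro mult_right_mono) auto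
      also have "\<dots> \<le> B * inverse ((real n + 1) ^ N)"
        using M0(1) by (simp add: B_def algebra_simps)
      finally show ?thesis .
    qed
    ultimately have 1: "ck_bounded k (ball l0 \<epsilon>) (\<lambda>l. inverse ((\<i> * of_nat n) ^ N) * J N n l) (B * inverse ((real n + 1) ^ N))"
      by (rule ck_bounded_mono)
    show ?thesis
    proof (rule ck_bounded_cong[OF open_ball _ 1])
      fix l assume "l \<in> ball l0 \<epsilon>"
      then have "l \<in> U" using assms(5) by auto
      from J[OF this, of n N, symmetric] False
      show "inverse ((\<i> * of_nat n) ^ N) * J N n l = J 0 n l" by simp
    qed
  qed
  moreover have "J 0 n = (\<lambda>l. integral {-2..2} (\<lambda>x. of_real (f (l, x)) * exp (- (\<i> * of_nat n * of_real x))))" for n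
    by (simp add: J_def[abs_def] g_def)
  moreover have "B \<ge> 0" using M M0 by (simp add: B_def)
  ultimately show ?thesis by auto
qed

definition quartic_box :: "(real^4) set" where
  "quartic_box = {p. \<forall>j. \<bar>p $ j\<bar> < 1/256}"

lemma open_quartic_box: "open quartic_box"
proof -
  have "quartic_box = (\<Inter>j\<in>UNIV. (\<lambda>p. p $ j) -` ball 0 (1/256))" by (auto simp: quartic_box_def dist_real_def)
  also have "open \<dots>" by (intro open_INT ballI finite open_vimage open_ball continuous_intros)
  finally show ?thesis .
qed

lemma quartic_dom_iff: "(p, x) \<in> quartic_dom \<longleftrightarrow> p \<in> quartic_box \<and> \<bar>x\<bar> < 1/4"
  by (auto simp: quartic_dom_def quartic_box_def)

text \<open>Weight the divisions of the exponentials with the Fourier coefficients of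
  \<open>f (l, _)\<close> and sum. The coefficients and all their derivatives in \<open>l\<close>
  decay faster than the quotients and remainders grow, so the sums are jointly smooth.\<close>

theorem smooth_quartic_division:
  fixes f :: "'c::euclidean_space \<times> real \<Rightarrow> real"
  assumes "open U" "l0 \<in> U" "smooth_on (U \<times> UNIV) f" "\<And>l x. l \<in> U \<Longrightarrow> 1 < \<bar>x\<bar> \<Longrightarrow> f (l, x) = 0"
  obtains \<epsilon> Q R where "0 < \<epsilon>" "ball l0 \<epsilon> \<subseteq> U" "smooth_on (ball l0 \<epsilon> \<times> quartic_dom) Q"
    "\<And>j. smooth_on (ball l0 \<epsilon> \<times> quartic_box) (R j)"
    "\<And>l p x. l \<in> ball l0 \<epsilon> \<Longrightarrow> p \<in> quartic_box \<Longrightarrow> \<bar>x\<bar> < 1/4 \<Longrightarrow>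
       f (l, x) = quartic p x * Q (l, (p, x)) + (\<Sum>j<4. x ^ j * R j (l, p))"
proof -
  obtain \<epsilon> where \<epsilon>: "0 < \<epsilon>" "cball l0 \<epsilon> \<subseteq> U" using assms(1,2) open_contains_cball by blast
  define L where "L = ball l0 \<epsilon>"
  have L: "open L" "convex L" "L \<subseteq> U" using \<epsilon> by (auto simp: L_def)
  define a where "a n l = integral {-2..2} (\<lambda>x. of_real (f (l, x)) * exp (- (\<i> * of_nat n * of_real x)))" for n l
  define w where "w n = (if n = 0 then 1 else 2 :: complex)" for n :: nat
  obtain q :: "nat \<Rightarrow> (real^4) \<times> real \<Rightarrow> complex" and r :: "nat \<Rightarrow> nat \<Rightarrow> (real^4) \<times> real \<Rightarrow> complex"
    where q: "\<And>k. \<exists>C N. 0 \<le> C \<and> (\<forall>n. ck_bounded k quartic_dom (q n) (C * (real n + 1) ^ N))"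
    and r: "\<And>k j. \<exists>C N. 0 \<le> C \<and> (\<forall>n. ck_bounded k quartic_dom (r n j) (C * (real n + 1) ^ N))"
    and rp: "\<And>n j p x. r n j (p, x) = r n j (p, 0)"
    and ex: "\<And>n p x. (p, x) \<in> quartic_dom \<Longrightarrow> exp (\<i> * of_nat n * of_real x) =
       of_real (quartic p x) * q n (p, x) + (\<Sum>j<4. of_real x ^ j * r n j (p, x))"
    by (rule exp_division) blast
  define T where "T s n z = w n * a n (fst z) * s n (snd z)"
    for s :: "nat \<Rightarrow> (real^4) \<times> real \<Rightarrow> complex" and n :: nat and z :: "'c \<times> ((real^4) \<times> real)"
  have o: "open (L \<times> quartic_dom)" "convex (L \<times> quartic_dom)"
    using L open_quartic_dom convex_quartic_dom by (auto intro: open_Times convex_Times)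
  have T: "\<exists>M. summable M \<and> (\<forall>n. ck_bounded k (L \<times> quartic_dom) (T s n) (M n))"
    if s: "\<exists>C N. 0 \<le> C \<and> (\<forall>n. ck_bounded k quartic_dom (s n) (C * (real n + 1) ^ N))" for k s
  proof -
    from s obtain C N where C: "0 \<le> C" "\<And>n. ck_bounded k quartic_dom (s n) (C * (real n + 1) ^ N)" by blast
    \<comment> \<open>Decay of order \<open>N + 2\<close> is requested: \<open>N\<close> to cancel
      the growth of \<open>s\<close> and 2 for summability.\<close>
    obtain B where B: "0 \<le> B" "\<And>n. ck_bounded k L (a n) (B * inverse ((real n + 1) ^ (N + 2)))"
      using Fourier_coefficient_decay[OF assms(1,3,4) \<epsilon>, of k "N + 2"] unfolding L_def a_def[abs_def] by blast
    have "ck_bounded k (L \<times> quartic_dom) (T s n) (2 * 2 ^ k * B * C * inverse ((real n + 1) ^ 2))" for n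
    proof -
      have 1: "ck_bounded k L (\<lambda>l. w n * a n l) (2 * (B * inverse ((real n + 1) ^ (N + 2))))"
        by (rule ck_bounded_bounded_linear[OF L(1) bounded_linear_mult_right _ _ B(2)])
          (auto simp: w_def norm_mult)
      have "ck_bounded k (L \<times> quartic_dom) (T s n) (2 ^ k * (2 * (B * inverse ((real n + 1) ^ (N + 2)))) * (C * (real n + 1) ^ N))"
        unfolding T_def
        by (intro ck_bounded_mult o ck_bounded_fst[OF L(1) open_quartic_dom _ 1] ck_bounded_snd[OF open_quartic_dom L(1) _ C(2)])
          (use B(1) C(1) in auto)
      moreover have "2 ^ k * (2 * (B * inverse ((real n + 1) ^ (N + 2)))) * (C * (real n + 1) ^ N) =
          2 * 2 ^ k * B * C * inverse ((real n + 1) ^ 2)"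
      proof -
        define m where "m = real n + 1"
        have "m \<noteq> 0" by (simp add: m_def)
        then have m: "inverse (m ^ (N + 2)) * m ^ N = inverse (m ^ 2)"
          by (simp add: power_add power2_eq_square field_simps)
        have "2 ^ k * (2 * (B * inverse (m ^ (N + 2)))) * (C * m ^ N) = 2 * 2 ^ k * B * C * (inverse (m ^ (N + 2)) * m ^ N)"
          by (simp only: mult_ac)
        then show ?thesis unfolding m by (simp only: m_def)
      qed
      ultimately show ?thesis by (simp only:)
    qed
    moreover have "summable (\<lambda>n. 2 * 2 ^ k * B * C * inverse ((real n + 1) ^ 2))"
    proof -
      have "summable (\<lambda>n. inverse (real (Suc n) ^ 2))"
        by (subst summable_Suc_iff) (rule inverse_power_summable, simp)
      then show ?thesis by (intro summable_mult) (simp add: add.commute)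
    qed
    ultimately show ?thesis by blast
  qed
  define S where "S s z = (\<Sum>n. T s n z)"
    for s :: "nat \<Rightarrow> (real^4) \<times> real \<Rightarrow> complex" and z :: "'c \<times> ((real^4) \<times> real)"
  have S: "smooth_on (L \<times> quartic_dom) (S s)" "\<And>z. z \<in> L \<times> quartic_dom \<Longrightarrow> summable (\<lambda>n. T s n z)"
    if s: "\<And>k. \<exists>C N. 0 \<le> C \<and> (\<forall>n. ck_bounded k quartic_dom (s n) (C * (real n + 1) ^ N))" for s
  proof -
    obtain M where M: "\<And>k. summable (M k)" "\<And>k n. ck_bounded k (L \<times> quartic_dom) (T s n) (M k n)"
      using T[OF s] by metis
    have "ck_bounded k (L \<times> quartic_dom) (S s) (suminf (M k))" for k
      unfolding S_def by (rule ck_bounded_series[OF o M(2,1)])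
    then show "smooth_on (L \<times> quartic_dom) (S s)" using smooth_on_ck_boundedI[OF o(1)] by blast
    show "summable (\<lambda>n. T s n z)" if "z \<in> L \<times> quartic_dom" for z
      using M(1)[of 0] by (rule summable_comparison_test'[where N = 0]) (use M(2)[of 0] that in auto)
  qed
  define rr where "rr j n v = r n j v" for j n v
  have rr: "\<exists>C N. 0 \<le> C \<and> (\<forall>n. ck_bounded k quartic_dom (rr j n) (C * (real n + 1) ^ N))" for k j
    using r[of k j] by (simp add: rr_def[abs_def])
  define Q where "Q z = Re (S q z) / (2 * pi)" for z
  \<comment> \<open>By \<open>rp\<close> the remainder coefficients may be evaluated at
    \<open>x = 0\<close>, so that \<open>R j\<close> depends on \<open>l\<close> and
    \<open>p\<close> alone. The divisor 2 pi undoes the normalization of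
    \<open>Fourier_series_half\<close>.\<close>
  define R where "R j z = Re (S (rr j) (fst z, (snd z, 0))) / (2 * pi)" for j z
  show ?thesis
  proof (rule that)
    show "0 < \<epsilon>" "ball l0 \<epsilon> \<subseteq> U" using \<epsilon> by auto
    show "smooth_on (ball l0 \<epsilon> \<times> quartic_dom) Q"
      unfolding Q_def L_def[symmetric]
      by (intro smooth_on_divide smooth_on_Re S(1)[OF q] o smooth_on_const) auto
    show "smooth_on (ball l0 \<epsilon> \<times> quartic_box) (R j)" for j
    proof -
      have ob: "open (L \<times> quartic_box)" using L open_quartic_box by (intro open_Times)
      show ?thesis
        unfolding R_def L_def[symmetric]
        by (intro smooth_on_divide smooth_on_Re smooth_on_compose[OF S(1)[OF rr]] o ob smooth_on_const
            smooth_on_Pair smooth_on_fst smooth_on_snd smooth_on_id) (auto simp: quartic_dom_iff)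
    qed
    fix l p and x :: real assume lpx: "l \<in> ball l0 \<epsilon>" "p \<in> quartic_box" "\<bar>x\<bar> < 1/4"
    define z where "z = (l, (p, x))"
    have d: "(p, x) \<in> quartic_dom" using lpx by (simp add: quartic_dom_iff)
    have z: "z \<in> L \<times> quartic_dom" using lpx d by (simp add: z_def L_def)
    have lU: "l \<in> U" using lpx L by (auto simp: L_def)
    have smf: "smooth_on UNIV (\<lambda>x. f (l, x))"
      by (rule smooth_on_compose[OF assms(3)])
        (use lU assms(1) in \<open>auto intro!: smooth_on_Pair smooth_on_id open_Times\<close>)
    have 1: "(\<lambda>M. Re (\<Sum>n\<le>M. w n * a n l * exp (\<i> * of_nat n * of_real x))) \<longlonglongrightarrow> 2 * pi * f (l, x)"
      unfolding w_def a_def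
      by (rule Fourier_series_half[OF smf assms(4)[OF lU]]) (use lpx in auto)
    have "(\<Sum>n\<le>M. w n * a n l * exp (\<i> * of_nat n * of_real x)) =
        of_real (quartic p x) * (\<Sum>n\<le>M. T q n z) + (\<Sum>j<4. of_real x ^ j * (\<Sum>n\<le>M. T (rr j) n z))" for M
    proof -
      have "(\<Sum>j<4. of_real x ^ j * (\<Sum>n\<le>M. T (rr j) n z)) = (\<Sum>n\<le>M. \<Sum>j<4. of_real x ^ j * T (rr j) n z)"
        unfolding sum_distrib_left by (rule sum.swap)
      then have "of_real (quartic p x) * (\<Sum>n\<le>M. T q n z) + (\<Sum>j<4. of_real x ^ j * (\<Sum>n\<le>M. T (rr j) n z)) =
          (\<Sum>n\<le>M. of_real (quartic p x) * T q n z + (\<Sum>j<4. of_real x ^ j * T (rr j) n z))"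
        by (simp add: sum.distrib sum_distrib_left)
      also have "\<dots> = (\<Sum>n\<le>M. w n * a n l * exp (\<i> * of_nat n * of_real x))"
        unfolding ex[OF d] T_def z_def rr_def fst_conv snd_conv
        by (intro sum.cong refl) (simp add: sum_distrib_left algebra_simps)
      finally show ?thesis by simp
    qed
    moreover have "(\<lambda>M. of_real (quartic p x) * (\<Sum>n\<le>M. T q n z) + (\<Sum>j<4. of_real x ^ j * (\<Sum>n\<le>M. T (rr j) n z)))
        \<longlonglongrightarrow> of_real (quartic p x) * S q z + (\<Sum>j<4. of_real x ^ j * S (rr j) z)"
      unfolding S_def
      by (intro tendsto_intros summable_LIMSEQ' S(2)[OF q z] S(2)[OF rr z])
    ultimately have 2: "(\<lambda>M. Re (\<Sum>n\<le>M. w n * a n l * exp (\<i> * of_nat n * of_real x)))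
        \<longlonglongrightarrow> Re (of_real (quartic p x) * S q z + (\<Sum>j<4. of_real x ^ j * S (rr j) z))"
      by (simp only:) (rule tendsto_Re)
    have "2 * pi * f (l, x) = Re (of_real (quartic p x) * S q z + (\<Sum>j<4. of_real x ^ j * S (rr j) z))"
      using 1 2 by (rule LIMSEQ_unique)
    also have "\<dots> = quartic p x * Re (S q z) + (\<Sum>j<4. x ^ j * Re (S (rr j) z))"
      by (simp flip: of_real_power)
    also have "\<dots> = quartic p x * (2 * pi * Q z) + (\<Sum>j<4. x ^ j * (2 * pi * R j (l, p)))"
    proof -
      have "S (rr j) z = S (rr j) (l, (p, 0))" for j
        unfolding S_def T_def z_def rr_def fst_conv snd_conv by (subst rp) rule
      then show ?thesis by (simp add: Q_def R_def)
    qed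
    also have "\<dots> = 2 * pi * (quartic p x * Q z + (\<Sum>j<4. x ^ j * R j (l, p)))"
      by (simp add: sum_distrib_left algebra_simps)
    finally show "f (l, x) = quartic p x * Q (l, (p, x)) + (\<Sum>j<4. x ^ j * R j (l, p))"
      by (simp add: z_def)
  qed
qed

section \<open>From division to preparation\<close>

lemma eventually_neq_0: "\<forall>\<^sub>F x in at 0. x \<noteq> (0 :: real)"
  by (simp add: eventually_at_filter)

lemma eventually_abs_less: "0 < e \<Longrightarrow> \<forall>\<^sub>F x in at 0. \<bar>x\<bar> < (e :: real)"
  by (auto simp: eventually_at dist_real_def)

text \<open>Letting \<open>x\<close> tend to 0 gives \<open>a 0 = 0\<close>; divide by
  \<open>x\<close> and repeat. This comparison of coefficients takes the place of Taylor expansions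
  in what follows.\<close>

lemma poly_small_eq_0:
  fixes a :: "nat \<Rightarrow> real"
  assumes "\<forall>\<^sub>F x in at 0. \<bar>\<Sum>j<n. a j * x ^ j\<bar> \<le> C * \<bar>x\<bar> ^ n" "j < n"
  shows "a j = 0"
  using assms
proof (induction n arbitrary: a j)
  case (Suc n)
  have "((\<lambda>x. \<bar>\<Sum>j<Suc n. a j * x ^ j\<bar>) \<longlongrightarrow> \<bar>\<Sum>j<Suc n. a j * 0 ^ j\<bar>) (at 0)"
    by (intro tendsto_intros)
  moreover have "((\<lambda>x::real. C * \<bar>x\<bar> ^ Suc n) \<longlongrightarrow> C * \<bar>0\<bar> ^ Suc n) (at 0)"
    by (intro tendsto_intros)
  ultimately have "\<bar>\<Sum>j<Suc n. a j * 0 ^ j\<bar> \<le> C * \<bar>0\<bar> ^ Suc n"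
    using tendsto_le[OF at_neq_bot] Suc.prems(1) by blast
  moreover have sh: "(\<Sum>j<Suc n. a j * x ^ j) = a 0 + x * (\<Sum>j<n. a (Suc j) * x ^ j)" for x
    by (subst sum.lessThan_Suc_shift) (simp add: sum_distrib_left algebra_simps)
  ultimately have a0: "a 0 = 0" by simp
  have "\<forall>\<^sub>F x in at 0. \<bar>\<Sum>j<n. a (Suc j) * x ^ j\<bar> \<le> C * \<bar>x\<bar> ^ n"
    using Suc.prems(1) eventually_neq_0
  proof eventually_elim
    case (elim x)
    then have "\<bar>x\<bar> * \<bar>\<Sum>j<n. a (Suc j) * x ^ j\<bar> \<le> \<bar>x\<bar> * (C * \<bar>x\<bar> ^ n)"
      unfolding sh a0 by (simp add: abs_mult algebra_simps)
    then show ?case using elim(2) by (simp add: mult_le_cancel_left)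
  qed
  then have "a (Suc i) = 0" if "i < n" for i using Suc.IH[of "\<lambda>j. a (Suc j)" i] that by simp
  then show ?case using a0 Suc.prems(2) by (cases j) auto
qed simp

lemma smooth_cutoff_exists:
  obtains cut :: "real \<Rightarrow> real" where "smooth_on UNIV cut" "\<And>x. \<bar>x\<bar> \<le> 1/2 \<Longrightarrow> cut x = 1" "\<And>x. 1 \<le> \<bar>x\<bar> \<Longrightarrow> cut x = 0"
proof -
  obtain \<sigma> :: "real \<Rightarrow> real" where \<sigma>: "smooth_on UNIV \<sigma>" "\<And>x. x \<le> 0 \<Longrightarrow> \<sigma> x = 0" "\<And>x. 1 \<le> x \<Longrightarrow> \<sigma> x = 1"
    using smooth_step_exists by blast
  show ?thesis
  proof (rule that)
    show "smooth_on UNIV (\<lambda>x. \<sigma> (2 - 2 * x) * \<sigma> (2 + 2 * x))"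
      by (intro smooth_on_mult smooth_on_compose[OF \<sigma>(1)] smooth_on_add smooth_on_diff smooth_on_id) auto
    show "\<sigma> (2 - 2 * x) * \<sigma> (2 + 2 * x) = 1" if "\<bar>x\<bar> \<le> 1/2" for x
      using that \<sigma>(3)[of "2 - 2 * x"] \<sigma>(3)[of "2 + 2 * x"] by auto
    show "\<sigma> (2 - 2 * x) * \<sigma> (2 + 2 * x) = 0" if "1 \<le> \<bar>x\<bar>" for x
      using that \<sigma>(2)[of "2 - 2 * x"] \<sigma>(2)[of "2 + 2 * x"] by (auto simp: abs_if split: if_splits)
  qed
qed

text \<open>Numerals of type \<open>4\<close> are residues modulo 4; this picks the representatives
  0 to 3 and so turns coordinates into exponents.\<close>

definition nat_of_index :: "4 \<Rightarrow> nat" where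
  "nat_of_index j = (if j = 0 then 0 else if j = 1 then 1 else if j = 2 then 2 else 3)"

lemma nat_of_index: "n < 4 \<Longrightarrow> nat_of_index (of_nat n) = n" "of_nat (nat_of_index j) = j" "nat_of_index j < 4"
proof -
  show "nat_of_index j < 4" by (simp add: nat_of_index_def)
  show "of_nat (nat_of_index j) = j" using exhaust_4[of j] by (auto simp: nat_of_index_def)
  assume "n < 4"
  then have "n = 0 \<or> n = 1 \<or> n = 2 \<or> n = 3" by linarith
  then show "nat_of_index (of_nat n) = n" by (auto simp: nat_of_index_def)
qed

lemma quartic_sum: "quartic p x = x ^ 4 + (\<Sum>j<4. of_real (p $ of_nat j) * x ^ j)"
  by (simp add: quartic_def eval_nat_numeral)

text \<open>Divide by the generic quartic and choose its coefficients, as a function of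
  \<open>l\<close>, so that the remainder vanishes. What is left is the quotient, a unit, times a
  quartic.\<close>

theorem quartic_preparation:
  fixes f :: "'c::euclidean_space \<times> real \<Rightarrow> real"
  assumes "open W" "(l0, 0) \<in> W" "smooth_on W f"
    and lim: "((\<lambda>x. f (l0, x) / x ^ 4) \<longlongrightarrow> e0) (at 0)" and "e0 \<noteq> 0"
  obtains \<epsilon> P q where "0 < \<epsilon>" "ball l0 \<epsilon> \<times> {-\<epsilon><..<\<epsilon>} \<subseteq> W"
    "smooth_on (ball l0 \<epsilon>) P" "P l0 = 0"
    "smooth_on (ball l0 \<epsilon> \<times> {-\<epsilon><..<\<epsilon>}) q" "\<And>z. z \<in> ball l0 \<epsilon> \<times> {-\<epsilon><..<\<epsilon>} \<Longrightarrow> q z \<noteq> 0"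
    "\<And>l x. l \<in> ball l0 \<epsilon> \<Longrightarrow> \<bar>x\<bar> < \<epsilon> \<Longrightarrow> f (l, x) = q (l, x) * quartic (P l) x"
proof -
  obtain A B where AB: "open A" "open B" "l0 \<in> A" "0 \<in> B" "A \<times> B \<subseteq> W"
    using assms(1,2) open_prod_elim by (metis mem_Sigma_iff)
  obtain \<rho> where \<rho>: "0 < \<rho>" "ball l0 \<rho> \<subseteq> A" using AB open_contains_ball by blast
  obtain \<rho>' where \<rho>': "0 < \<rho>'" "ball 0 \<rho>' \<subseteq> B" using AB open_contains_ball by blast
  \<comment> \<open>Division wants a function of all real \<open>x\<close> that vanishes for |x| >
    1. Scaling by \<open>\<eta>\<close> brings all |x| < 2 into the domain of \<open>f\<close>,
    which leaves room for a cutoff.\<close>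
  define \<eta> where "\<eta> = \<rho>' / 2"
  have \<eta>: "0 < \<eta>" using \<rho>' by (simp add: \<eta>_def)
  define U where "U = ball l0 \<rho>"
  have W: "(l, \<eta> * x) \<in> W" if "l \<in> U" "\<bar>x\<bar> < 2" for l x
  proof -
    have "\<bar>\<eta> * x\<bar> < \<rho>'" using that(2) \<rho>'(1) by (simp add: \<eta>_def abs_mult)
    then have "\<eta> * x \<in> B" using \<rho>' by (auto simp: dist_real_def)
    then show ?thesis using that(1) \<rho> AB by (auto simp: U_def)
  qed
  obtain cut :: "real \<Rightarrow> real" where cut: "smooth_on UNIV cut" "\<And>x. \<bar>x\<bar> \<le> 1/2 \<Longrightarrow> cut x = 1" "\<And>x. 1 \<le> \<bar>x\<bar> \<Longrightarrow> cut x = 0"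
    using smooth_cutoff_exists by blast
  define F where "F z = (if \<bar>snd z\<bar> < 2 then cut (snd z) * f (fst z, \<eta> * snd z) else 0)" for z :: "'c \<times> real"
  have oU: "open (U \<times> (UNIV :: real set))" by (auto simp: U_def intro: open_Times)
  have o1: "open (U \<times> {x::real. \<bar>x\<bar> < 2})" and o2: "open (U \<times> {x::real. 1 < \<bar>x\<bar>})"
    by (auto simp: U_def intro!: open_Times open_Collect_less continuous_intros)
  have F0: "F (l, x) = 0" if "1 < \<bar>x\<bar>" for l x
    using cut(3)[of x] that by (simp add: F_def)
  have F1: "F (l, x) = f (l, \<eta> * x)" if "\<bar>x\<bar> \<le> 1/2" for l x
    using cut(2)[of x] that by (simp add: F_def)
  have smF: "smooth_on (U \<times> UNIV) F"
  proof (rule smooth_on_local)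
    fix z :: "'c \<times> real" assume z: "z \<in> U \<times> UNIV"
    show "\<exists>V. open V \<and> z \<in> V \<and> smooth_on V F"
    proof (cases "\<bar>snd z\<bar> < 2")
      case True
      have "smooth_on (U \<times> {x. \<bar>x\<bar> < 2}) (\<lambda>z. cut (snd z) * f (fst z, \<eta> * snd z))"
        by (intro smooth_on_mult smooth_on_compose[OF cut(1)] smooth_on_compose[OF assms(3)] o1 assms(1)
            smooth_on_Pair smooth_on_fst smooth_on_snd smooth_on_id smooth_on_const open_UNIV) (auto intro!: W)
      then have "smooth_on (U \<times> {x. \<bar>x\<bar> < 2}) F"
        by (rule smooth_on_cong[OF o1, rotated]) (auto simp: F_def)
      then show ?thesis using o1 True z by (auto intro!: exI[of _ "U \<times> {x. \<bar>x\<bar> < 2}"])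
    next
      case False
      have "smooth_on (U \<times> {x. 1 < \<bar>x\<bar>}) F"
        by (rule smooth_on_cong[OF o2 _ smooth_on_const[of _ 0]]) (auto simp: F0)
      then show ?thesis using o2 False z by (auto intro!: exI[of _ "U \<times> {x. 1 < \<bar>x\<bar>}"])
    qed
  qed
  have limF: "((\<lambda>x. F (l0, x) / x ^ 4) \<longlongrightarrow> \<eta> ^ 4 * e0) (at 0)"
  proof -
    have "filterlim (\<lambda>x. \<eta> * x) (at 0) (at 0)"
      using \<eta> by (intro filterlim_atI tendsto_eq_intros) (auto simp: eventually_at_filter)
    from filterlim_compose[OF lim this]
    have "((\<lambda>x. \<eta> ^ 4 * (f (l0, \<eta> * x) / (\<eta> * x) ^ 4)) \<longlongrightarrow> \<eta> ^ 4 * e0) (at 0)"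
      by (intro tendsto_intros)
    then show ?thesis
    proof (rule Lim_transform_eventually)
      have "\<forall>\<^sub>F x in at 0. \<bar>x\<bar> < (1/2 :: real)"
        by (rule eventually_abs_less) simp
      then show "\<forall>\<^sub>F x in at 0. \<eta> ^ 4 * (f (l0, \<eta> * x) / (\<eta> * x) ^ 4) = F (l0, x) / x ^ 4"
        by eventually_elim (use \<eta> in \<open>simp add: F1 power_mult_distrib\<close>)
    qed
  qed
  obtain \<epsilon> Q R where \<epsilon>: "0 < \<epsilon>" "ball l0 \<epsilon> \<subseteq> U" and smQ: "smooth_on (ball l0 \<epsilon> \<times> quartic_dom) Q"
    and smR: "\<And>j. smooth_on (ball l0 \<epsilon> \<times> quartic_box) (R j)"
    and div: "\<And>l p x. l \<in> ball l0 \<epsilon> \<Longrightarrow> p \<in> quartic_box \<Longrightarrow> \<bar>x\<bar> < 1/4 \<Longrightarrow>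
       F (l, x) = quartic p x * Q (l, (p, x)) + (\<Sum>j<4. x ^ j * R j (l, p))"
    using smooth_quartic_division[of U l0 F] smF F0 \<rho>(1) by (auto simp: U_def)
  have l0: "l0 \<in> ball l0 \<epsilon>" and p0: "0 \<in> quartic_box" using \<epsilon> by (auto simp: quartic_box_def)
  have oQ: "open (ball l0 \<epsilon> \<times> quartic_dom)" and oR: "open (ball l0 \<epsilon> \<times> quartic_box)"
    by (auto intro!: open_Times open_quartic_dom open_quartic_box)
  have q0: "quartic 0 x = x ^ 4" for x :: real by (simp add: quartic_def)
  have near0: "\<forall>\<^sub>F x in at 0. \<bar>x\<bar> < (1/4 :: real)"
    by (rule eventually_abs_less) simp
  have d0: "(l0, (0, x)) \<in> ball l0 \<epsilon> \<times> quartic_dom" if "\<bar>x\<bar> < 1/4" for x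
    using l0 p0 that by (auto simp: quartic_dom_iff)
  have cont_line: "((\<lambda>x. g (l0, (0, x))) \<longlongrightarrow> g (l0, (0, 0))) (at (0::real))"
    if "smooth_on (ball l0 \<epsilon> \<times> quartic_dom) g" for g :: "'c \<times> (real^4) \<times> real \<Rightarrow> real"
  proof -
    have "isCont g (l0, (0, 0))"
      using smooth_on_imp_continuous_on[OF that] oQ d0[of 0] by (simp add: continuous_on_eq_continuous_at)
    then show ?thesis
      by (rule isCont_tendsto_compose) (intro tendsto_intros)
  qed
  \<comment> \<open>At \<open>p = 0\<close> the identity reads F = x^4 Q + sum of R_j x^j, and F is
    O(x^4).\<close>
  have R0: "R j (l0, 0) = 0" if "j < 4" for j
  proof (rule poly_small_eq_0[OF _ that])
    have "((\<lambda>x. F (l0, x) / x ^ 4 - Q (l0, (0, x))) \<longlongrightarrow> \<eta> ^ 4 * e0 - Q (l0, (0, 0))) (at 0)"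
      by (intro tendsto_intros limF cont_line smQ)
    then have "\<forall>\<^sub>F x in at 0. \<bar>F (l0, x) / x ^ 4 - Q (l0, (0, x))\<bar> < \<bar>\<eta> ^ 4 * e0 - Q (l0, (0, 0))\<bar> + 1"
      by (intro order_tendstoD(2)[OF tendsto_rabs]) auto
    then show "\<forall>\<^sub>F x in at 0. \<bar>\<Sum>j<4. R j (l0, 0) * x ^ j\<bar> \<le> (\<bar>\<eta> ^ 4 * e0 - Q (l0, (0, 0))\<bar> + 1) * \<bar>x\<bar> ^ 4"
      using near0 eventually_neq_0
    proof eventually_elim
      case (elim x)
      have "(\<Sum>j<4. R j (l0, 0) * x ^ j) = (F (l0, x) / x ^ 4 - Q (l0, (0, x))) * x ^ 4"
        using div[OF l0 p0 elim(2)] elim(3) by (simp add: q0 field_simps)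
      then show ?case using elim(1) by (simp add: abs_mult power_abs mult_right_mono)
    qed
  qed
  have Q0: "Q (l0, (0, 0)) = \<eta> ^ 4 * e0"
  proof -
    have "((\<lambda>x. Q (l0, (0, x))) \<longlongrightarrow> \<eta> ^ 4 * e0) (at 0)"
    proof (rule Lim_transform_eventually[OF limF])
      show "\<forall>\<^sub>F x in at 0. F (l0, x) / x ^ 4 = Q (l0, (0, x))"
        using near0 eventually_neq_0
        by eventually_elim (simp add: div[OF l0 p0] q0 R0)
    qed
    then show ?thesis using cont_line[OF smQ] tendsto_unique[OF at_neq_bot] by blast
  qed
  then have Qn0: "Q (l0, (0, 0)) \<noteq> 0" using \<eta> assms(5) by simp
  define RR where "RR z = (\<chi> j. R (nat_of_index j) z)" for z
  have smRR: "smooth_on (ball l0 \<epsilon> \<times> quartic_box) RR"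
    by (rule smooth_on_vecI[OF oR]) (simp add: RR_def smR)
  have RR_nth: "RR z $ j = R (nat_of_index j) z" for z j by (simp add: RR_def)
  have lp0: "(l0, 0) \<in> ball l0 \<epsilon> \<times> quartic_box" using l0 p0 by auto
  \<comment> \<open>Differentiate the division identity at \<open>p = 0\<close> in the direction
    \<open>v\<close>; its left side does not depend on \<open>p\<close>. If all differentials of the
    \<open>R j\<close> vanish on \<open>v\<close>, the polynomial with coefficients \<open>v\<close>
    times \<open>Q\<close> is O(x^4). As \<open>Q\<close> is nonzero at the base point, this forces
    \<open>v = 0\<close>.\<close>
  have inj: "v = 0" if v: "frechet_derivative RR (at (l0, 0)) (0, v) = 0" for v
  proof -
    have dR: "((\<lambda>t. R j (l0, t *\<^sub>R v)) has_real_derivative 0) (at 0)" if "j < 4" for j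
    proof -
      have g: "((\<lambda>t::real. (l0, t *\<^sub>R v)) has_derivative (\<lambda>t. (0, t *\<^sub>R v))) (at 0)"
        by (auto intro!: derivative_eq_intros)
      have "(RR has_derivative frechet_derivative RR (at (l0, 0 *\<^sub>R v))) (at (l0, 0 *\<^sub>R v))"
        using smooth_on_has_derivative[OF smRR lp0] by simp
      from has_derivative_compose[OF g this]
      have "((\<lambda>t. RR (l0, t *\<^sub>R v)) has_derivative (\<lambda>t. frechet_derivative RR (at (l0, 0)) (0, t *\<^sub>R v))) (at 0)"
        by simp
      moreover have "frechet_derivative RR (at (l0, 0)) (0, t *\<^sub>R v) = 0" for t
        using linear_scale[OF has_derivative_linear[OF smooth_on_has_derivative[OF smRR lp0]], of t "(0, v)"] v by simp
      ultimately have "((\<lambda>t. RR (l0, t *\<^sub>R v)) has_derivative (\<lambda>t. 0)) (at 0)" by simp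
      from bounded_linear.has_derivative[OF bounded_linear_vec_nth this, of "of_nat j"]
      have "((\<lambda>t. R j (l0, t *\<^sub>R v)) has_derivative (\<lambda>t. 0)) (at 0)"
        using that by (simp add: RR_nth nat_of_index(1))
      moreover have "(*) (0::real) = (\<lambda>t. 0)" by auto
      ultimately show ?thesis unfolding has_field_derivative_def by (simp only:)
    qed
    define Q' where "Q' z = frechet_derivative Q (at z) (0, (v, 0))" for z
    have smQ': "smooth_on (ball l0 \<epsilon> \<times> quartic_dom) Q'"
      unfolding Q'_def using smQ by (rule smooth_on_frechet_derivative)
    have eqx: "(\<Sum>j<4. v $ of_nat j * x ^ j) * Q (l0, (0, x)) = - (x ^ 4 * Q' (l0, (0, x)))" if x: "\<bar>x\<bar> < 1/4" for x
    proof -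
      have g: "((\<lambda>t::real. (l0, (t *\<^sub>R v, x))) has_derivative (\<lambda>t. (0, (t *\<^sub>R v, 0)))) (at 0)"
        by (auto intro!: derivative_eq_intros)
      have "(Q has_derivative frechet_derivative Q (at (l0, (0 *\<^sub>R v, x)))) (at (l0, (0 *\<^sub>R v, x)))"
        using smooth_on_has_derivative[OF smQ d0[OF x]] by simp
      from has_derivative_compose[OF g this]
      have "((\<lambda>t. Q (l0, (t *\<^sub>R v, x))) has_derivative (\<lambda>t. frechet_derivative Q (at (l0, (0, x))) (0, (t *\<^sub>R v, 0)))) (at 0)"
        by simp
      moreover have "frechet_derivative Q (at (l0, (0, x))) (0, (t *\<^sub>R v, 0)) = Q' (l0, (0, x)) * t" for t
        using linear_scale[OF has_derivative_linear[OF smooth_on_has_derivative[OF smQ d0[OF x]]], of t "(0, (v, 0))"]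
        by (simp add: Q'_def)
      ultimately have dQ: "((\<lambda>t. Q (l0, (t *\<^sub>R v, x))) has_real_derivative Q' (l0, (0, x))) (at 0)"
        by (simp add: has_field_derivative_def)
      define S where "S = (\<Sum>j<4. v $ of_nat j * x ^ j)"
      have dq: "((\<lambda>t. quartic (t *\<^sub>R v) x) has_real_derivative S) (at 0)"
      proof -
        have "quartic (t *\<^sub>R v) x = x ^ 4 + t * S" for t
          by (simp add: quartic_sum S_def sum_distrib_left mult.assoc)
        then show ?thesis by (auto intro!: derivative_eq_intros)
      qed
      have "((\<lambda>t. quartic (t *\<^sub>R v) x * Q (l0, (t *\<^sub>R v, x)) + (\<Sum>j<4. x ^ j * R j (l0, t *\<^sub>R v)))
          has_real_derivative (S * Q (l0, (0 *\<^sub>R v, x)) + Q' (l0, (0, x)) * quartic (0 *\<^sub>R v) x) + (\<Sum>j<4. x ^ j * 0)) (at 0)"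
        by (intro DERIV_add DERIV_sum DERIV_cmult DERIV_mult dq dQ dR) auto
      moreover have "((\<lambda>t. quartic (t *\<^sub>R v) x * Q (l0, (t *\<^sub>R v, x)) + (\<Sum>j<4. x ^ j * R j (l0, t *\<^sub>R v)))
          has_real_derivative 0) (at 0)"
      proof -
        have "open ((\<lambda>t. t *\<^sub>R v) -` quartic_box)" by (intro open_vimage open_quartic_box continuous_intros)
        from has_field_derivative_transform_within_open[OF DERIV_const this, of 0 "F (l0, x)"]
        show ?thesis using p0 div[OF l0 _ x] by simp
      qed
      ultimately have "(S * Q (l0, (0 *\<^sub>R v, x)) + Q' (l0, (0, x)) * quartic (0 *\<^sub>R v) x) + (\<Sum>j<4. x ^ j * 0) = 0"
        by (rule DERIV_unique)
      then have "S * Q (l0, (0, x)) = - (x ^ 4 * Q' (l0, (0, x)))"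
        by (simp add: q0 mult.commute add_eq_0_iff2)
      then show ?thesis unfolding S_def .
    qed
    have "\<forall>\<^sub>F x in at 0. \<bar>Q (l0, (0, 0))\<bar> / 2 < \<bar>Q (l0, (0, x))\<bar>"
      using Qn0 by (intro order_tendstoD(1)[OF tendsto_rabs[OF cont_line[OF smQ]]]) simp
    moreover have "\<forall>\<^sub>F x in at 0. \<bar>Q' (l0, (0, x))\<bar> < \<bar>Q' (l0, (0, 0))\<bar> + 1"
      by (intro order_tendstoD(2)[OF tendsto_rabs[OF cont_line[OF smQ']]]) simp
    ultimately have small: "\<forall>\<^sub>F x in at 0. \<bar>\<Sum>j<4. v $ of_nat j * x ^ j\<bar> \<le>
        ((\<bar>Q' (l0, (0, 0))\<bar> + 1) / (\<bar>Q (l0, (0, 0))\<bar> / 2)) * \<bar>x\<bar> ^ 4"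
      using near0
    proof eventually_elim
      case (elim x)
      define S where "S = (\<Sum>j<4. v $ of_nat j * x ^ j)"
      define c where "c = \<bar>Q (l0, (0, 0))\<bar> / 2"
      have c: "0 < c" using Qn0 by (simp add: c_def)
      have "\<bar>S\<bar> * c \<le> \<bar>S\<bar> * \<bar>Q (l0, (0, x))\<bar>" using elim(1) by (intro mult_left_mono) (auto simp: c_def)
      also have "\<dots> = \<bar>x\<bar> ^ 4 * \<bar>Q' (l0, (0, x))\<bar>"
        using arg_cong[OF eqx[OF elim(3)], of abs] by (simp add: S_def abs_mult power_abs)
      also have "\<dots> \<le> \<bar>x\<bar> ^ 4 * (\<bar>Q' (l0, (0, 0))\<bar> + 1)" using elim(2) by (intro mult_left_mono) auto
      finally have "\<bar>S\<bar> \<le> \<bar>x\<bar> ^ 4 * (\<bar>Q' (l0, (0, 0))\<bar> + 1) / c" using c by (simp add: field_simps)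
      also have "\<bar>x\<bar> ^ 4 * (\<bar>Q' (l0, (0, 0))\<bar> + 1) / c = (\<bar>Q' (l0, (0, 0))\<bar> + 1) / c * \<bar>x\<bar> ^ 4" by simp
      finally show ?case by (simp only: S_def c_def)
    qed
    have "v $ j = 0" for j
      using poly_small_eq_0[OF small nat_of_index(3)[of j]] by (simp add: nat_of_index(2))
    then show ?thesis by (simp add: vec_eq_iff)
  qed
  have RR0: "RR (l0, 0) = 0" by (simp add: vec_eq_iff RR_nth R0 nat_of_index(3))
  obtain U1 V1 \<phi> where \<phi>: "open U1" "l0 \<in> U1" "open V1" "0 \<in> V1" "U1 \<times> V1 \<subseteq> ball l0 \<epsilon> \<times> quartic_box" "smooth_on U1 \<phi>"
    "\<And>c. c \<in> U1 \<Longrightarrow> \<phi> c \<in> V1" "\<And>c d. c \<in> U1 \<Longrightarrow> d \<in> V1 \<Longrightarrow> RR (c, d) = 0 \<longleftrightarrow> d = \<phi> c"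
    using smooth_implicit_function[OF oR smRR lp0 RR0 inj] by blast
  have \<phi>0: "\<phi> l0 = 0" using \<phi>(8)[OF \<phi>(2,4)] RR0 by simp
  have \<phi>b: "l \<in> ball l0 \<epsilon>" "\<phi> l \<in> quartic_box" if "l \<in> U1" for l using \<phi>(5) \<phi>(7)[OF that] that by auto
  have F\<phi>: "F (l, x) = quartic (\<phi> l) x * Q (l, (\<phi> l, x))" if "l \<in> U1" "\<bar>x\<bar> < 1/4" for l x
  proof -
    have "RR (l, \<phi> l) = 0" using \<phi>(7,8) that(1) by blast
    then have "R j (l, \<phi> l) = 0" if "j < 4" for j
      using RR_nth[of "(l, \<phi> l)" "of_nat j"] that by (simp add: nat_of_index(1))
    then show ?thesis using div[OF \<phi>b[OF that(1)] that(2)] by simp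
  qed
  \<comment> \<open>Undoing the scaling of the variable multiplies the coefficient of degree
    \<open>j\<close> by \<open>\<eta> ^ (4 - j)\<close>.\<close>
  define P where "P l = (\<chi> j. \<eta> ^ (4 - nat_of_index j) * \<phi> l $ j)" for l
  have smP: "smooth_on U1 P"
    unfolding P_def using \<phi>(1,6)
    by (intro smooth_on_vecI) (auto intro!: smooth_on_mult smooth_on_vec_nth)
  have P_quartic: "quartic (P l) y = \<eta> ^ 4 * quartic (\<phi> l) (y / \<eta>)" for l and y :: real
  proof -
    have "\<eta> ^ 4 * (\<phi> l $ of_nat j * (y / \<eta>) ^ j) = P l $ of_nat j * y ^ j" if "j < 4" for j
    proof -
      have "\<eta> ^ 4 = \<eta> ^ (4 - j) * \<eta> ^ j" using that by (simp flip: power_add)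
      then show ?thesis using \<eta> that by (simp add: P_def nat_of_index(1) power_divide field_simps)
    qed
    then show ?thesis
      using \<eta> by (simp add: quartic_sum distrib_left sum_distrib_left power_divide)
  qed
  define q where "q z = inverse (\<eta> ^ 4) * Q (fst z, (\<phi> (fst z), snd z / \<eta>))" for z
  define V where "V = U1 \<times> {-\<eta>/4<..<\<eta>/4}"
  have oV: "open V" using \<phi>(1) by (auto simp: V_def intro: open_Times)
  have Vx: "\<bar>snd z / \<eta>\<bar> < 1/4" "fst z \<in> U1" if "z \<in> V" for z
    using that \<eta> by (auto simp: V_def abs_less_iff field_simps)
  have smq: "smooth_on V q"
    unfolding q_def
    by (intro smooth_on_mult smooth_on_compose[OF smQ] smooth_on_compose[OF \<phi>(6)] smooth_on_Pair smooth_on_fst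
        smooth_on_snd smooth_on_id smooth_on_const smooth_on_divide oV oQ \<phi>(1)) (use Vx \<phi>b \<eta> in \<open>auto simp: quartic_dom_iff\<close>)
  have m0: "(l0, 0) \<in> V" using \<phi>(2) \<eta> by (simp add: V_def)
  have "q (l0, 0) \<noteq> 0" using Qn0 \<eta> by (simp add: q_def \<phi>0)
  define V' where "V' = {z \<in> V. q z \<in> - {0}}"
  have "open V'"
    unfolding V'_def using continuous_open_preimage[OF smooth_on_imp_continuous_on[OF smq] oV, of "- {0}"]
    by (simp add: vimage_def Int_def open_Compl)
  moreover have "(l0, 0) \<in> V'" using m0 \<open>q (l0, 0) \<noteq> 0\<close> by (simp add: V'_def)
  ultimately obtain A' B' where A': "open A'" "open B'" "l0 \<in> A'" "0 \<in> B'" "A' \<times> B' \<subseteq> V'"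
    using open_prod_elim by (metis mem_Sigma_iff)
  obtain e1 e2 where e: "0 < e1" "ball l0 e1 \<subseteq> A'" "0 < e2" "ball (0::real) e2 \<subseteq> B'"
    using A' open_contains_ball by metis
  define \<delta> where "\<delta> = min e1 e2"
  have sub: "ball l0 \<delta> \<times> {-\<delta><..<\<delta>} \<subseteq> V'"
    using e A'(5) by (force simp: \<delta>_def dist_real_def subset_iff)
  have \<delta>: "0 < \<delta>" using e by (simp add: \<delta>_def)
  have subV: "ball l0 \<delta> \<times> {-\<delta><..<\<delta>} \<subseteq> V" using sub by (auto simp: V'_def)
  have feq: "f (l, x) = q (l, x) * quartic (P l) x" "(l, x) \<in> W" if "(l, x) \<in> V" for l x
  proof -
    have lx: "\<bar>x / \<eta>\<bar> < 1/4" "l \<in> U1" using Vx[OF that] by auto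
    have "F (l, x / \<eta>) = f (l, x)" using F1[of "x / \<eta>" l] lx \<eta> by simp
    then show "f (l, x) = q (l, x) * quartic (P l) x"
      using F\<phi>[OF lx(2,1)] \<eta> by (simp add: q_def P_quartic field_simps)
    have "l \<in> U" using \<phi>b(1)[OF lx(2)] \<epsilon>(2) by auto
    moreover have "\<bar>x / \<eta>\<bar> < 2" using lx(1) by linarith
    ultimately show "(l, x) \<in> W" using W[of l "x / \<eta>"] \<eta> by simp
  qed
  show ?thesis
  proof (rule that[OF \<delta>])
    show "ball l0 \<delta> \<times> {-\<delta><..<\<delta>} \<subseteq> W" using subV feq(2) by auto
    show "smooth_on (ball l0 \<delta>) P"
    proof (rule smooth_on_subset[OF smP])
      show "ball l0 \<delta> \<subseteq> U1"
      proof
        fix l assume "l \<in> ball l0 \<delta>"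
        then have "(l, 0) \<in> V" using subV \<delta> by auto
        then show "l \<in> U1" by (simp add: V_def)
      qed
    qed
    show "P l0 = 0" by (simp add: P_def \<phi>0 vec_eq_iff)
    show "smooth_on (ball l0 \<delta> \<times> {-\<delta><..<\<delta>}) q" using smq subV by (rule smooth_on_subset)
    show "q z \<noteq> 0" if "z \<in> ball l0 \<delta> \<times> {-\<delta><..<\<delta>}" for z using sub that by (auto simp: V'_def)
    show "f (l, x) = q (l, x) * quartic (P l) x" if "l \<in> ball l0 \<delta>" "\<bar>x\<bar> < \<delta>" for l x
    proof (rule feq(1))
      have "x \<in> {-\<delta><..<\<delta>}" using that(2) by auto
      then show "(l, x) \<in> V" using subV that(1) by blast
    qed
  qed
qed

text \<open>Multiplication by \<open>x ^ (4 - k)\<close> reduces the order \<open>k\<close> to the order \<open>4\<close>.\<close>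

theorem smooth_preparation:
  fixes f :: "'c::euclidean_space \<times> real \<Rightarrow> real"
  assumes "open W" "(l0, 0) \<in> W" "smooth_on W f" "k \<le> 4"
    and lim: "((\<lambda>x. f (l0, x) / x ^ k) \<longlongrightarrow> e0) (at 0)" and "e0 \<noteq> 0"
  obtains \<epsilon> P q where "0 < \<epsilon>" "ball l0 \<epsilon> \<times> {-\<epsilon><..<\<epsilon>} \<subseteq> W"
    "\<And>i. smooth_on (ball l0 \<epsilon>) (P i)" "\<And>i. P i l0 = (0::real)"
    "smooth_on (ball l0 \<epsilon> \<times> {-\<epsilon><..<\<epsilon>}) q" "\<And>z. z \<in> ball l0 \<epsilon> \<times> {-\<epsilon><..<\<epsilon>} \<Longrightarrow> q z \<noteq> 0"
    "\<And>l x. l \<in> ball l0 \<epsilon> \<Longrightarrow> \<bar>x\<bar> < \<epsilon> \<Longrightarrow> f (l, x) = q (l, x) * (x ^ k + (\<Sum>i<k. P i l * x ^ i))"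
proof -
  define m where "m = 4 - k"
  have km: "k + m = 4" using assms(4) by (simp add: m_def)
  define g where "g z = snd z ^ m * f z" for z
  have smg: "smooth_on W g"
    unfolding g_def using assms(1,3) by (intro smooth_on_mult smooth_on_power smooth_on_snd smooth_on_id)
  have limg: "((\<lambda>x. g (l0, x) / x ^ 4) \<longlongrightarrow> e0) (at 0)"
  proof (rule Lim_transform_eventually[OF lim])
    show "\<forall>\<^sub>F x in at 0. f (l0, x) / x ^ k = g (l0, x) / x ^ 4"
      using eventually_neq_0
      by eventually_elim (simp add: g_def power_add flip: km)
  qed
  obtain \<epsilon> P q where \<epsilon>: "0 < \<epsilon>" "ball l0 \<epsilon> \<times> {-\<epsilon><..<\<epsilon>} \<subseteq> W"
    and P: "smooth_on (ball l0 \<epsilon>) P" "P l0 = 0"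
    and q: "smooth_on (ball l0 \<epsilon> \<times> {-\<epsilon><..<\<epsilon>}) q" "\<And>z. z \<in> ball l0 \<epsilon> \<times> {-\<epsilon><..<\<epsilon>} \<Longrightarrow> q z \<noteq> 0"
    and eq: "\<And>l x. l \<in> ball l0 \<epsilon> \<Longrightarrow> \<bar>x\<bar> < \<epsilon> \<Longrightarrow> g (l, x) = q (l, x) * quartic (P l) x"
    using quartic_preparation[OF assms(1,2) smg limg assms(6)] by blast
  have oV: "open (ball l0 \<epsilon> \<times> {-\<epsilon><..<\<epsilon>})" by (auto intro: open_Times)
  \<comment> \<open>Division of \<open>x ^ m * f = q * quartic\<close> by \<open>q\<close> shows
    that the part of the quartic below degree \<open>m\<close> is O(x^m), hence zero. This is needed
    for every \<open>l\<close> in the ball, beyond \<open>l0\<close> itself.\<close>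
  have low: "P l $ of_nat j = 0" if l: "l \<in> ball l0 \<epsilon>" and j: "j < m" for l j
  proof (rule poly_small_eq_0[OF _ j])
    have c: "continuous_on (ball l0 \<epsilon> \<times> {-\<epsilon><..<\<epsilon>}) (\<lambda>z. f z / q z)"
      using q(2) smooth_on_imp_continuous_on[OF q(1)] smooth_on_imp_continuous_on[OF assms(3)] \<epsilon>(2)
      by (intro continuous_intros) (auto intro: continuous_on_subset)
    have "(l, 0) \<in> ball l0 \<epsilon> \<times> {-\<epsilon><..<\<epsilon>}" using l \<epsilon>(1) by auto
    with c oV have "isCont (\<lambda>z. f z / q z) (l, 0)" by (simp add: continuous_on_eq_continuous_at)
    then have "((\<lambda>x. f (l, x) / q (l, x)) \<longlongrightarrow> f (l, 0) / q (l, 0)) (at 0)"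
      by (rule isCont_tendsto_compose) (intro tendsto_intros)
    moreover define h where "h x = x ^ (4 - m) + (\<Sum>j<4 - m. P l $ of_nat (j + m) * x ^ j)" for x
    moreover have "(h \<longlongrightarrow> h 0) (at 0)" unfolding h_def by (intro tendsto_intros)
    ultimately have "((\<lambda>x. f (l, x) / q (l, x) - h x) \<longlongrightarrow> f (l, 0) / q (l, 0) - h 0) (at 0)"
      by (intro tendsto_diff)
    then have "\<forall>\<^sub>F x in at 0. \<bar>f (l, x) / q (l, x) - h x\<bar> < \<bar>f (l, 0) / q (l, 0) - h 0\<bar> + 1"
      by (intro order_tendstoD(2)[OF tendsto_rabs]) auto
    moreover have "\<forall>\<^sub>F x in at 0. \<bar>x\<bar> < \<epsilon>"
      using \<epsilon>(1) by (rule eventually_abs_less)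
    ultimately show "\<forall>\<^sub>F x in at 0. \<bar>\<Sum>j<m. P l $ of_nat j * x ^ j\<bar> \<le> (\<bar>f (l, 0) / q (l, 0) - h 0\<bar> + 1) * \<bar>x\<bar> ^ m"
    proof eventually_elim
      case (elim x)
      have sp: "(\<Sum>j<4. P l $ of_nat j * x ^ j) = (\<Sum>j<m. P l $ of_nat j * x ^ j) + x ^ m * (\<Sum>j<4 - m. P l $ of_nat (j + m) * x ^ j)"
      proof -
        have "{..<4} = {..<m} \<union> {m..<4}" "{..<m} \<inter> {m..<4} = {}" using km by auto
        then have "(\<Sum>j<4. P l $ of_nat j * x ^ j) = (\<Sum>j<m. P l $ of_nat j * x ^ j) + (\<Sum>j\<in>{m..<4}. P l $ of_nat j * x ^ j)"
          by (simp add: sum.union_disjoint)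
        also have "(\<Sum>j\<in>{m..<4}. P l $ of_nat j * x ^ j) = (\<Sum>j<4 - m. P l $ of_nat (j + m) * x ^ (j + m))"
          using sum.shift_bounds_nat_ivl[of "\<lambda>j. P l $ of_nat j * x ^ j" 0 m "4 - m"] km
          by (simp add: atLeast0LessThan)
        finally show ?thesis by (simp add: sum_distrib_left power_add mult_ac)
      qed
      have "x \<in> {-\<epsilon><..<\<epsilon>}" using elim(2) by auto
      then have qz: "q (l, x) \<noteq> 0" using q(2)[of "(l, x)"] l by blast
      have "x ^ m * (f (l, x) / q (l, x)) = x ^ 4 + (\<Sum>j<4. P l $ of_nat j * x ^ j)"
        using eq[OF l elim(2)] qz by (simp add: g_def quartic_sum field_simps)
      also have "x ^ 4 = x ^ m * x ^ (4 - m)" using km by (simp flip: power_add)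
      finally have "(\<Sum>j<m. P l $ of_nat j * x ^ j) = x ^ m * (f (l, x) / q (l, x) - h x)"
        unfolding sp h_def by (simp add: algebra_simps)
      then have "\<bar>\<Sum>j<m. P l $ of_nat j * x ^ j\<bar> = \<bar>f (l, x) / q (l, x) - h x\<bar> * \<bar>x\<bar> ^ m"
        by (simp add: abs_mult power_abs)
      then show ?case using elim(1) by (simp add: mult_right_mono)
    qed
  qed
  define P' where "P' i l = P l $ of_nat (i + m)" for i l
  have eq0: "f (l, x) = q (l, x) * (x ^ k + (\<Sum>i<k. P' i l * x ^ i))"
    if l: "l \<in> ball l0 \<epsilon>" and x: "\<bar>x\<bar> < \<epsilon>" "x \<noteq> 0" for l x
  proof -
    have "{..<4} = {..<m} \<union> {m..<4}" "{..<m} \<inter> {m..<4} = {}" using km by auto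
    then have "(\<Sum>j<4. P l $ of_nat j * x ^ j) = (\<Sum>j<m. P l $ of_nat j * x ^ j) + (\<Sum>j\<in>{m..<4}. P l $ of_nat j * x ^ j)"
      by (simp add: sum.union_disjoint)
    also have "(\<Sum>j\<in>{m..<4}. P l $ of_nat j * x ^ j) = (\<Sum>j<k. P l $ of_nat (j + m) * x ^ (j + m))"
      using sum.shift_bounds_nat_ivl[of "\<lambda>j. P l $ of_nat j * x ^ j" 0 m k] km
      by (simp add: atLeast0LessThan)
    also have "(\<Sum>j<m. P l $ of_nat j * x ^ j) = 0" using low[OF l] by simp
    finally have "quartic (P l) x = x ^ m * (x ^ k + (\<Sum>i<k. P' i l * x ^ i))"
      by (simp add: quartic_sum P'_def sum_distrib_left power_add algebra_simps flip: km)
    then show ?thesis using eq[OF l x(1)] x(2) by (simp add: g_def)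
  qed
  show ?thesis
  proof (rule that[OF \<epsilon> _ _ q])
    show "smooth_on (ball l0 \<epsilon>) (P' i)" for i unfolding P'_def by (intro smooth_on_vec_nth P open_ball)
    show "P' i l0 = 0" for i by (simp add: P'_def P(2))
    fix l x assume l: "l \<in> ball l0 \<epsilon>" and x: "\<bar>x\<bar> < \<epsilon>"
    define d where "d x = f (l, x) - q (l, x) * (x ^ k + (\<Sum>i<k. P' i l * x ^ i))" for x
    have "d x = 0"
    proof (cases "x = 0")
      \<comment> \<open>The identity for \<open>x\<close> different from 0 was obtained by
        cancelling \<open>x ^ m\<close>; at 0 it follows by continuity.\<close>
      case True
      have m: "(l, 0) \<in> ball l0 \<epsilon> \<times> {-\<epsilon><..<\<epsilon>}" using l \<epsilon>(1) by auto
      have c: "isCont f (l, 0)" "isCont q (l, 0)"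
        using m subsetD[OF \<epsilon>(2) m] smooth_on_imp_continuous_on[OF q(1)] smooth_on_imp_continuous_on[OF assms(3)]
        unfolding continuous_on_eq_continuous_at[OF oV] continuous_on_eq_continuous_at[OF assms(1)] by blast+
      have "((\<lambda>x. f (l, x)) \<longlongrightarrow> f (l, 0)) (at 0)" "((\<lambda>x. q (l, x)) \<longlongrightarrow> q (l, 0)) (at 0)"
        by (rule isCont_tendsto_compose[OF c(1)], intro tendsto_intros)
          (rule isCont_tendsto_compose[OF c(2)], intro tendsto_intros)
      then have "(d \<longlongrightarrow> d 0) (at 0)" unfolding d_def by (intro tendsto_intros)
      moreover have "(d \<longlongrightarrow> 0) (at 0)"
      proof (rule Lim_transform_eventually[OF tendsto_const])
        have "\<forall>\<^sub>F x in at 0. \<bar>x\<bar> < \<epsilon>"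
          using \<epsilon>(1) by (rule eventually_abs_less)
        then show "\<forall>\<^sub>F x in at 0. 0 = d x"
          using eventually_neq_0 by eventually_elim (simp add: d_def eq0[OF l])
      qed
      ultimately show ?thesis using True tendsto_unique[OF at_neq_bot] by blast
    qed (use eq0[OF l x] in \<open>simp add: d_def\<close>)
    then show "f (l, x) = q (l, x) * (x ^ k + (\<Sum>i<k. P' i l * x ^ i))" by (simp add: d_def)
  qed
qed

section \<open>Versal deformations\<close>

text \<open>Take Hadamard quotients until one of them does not vanish at 0. A smooth function may be
  flat, so the process is stopped at a prescribed \<open>n\<close>.\<close>

lemma smooth_order_dichotomy:
  fixes u :: "real \<Rightarrow> real"
  assumes "open S" "convex S" "0 \<in> S" "smooth_on S u"
  shows "(\<exists>v. smooth_on S v \<and> (\<forall>y\<in>S. u y = y ^ n * v y)) \<or>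
    (\<exists>k<n. \<exists>v. smooth_on S v \<and> (\<forall>y\<in>S. u y = y ^ k * v y) \<and> v 0 \<noteq> 0)"
proof (induction n)
  case 0
  show ?case using assms(4) by auto
next
  case (Suc n)
  show ?case
  proof (cases "\<exists>k<n. \<exists>v. smooth_on S v \<and> (\<forall>y\<in>S. u y = y ^ k * v y) \<and> v 0 \<noteq> 0")
    case True
    then show ?thesis using less_SucI by blast
  next
    case False
    with Suc obtain v where v: "smooth_on S v" "\<And>y. y \<in> S \<Longrightarrow> u y = y ^ n * v y" by blast
    show ?thesis
    proof (cases "v 0 = 0")
      case True
      obtain k where k: "smooth_on S k" "\<And>y. y \<in> S \<Longrightarrow> v y - v 0 = (y - 0) *\<^sub>R k y"
        by (rule Hadamard_quotient[OF assms(1-3) v(1)]) simp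
      have "\<forall>y\<in>S. u y = y ^ Suc n * k y"
        using v(2) k(2) True by (auto simp: mult_ac)
      then show ?thesis using k(1) by blast
    next
      case False
      then show ?thesis using v by blast
    qed
  qed
qed

lemma real_deriv_bigO:
  fixes v :: "real \<Rightarrow> real"
  assumes "open S" "0 \<in> S" "smooth_on S v"
  shows "\<exists>C. \<forall>\<^sub>F y in at 0. \<bar>v y\<bar> \<le> C"
proof -
  have "isCont v 0"
    using smooth_on_imp_continuous_on[OF assms(3)] assms(1,2) by (simp add: continuous_on_eq_continuous_at)
  then have "(v \<longlongrightarrow> v 0) (at 0)" by (simp add: isCont_def)
  then have "\<forall>\<^sub>F y in at 0. \<bar>v y\<bar> < \<bar>v 0\<bar> + 1"
    by (intro order_tendstoD(2)[OF tendsto_rabs]) auto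
  then show ?thesis by (auto intro!: exI[of _ "\<bar>v 0\<bar> + 1"] elim!: eventually_mono)
qed

text \<open>The derivative \<open>d\<close> comes in some other form than the product rule produces.
  Comparison of the two forms shows that it vanishes to one order less than
  \<open>h\<close>.\<close>

lemma DERIV_power_mult_bigO:
  fixes a v h :: "real \<Rightarrow> real"
  assumes S: "open S" "0 \<in> S" and sm: "smooth_on S a" "smooth_on S v"
    and h: "\<And>y. y \<in> S \<Longrightarrow> h y = y ^ Suc k * v y"
    and d: "\<And>y. y \<in> S \<Longrightarrow> ((\<lambda>y. a y * h y) has_real_derivative d y) (at y)"
  shows "\<exists>C. \<forall>\<^sub>F y in at 0. \<bar>d y\<bar> \<le> C * \<bar>y\<bar> ^ k"
proof -
  define w where "w y = a y * v y" for y
  have smw: "smooth_on S w" unfolding w_def by (intro smooth_on_mult S sm)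
  define w' where "w' y = frechet_derivative w (at y) 1" for y
  have w': "smooth_on S w'" "\<And>y. y \<in> S \<Longrightarrow> (w has_real_derivative w' y) (at y)"
    using smooth_on_vector_derivative[OF S(1) smw]
    by (simp_all add: w'_def[abs_def] has_real_derivative_iff_has_vector_derivative)
  define g where "g y = (1 + real k) * w y + y * w' y" for y
  have "smooth_on S g"
    unfolding g_def by (intro smooth_on_add smooth_on_mult smooth_on_const smooth_on_id S smw w'(1))
  then obtain C where C: "\<forall>\<^sub>F y in at 0. \<bar>g y\<bar> \<le> C" using real_deriv_bigO[OF S] by blast
  have "d y = y ^ k * g y" if y: "y \<in> S" for y
  proof -
    have "((\<lambda>y. y ^ Suc k * w y) has_real_derivative (y ^ k * g y)) (at y)"
      by (rule DERIV_cong[OF DERIV_mult[OF DERIV_power[OF DERIV_ident] w'(2)[OF y]]])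
        (simp add: g_def algebra_simps)
    then have "((\<lambda>y. a y * h y) has_real_derivative (y ^ k * g y)) (at y)"
      by (rule has_field_derivative_transform_within_open[OF _ S(1) y]) (simp add: h w_def mult_ac)
    then show ?thesis using d[OF y] DERIV_unique by blast
  qed
  moreover have "\<forall>\<^sub>F y in at 0. y \<in> S" using S eventually_at_in_open' by blast
  ultimately have "\<forall>\<^sub>F y in at 0. d y = y ^ k * g y" by (auto elim!: eventually_mono)
  with C have "\<forall>\<^sub>F y in at 0. \<bar>d y\<bar> \<le> C * \<bar>y\<bar> ^ k"
  proof eventually_elim
    case (elim y)
    then show ?case by (simp add: abs_mult power_abs mult.commute mult_right_mono)
  qed
  then show ?thesis by blast
qed

text \<open>The dimension of the ambient space enters here and bounds the order of
  \<open>h\<close>.\<close>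

lemma dependent_family4:
  fixes d :: "nat \<Rightarrow> real^3"
  obtains c :: "real^4" where "c \<noteq> 0" "(\<Sum>j<4. c $ of_nat j *\<^sub>R d j) = 0"
proof -
  define f where "f c = (\<Sum>j<4. c $ of_nat j *\<^sub>R d j)" for c :: "real^4"
  have lin: "linear f"
    unfolding f_def by (rule linearI) (simp_all add: algebra_simps sum.distrib scaleR_sum_right)
  have "\<not> inj f"
  proof
    assume "inj f"
    then have "dim (f ` UNIV) = dim (UNIV :: (real^4) set)"
      by (intro dim_image_eq lin) simp
    moreover have "dim (f ` UNIV) \<le> DIM(real^3)" by (rule dim_subset_UNIV)
    ultimately show False by simp
  qed
  then show ?thesis using that lin by (auto simp: linear_injective_0 f_def)
qed

text \<open>The hypothesis \<open>vers\<close> is the derivative along the curve \<open>g = 0\<close> of the versality condition, applied to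
  \<open>(s - s0) ^ i\<close>; it forces the order of \<open>h (x, _)\<close> to be at most \<open>4\<close> and the coefficients of the
  prepared polynomial to have independent differentials.\<close>

theorem versal_preparation:
  fixes h :: "(real^3) \<times> real \<Rightarrow> real"
  assumes W: "open W" "(x, 0) \<in> W" "smooth_on W h"
    and S: "open S" "convex S" "0 \<in> S" "\<And>y. y \<in> S \<Longrightarrow> (x, y) \<in> W"
    and h0: "h (x, 0) = 0" "frechet_derivative h (at (x, 0)) (0, 1) = 0"
    and a: "\<And>i. smooth_on S (a i)"
    and vers: "\<And>i y. 1 \<le> i \<Longrightarrow> i \<le> 4 \<Longrightarrow> y \<in> S \<Longrightarrow> ((\<lambda>y. a i y * h (x, y)) has_real_derivative
       (real i * y ^ (i - 1) + frechet_derivative h (at (x, y)) (d i, 0))) (at y)"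
  obtains k \<epsilon> P q \<omega> where "2 \<le> k" "k \<le> 4" "0 < \<epsilon>" "ball x \<epsilon> \<times> {-\<epsilon><..<\<epsilon>} \<subseteq> W"
    "\<And>i. smooth_on (ball x \<epsilon>) (P i)" "\<And>i. P i x = (0::real)"
    "smooth_on (ball x \<epsilon> \<times> {-\<epsilon><..<\<epsilon>}) q" "\<And>z. z \<in> ball x \<epsilon> \<times> {-\<epsilon><..<\<epsilon>} \<Longrightarrow> q z \<noteq> 0"
    "\<And>l y. l \<in> ball x \<epsilon> \<Longrightarrow> \<bar>y\<bar> < \<epsilon> \<Longrightarrow> h (l, y) = q (l, y) * (y ^ k + (\<Sum>i<k. P i l * y ^ i))"
    "\<And>i. (P i has_derivative \<omega> i) (at x)"
    "\<And>i. i + 1 < k \<Longrightarrow> \<omega> i (d (i + 1)) \<noteq> 0" "\<And>i j. i + 1 < k \<Longrightarrow> j < i \<Longrightarrow> \<omega> j (d (i + 1)) = 0"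
proof -
  define u where "u y = h (x, y)" for y
  have smu: "smooth_on S u"
    unfolding u_def by (rule smooth_on_compose[OF W(3) S(1) W(1)])
      (auto intro!: smooth_on_Pair smooth_on_id S)
  have linh: "linear (frechet_derivative h (at (x, y)))" if "y \<in> S" for y
    using has_derivative_linear[OF smooth_on_has_derivative[OF W(3) S(4)[OF that]]] .
  \<comment> \<open>If \<open>u\<close> is divisible by y^5, a linear relation between
    \<open>d 1\<close> to \<open>d 4\<close> eliminates the derivatives of \<open>h\<close> in
    \<open>l\<close>. The derivative of \<open>A u\<close> is then a polynomial of degree at most 3
    that is also O(y^4), so the relation is trivial.\<close>
  have no5: False if v: "smooth_on S v" "\<And>y. y \<in> S \<Longrightarrow> u y = y ^ 5 * v y" for v
  proof -
    obtain c :: "real^4" where c: "c \<noteq> 0" "(\<Sum>j<4. c $ of_nat j *\<^sub>R d (Suc j)) = 0"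
      by (rule dependent_family4)
    define A where "A y = (\<Sum>j<4. c $ of_nat j * a (Suc j) y)" for y
    have smA: "smooth_on S A" unfolding A_def by (intro smooth_on_sum smooth_on_mult S a smooth_on_const)
    have "((\<lambda>y. A y * u y) has_real_derivative (\<Sum>j<4. (c $ of_nat j * real (Suc j)) * y ^ j)) (at y)" if y: "y \<in> S" for y
    proof -
      have "((\<lambda>y. \<Sum>j<4. c $ of_nat j * (a (Suc j) y * u y)) has_real_derivative
          (\<Sum>j<4. c $ of_nat j * (real (Suc j) * y ^ (Suc j - 1) + frechet_derivative h (at (x, y)) (d (Suc j), 0)))) (at y)"
        unfolding u_def by (intro DERIV_sum DERIV_cmult vers y) auto
      moreover have "(\<Sum>j<4. c $ of_nat j * frechet_derivative h (at (x, y)) (d (Suc j), 0)) = 0"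
      proof -
        have "(\<Sum>j<4. c $ of_nat j * frechet_derivative h (at (x, y)) (d (Suc j), 0)) =
            frechet_derivative h (at (x, y)) (\<Sum>j<4. c $ of_nat j *\<^sub>R (d (Suc j), 0))"
          by (simp only: linear_sum[OF linh[OF y]] linear_scale[OF linh[OF y]] real_scaleR_def)
        also have "(\<Sum>j<4. c $ of_nat j *\<^sub>R (d (Suc j), 0::real)) = (\<Sum>j<4. c $ of_nat j *\<^sub>R d (Suc j), 0)"
          by (simp add: sum_prod)
        finally show ?thesis using linear_0[OF linh[OF y]] c(2) by (simp add: zero_prod_def)
      qed
      moreover from this have "(\<Sum>j<4. c $ of_nat j * (real (Suc j) * y ^ (Suc j - 1) + frechet_derivative h (at (x, y)) (d (Suc j), 0))) =
          (\<Sum>j<4. (c $ of_nat j * real (Suc j)) * y ^ j)"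
        by (simp only: distrib_left sum.distrib diff_Suc_1 mult.assoc add_0_right)
      moreover have "(\<lambda>y. A y * u y) = (\<lambda>y. \<Sum>j<4. c $ of_nat j * (a (Suc j) y * u y))"
        by (simp only: A_def sum_distrib_right mult.assoc)
      ultimately show ?thesis by simp
    qed
    from DERIV_power_mult_bigO[where k = 4, OF S(1,3) smA v(1) _ this]
    obtain C where "\<forall>\<^sub>F y in at 0. \<bar>\<Sum>j<4. (c $ of_nat j * real (Suc j)) * y ^ j\<bar> \<le> C * \<bar>y\<bar> ^ 4"
      using v(2) by auto
    from poly_small_eq_0[OF this] have "c $ of_nat j = 0" if "j < 4" for j using that by fastforce
    then have "c $ j = 0" for j using nat_of_index(2,3)[of j] by metis
    then show False using c(1) by (simp add: vec_eq_iff)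
  qed
  obtain k v where k: "k < 5" "smooth_on S v" "\<And>y. y \<in> S \<Longrightarrow> u y = y ^ k * v y" "v 0 \<noteq> 0"
    using smooth_order_dichotomy[OF S(1-3) smu, of 5] no5 by blast
  have du: "(u has_real_derivative 0) (at 0)"
    using has_vector_derivative_slice_snd[OF smooth_on_has_derivative[OF W(3,2)]] h0(2)
    by (simp add: u_def[abs_def] has_real_derivative_iff_has_vector_derivative)
  have k2: "2 \<le> k"
  proof (rule ccontr)
    assume "\<not> 2 \<le> k"
    then consider "k = 0" | "k = 1" by linarith
    then show False
    proof cases
      case 1
      then show False using k(3)[OF S(3)] k(4) h0(1) by (simp add: u_def)
    next
      case 2
      have v': "(v has_real_derivative frechet_derivative v (at 0) 1) (at 0)"
        using smooth_on_vector_derivative(2)[OF S(1) k(2) S(3)] by (simp add: has_real_derivative_iff_has_vector_derivative)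
      have "((\<lambda>y. y * v y) has_real_derivative v 0) (at 0)"
        by (rule DERIV_cong[OF DERIV_mult[OF DERIV_ident v']]) simp
      then have "(u has_real_derivative v 0) (at 0)"
        by (rule has_field_derivative_transform_within_open[OF _ S(1,3)]) (simp add: k(3) 2)
      then show False using du k(4) DERIV_unique by blast
    qed
  qed
  have evS: "\<forall>\<^sub>F y in at 0. y \<in> S" using S eventually_at_in_open' by blast
  have lim: "((\<lambda>y. h (x, y) / y ^ k) \<longlongrightarrow> v 0) (at 0)"
  proof (rule Lim_transform_eventually)
    have "isCont v 0"
      using smooth_on_imp_continuous_on[OF k(2)] S by (simp add: continuous_on_eq_continuous_at)
    then show "(v \<longlongrightarrow> v 0) (at 0)" by (simp add: isCont_def)
    show "\<forall>\<^sub>F y in at 0. v y = h (x, y) / y ^ k"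
      using evS eventually_neq_0 by eventually_elim (use k(3) in \<open>simp add: u_def\<close>)
  qed
  obtain \<epsilon> P q where \<epsilon>: "0 < \<epsilon>" "ball x \<epsilon> \<times> {-\<epsilon><..<\<epsilon>} \<subseteq> W"
    and P: "\<And>i. smooth_on (ball x \<epsilon>) (P i)" "\<And>i. P i x = (0::real)"
    and q: "smooth_on (ball x \<epsilon> \<times> {-\<epsilon><..<\<epsilon>}) q" "\<And>z. z \<in> ball x \<epsilon> \<times> {-\<epsilon><..<\<epsilon>} \<Longrightarrow> q z \<noteq> 0"
    and eq: "\<And>l y. l \<in> ball x \<epsilon> \<Longrightarrow> \<bar>y\<bar> < \<epsilon> \<Longrightarrow> h (l, y) = q (l, y) * (y ^ k + (\<Sum>i<k. P i l * y ^ i))"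
    using smooth_preparation[OF W(1,2,3) _ lim k(4)] k(1) by auto
  have xb: "x \<in> ball x \<epsilon>" using \<epsilon> by simp
  have oV: "open (ball x \<epsilon> \<times> {-\<epsilon><..<\<epsilon>})" by (auto intro: open_Times)
  define \<omega> where "\<omega> i = frechet_derivative (P i) (at x)" for i
  have \<omega>: "(P i has_derivative \<omega> i) (at x)" for i
    unfolding \<omega>_def by (rule smooth_on_has_derivative[OF P(1) xb])
  have evE: "\<forall>\<^sub>F y in at 0. \<bar>y\<bar> < \<epsilon>" using \<epsilon>(1) by (rule eventually_abs_less)
  define q' where "q' v y = frechet_derivative q (at (x, y)) (v, 0)" for v y
  \<comment> \<open>The prepared form differentiated in \<open>l\<close> at \<open>x\<close>, where
    every \<open>P i\<close> vanishes.\<close>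
  have qder: "frechet_derivative h (at (x, y)) (v, 0) = q' v y * y ^ k + q (x, y) * (\<Sum>i<k. \<omega> i v * y ^ i)"
    if y: "\<bar>y\<bar> < \<epsilon>" for v y
  proof -
    have m: "(x, y) \<in> ball x \<epsilon> \<times> {-\<epsilon><..<\<epsilon>}" using y xb by auto
    have "((\<lambda>l. q (l, y)) has_derivative (\<lambda>v. q' v y)) (at x)"
      unfolding q'_def by (rule has_derivative_slice[OF smooth_on_has_derivative[OF q(1) m]])
    moreover have "((\<lambda>l. y ^ k + (\<Sum>i<k. P i l * y ^ i)) has_derivative (\<lambda>v. 0 + (\<Sum>i<k. \<omega> i v * y ^ i))) (at x)"
      by (intro has_derivative_add has_derivative_const has_derivative_sum has_derivative_mult_left \<omega>)
    ultimately have "((\<lambda>l. q (l, y) * (y ^ k + (\<Sum>i<k. P i l * y ^ i))) has_derivative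
       (\<lambda>v. q (x, y) * (0 + (\<Sum>i<k. \<omega> i v * y ^ i)) + q' v y * (y ^ k + (\<Sum>i<k. P i x * y ^ i)))) (at x)"
      by (rule has_derivative_mult)
    then have "((\<lambda>l. h (l, y)) has_derivative
       (\<lambda>v. q (x, y) * (0 + (\<Sum>i<k. \<omega> i v * y ^ i)) + q' v y * (y ^ k + (\<Sum>i<k. P i x * y ^ i)))) (at x)"
      by (rule has_derivative_transform_within_open[OF _ open_ball xb]) (simp add: eq y)
    moreover have "((\<lambda>l. h (l, y)) has_derivative (\<lambda>v. frechet_derivative h (at (x, y)) (v, 0))) (at x)"
      by (rule has_derivative_slice[OF smooth_on_has_derivative[OF W(3)]]) (use m \<epsilon>(2) in blast)
    ultimately have "(\<lambda>v. frechet_derivative h (at (x, y)) (v, 0)) =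
       (\<lambda>v. q (x, y) * (0 + (\<Sum>i<k. \<omega> i v * y ^ i)) + q' v y * (y ^ k + (\<Sum>i<k. P i x * y ^ i)))"
      using has_derivative_unique by blast
    from fun_cong[OF this, of v] show ?thesis by (simp add: P(2))
  qed
  have limq: "((\<lambda>y. q (x, y)) \<longlongrightarrow> q (x, 0)) (at 0)" and bdq': "\<exists>C. \<forall>\<^sub>F y in at 0. \<bar>q' v y\<bar> \<le> C" for v
  proof -
    have m: "(x, 0) \<in> ball x \<epsilon> \<times> {-\<epsilon><..<\<epsilon>}" using xb \<epsilon>(1) by auto
    have "isCont q (x, 0)" "isCont (\<lambda>z. frechet_derivative q (at z) (v, 0)) (x, 0)"
      using smooth_on_imp_continuous_on[OF q(1)] smooth_on_imp_continuous_on[OF smooth_on_frechet_derivative[OF q(1)]] m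
      unfolding continuous_on_eq_continuous_at[OF oV] by blast+
    note c = this
    show "((\<lambda>y. q (x, y)) \<longlongrightarrow> q (x, 0)) (at 0)"
      by (rule isCont_tendsto_compose[OF c(1)]) (intro tendsto_intros)
    have "((\<lambda>y. q' v y) \<longlongrightarrow> q' v 0) (at 0)"
      unfolding q'_def by (rule isCont_tendsto_compose[OF c(2)]) (intro tendsto_intros)
    then have "\<forall>\<^sub>F y in at 0. \<bar>q' v y\<bar> < \<bar>q' v 0\<bar> + 1"
      by (intro order_tendstoD(2)[OF tendsto_rabs]) auto
    then show "\<exists>C. \<forall>\<^sub>F y in at 0. \<bar>q' v y\<bar> \<le> C"
      by (auto intro!: exI[of _ "\<bar>q' v 0\<bar> + 1"] elim!: eventually_mono)
  qed
  have qx0: "q (x, 0) \<noteq> 0" using q(2)[of "(x, 0)"] xb \<epsilon>(1) by auto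
  \<comment> \<open>\<open>K = k - 1\<close> is the precision of the comparison: by
    \<open>vers\<close> the derivative of a function vanishing to order \<open>k\<close> is at hand.
    The differential of \<open>P K\<close> is lost in the error term.\<close>
  obtain K where K: "k = Suc K" using k2 by (cases k) auto
  \<comment> \<open>Divide the differentiated versality condition by \<open>q\<close>: up to O(y^K),
    the differentials of the \<open>P j\<close> along \<open>d i\<close> are the coefficients of - i
    y^(i-1) / q.\<close>
  have key: "\<exists>C. \<forall>\<^sub>F y in at 0. \<bar>(\<Sum>j<K. \<omega> j (d i) * y ^ j) + real i * y ^ (i - 1) / q (x, y)\<bar> \<le> C * \<bar>y\<bar> ^ K"
    if i: "1 \<le> i" "i \<le> 4" for i
  proof -
    define D where "D y = real i * y ^ (i - 1) + frechet_derivative h (at (x, y)) (d i, 0)" for y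
    have "\<exists>C. \<forall>\<^sub>F y in at 0. \<bar>D y\<bar> \<le> C * \<bar>y\<bar> ^ K"
    proof (rule DERIV_power_mult_bigO[OF S(1,3) a k(2)])
      show "u y = y ^ Suc K * v y" if "y \<in> S" for y using k(3)[OF that] by (simp add: K)
      show "((\<lambda>y. a i y * u y) has_real_derivative D y) (at y)" if "y \<in> S" for y
        unfolding u_def D_def by (rule vers[OF i that])
    qed
    then obtain C1 where C1: "\<forall>\<^sub>F y in at 0. \<bar>D y\<bar> \<le> C1 * \<bar>y\<bar> ^ K" by blast
    obtain C2 where C2: "\<forall>\<^sub>F y in at 0. \<bar>q' (d i) y\<bar> \<le> C2" using bdq' by blast
    define b where "b = \<bar>q (x, 0)\<bar> / 2"
    have b: "0 < b" using qx0 by (simp add: b_def)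
    have "\<forall>\<^sub>F y in at 0. b < \<bar>q (x, y)\<bar>"
      using qx0 by (intro order_tendstoD(1)[OF tendsto_rabs[OF limq]]) (simp add: b_def)
    moreover have "\<forall>\<^sub>F y in at 0. \<bar>y\<bar> < (1::real)" by (rule eventually_abs_less) simp
    ultimately have "\<forall>\<^sub>F y in at 0. \<bar>(\<Sum>j<K. \<omega> j (d i) * y ^ j) + real i * y ^ (i - 1) / q (x, y)\<bar> \<le>
        ((C1 + \<bar>C2\<bar>) / b + \<bar>\<omega> K (d i)\<bar>) * \<bar>y\<bar> ^ K"
      using C1 C2 evE
    proof eventually_elim
      case (elim y)
      define E where "E = (\<Sum>j<K. \<omega> j (d i) * y ^ j) + real i * y ^ (i - 1) / q (x, y)"
      have qn: "q (x, y) \<noteq> 0" using elim(1) b by auto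
      have "D y = q (x, y) * E + q' (d i) y * y ^ Suc K + q (x, y) * (\<omega> K (d i) * y ^ K)"
        unfolding D_def qder[OF elim(5)] using qn by (simp add: K E_def field_simps)
      then have e: "q (x, y) * E = D y - q' (d i) y * y ^ Suc K - q (x, y) * (\<omega> K (d i) * y ^ K)" by simp
      have yK: "\<bar>y ^ Suc K\<bar> \<le> \<bar>y\<bar> ^ K"
        using elim(2) mult_right_mono[of "\<bar>y\<bar>" 1 "\<bar>y\<bar> ^ K"] by (simp add: abs_mult power_abs)
      have "\<bar>q' (d i) y * y ^ Suc K\<bar> \<le> \<bar>C2\<bar> * \<bar>y\<bar> ^ K"
        unfolding abs_mult using elim(4) yK by (intro mult_mono) auto
      moreover have "\<bar>q (x, y) * (\<omega> K (d i) * y ^ K)\<bar> = \<bar>q (x, y)\<bar> * (\<bar>\<omega> K (d i)\<bar> * \<bar>y\<bar> ^ K)"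
        by (simp add: abs_mult power_abs)
      ultimately have "\<bar>q (x, y)\<bar> * \<bar>E\<bar> \<le> (C1 + \<bar>C2\<bar>) * \<bar>y\<bar> ^ K + \<bar>q (x, y)\<bar> * (\<bar>\<omega> K (d i)\<bar> * \<bar>y\<bar> ^ K)"
        unfolding abs_mult[symmetric] e using elim(3) by (simp only: distrib_right) linarith
      then have "\<bar>q (x, y)\<bar> * (\<bar>E\<bar> - \<bar>\<omega> K (d i)\<bar> * \<bar>y\<bar> ^ K) \<le> (C1 + \<bar>C2\<bar>) * \<bar>y\<bar> ^ K"
        by (simp add: right_diff_distrib)
      moreover have "b * (\<bar>E\<bar> - \<bar>\<omega> K (d i)\<bar> * \<bar>y\<bar> ^ K) \<le> \<bar>q (x, y)\<bar> * (\<bar>E\<bar> - \<bar>\<omega> K (d i)\<bar> * \<bar>y\<bar> ^ K)"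
        if "0 \<le> \<bar>E\<bar> - \<bar>\<omega> K (d i)\<bar> * \<bar>y\<bar> ^ K"
        using that elim(1) by (intro mult_right_mono) auto
      moreover have "0 \<le> (C1 + \<bar>C2\<bar>) * \<bar>y\<bar> ^ K"
      proof -
        have "0 \<le> C1 * \<bar>y\<bar> ^ K" using elim(3) by linarith
        then show ?thesis by (simp add: distrib_right)
      qed
      ultimately have "b * (\<bar>E\<bar> - \<bar>\<omega> K (d i)\<bar> * \<bar>y\<bar> ^ K) \<le> (C1 + \<bar>C2\<bar>) * \<bar>y\<bar> ^ K"
        using b mult_nonneg_nonpos[of b "\<bar>E\<bar> - \<bar>\<omega> K (d i)\<bar> * \<bar>y\<bar> ^ K"] by linarith
      then have "\<bar>E\<bar> - \<bar>\<omega> K (d i)\<bar> * \<bar>y\<bar> ^ K \<le> (C1 + \<bar>C2\<bar>) * \<bar>y\<bar> ^ K / b"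
        using b by (simp add: pos_le_divide_eq mult.commute)
      then show ?case by (simp add: E_def distrib_right add_divide_distrib)
    qed
    then show ?thesis by blast
  qed
  \<comment> \<open>The term (i + 1) y^i / q contributes nothing below degree \<open>i\<close>, so
    the coefficients there vanish.\<close>
  have tri0: "\<omega> j (d (i + 1)) = 0" if i: "i + 1 < k" and j: "j < i" for i j
  proof -
    have i4: "1 \<le> i + 1" "i + 1 \<le> 4" "i < K" using i k(1) K by auto
    from key[OF i4(1,2)] obtain C where C: "\<forall>\<^sub>F y in at 0.
        \<bar>(\<Sum>j<K. \<omega> j (d (i + 1)) * y ^ j) + real (i + 1) * y ^ i / q (x, y)\<bar> \<le> C * \<bar>y\<bar> ^ K" by auto
    have "((\<lambda>y. \<bar>real (i + 1) / q (x, y)\<bar> + (\<Sum>j\<in>{i..<K}. \<bar>\<omega> j (d (i + 1))\<bar> * \<bar>y\<bar> ^ (j - i)) + C * \<bar>y\<bar> ^ (K - i)) \<longlongrightarrow>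
        (\<bar>real (i + 1) / q (x, 0)\<bar> + (\<Sum>j\<in>{i..<K}. \<bar>\<omega> j (d (i + 1))\<bar> * \<bar>0\<bar> ^ (j - i)) + C * \<bar>0\<bar> ^ (K - i))) (at 0)"
      using qx0 by (intro tendsto_intros limq)
    then obtain B where B: "\<forall>\<^sub>F y in at 0.
        \<bar>real (i + 1) / q (x, y)\<bar> + (\<Sum>j\<in>{i..<K}. \<bar>\<omega> j (d (i + 1))\<bar> * \<bar>y\<bar> ^ (j - i)) + C * \<bar>y\<bar> ^ (K - i) < B"
      using order_tendstoD(2) less_add_one by blast
    have "\<forall>\<^sub>F y in at 0. \<bar>\<Sum>j<i. \<omega> j (d (i + 1)) * y ^ j\<bar> \<le> B * \<bar>y\<bar> ^ i"
      using C B
    proof eventually_elim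
      case (elim y)
      define T where "T = (\<Sum>j\<in>{i..<K}. \<bar>\<omega> j (d (i + 1))\<bar> * \<bar>y\<bar> ^ (j - i))"
      have "{..<K} = {..<i} \<union> {i..<K}" "{..<i} \<inter> {i..<K} = {}" using i4 by auto
      then have sp: "(\<Sum>j<K. \<omega> j (d (i + 1)) * y ^ j) = (\<Sum>j<i. \<omega> j (d (i + 1)) * y ^ j) + (\<Sum>j\<in>{i..<K}. \<omega> j (d (i + 1)) * y ^ j)"
        by (simp add: sum.union_disjoint)
      have "\<bar>\<Sum>j\<in>{i..<K}. \<omega> j (d (i + 1)) * y ^ j\<bar> \<le> (\<Sum>j\<in>{i..<K}. \<bar>\<omega> j (d (i + 1)) * y ^ j\<bar>)" by (rule sum_abs)
      also have "\<dots> = T * \<bar>y\<bar> ^ i"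
        unfolding T_def sum_distrib_right
        by (intro sum.cong) (auto simp: abs_mult power_abs mult.assoc simp flip: power_add)
      finally have 1: "\<bar>\<Sum>j\<in>{i..<K}. \<omega> j (d (i + 1)) * y ^ j\<bar> \<le> T * \<bar>y\<bar> ^ i" .
      have 2: "\<bar>real (i + 1) * y ^ i / q (x, y)\<bar> = \<bar>real (i + 1) / q (x, y)\<bar> * \<bar>y\<bar> ^ i"
        by (simp add: abs_mult power_abs)
      have "\<bar>y\<bar> ^ K = \<bar>y\<bar> ^ (K - i) * \<bar>y\<bar> ^ i" using i4 by (simp flip: power_add)
      then have 3: "\<bar>(\<Sum>j<K. \<omega> j (d (i + 1)) * y ^ j) + real (i + 1) * y ^ i / q (x, y)\<bar> \<le> C * \<bar>y\<bar> ^ (K - i) * \<bar>y\<bar> ^ i"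
        using elim(1) by simp
      have "\<bar>\<Sum>j<i. \<omega> j (d (i + 1)) * y ^ j\<bar> \<le> C * \<bar>y\<bar> ^ (K - i) * \<bar>y\<bar> ^ i + \<bar>real (i + 1) / q (x, y)\<bar> * \<bar>y\<bar> ^ i + T * \<bar>y\<bar> ^ i"
      proof -
        have "\<bar>a\<bar> \<le> R + \<bar>e\<bar> + T" if "\<bar>a + b + e\<bar> \<le> R" "\<bar>b\<bar> \<le> T" for a b e R T :: real
          using that by linarith
        from this[OF 3[unfolded sp] 1] show ?thesis unfolding 2 .
      qed
      also have "\<dots> = (\<bar>real (i + 1) / q (x, y)\<bar> + T + C * \<bar>y\<bar> ^ (K - i)) * \<bar>y\<bar> ^ i" by (simp add: algebra_simps)
      also have "\<dots> \<le> B * \<bar>y\<bar> ^ i" using elim(2) by (intro mult_right_mono) (auto simp: T_def)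
      finally show ?case .
    qed
    from poly_small_eq_0[OF this j] show ?thesis .
  qed
  \<comment> \<open>In degree \<open>i\<close> the coefficient has to balance (i + 1) / q(x, 0). If
    it were 0, division by |y|^i and the limit at 0 would give (i + 1) / q(x, 0) = 0.\<close>
  have tri1: "\<omega> i (d (i + 1)) \<noteq> 0" if i: "i + 1 < k" for i
  proof
    assume z: "\<omega> i (d (i + 1)) = 0"
    have i4: "1 \<le> i + 1" "i + 1 \<le> 4" "i < K" using i k(1) K by auto
    from key[OF i4(1,2)] obtain C where C: "\<forall>\<^sub>F y in at 0.
        \<bar>(\<Sum>j<K. \<omega> j (d (i + 1)) * y ^ j) + real (i + 1) * y ^ i / q (x, y)\<bar> \<le> C * \<bar>y\<bar> ^ K" by auto
    have "\<forall>\<^sub>F y in at 0. \<bar>real (i + 1) / q (x, y)\<bar> \<le>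
        C * \<bar>y\<bar> ^ (K - i) + (\<Sum>j\<in>{Suc i..<K}. \<bar>\<omega> j (d (i + 1))\<bar> * \<bar>y\<bar> ^ (j - i))"
      using C eventually_neq_0
    proof eventually_elim
      case (elim y)
      define T where "T = (\<Sum>j\<in>{Suc i..<K}. \<bar>\<omega> j (d (i + 1))\<bar> * \<bar>y\<bar> ^ (j - i))"
      have "(\<Sum>j<K. \<omega> j (d (i + 1)) * y ^ j) = (\<Sum>j\<in>{Suc i..<K}. \<omega> j (d (i + 1)) * y ^ j)"
      proof (rule sum.mono_neutral_right)
        show "\<forall>j\<in>{..<K} - {Suc i..<K}. \<omega> j (d (i + 1)) * y ^ j = 0"
        proof
          fix j assume "j \<in> {..<K} - {Suc i..<K}"
          then have "j < i \<or> j = i" by auto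
          then show "\<omega> j (d (i + 1)) * y ^ j = 0" using tri0[OF i, of j] z by auto
        qed
      qed auto
      then have sp: "\<bar>(\<Sum>j\<in>{Suc i..<K}. \<omega> j (d (i + 1)) * y ^ j) + real (i + 1) * y ^ i / q (x, y)\<bar> \<le> C * \<bar>y\<bar> ^ K"
        using elim(1) by simp
      have "\<bar>\<Sum>j\<in>{Suc i..<K}. \<omega> j (d (i + 1)) * y ^ j\<bar> \<le> (\<Sum>j\<in>{Suc i..<K}. \<bar>\<omega> j (d (i + 1)) * y ^ j\<bar>)" by (rule sum_abs)
      also have "\<dots> = T * \<bar>y\<bar> ^ i"
        unfolding T_def sum_distrib_right
        by (intro sum.cong) (auto simp: abs_mult power_abs mult.assoc simp flip: power_add)
      finally have 1: "\<bar>\<Sum>j\<in>{Suc i..<K}. \<omega> j (d (i + 1)) * y ^ j\<bar> \<le> T * \<bar>y\<bar> ^ i" .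
      have 2: "\<bar>real (i + 1) * y ^ i / q (x, y)\<bar> = \<bar>real (i + 1) / q (x, y)\<bar> * \<bar>y\<bar> ^ i"
        by (simp add: abs_mult power_abs)
      have "\<bar>y\<bar> ^ K = \<bar>y\<bar> ^ (K - i) * \<bar>y\<bar> ^ i" using i4 by (simp flip: power_add)
      then have "\<bar>real (i + 1) / q (x, y)\<bar> * \<bar>y\<bar> ^ i \<le> C * \<bar>y\<bar> ^ (K - i) * \<bar>y\<bar> ^ i + T * \<bar>y\<bar> ^ i"
        using 1 sp unfolding 2[symmetric] by simp linarith
      then have "\<bar>real (i + 1) / q (x, y)\<bar> * \<bar>y\<bar> ^ i \<le> (C * \<bar>y\<bar> ^ (K - i) + T) * \<bar>y\<bar> ^ i"
        by (simp only: distrib_right)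
      then show ?case using elim(2) unfolding T_def by (simp only: mult_le_cancel_right) auto
    qed
    moreover have "((\<lambda>y. \<bar>real (i + 1) / q (x, y)\<bar>) \<longlongrightarrow> \<bar>real (i + 1) / q (x, 0)\<bar>) (at 0)"
      using qx0 by (intro tendsto_intros limq)
    moreover have "((\<lambda>y. C * \<bar>y\<bar> ^ (K - i) + (\<Sum>j\<in>{Suc i..<K}. \<bar>\<omega> j (d (i + 1))\<bar> * \<bar>y\<bar> ^ (j - i))) \<longlongrightarrow>
        C * \<bar>0\<bar> ^ (K - i) + (\<Sum>j\<in>{Suc i..<K}. \<bar>\<omega> j (d (i + 1))\<bar> * \<bar>0\<bar> ^ (j - i))) (at 0)"
      by (intro tendsto_intros)
    ultimately have "\<bar>real (i + 1) / q (x, 0)\<bar> \<le> C * \<bar>0\<bar> ^ (K - i) + (\<Sum>j\<in>{Suc i..<K}. \<bar>\<omega> j (d (i + 1))\<bar> * \<bar>0\<bar> ^ (j - i))"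
      using tendsto_le[OF at_neq_bot] by blast
    also have "\<dots> = 0" using i4 by (simp add: power_0_left)
    finally show False using qx0 by simp
  qed
  show ?thesis
    by (rule that[OF k2 _ \<epsilon> P q eq \<omega> tri1 tri0]) (use k(1) in simp)
qed

section \<open>Loci of double roots\<close>

lemma vec3_nth [simp]: "vec3 a b c $ 0 = a" "vec3 a b c $ 1 = b" "vec3 a b c $ 2 = c"
  by (simp_all add: vec3_def)

lemma index3: "i = 0 \<or> i = 1 \<or> i = (2::3)"
  using exhaust_3[of i] by auto

lemma vec3_eq_iff: "z = vec3 a b c \<longleftrightarrow> z $ 0 = a \<and> z $ 1 = b \<and> z $ 2 = c"
proof
  assume "z $ 0 = a \<and> z $ 1 = b \<and> z $ 2 = c"
  then show "z = vec3 a b c" unfolding vec_eq_iff using index3 by (metis vec3_nth)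
qed simp

lemma vec3_eta: "vec3 (z $ 0) (z $ 1) (z $ 2) = z"
  by (metis vec3_eq_iff)

lemma vec3_expand: "vec3 a b c = a *\<^sub>R vec3 1 0 0 + b *\<^sub>R vec3 0 1 0 + c *\<^sub>R vec3 0 0 1"
  by (rule sym, subst vec3_eq_iff) simp

lemma has_derivative_vec3:
  assumes "(f has_derivative f') F" "(g has_derivative g') F" "(h has_derivative h') F"
  shows "((\<lambda>x. vec3 (f x) (g x) (h x)) has_derivative (\<lambda>v. vec3 (f' v) (g' v) (h' v))) F"
  unfolding vec3_expand[of "f _"] vec3_expand[of "f' _"]
  by (intro has_derivative_add has_derivative_scaleR_left assms)

lemma smooth_on_vec3:
  assumes "open S" "smooth_on S f" "smooth_on S g" "smooth_on S h"
  shows "smooth_on S (\<lambda>x. vec3 (f x) (g x) (h x))"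
  unfolding vec3_expand[of "f _"]
  by (intro smooth_on_add smooth_on_scaleR smooth_on_const assms)

text \<open>An injective derivative makes \<open>\<Phi>\<close> a local diffeomorphism, so a
  description of \<open>C\<close> as a preimage of \<open>M\<close> identifies the germs.\<close>

lemma locally_diffeomorphicI:
  assumes "open U" "x \<in> U" "smooth_on U \<Phi>" "\<Phi> x = 0"
    and D: "(\<Phi> has_derivative D) (at x)" "\<And>v. D v = 0 \<Longrightarrow> v = 0"
    and C: "\<And>l. l \<in> U \<Longrightarrow> l \<in> C \<longleftrightarrow> \<Phi> l \<in> M"
  shows "locally_diffeomorphic C x M 0"
proof -
  have "frechet_derivative \<Phi> (at x) = D" using D(1) by (rule frechet_derivative_eqI)
  then have inj: "inj (frechet_derivative \<Phi> (at x))"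
    using D(2) has_derivative_linear[OF D(1)] by (simp add: linear_injective_0)
  obtain U' V g where g: "open U'" "U' \<subseteq> U" "x \<in> U'" "open V" "\<Phi> x \<in> V"
    "homeomorphism U' V \<Phi> g" "smooth_on V g"
    by (rule smooth_inverse_function[OF assms(1,3,2) inj])
  have im: "\<Phi> ` U' = V" "g ` V = U'" "\<And>z. z \<in> U' \<Longrightarrow> g (\<Phi> z) = z" "\<And>z. z \<in> V \<Longrightarrow> \<Phi> (g z) = z"
    using g(6) by (auto simp: homeomorphism_def)
  have "\<Phi> ` (C \<inter> U') = M \<inter> V"
  proof (intro set_eqI iffI)
    fix z assume "z \<in> \<Phi> ` (C \<inter> U')"
    then show "z \<in> M \<inter> V" using C g(2) im(1) by blast
  next
    fix z assume z: "z \<in> M \<inter> V"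
    then have "g z \<in> U'" "\<Phi> (g z) = z" using im by auto
    then show "z \<in> \<Phi> ` (C \<inter> U')" using C g(2) z by (metis IntD1 IntI image_eqI subsetD)
  qed
  then show ?thesis
    unfolding locally_diffeomorphic_def
    using g(1,3,4) g(5)[unfolded assms(4)] smooth_on_subset[OF assms(3) g(2)] g(7) im assms(4)
    by (intro exI[of _ U'] exI[of _ V] exI[of _ \<Phi>] exI[of _ g] conjI ballI)
qed

text \<open>The plane is pulled back by \<open>\<psi>\<close>. Projecting \<open>\<phi>\<close> to
  the first two coordinates gives a smooth left inverse of this parametrization, which yields both
  the injective derivative and the continuous inverse.\<close>

lemma regular_surface_near_plane:
  assumes "locally_diffeomorphic C x {z :: real^3. z $ 2 = 0} 0"
  shows "regular_surface_near C x"
proof -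
  obtain U V \<phi> \<psi> where d: "open U" "x \<in> U" "open V" "0 \<in> V" "smooth_on U \<phi>" "smooth_on V \<psi>"
    "\<phi> ` U = V" "\<psi> ` V = U" "\<forall>z\<in>U. \<psi> (\<phi> z) = z" "\<forall>z\<in>V. \<phi> (\<psi> z) = z" "\<phi> x = 0"
    "\<phi> ` (C \<inter> U) = {z :: real^3. z $ 2 = 0} \<inter> V"
    using assms unfolding locally_diffeomorphic_def by (elim exE conjE) (rule that, assumption+)
  define e :: "real \<times> real \<Rightarrow> real^3" where "e p = vec3 (fst p) (snd p) 0" for p
  define \<pi> :: "real^3 \<Rightarrow> real \<times> real" where "\<pi> z = (z $ 0, z $ 1)" for z
  define T where "T = {p. e p \<in> V}"
  define f where "f p = \<psi> (e p)" for p
  have sme: "smooth_on S e" if "open S" for S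
    unfolding e_def by (intro smooth_on_vec3 smooth_on_fst smooth_on_snd smooth_on_id smooth_on_const that)
  have sm\<pi>: "smooth_on U (\<lambda>l. \<pi> (\<phi> l))"
    unfolding \<pi>_def by (intro smooth_on_Pair smooth_on_vec_nth d)
  have "open (e -` V)"
    using smooth_on_imp_continuous_on[OF sme[OF open_UNIV]] d(3) by (rule open_vimage[rotated])
  then have T: "open T" by (simp add: T_def vimage_def)
  have smf: "smooth_on T f"
    unfolding f_def by (rule smooth_on_compose[OF d(6) T d(3) sme[OF T]]) (simp add: T_def)
  have fU: "f p \<in> U" if "p \<in> T" for p using that d(8) by (auto simp: T_def f_def)
  have \<pi>f: "\<pi> (\<phi> (f p)) = p" if "p \<in> T" for p
    using that d(10) by (simp add: T_def f_def \<pi>_def e_def)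
  have "inj (frechet_derivative f (at p))" if p: "p \<in> T" for p
  proof -
    have "((\<lambda>p. \<pi> (\<phi> (f p))) has_derivative
        (\<lambda>v. frechet_derivative (\<lambda>l. \<pi> (\<phi> l)) (at (f p)) (frechet_derivative f (at p) v))) (at p)"
      by (rule has_derivative_compose[OF smooth_on_has_derivative[OF smf p] smooth_on_has_derivative[OF sm\<pi> fU[OF p]]])
    moreover have "((\<lambda>p. \<pi> (\<phi> (f p))) has_derivative (\<lambda>v. v)) (at p)"
      by (rule has_derivative_transform_within_open[OF has_derivative_ident T p]) (simp add: \<pi>f)
    ultimately have "(\<lambda>v. frechet_derivative (\<lambda>l. \<pi> (\<phi> l)) (at (f p)) (frechet_derivative f (at p) v)) = (\<lambda>v. v)"
      by (rule has_derivative_unique)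
    then show ?thesis by (metis injI)
  qed
  moreover have "f ` T = C \<inter> U"
  proof (intro set_eqI iffI)
    fix l assume "l \<in> f ` T"
    then obtain p where p: "p \<in> T" "l = f p" by blast
    then have "e p \<in> {z :: real^3. z $ 2 = 0} \<inter> V" by (simp add: T_def e_def)
    then obtain z where "z \<in> C \<inter> U" "e p = \<phi> z" using d(12) by blast
    then show "l \<in> C \<inter> U" using d(9) p by (simp add: f_def)
  next
    fix l assume l: "l \<in> C \<inter> U"
    then have m: "\<phi> l $ 2 = 0" "\<phi> l \<in> V" using d(12) by auto
    then have "e (\<pi> (\<phi> l)) = \<phi> l" using vec3_eta[of "\<phi> l"] by (simp add: e_def \<pi>_def)
    then show "l \<in> f ` T" using m l d(9) by (intro image_eqI[of _ _ "\<pi> (\<phi> l)"]) (auto simp: T_def f_def)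
  qed
  moreover have "homeomorphism T (f ` T) f (\<lambda>l. \<pi> (\<phi> l))"
  proof (rule homeomorphismI)
    show "continuous_on T f" by (rule smooth_on_imp_continuous_on[OF smf])
    show "continuous_on (f ` T) (\<lambda>l. \<pi> (\<phi> l))"
      by (rule continuous_on_subset[OF smooth_on_imp_continuous_on[OF sm\<pi>]]) (use fU in auto)
  qed (auto simp: \<pi>f)
  ultimately show ?thesis
    unfolding regular_surface_near_def smooth_embedding_def using d(1,2) T smf by blast
qed

lemma kernel_of_two_functionals:
  fixes a b :: "real^3 \<Rightarrow> real"
  assumes "linear a" "linear b"
  obtains v where "v \<noteq> 0" "a v = 0" "b v = 0"
proof -
  define f where "f v = (a v, b v)" for v
  have lin: "linear f" unfolding f_def
    by (rule linearI) (simp_all add: linear_add[OF assms(1)] linear_add[OF assms(2)] linear_scale[OF assms(1)] linear_scale[OF assms(2)])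
  have "\<not> inj f"
  proof
    assume "inj f"
    then have "dim (f ` UNIV) = dim (UNIV :: (real^3) set)"
      by (intro dim_image_eq lin) simp
    moreover have "dim (f ` UNIV) \<le> DIM(real \<times> real)" by (rule dim_subset_UNIV)
    ultimately show False by simp
  qed
  then obtain v where "v \<noteq> 0" "f v = 0" using lin by (auto simp: linear_injective_0)
  then show ?thesis using that by (simp add: f_def zero_prod_def)
qed

text \<open>On \<open>d1\<close>, \<open>d2\<close>, \<open>d3\<close> the functionals have a
  triangular matrix with nonzero diagonal. Solving for \<open>r1\<close>, \<open>r2\<close>,
  \<open>r3\<close> in turn shows surjectivity, hence injectivity in dimension 3.\<close>

lemma triangular_functionals_inj:
  fixes a b c :: "real^3 \<Rightarrow> real"
  assumes lin: "linear a" "linear b" "linear c"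
    and d1: "a d1 \<noteq> 0" and d2: "a d2 = 0" "b d2 \<noteq> 0" and d3: "a d3 = 0" "b d3 = 0" "c d3 \<noteq> 0"
    and v: "a v = 0" "b v = 0" "c v = 0"
  shows "v = 0"
proof -
  define L where "L v = vec3 (a v) (b v) (c v)" for v
  have linL: "linear L"
    by (rule linearI; unfold L_def, rule sym, subst vec3_eq_iff)
      (simp_all add: linear_add[OF lin(1)] linear_add[OF lin(2)] linear_add[OF lin(3)]
        linear_scale[OF lin(1)] linear_scale[OF lin(2)] linear_scale[OF lin(3)])
  have "surj L"
  proof (rule surjI)
    fix z :: "real^3"
    define r1 where "r1 = z $ 0 / a d1"
    define r2 where "r2 = (z $ 1 - r1 * b d1) / b d2"
    define r3 where "r3 = (z $ 2 - r1 * c d1 - r2 * c d2) / c d3"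
    have "a (r1 *\<^sub>R d1 + r2 *\<^sub>R d2 + r3 *\<^sub>R d3) = z $ 0" "b (r1 *\<^sub>R d1 + r2 *\<^sub>R d2 + r3 *\<^sub>R d3) = z $ 1"
      "c (r1 *\<^sub>R d1 + r2 *\<^sub>R d2 + r3 *\<^sub>R d3) = z $ 2"
      using d1 d2 d3
      by (simp_all add: linear_add[OF lin(1)] linear_add[OF lin(2)] linear_add[OF lin(3)]
          linear_scale[OF lin(1)] linear_scale[OF lin(2)] linear_scale[OF lin(3)] r1_def r2_def r3_def)
    then show "L (let r1 = z $ 0 / a d1; r2 = (z $ 1 - r1 * b d1) / b d2; r3 = (z $ 2 - r1 * c d1 - r2 * c d2) / c d3
       in r1 *\<^sub>R d1 + r2 *\<^sub>R d2 + r3 *\<^sub>R d3) = z"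
      by (simp add: Let_def L_def vec3_eta r1_def r2_def r3_def)
  qed
  then have "inj L" using linL linear_surjective_imp_injective by blast
  moreover have "L v = 0" using v by (simp add: L_def vec_eq_iff vec3_def)
  ultimately show ?thesis using linL by (simp add: linear_injective_0)
qed

text \<open>The shift z = y + a/3 removes the quadratic term. A depressed cubic z^3 + B z + C has
  the double root \<open>z\<close> exactly when B = - 3 z^2 and C = 2 z^3, which after scaling is
  (z^2, z^3).\<close>

lemma double_root_cubic:
  fixes a b c :: real
  shows "(\<exists>y. y ^ 3 + (c + b * y + a * y\<^sup>2) = 0 \<and> 3 * y\<^sup>2 + (b + a * (2 * y)) = 0) \<longleftrightarrow>
    (\<exists>z. - (b - a\<^sup>2 / 3) / 3 = z\<^sup>2 \<and> (c - a * b / 3 + 2 * a ^ 3 / 27) / 2 = z ^ 3)"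
proof
  assume "\<exists>y. y ^ 3 + (c + b * y + a * y\<^sup>2) = 0 \<and> 3 * y\<^sup>2 + (b + a * (2 * y)) = 0"
  then obtain y where "y ^ 3 + (c + b * y + a * y\<^sup>2) = 0" "3 * y\<^sup>2 + (b + a * (2 * y)) = 0" by blast
  then have y: "c = - (y ^ 3 + b * y + a * y\<^sup>2)" "b = - (3 * y\<^sup>2 + a * (2 * y))" by linarith+
  show "\<exists>z. - (b - a\<^sup>2 / 3) / 3 = z\<^sup>2 \<and> (c - a * b / 3 + 2 * a ^ 3 / 27) / 2 = z ^ 3"
    by (rule exI[of _ "y + a / 3"]) (simp add: y field_simps power2_eq_square power3_eq_cube)
next
  assume "\<exists>z. - (b - a\<^sup>2 / 3) / 3 = z\<^sup>2 \<and> (c - a * b / 3 + 2 * a ^ 3 / 27) / 2 = z ^ 3"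
  then obtain z where z: "b = a\<^sup>2 / 3 - 3 * z\<^sup>2" "c = 2 * z ^ 3 + a * b / 3 - 2 * a ^ 3 / 27" by (auto simp: algebra_simps)
  show "\<exists>y. y ^ 3 + (c + b * y + a * y\<^sup>2) = 0 \<and> 3 * y\<^sup>2 + (b + a * (2 * y)) = 0"
    by (rule exI[of _ "z - a / 3"]) (simp add: z field_simps power2_eq_square power3_eq_cube)
qed

text \<open>A shift by a/4 removes the cubic term. A depressed quartic with quadratic coefficient A
  has the double root - u exactly when its linear coefficient is 4 u^3 + 2 u A and its constant term
  3 u^4 + u^2 A; the sign of \<open>u\<close> is chosen to match \<open>swallowtail\<close>.\<close>

lemma double_root_quartic:
  fixes a b c d :: real
  shows "(\<exists>y. y ^ 4 + (d + c * y + b * y\<^sup>2 + a * y ^ 3) = 0 \<and> 4 * y ^ 3 + (c + b * (2 * y) + a * (3 * y\<^sup>2)) = 0) \<longleftrightarrow>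
    (\<exists>u. let A = b - 3 * a\<^sup>2 / 8 in
      d - a * c / 4 + b * a\<^sup>2 / 16 - 3 * a ^ 4 / 256 = 3 * u ^ 4 + u\<^sup>2 * A \<and> c - a * b / 2 + a ^ 3 / 8 = 4 * u ^ 3 + 2 * u * A)"
    (is "?L \<longleftrightarrow> ?R")
proof
  assume ?L
  then obtain y where "y ^ 4 + (d + c * y + b * y\<^sup>2 + a * y ^ 3) = 0" "4 * y ^ 3 + (c + b * (2 * y) + a * (3 * y\<^sup>2)) = 0" by blast
  then have y: "d = - (y ^ 4 + c * y + b * y\<^sup>2 + a * y ^ 3)" "c = - (4 * y ^ 3 + b * (2 * y) + a * (3 * y\<^sup>2))"
    by linarith+
  show ?R
    by (rule exI[of _ "- y - a / 4"]) (simp add: y Let_def field_simps power2_eq_square power3_eq_cube power4_eq_xxxx)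
next
  assume ?R
  then obtain u where "d - a * c / 4 + b * a\<^sup>2 / 16 - 3 * a ^ 4 / 256 = 3 * u ^ 4 + u\<^sup>2 * (b - 3 * a\<^sup>2 / 8)"
      "c - a * b / 2 + a ^ 3 / 8 = 4 * u ^ 3 + 2 * u * (b - 3 * a\<^sup>2 / 8)"
    unfolding Let_def by blast
  then have u: "d = 3 * u ^ 4 + u\<^sup>2 * (b - 3 * a\<^sup>2 / 8) + a * c / 4 - b * a\<^sup>2 / 16 + 3 * a ^ 4 / 256"
    "c = 4 * u ^ 3 + 2 * u * (b - 3 * a\<^sup>2 / 8) + a * b / 2 - a ^ 3 / 8" by linarith+
  show ?L
    by (rule exI[of _ "- u - a / 4"]) (simp add: u field_simps power2_eq_square power3_eq_cube power4_eq_xxxx)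
qed

text \<open>The coefficients of the shifted polynomial serve as coordinates. Since all
  \<open>P i\<close> vanish at \<open>x\<close>, products of them have zero differential there, so
  up to scaling these coordinates have the differentials of \<open>P 0\<close> to
  \<open>P (k - 2)\<close>, independent by \<open>tri\<close>. Linear functionals supply the missing
  coordinates.\<close>

theorem double_root_locus:
  fixes P :: "nat \<Rightarrow> real^3 \<Rightarrow> real"
  assumes k: "2 \<le> k" "k \<le> 4"
    and U: "open U" "x \<in> U" and P: "\<And>i. smooth_on U (P i)" "\<And>i. P i x = 0"
    and \<omega>: "\<And>i. (P i has_derivative \<omega> i) (at x)"
    and tri: "\<And>i. i + 1 < k \<Longrightarrow> \<omega> i (d (i + 1)) \<noteq> 0" "\<And>i j. i + 1 < k \<Longrightarrow> j < i \<Longrightarrow> \<omega> j (d (i + 1)) = 0"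
    and C: "\<And>l. l \<in> U \<Longrightarrow> l \<in> C \<longleftrightarrow> (\<exists>y. y ^ k + (\<Sum>i<k. P i l * y ^ i) = 0 \<and>
       real k * y ^ (k - 1) + (\<Sum>i<k. P i l * (real i * y ^ (i - 1))) = 0)"
  shows "regular_surface_near C x \<or> locally_diffeomorphic C x cuspidal_edge 0 \<or> locally_diffeomorphic C x swallowtail 0"
proof -
  have lin: "linear (\<omega> i)" for i using has_derivative_linear[OF \<omega>] .
  have lini: "linear (\<lambda>v. v \<bullet> n)" for n :: "real^3" by (rule bounded_linear.linear[OF bounded_linear_inner_left])
  have smi: "smooth_on U (\<lambda>l. (l - x) \<bullet> n)" for n :: "real^3"
    by (rule smooth_on_bounded_linear[OF bounded_linear_inner_left U(1)]) (intro smooth_on_diff smooth_on_id smooth_on_const U)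
  have di: "((\<lambda>l. (l - x) \<bullet> n) has_derivative (\<lambda>v. v \<bullet> n)) (at x)" for n :: "real^3"
    by (auto intro!: derivative_eq_intros)
  note sm = smooth_on_vec3 smooth_on_add smooth_on_diff smooth_on_mult smooth_on_uminus smooth_on_power smooth_on_divide
     smooth_on_const P(1) U(1) smi
  have z: "vec3 a b c = 0 \<longleftrightarrow> a = 0 \<and> b = 0 \<and> c = 0" for a b c
    using vec3_eq_iff[of 0 a b c] by auto
  consider "k = 2" | "k = 3" | "k = 4" using k by linarith
  then show ?thesis
  proof cases
    case 1
    have t: "\<omega> 0 (d 1) \<noteq> 0" using tri(1)[of 0] 1 by simp
    \<comment> \<open>\<open>m\<close> and \<open>n\<close> form an orthogonal basis of the kernel
      of \<open>\<omega> 0\<close>, so inner products with them complete \<open>\<omega> 0\<close>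
      to coordinates.\<close>
    obtain m where m: "m \<noteq> 0" "\<omega> 0 m = 0" using kernel_of_two_functionals[OF lin lin] by blast
    obtain n where n: "n \<noteq> 0" "\<omega> 0 n = 0" "n \<bullet> m = 0" using kernel_of_two_functionals[OF lin lini] by blast
    define \<Phi> where "\<Phi> l = vec3 ((l - x) \<bullet> m) ((l - x) \<bullet> n) (P 0 l - (P 1 l)\<^sup>2 / 4)" for l
    have "locally_diffeomorphic C x {z :: real^3. z $ 2 = 0} 0"
    proof (rule locally_diffeomorphicI[OF U])
      show "smooth_on U \<Phi>" unfolding \<Phi>_def by (intro sm) auto
      show "\<Phi> x = 0" by (simp add: \<Phi>_def P(2) z)
      have "((\<lambda>l. P 0 l - (P 1 l)\<^sup>2 / 4) has_derivative \<omega> 0) (at x)"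
        by (auto intro!: derivative_eq_intros \<omega> simp: P(2))
      then show "(\<Phi> has_derivative (\<lambda>v. vec3 (v \<bullet> m) (v \<bullet> n) (\<omega> 0 v))) (at x)"
        unfolding \<Phi>_def by (intro has_derivative_vec3 di)
      show "v = 0" if "vec3 (v \<bullet> m) (v \<bullet> n) (\<omega> 0 v) = 0" for v
        by (rule triangular_functionals_inj[OF lin lini[of m] lini[of n] t m(2) _ n(2) n(3)]) (use that m(1) n(1) in \<open>auto simp: z\<close>)
      show "l \<in> C \<longleftrightarrow> \<Phi> l \<in> {z :: real^3. z $ 2 = 0}" if "l \<in> U" for l
      proof -
        have "l \<in> C \<longleftrightarrow> (\<exists>y. y\<^sup>2 + (P 0 l + P 1 l * y) = 0 \<and> 2 * y + P 1 l = 0)"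
          using C[OF that] 1 by (simp add: eval_nat_numeral)
        also have "\<dots> \<longleftrightarrow> P 0 l - (P 1 l)\<^sup>2 / 4 = 0"
        proof
          assume "\<exists>y. y\<^sup>2 + (P 0 l + P 1 l * y) = 0 \<and> 2 * y + P 1 l = 0"
          then obtain y where y: "y\<^sup>2 + (P 0 l + P 1 l * y) = 0" "2 * y + P 1 l = 0" by blast
          from y(2) have "P 1 l = - 2 * y" by linarith
          with y(1) show "P 0 l - (P 1 l)\<^sup>2 / 4 = 0" by (simp add: power2_eq_square)
        next
          assume "P 0 l - (P 1 l)\<^sup>2 / 4 = 0"
          then show "\<exists>y. y\<^sup>2 + (P 0 l + P 1 l * y) = 0 \<and> 2 * y + P 1 l = 0"
            by (intro exI[of _ "- P 1 l / 2"]) (simp add: power2_eq_square)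
        qed
        finally show ?thesis by (simp add: \<Phi>_def)
      qed
    qed
    then show ?thesis using regular_surface_near_plane by blast
  next
    case 2
    have t: "\<omega> 0 (d 1) \<noteq> 0" "\<omega> 0 (d 2) = 0" "\<omega> 1 (d 2) \<noteq> 0"
      using tri(1)[of 0] tri(1)[of 1] tri(2)[of 1 0] 2 by (auto simp: numeral_2_eq_2)
    obtain n where n: "n \<noteq> 0" "\<omega> 0 n = 0" "\<omega> 1 n = 0" using kernel_of_two_functionals[OF lin lin] by blast
    define A where "A l = - (P 1 l - (P 2 l)\<^sup>2 / 3) / 3" for l
    define B where "B l = (P 0 l - P 2 l * P 1 l / 3 + 2 * P 2 l ^ 3 / 27) / 2" for l
    define \<Phi> where "\<Phi> l = vec3 ((l - x) \<bullet> n) (A l) (B l)" for l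
    have "locally_diffeomorphic C x cuspidal_edge 0"
    proof (rule locally_diffeomorphicI[OF U])
      show "smooth_on U \<Phi>" unfolding \<Phi>_def A_def B_def by (intro sm) auto
      show "\<Phi> x = 0" by (simp add: \<Phi>_def A_def B_def P(2) z)
      have "(A has_derivative (\<lambda>v. - \<omega> 1 v / 3)) (at x)" "(B has_derivative (\<lambda>v. \<omega> 0 v / 2)) (at x)"
        unfolding A_def B_def by (auto intro!: derivative_eq_intros \<omega> simp: P(2))
      then show "(\<Phi> has_derivative (\<lambda>v. vec3 (v \<bullet> n) (- \<omega> 1 v / 3) (\<omega> 0 v / 2))) (at x)"
        unfolding \<Phi>_def by (intro has_derivative_vec3 di)
      show "v = 0" if "vec3 (v \<bullet> n) (- \<omega> 1 v / 3) (\<omega> 0 v / 2) = 0" for v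
        by (rule triangular_functionals_inj[OF lin lin lini t n(2,3)]) (use that n(1) in \<open>auto simp: z\<close>)
      show "l \<in> C \<longleftrightarrow> \<Phi> l \<in> cuspidal_edge" if "l \<in> U" for l
      proof -
        have "l \<in> C \<longleftrightarrow> (\<exists>y. y ^ 3 + (P 0 l + P 1 l * y + P 2 l * y\<^sup>2) = 0 \<and> 3 * y\<^sup>2 + (P 1 l + P 2 l * (2 * y)) = 0)"
          using C[OF that] 2 by (simp add: eval_nat_numeral)
        then show ?thesis
          unfolding double_root_cubic by (auto simp: \<Phi>_def A_def B_def cuspidal_edge_def vec3_eq_iff)
      qed
    qed
    then show ?thesis by blast
  next
    case 3
    have t: "\<omega> 0 (d 1) \<noteq> 0" "\<omega> 0 (d 2) = 0" "\<omega> 1 (d 2) \<noteq> 0" "\<omega> 0 (d 3) = 0" "\<omega> 1 (d 3) = 0" "\<omega> 2 (d 3) \<noteq> 0"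
      using tri(1)[of 0] tri(1)[of 1] tri(1)[of 2] tri(2)[of 1 0] tri(2)[of 2 0] tri(2)[of 2 1] 3
      by (auto simp: numeral_2_eq_2 numeral_3_eq_3)
    define A where "A l = P 2 l - 3 * (P 3 l)\<^sup>2 / 8" for l
    define B where "B l = P 1 l - P 3 l * P 2 l / 2 + P 3 l ^ 3 / 8" for l
    define D where "D l = P 0 l - P 3 l * P 1 l / 4 + P 2 l * (P 3 l)\<^sup>2 / 16 - 3 * P 3 l ^ 4 / 256" for l
    define \<Phi> where "\<Phi> l = vec3 (D l) (B l) (A l)" for l
    have "locally_diffeomorphic C x swallowtail 0"
    proof (rule locally_diffeomorphicI[OF U])
      show "smooth_on U \<Phi>" unfolding \<Phi>_def A_def B_def D_def by (intro sm) auto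
      show "\<Phi> x = 0" by (simp add: \<Phi>_def A_def B_def D_def P(2) z)
      have "(A has_derivative \<omega> 2) (at x)" "(B has_derivative \<omega> 1) (at x)" "(D has_derivative \<omega> 0) (at x)"
        unfolding A_def B_def D_def by (auto intro!: derivative_eq_intros \<omega> simp: P(2))
      then show "(\<Phi> has_derivative (\<lambda>v. vec3 (\<omega> 0 v) (\<omega> 1 v) (\<omega> 2 v))) (at x)"
        unfolding \<Phi>_def by (intro has_derivative_vec3)
      show "v = 0" if "vec3 (\<omega> 0 v) (\<omega> 1 v) (\<omega> 2 v) = 0" for v
        by (rule triangular_functionals_inj[OF lin lin lin t]) (use that in \<open>auto simp: z\<close>)
      show "l \<in> C \<longleftrightarrow> \<Phi> l \<in> swallowtail" if "l \<in> U" for l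
      proof -
        have "l \<in> C \<longleftrightarrow> (\<exists>y. y ^ 4 + (P 0 l + P 1 l * y + P 2 l * y\<^sup>2 + P 3 l * y ^ 3) = 0 \<and>
            4 * y ^ 3 + (P 1 l + P 2 l * (2 * y) + P 3 l * (3 * y\<^sup>2)) = 0)"
          using C[OF that] 3 by (simp add: eval_nat_numeral)
        then show ?thesis
          unfolding double_root_quartic by (auto simp: \<Phi>_def A_def B_def D_def swallowtail_def vec3_eq_iff Let_def)
      qed
    qed
    then show ?thesis by blast
  qed
qed

text \<open>With \<open>M\<close> bounding all lower powers of |y|, a root of size at least
  \<open>\<delta>\<close> would give |y|^k \<le> e k M < \<delta>^k M \<le> |y|^k. The bound keeps
  every real root inside the range where the prepared form is valid.\<close>

lemma monic_root_bound:
  fixes y :: real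
  assumes "0 < \<delta>" "\<delta> \<le> 1" "1 \<le> k" and p: "\<And>i. i < k \<Longrightarrow> \<bar>p i\<bar> < e" "e * real k < \<delta> ^ k"
    and root: "y ^ k + (\<Sum>i<k. p i * y ^ i) = 0"
  shows "\<bar>y\<bar> < \<delta>"
proof (rule ccontr)
  assume "\<not> \<bar>y\<bar> < \<delta>"
  then have y: "\<delta> \<le> \<bar>y\<bar>" by simp
  define M where "M = max 1 (\<bar>y\<bar> ^ (k - 1))"
  have e: "0 < e" using p(1)[of 0] assms(3) by auto
  have "\<bar>y\<bar> ^ i \<le> M" if "i < k" for i
  proof (cases "\<bar>y\<bar> \<le> 1")
    case True
    then show ?thesis using power_le_one[of "\<bar>y\<bar>" i] by (simp add: M_def)
  next
    case False
    then have "\<bar>y\<bar> ^ i \<le> \<bar>y\<bar> ^ (k - 1)" using that by (intro power_increasing) auto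
    then show ?thesis by (simp add: M_def)
  qed
  then have "\<bar>p i * y ^ i\<bar> \<le> e * M" if "i < k" for i
    unfolding abs_mult power_abs using that p(1)[OF that] e by (intro mult_mono) auto
  then have "(\<Sum>i<k. \<bar>p i * y ^ i\<bar>) \<le> real k * (e * M)"
    using sum_bounded_above[of "{..<k}" "\<lambda>i. \<bar>p i * y ^ i\<bar>" "e * M"] by simp
  moreover have "\<bar>y ^ k\<bar> \<le> (\<Sum>i<k. \<bar>p i * y ^ i\<bar>)"
    using root sum_abs[of "\<lambda>i. p i * y ^ i" "{..<k}"] by linarith
  ultimately have "\<bar>y\<bar> ^ k \<le> (e * real k) * M" by (simp add: power_abs mult_ac)
  also have "\<dots> < \<delta> ^ k * M" using p(2) by (simp add: M_def mult_strict_right_mono)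
  also have "\<dots> \<le> \<bar>y\<bar> ^ k"
  proof (cases "\<bar>y\<bar> ^ (k - 1) \<le> 1")
    case True
    then show ?thesis using y assms(1) by (simp add: M_def power_mono)
  next
    case False
    have "\<delta> ^ k \<le> \<delta>" using assms(1-3) power_decreasing[of 1 k \<delta>] by simp
    also have "\<delta> \<le> \<bar>y\<bar>" by (rule y)
    finally have "\<delta> ^ k * M \<le> \<bar>y\<bar> * \<bar>y\<bar> ^ (k - 1)" using False by (simp add: M_def mult_right_mono)
    then show ?thesis using assms(3) by (simp flip: power_Suc)
  qed
  finally show False by simp
qed

section \<open>Envelopes of versal families\<close>

text \<open>Multiplication by the nonvanishing \<open>q\<close> changes neither the zeros in
  \<open>y\<close> nor which of them are multiple.\<close>

lemma prepared_double_zero: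
  fixes h q :: "'a::euclidean_space \<times> real \<Rightarrow> real"
  assumes W: "B \<times> {-\<epsilon><..<\<epsilon>} \<subseteq> W" "smooth_on W h"
    and q: "smooth_on (B \<times> {-\<epsilon><..<\<epsilon>}) q" "\<And>z. z \<in> B \<times> {-\<epsilon><..<\<epsilon>} \<Longrightarrow> q z \<noteq> 0"
    and eq: "\<And>l y. l \<in> B \<Longrightarrow> \<bar>y\<bar> < \<epsilon> \<Longrightarrow> h (l, y) = q (l, y) * (y ^ k + (\<Sum>i<k. p i l * y ^ i))"
    and l: "l \<in> B" "\<bar>y\<bar> < \<epsilon>"
  shows "h (l, y) = 0 \<and> frechet_derivative h (at (l, y)) (0, 1) = 0 \<longleftrightarrow>
    y ^ k + (\<Sum>i<k. p i l * y ^ i) = 0 \<and> real k * y ^ (k - 1) + (\<Sum>i<k. p i l * (real i * y ^ (i - 1))) = 0"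
proof -
  define f where "f y = y ^ k + (\<Sum>i<k. p i l * y ^ i)" for y
  define f' where "f' y = real k * y ^ (k - 1) + (\<Sum>i<k. p i l * (real i * y ^ (i - 1)))" for y
  have f': "(f has_real_derivative f' y) (at y)"
    unfolding f_def f'_def One_nat_def by (intro DERIV_add DERIV_sum DERIV_cmult DERIV_pow)
  have m: "(l, y) \<in> B \<times> {-\<epsilon><..<\<epsilon>}" using l by auto
  have q0: "q (l, y) \<noteq> 0" by (rule q(2)[OF m])
  have "((\<lambda>y. q (l, y)) has_real_derivative frechet_derivative q (at (l, y)) (0, 1)) (at y)"
    using has_vector_derivative_slice_snd[OF smooth_on_has_derivative[OF q(1) m]]
    by (simp add: has_real_derivative_iff_has_vector_derivative)
  from DERIV_mult[OF this f']
  have "((\<lambda>y. h (l, y)) has_real_derivative (frechet_derivative q (at (l, y)) (0, 1) * f y + f' y * q (l, y))) (at y)"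
    by (rule has_field_derivative_transform_within_open[where S = "{-\<epsilon><..<\<epsilon>}"]) (use l in \<open>auto simp: eq f_def\<close>)
  moreover have "((\<lambda>y. h (l, y)) has_real_derivative frechet_derivative h (at (l, y)) (0, 1)) (at y)"
    using has_vector_derivative_slice_snd[OF smooth_on_has_derivative[OF W(2) subsetD[OF W(1) m]]]
    by (simp add: has_real_derivative_iff_has_vector_derivative)
  ultimately have "frechet_derivative h (at (l, y)) (0, 1) = frechet_derivative q (at (l, y)) (0, 1) * f y + f' y * q (l, y)"
    using DERIV_unique by blast
  moreover have "h (l, y) = q (l, y) * f y" using eq[OF l] by (simp add: f_def)
  ultimately show ?thesis using q0 by (auto simp: f_def f'_def)
qed

text \<open>The zero set of \<open>G\<close> is the graph of a function \<open>\<phi> (l, y)\<close> over the parameter \<open>l\<close> and \<open>y = s - s0\<close>;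
  the envelope equations become \<open>h = h\<^sub>y = 0\<close> for \<open>h = \<phi>\<^sub>y\<close>, and \<open>S.P\<^sup>+\<close>-versality of \<open>G\<close> becomes
  the hypothesis of \<open>versal_preparation\<close> for \<open>h\<close>.\<close>

theorem versal_envelope:
  fixes G :: "(real \<times> real) \<times> (real^3) \<Rightarrow> real"
  defines "Gs z \<equiv> frechet_derivative G (at z) ((1, 0), 0)"
    and "Gt z \<equiv> frechet_derivative G (at z) ((0, 1), 0)"
  defines "Gss z \<equiv> frechet_derivative Gs (at z) ((1, 0), 0)"
  assumes D: "open D" "(s0, t0) \<in> D" and smG: "smooth_on (D \<times> UNIV) G"
    and z0: "G ((s0, t0), x) = 0" "Gs ((s0, t0), x) = 0" "Gss ((s0, t0), x) = 0" "Gt ((s0, t0), x) \<noteq> 0"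
    and versal: "\<And>H. smooth_near (s0, t0) H \<Longrightarrow> \<exists>a b c d. smooth_near (s0, t0) a \<and>
      (\<forall>\<^sub>F p in nhds (s0, t0). H p = a p * Gs (p, x) + b p * G (p, x) + c * Gt (p, x)
         + frechet_derivative G (at (p, x)) ((0, 0), d))"
  obtains \<eta> where "0 < \<eta>"
    "\<And>J1 I1. open J1 \<Longrightarrow> s0 \<in> J1 \<Longrightarrow> J1 \<subseteq> ball s0 \<eta> \<Longrightarrow> open I1 \<Longrightarrow> t0 \<in> I1 \<Longrightarrow> I1 \<subseteq> ball t0 \<eta> \<Longrightarrow>
      \<exists>V. open V \<and> x \<in> V \<and> (\<forall>Y C. open Y \<and> x \<in> Y \<and> Y \<subseteq> V \<and> (\<forall>l\<in>Y. l \<in> C \<longleftrightarrow>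
         (\<exists>p\<in>J1 \<times> I1. G (p, l) = 0 \<and> Gs (p, l) = 0 \<and> Gss (p, l) = 0)) \<longrightarrow>
        regular_surface_near C x \<or> locally_diffeomorphic C x cuspidal_edge 0 \<or> locally_diffeomorphic C x swallowtail 0)"
proof -
  have oD: "open (D \<times> (UNIV :: (real^3) set))" using D by (intro open_Times) auto
  have smd: "smooth_on (D \<times> UNIV) (\<lambda>z. frechet_derivative G (at z) v)" for v
    by (rule smooth_on_frechet_derivative[OF smG])
  have smGs: "smooth_on (D \<times> UNIV) Gs" and smGt: "smooth_on (D \<times> UNIV) Gt"
    using smd unfolding Gs_def[abs_def] Gt_def[abs_def] by blast+
  \<comment> \<open>The variables are reordered for the implicit function theorem: parameters
    \<open>l\<close> and \<open>y = s - s0\<close> first, the unknown \<open>t\<close> last.\<close>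
  define e :: "((real^3) \<times> real) \<times> real \<Rightarrow> (real \<times> real) \<times> (real^3)"
    where "e w = ((s0 + snd (fst w), snd w), fst (fst w))" for w
  have sme: "smooth_on S e" if "open S" for S
    unfolding e_def
    by (intro smooth_on_Pair smooth_on_add smooth_on_fst smooth_on_snd smooth_on_id smooth_on_const that)
  define W0 where "W0 = e -` (D \<times> UNIV)"
  have W0: "open W0"
    unfolding W0_def using smooth_on_imp_continuous_on[OF sme[OF open_UNIV]] oD by (rule open_vimage[rotated])
  have smF: "smooth_on W0 (\<lambda>w. G (e w))"
    by (rule smooth_on_compose[OF smG W0 oD sme[OF W0]]) (simp add: W0_def)
  have m0: "((x, 0), t0) \<in> W0" using D by (simp add: W0_def e_def)
  have "frechet_derivative (\<lambda>w. G (e w)) (at ((x, 0), t0)) (0, v) = v * Gt ((s0, t0), x)" for v :: real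
  proof -
    have "(e has_derivative (\<lambda>w. ((snd (fst w), snd w), fst (fst w)))) (at ((x, 0), t0))"
      unfolding e_def by (auto intro!: derivative_eq_intros)
    from has_derivative_compose[OF this smooth_on_has_derivative[OF smG, of "e ((x, 0), t0)"]]
    have "((\<lambda>w. G (e w)) has_derivative (\<lambda>w. frechet_derivative G (at ((s0, t0), x)) ((snd (fst w), snd w), fst (fst w)))) (at ((x, 0), t0))"
      using D by (simp add: e_def)
    from frechet_derivative_eqI[OF this]
    have "frechet_derivative (\<lambda>w. G (e w)) (at ((x, 0), t0)) (0, v) = frechet_derivative G (at ((s0, t0), x)) (v *\<^sub>R ((0, 1), 0))"
      by simp
    also have "\<dots> = v * Gt ((s0, t0), x)"
    proof -
      have "linear (frechet_derivative G (at ((s0, t0), x)))"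
        by (rule has_derivative_linear[OF smooth_on_has_derivative[OF smG]]) (simp add: D)
      from linear_scale[OF this] show ?thesis by (simp only: Gt_def real_scaleR_def)
    qed
    finally show ?thesis .
  qed
  then have inj: "v = 0" if "frechet_derivative (\<lambda>w. G (e w)) (at ((x, 0), t0)) (0, v) = 0" for v
    using that z0(4) by simp
  have F0: "G (e ((x, 0), t0)) = 0" using z0(1) by (simp add: e_def)
  obtain U0 V \<phi> where U0: "open U0" "(x, 0) \<in> U0" and V: "open V" "t0 \<in> V" and UV: "U0 \<times> V \<subseteq> W0"
    and sm\<phi>0: "smooth_on U0 \<phi>" and \<phi>V: "\<And>c. c \<in> U0 \<Longrightarrow> \<phi> c \<in> V"
    and \<phi>: "\<And>c t. c \<in> U0 \<Longrightarrow> t \<in> V \<Longrightarrow> G (e (c, t)) = 0 \<longleftrightarrow> t = \<phi> c"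
  proof (rule smooth_implicit_function[OF W0 smF m0 F0])
    show "v = 0" if "frechet_derivative (\<lambda>w. G (e w)) (at ((x, 0), t0)) (0, v) = 0" for v
      by (rule inj[OF that])
  qed (rule that; assumption)
  have \<phi>0: "\<phi> (x, 0) = t0" using \<phi>[OF U0(2) V(2)] F0 by simp
  define Q where "Q c = e (c, \<phi> c)" for c
  have QD0: "Q c \<in> D \<times> UNIV" if "c \<in> U0" for c
    using UV \<phi>V[OF that] that by (auto simp: Q_def W0_def)
  have smQ0: "smooth_on U0 Q"
    unfolding Q_def by (rule smooth_on_compose[OF sme[OF open_UNIV] U0(1) open_UNIV])
      (auto intro!: smooth_on_Pair smooth_on_id U0 sm\<phi>0)
  define U where "U = {c \<in> U0. Gt (Q c) \<noteq> 0}"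
  have U: "open U" "(x, 0) \<in> U" "U \<subseteq> U0"
  proof -
    have "continuous_on U0 (\<lambda>c. Gt (Q c))"
      by (rule smooth_on_imp_continuous_on[OF smooth_on_compose[OF smGt U0(1) oD smQ0 QD0]])
    then have "open (U0 \<inter> (\<lambda>c. Gt (Q c)) -` (- {0}))"
      using U0(1) by (intro continuous_open_preimage) auto
    moreover have "U = U0 \<inter> (\<lambda>c. Gt (Q c)) -` (- {0})" by (auto simp: U_def)
    ultimately show "open U" by simp
    show "(x, 0) \<in> U" using U0(2) z0(4) \<phi>0 by (simp add: U_def Q_def e_def)
  qed (auto simp: U_def)
  have sm\<phi>: "smooth_on U \<phi>" and smQ: "smooth_on U Q"
    using smooth_on_subset[OF sm\<phi>0 U(3)] smooth_on_subset[OF smQ0 U(3)] .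
  have QD: "Q c \<in> D \<times> UNIV" if "c \<in> U" for c using QD0 U(3) that by blast
  have Gt0: "Gt (Q c) \<noteq> 0" if "c \<in> U" for c using that by (simp add: U_def)
  have GQ: "G (Q c) = 0" if "c \<in> U" for c
    using \<phi>[of c "\<phi> c"] \<phi>V U(3) that by (auto simp: Q_def)
  define h where "h c = frechet_derivative \<phi> (at c) (0, 1)" for c
  have smh: "smooth_on U h" unfolding h_def by (rule smooth_on_frechet_derivative[OF sm\<phi>])
  have dQ: "(Q has_derivative (\<lambda>w. ((snd w, frechet_derivative \<phi> (at c) w), fst w))) (at c)" if c: "c \<in> U" for c
  proof -
    note dp = smooth_on_has_derivative[OF sm\<phi> c]
    show ?thesis unfolding Q_def e_def
      by (auto intro!: derivative_eq_intros dp)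
  qed
  have DGQ: "frechet_derivative G (at (Q c)) ((r, \<tau>), v) = r * Gs (Q c) + \<tau> * Gt (Q c) + frechet_derivative G (at (Q c)) ((0, 0), v)"
    if "c \<in> U" for c r \<tau> v
  proof -
    have lin: "linear (frechet_derivative G (at (Q c)))"
      using has_derivative_linear[OF smooth_on_has_derivative[OF smG QD[OF that]]] .
    have "((r, \<tau>), v) = r *\<^sub>R ((1, 0), 0) + \<tau> *\<^sub>R ((0, 1), 0) + ((0, 0), v)" by simp
    then show ?thesis
      unfolding Gs_def Gt_def by (simp only: linear_add[OF lin] linear_scale[OF lin] real_scaleR_def)
  qed
  \<comment> \<open>The total derivative of the constant function \<open>G (Q c)\<close>; taking
    \<open>r = 0\<close>, or \<open>r = 1\<close> and \<open>v = 0\<close>, gives \<open>Gl\<close>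
    and \<open>Gsh\<close>.\<close>
  have E: "r * Gs (Q c) + frechet_derivative \<phi> (at c) (v, r) * Gt (Q c) + frechet_derivative G (at (Q c)) ((0, 0), v) = 0"
    if c: "c \<in> U" for c v r
  proof -
    have "((\<lambda>c. G (Q c)) has_derivative (\<lambda>w. frechet_derivative G (at (Q c)) ((snd w, frechet_derivative \<phi> (at c) w), fst w))) (at c)"
      by (rule has_derivative_compose[OF dQ[OF c] smooth_on_has_derivative[OF smG QD[OF c]]])
    moreover have "((\<lambda>c. G (Q c)) has_derivative (\<lambda>w. 0)) (at c)"
      by (rule has_derivative_transform_within_open[OF has_derivative_const U(1) c]) (simp add: GQ)
    ultimately have "(\<lambda>w. frechet_derivative G (at (Q c)) ((snd w, frechet_derivative \<phi> (at c) w), fst w)) = (\<lambda>w. 0)"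
      by (rule has_derivative_unique)
    from fun_cong[OF this, of "(v, r)"] show ?thesis unfolding fst_conv snd_conv DGQ[OF c, of r "frechet_derivative \<phi> (at c) (v, r)" v] .
  qed
  have Gl: "frechet_derivative G (at (Q c)) ((0, 0), v) = - frechet_derivative \<phi> (at c) (v, 0) * Gt (Q c)" if "c \<in> U" for c v
    using E[OF that, of 0 v] by simp
  have Gsh: "Gs (Q c) = - h c * Gt (Q c)" if "c \<in> U" for c
  proof -
    have "frechet_derivative G (at (Q c)) ((0, 0), 0) = 0"
      using linear_0[OF has_derivative_linear[OF smooth_on_has_derivative[OF smG QD[OF that]]]] by (simp only: zero_prod_def)
    then show ?thesis using E[OF that, of 1 0] by (simp add: h_def)
  qed
  \<comment> \<open>Along \<open>y\<close> the lift \<open>Q\<close> moves with velocity (1, h) in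
    the (s, t) plane. Where \<open>h\<close> vanishes this is the \<open>s\<close> direction, and in
    the derivative of - h \<open>Gt\<close> only the term with the derivative of \<open>h\<close>
    remains.\<close>
  have hy: "Gss (Q c) = - frechet_derivative h (at c) (0, 1) * Gt (Q c)" if c: "c \<in> U" "h c = 0" for c
  proof -
    have lin: "linear (frechet_derivative Gs (at (Q c)))"
      using has_derivative_linear[OF smooth_on_has_derivative[OF smGs QD[OF c(1)]]] .
    have 1: "((\<lambda>c. Gs (Q c)) has_derivative (\<lambda>w. frechet_derivative Gs (at (Q c)) ((snd w, frechet_derivative \<phi> (at c) w), fst w))) (at c)"
      by (rule has_derivative_compose[OF dQ[OF c(1)] smooth_on_has_derivative[OF smGs QD[OF c(1)]]])
    define k where "k = frechet_derivative (\<lambda>c. Gt (Q c)) (at c)"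
    have "((\<lambda>c. Gt (Q c)) has_derivative k) (at c)"
      unfolding k_def
      by (rule smooth_on_has_derivative[OF smooth_on_compose[OF smGt U(1) oD smQ QD] c(1)])
    from has_derivative_minus[OF has_derivative_mult[OF smooth_on_has_derivative[OF smh c(1)] this]]
    have "((\<lambda>c. - (h c * Gt (Q c))) has_derivative (\<lambda>w. - (h c * k w + frechet_derivative h (at c) w * Gt (Q c)))) (at c)" .
    then have "((\<lambda>c. Gs (Q c)) has_derivative (\<lambda>w. - (h c * k w + frechet_derivative h (at c) w * Gt (Q c)))) (at c)"
      by (rule has_derivative_transform_within_open[OF _ U(1) c(1)]) (simp add: Gsh)
    from fun_cong[OF has_derivative_unique[OF 1 this], of "(0, 1)"]
    show ?thesis using c(2) by (simp add: Gss_def h_def)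
  qed
  have char: "h c = 0 \<and> frechet_derivative h (at c) (0, 1) = 0 \<longleftrightarrow> Gs (Q c) = 0 \<and> Gss (Q c) = 0" if "c \<in> U" for c
    using Gsh[OF that] hy[OF that] Gt0[OF that] by auto
  have Qx0: "Q (x, 0) = ((s0, t0), x)" by (simp add: Q_def e_def \<phi>0)
  have "\<exists>\<delta> a d. 0 < \<delta> \<and> (\<forall>y\<in>ball 0 \<delta>. (x, y) \<in> U) \<and> smooth_on (ball 0 \<delta>) a \<and> (\<forall>y\<in>ball 0 \<delta>.
      ((\<lambda>y. a y * h (x, y)) has_real_derivative
       (real i * y ^ (i - 1) + frechet_derivative h (at (x, y)) (d, 0))) (at y))" for i
  proof -
    \<comment> \<open>The factor \<open>Gt\<close> in the test function makes division by
      \<open>Gt\<close> leave the bare monomial in \<open>y\<close>.\<close>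
    define H where "H p = Gt (p, x) * (fst p - s0) ^ i" for p
    have "smooth_on D (\<lambda>p. Gt (p, x))"
      by (rule smooth_on_compose[OF smGt D(1) oD]) (auto intro!: smooth_on_Pair smooth_on_id D)
    then have "smooth_on D H" unfolding H_def
      by (intro smooth_on_mult smooth_on_power smooth_on_diff smooth_on_fst smooth_on_id smooth_on_const D)
    then have "smooth_near (s0, t0) H" unfolding smooth_near_def using D by blast
    from versal[OF this] obtain a b c d where a: "smooth_near (s0, t0) a"
      and v: "\<forall>\<^sub>F p in nhds (s0, t0). H p = a p * Gs (p, x) + b p * G (p, x) + c * Gt (p, x)
         + frechet_derivative G (at (p, x)) ((0, 0), d)" by blast
    obtain N1 where N1: "open N1" "(s0, t0) \<in> N1" "smooth_on N1 a" using a unfolding smooth_near_def by blast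
    obtain N2 where N2: "open N2" "(s0, t0) \<in> N2" "\<And>p. p \<in> N2 \<Longrightarrow> H p = a p * Gs (p, x) + b p * G (p, x) + c * Gt (p, x)
         + frechet_derivative G (at (p, x)) ((0, 0), d)" using v unfolding eventually_nhds by blast
    define T where "T = U \<inter> (\<lambda>c. fst (Q c)) -` (N1 \<inter> N2)"
    have "continuous_on U (\<lambda>c. fst (Q c))" using smooth_on_imp_continuous_on[OF smQ] by (rule continuous_on_fst)
    then have "open T" unfolding T_def using U(1) N1(1) N2(1) by (intro continuous_open_preimage) auto
    moreover have "(x, 0) \<in> T" using U(2) N1(2) N2(2) by (simp add: T_def Qx0)
    ultimately obtain A B where AB: "open A" "open B" "x \<in> A" "0 \<in> B" "A \<times> B \<subseteq> T"
      using open_prod_elim by (metis mem_Sigma_iff)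
    obtain \<delta> where \<delta>: "0 < \<delta>" "ball 0 \<delta> \<subseteq> B" using AB(2,4) open_contains_ball by blast
    have T: "(x, y) \<in> T" if "y \<in> ball 0 \<delta>" for y using that \<delta>(2) AB by blast
    define \<alpha> where "\<alpha> y = - a (fst (Q (x, y)))" for y
    have sm\<alpha>: "smooth_on (ball 0 \<delta>) \<alpha>"
      unfolding \<alpha>_def
    proof (rule smooth_on_uminus[OF open_ball], rule smooth_on_compose[OF N1(3) open_ball N1(1)])
      show "smooth_on (ball 0 \<delta>) (\<lambda>y. fst (Q (x, y)))"
        by (rule smooth_on_fst[OF open_ball], rule smooth_on_compose[OF smQ open_ball U(1)])
          (use T in \<open>auto intro!: smooth_on_Pair smooth_on_id simp: T_def\<close>)
    qed (use T in \<open>auto simp: T_def\<close>)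
    have der: "((\<lambda>y. \<alpha> y * h (x, y)) has_real_derivative
       (real i * y ^ (i - 1) + frechet_derivative h (at (x, y)) (d, 0))) (at y)" if y: "y \<in> ball 0 \<delta>" for y
    proof -
      \<comment> \<open>On \<open>G = 0\<close> the term with \<open>b\<close> is absent, and
        division by \<open>Gt\<close> turns \<open>c * Gt\<close> into the constant
        \<open>c\<close>, which the derivative in \<open>y\<close> removes. The mixed derivative of
        \<open>\<phi>\<close> is the derivative of \<open>h\<close> along \<open>d\<close> by
        symmetry.\<close>
      have eq: "\<alpha> y * h (x, y) = y ^ i - c + frechet_derivative \<phi> (at (x, y)) (d, 0)" if "y \<in> ball 0 \<delta>" for y
      proof -
        have m: "(x, y) \<in> U" "fst (Q (x, y)) \<in> N2" using T[OF that] by (auto simp: T_def)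
        have Qe: "(fst (Q (x, y)), x) = Q (x, y)" "fst (fst (Q (x, y))) - s0 = y" by (simp_all add: Q_def e_def)
        have "Gt (Q (x, y)) * y ^ i = a (fst (Q (x, y))) * (- h (x, y) * Gt (Q (x, y))) + c * Gt (Q (x, y))
            + - frechet_derivative \<phi> (at (x, y)) (d, 0) * Gt (Q (x, y))"
          using N2(3)[OF m(2)] unfolding H_def Qe Gsh[OF m(1)] GQ[OF m(1)] Gl[OF m(1)] by simp
        then have "Gt (Q (x, y)) * (y ^ i - (\<alpha> y * h (x, y) + c - frechet_derivative \<phi> (at (x, y)) (d, 0))) = 0"
          by (simp add: \<alpha>_def algebra_simps)
        then show ?thesis using Gt0[OF m(1)] by simp
      qed
      have m: "(x, y) \<in> U" using T[OF y] by (auto simp: T_def)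
      have "((\<lambda>y. frechet_derivative \<phi> (at (x, y)) (d, 0)) has_real_derivative
          frechet_derivative (\<lambda>c. frechet_derivative \<phi> (at c) (d, 0)) (at (x, y)) (0, 1)) (at y)"
        using has_vector_derivative_slice_snd[OF smooth_on_has_derivative[OF smooth_on_frechet_derivative[OF sm\<phi>] m]]
        by (simp add: has_real_derivative_iff_has_vector_derivative)
      moreover have "frechet_derivative (\<lambda>c. frechet_derivative \<phi> (at c) (d, 0)) (at (x, y)) (0, 1) =
          frechet_derivative h (at (x, y)) (d, 0)"
        unfolding h_def[abs_def] by (rule smooth_on_second_derivative_symmetric[OF U(1) sm\<phi> m])
      ultimately have d\<phi>: "((\<lambda>y. frechet_derivative \<phi> (at (x, y)) (d, 0)) has_real_derivative
          frechet_derivative h (at (x, y)) (d, 0)) (at y)" by simp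
      have "((\<lambda>y. y ^ i - c + frechet_derivative \<phi> (at (x, y)) (d, 0)) has_real_derivative
          (real i * y ^ (i - 1) - 0 + frechet_derivative h (at (x, y)) (d, 0))) (at y)"
        unfolding One_nat_def by (rule DERIV_add[OF DERIV_diff[OF DERIV_pow DERIV_const] d\<phi>])
      then have "((\<lambda>y. \<alpha> y * h (x, y)) has_real_derivative
          (real i * y ^ (i - 1) - 0 + frechet_derivative h (at (x, y)) (d, 0))) (at y)"
        by (rule has_field_derivative_transform_within_open[OF _ open_ball y]) (simp add: eq)
      then show ?thesis by simp
    qed
    show ?thesis using \<delta>(1) sm\<alpha> der T by (intro exI[of _ \<delta>] exI[of _ \<alpha>] exI[of _ d]) (auto simp: T_def)
  qed
  then have "\<forall>i. \<exists>\<delta> a d. 0 < \<delta> \<and> (\<forall>y\<in>ball 0 \<delta>. (x, y) \<in> U) \<and> smooth_on (ball 0 \<delta>) a \<and> (\<forall>y\<in>ball 0 \<delta>.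
      ((\<lambda>y. a y * h (x, y)) has_real_derivative
       (real i * y ^ (i - 1) + frechet_derivative h (at (x, y)) (d, 0))) (at y))" by blast
  then obtain \<delta> a d where ad: "\<forall>i. 0 < \<delta> i \<and> (\<forall>y\<in>ball 0 (\<delta> i). (x, y) \<in> U) \<and> smooth_on (ball 0 (\<delta> i)) (a i) \<and> (\<forall>y\<in>ball 0 (\<delta> i).
      ((\<lambda>y. a i y * h (x, y)) has_real_derivative
       (real i * y ^ (i - 1) + frechet_derivative h (at (x, y)) (d i, 0))) (at y))"
    unfolding choice_iff by (elim exE) (rule that)
  define \<delta>0 where "\<delta>0 = Min (\<delta> ` {..4::nat})"
  have \<delta>0: "0 < \<delta>0" "\<And>i. i \<le> 4 \<Longrightarrow> \<delta>0 \<le> \<delta> i"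
    using ad unfolding \<delta>0_def by auto
  define S :: "real set" where "S = ball 0 \<delta>0"
  have S: "open S" "convex S" "0 \<in> S" using \<delta>0(1) by (simp_all add: S_def)
  have SB: "y \<in> ball 0 (\<delta> i)" if "y \<in> S" "i \<le> 4" for i y
    using that \<delta>0(2)[of i] by (simp add: S_def)
  have S4: "(x, y) \<in> U" if "y \<in> S" for y using SB[OF that, of 0] ad by blast
  \<comment> \<open>Zero beyond index 4, because the radius \<open>\<delta>0\<close> is adapted to
    the indices up to 4 only.\<close>
  define \<alpha> where "\<alpha> i = (if i \<le> 4 then a i else (\<lambda>y. 0))" for i
  have sm\<alpha>: "smooth_on S (\<alpha> i)" for i
  proof (cases "i \<le> 4")
    case True
    then have "S \<subseteq> ball 0 (\<delta> i)" using SB by blast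
    moreover have "smooth_on (ball 0 (\<delta> i)) (a i)" using ad by blast
    ultimately have "smooth_on S (a i)" by (rule smooth_on_subset[rotated])
    then show ?thesis using True by (simp add: \<alpha>_def)
  qed (simp add: \<alpha>_def)
  have vers: "((\<lambda>y. \<alpha> i y * h (x, y)) has_real_derivative
       (real i * y ^ (i - 1) + frechet_derivative h (at (x, y)) (d i, 0))) (at y)" if "1 \<le> i" "i \<le> 4" "y \<in> S" for i y
    using ad SB[OF that(3,2)] that(2) by (simp add: \<alpha>_def)
  have h0: "h (x, 0) = 0" "frechet_derivative h (at (x, 0)) (0, 1) = 0"
    using char[OF U(2)] z0(2,3) by (simp_all add: Qx0)
  obtain k \<epsilon> P q \<omega> where k: "2 \<le> k" "k \<le> 4" and \<epsilon>: "0 < \<epsilon>" "ball x \<epsilon> \<times> {-\<epsilon><..<\<epsilon>} \<subseteq> U"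
    and P: "\<And>i. smooth_on (ball x \<epsilon>) (P i)" "\<And>i. P i x = (0::real)"
    and q: "smooth_on (ball x \<epsilon> \<times> {-\<epsilon><..<\<epsilon>}) q" "\<And>z. z \<in> ball x \<epsilon> \<times> {-\<epsilon><..<\<epsilon>} \<Longrightarrow> q z \<noteq> 0"
    and heq: "\<And>l y. l \<in> ball x \<epsilon> \<Longrightarrow> \<bar>y\<bar> < \<epsilon> \<Longrightarrow> h (l, y) = q (l, y) * (y ^ k + (\<Sum>i<k. P i l * y ^ i))"
    and \<omega>: "\<And>i. (P i has_derivative \<omega> i) (at x)"
    and tri: "\<And>i. i + 1 < k \<Longrightarrow> \<omega> i (d (i + 1)) \<noteq> 0" "\<And>i j. i + 1 < k \<Longrightarrow> j < i \<Longrightarrow> \<omega> j (d (i + 1)) = 0"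
    by (rule versal_preparation[OF U(1,2) smh S S4 h0 sm\<alpha> vers]) (assumption | rule that)+
  have dz: "h (l, y) = 0 \<and> frechet_derivative h (at (l, y)) (0, 1) = 0 \<longleftrightarrow>
      y ^ k + (\<Sum>i<k. P i l * y ^ i) = 0 \<and> real k * y ^ (k - 1) + (\<Sum>i<k. P i l * (real i * y ^ (i - 1))) = 0"
    if "l \<in> ball x \<epsilon>" "\<bar>y\<bar> < \<epsilon>" for l y
    by (rule prepared_double_zero[OF \<epsilon>(2) smh q(1) _ _ that]) (erule q(2), erule (1) heq)
  have xb: "x \<in> ball x \<epsilon>" using \<epsilon>(1) by simp
  obtain \<eta>0 where \<eta>0: "0 < \<eta>0" "ball t0 \<eta>0 \<subseteq> V" using V open_contains_ball by blast
  define \<eta> where "\<eta> = min \<epsilon> \<eta>0"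
  have \<eta>: "0 < \<eta>" "\<eta> \<le> \<epsilon>" "\<eta> \<le> \<eta>0" using \<eta>0 \<epsilon> by (simp_all add: \<eta>_def)
  show ?thesis
  proof (rule that[OF \<eta>(1)])
    fix J1 I1 assume J1: "open J1" "s0 \<in> J1" "J1 \<subseteq> ball s0 \<eta>" and I1: "open I1" "t0 \<in> I1" "I1 \<subseteq> ball t0 \<eta>"
    define Z where "Z = U \<inter> Q -` ((J1 \<times> I1) \<times> UNIV)"
    have "open Z" unfolding Z_def
      using smooth_on_imp_continuous_on[OF smQ] U(1) J1 I1 by (intro continuous_open_preimage open_Times) auto
    moreover have "(x, 0) \<in> Z" using U(2) J1 I1 by (simp add: Z_def Qx0)
    ultimately obtain A B where AB: "open A" "open B" "x \<in> A" "0 \<in> B" "A \<times> B \<subseteq> Z"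
      using open_prod_elim by (metis mem_Sigma_iff)
    obtain \<delta>1 where \<delta>1: "0 < \<delta>1" "ball 0 \<delta>1 \<subseteq> B" using AB open_contains_ball by blast
    \<comment> \<open>Roots smaller than \<open>r\<close> stay over the prescribed intervals and in
      the domain of the prepared form. The cap at 1 and the size of \<open>\<epsilon>1\<close>, half
      of the admissible one, are for \<open>monic_root_bound\<close>.\<close>
    define r where "r = min (min \<delta>1 1) \<epsilon>"
    have r: "0 < r" "r \<le> 1" "r \<le> \<delta>1" "r \<le> \<epsilon>" using \<delta>1 \<epsilon> by (auto simp: r_def)
    define \<epsilon>1 where "\<epsilon>1 = r ^ k / (2 * real k)"
    have \<epsilon>1: "0 < \<epsilon>1" "\<epsilon>1 * real k < r ^ k" using r k by (simp_all add: \<epsilon>1_def)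
    have "\<forall>\<^sub>F l in nhds x. \<bar>P i l\<bar> < \<epsilon>1" for i
    proof -
      have "isCont (P i) x" using has_derivative_continuous[OF \<omega>[of i]] .
      then have "(P i \<longlongrightarrow> P i x) (nhds x)" by (simp only: isCont_def tendsto_at_iff_tendsto_nhds)
      from tendsto_rabs[OF this] have "((\<lambda>l. \<bar>P i l\<bar>) \<longlongrightarrow> 0) (nhds x)" by (simp add: P(2))
      then show ?thesis using \<epsilon>1(1) by (rule order_tendstoD)
    qed
    then have "\<forall>\<^sub>F l in nhds x. \<forall>i\<in>{..<k}. \<bar>P i l\<bar> < \<epsilon>1" by (intro eventually_ball_finite) auto
    then obtain Y where Y: "open Y" "x \<in> Y" "\<And>l. l \<in> Y \<Longrightarrow> \<forall>i\<in>{..<k}. \<bar>P i l\<bar> < \<epsilon>1"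
      unfolding eventually_nhds by blast
    define X where "X = A \<inter> Y \<inter> ball x \<epsilon>"
    have X: "open X" "x \<in> X" using AB Y xb by (auto simp: X_def)
    \<comment> \<open>From left to right, uniqueness in the implicit function theorem puts the
      parameter on the graph of \<open>\<phi>\<close>; from right to left, the roots are small
      enough for the graph to lie over \<open>J1 \<times> I1\<close>.\<close>
    have main: "(\<exists>p\<in>J1 \<times> I1. G (p, l) = 0 \<and> Gs (p, l) = 0 \<and> Gss (p, l) = 0) \<longleftrightarrow>
       (\<exists>y. y ^ k + (\<Sum>i<k. P i l * y ^ i) = 0 \<and> real k * y ^ (k - 1) + (\<Sum>i<k. P i l * (real i * y ^ (i - 1))) = 0)"
      if l: "l \<in> X" for l
    proof
      assume "\<exists>p\<in>J1 \<times> I1. G (p, l) = 0 \<and> Gs (p, l) = 0 \<and> Gss (p, l) = 0"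
      then obtain s t where st: "s \<in> J1" "t \<in> I1" "G ((s, t), l) = 0" "Gs ((s, t), l) = 0" "Gss ((s, t), l) = 0" by auto
      have lb: "l \<in> ball x \<epsilon>" using l by (simp add: X_def)
      have y: "\<bar>s - s0\<bar> < \<epsilon>" using subsetD[OF J1(3) st(1)] \<eta>(2) by (simp add: dist_real_def abs_minus_commute)
      have cU: "(l, s - s0) \<in> U" by (rule subsetD[OF \<epsilon>(2)]) (use lb y in auto)
      have "t \<in> V" using st(2) I1(3) \<eta>0(2) subset_ball[OF \<eta>(3), of t0] by blast
      then have t: "t = \<phi> (l, s - s0)" using \<phi>[of "(l, s - s0)" t] cU U(3) st(3) by (auto simp: e_def)
      then have "Q (l, s - s0) = ((s, t), l)" by (simp add: Q_def e_def)
      then have "h (l, s - s0) = 0 \<and> frechet_derivative h (at (l, s - s0)) (0, 1) = 0"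
        using char[OF cU] st by simp
      then show "\<exists>y. y ^ k + (\<Sum>i<k. P i l * y ^ i) = 0 \<and> real k * y ^ (k - 1) + (\<Sum>i<k. P i l * (real i * y ^ (i - 1))) = 0"
        using dz[OF lb y] by blast
    next
      assume "\<exists>y. y ^ k + (\<Sum>i<k. P i l * y ^ i) = 0 \<and> real k * y ^ (k - 1) + (\<Sum>i<k. P i l * (real i * y ^ (i - 1))) = 0"
      then obtain y where y: "y ^ k + (\<Sum>i<k. P i l * y ^ i) = 0"
          "real k * y ^ (k - 1) + (\<Sum>i<k. P i l * (real i * y ^ (i - 1))) = 0" by blast
      have lb: "l \<in> ball x \<epsilon>" using l by (simp add: X_def)
      have "\<bar>y\<bar> < r"
        by (rule monic_root_bound[OF r(1,2) _ _ \<epsilon>1(2) y(1)]) (use k Y(3)[of l] l in \<open>auto simp: X_def\<close>)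
      then have yr: "\<bar>y\<bar> < \<epsilon>" "y \<in> B" using r \<delta>1(2) by auto
      then have "(l, y) \<in> Z" using AB(5) l by (auto simp: X_def)
      then have c: "(l, y) \<in> U" "Q (l, y) \<in> (J1 \<times> I1) \<times> UNIV" by (auto simp: Z_def)
      have Ql: "(fst (Q (l, y)), l) = Q (l, y)" by (simp add: Q_def e_def)
      have "Gs (Q (l, y)) = 0 \<and> Gss (Q (l, y)) = 0" using char[OF c(1)] dz[OF lb yr(1)] y by blast
      then show "\<exists>p\<in>J1 \<times> I1. G (p, l) = 0 \<and> Gs (p, l) = 0 \<and> Gss (p, l) = 0"
        using GQ[OF c(1)] c(2) Ql by (intro bexI[of _ "fst (Q (l, y))"]) auto
    qed
    show "\<exists>V. open V \<and> x \<in> V \<and> (\<forall>Y C. open Y \<and> x \<in> Y \<and> Y \<subseteq> V \<and> (\<forall>l\<in>Y. l \<in> C \<longleftrightarrow>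
         (\<exists>p\<in>J1 \<times> I1. G (p, l) = 0 \<and> Gs (p, l) = 0 \<and> Gss (p, l) = 0)) \<longrightarrow>
        regular_surface_near C x \<or> locally_diffeomorphic C x cuspidal_edge 0 \<or> locally_diffeomorphic C x swallowtail 0)"
    proof (intro exI[of _ X] conjI X allI impI)
      fix Y' C assume "open Y' \<and> x \<in> Y' \<and> Y' \<subseteq> X \<and>
        (\<forall>l\<in>Y'. l \<in> C \<longleftrightarrow> (\<exists>p\<in>J1 \<times> I1. G (p, l) = 0 \<and> Gs (p, l) = 0 \<and> Gss (p, l) = 0))"
      then have Y': "open Y'" "x \<in> Y'" "Y' \<subseteq> X"
        and C: "\<And>l. l \<in> Y' \<Longrightarrow> l \<in> C \<longleftrightarrow> (\<exists>p\<in>J1 \<times> I1. G (p, l) = 0 \<and> Gs (p, l) = 0 \<and> Gss (p, l) = 0)" by blast+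
      have smP: "smooth_on Y' (P i)" for i by (rule smooth_on_subset[OF P(1)]) (use Y'(3) in \<open>auto simp: X_def\<close>)
      show "regular_surface_near C x \<or> locally_diffeomorphic C x cuspidal_edge 0 \<or> locally_diffeomorphic C x swallowtail 0"
        by (rule double_root_locus[where P = P and \<omega> = \<omega> and d = d, OF k Y'(1,2) smP P(2) \<omega> tri])
          (use C main Y'(3) in \<open>simp_all add: subset_iff\<close>)
    qed
  qed
qed

section \<open>World sheets\<close>

lemma bounded_bilinear_lorentz: "bounded_bilinear lorentz"
  unfolding bilinear_conv_bounded_bilinear[symmetric] bilinear_def
  by (intro conjI allI linearI) (simp_all add: lorentz_def algebra_simps)

lemmas lorentz_simps = bounded_bilinear.add_left[OF bounded_bilinear_lorentz] bounded_bilinear.add_right[OF bounded_bilinear_lorentz]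
  bounded_bilinear.diff_left[OF bounded_bilinear_lorentz] bounded_bilinear.diff_right[OF bounded_bilinear_lorentz]
  bounded_bilinear.minus_left[OF bounded_bilinear_lorentz] bounded_bilinear.minus_right[OF bounded_bilinear_lorentz]
  bounded_bilinear.scaleR_left[OF bounded_bilinear_lorentz] bounded_bilinear.scaleR_right[OF bounded_bilinear_lorentz]
  bounded_bilinear.zero_left[OF bounded_bilinear_lorentz] bounded_bilinear.zero_right[OF bounded_bilinear_lorentz]
  real_scaleR_def

lemmas smooth_on_lorentz = smooth_on_bounded_bilinear[OF bounded_bilinear_lorentz]

lemma lorentz_commute: "lorentz u v = lorentz v u"
  by (simp add: lorentz_def mult.commute)

text \<open>The Euclidean cross product with component 0 negated, which makes it pseudo-orthogonal
  to both factors.\<close>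

definition lorentz_cross :: "real^3 \<Rightarrow> real^3 \<Rightarrow> real^3" where
  "lorentz_cross u v = vec3 (- (u $ 1 * v $ 2 - u $ 2 * v $ 1)) (u $ 2 * v $ 0 - u $ 0 * v $ 2) (u $ 0 * v $ 1 - u $ 1 * v $ 0)"

lemma lorentz_lorentz_cross:
  "lorentz (lorentz_cross u v) u = 0" "lorentz (lorentz_cross u v) v = 0"
  "lorentz (lorentz_cross u v) (lorentz_cross u v) = (lorentz u v)\<^sup>2 - lorentz u u * lorentz v v"
  by (simp_all add: lorentz_def lorentz_cross_def algebra_simps power2_eq_square)

text \<open>A polynomial identity for arbitrary \<open>a\<close> and \<open>n\<close>, with their
  Gram determinant as factor, is checked by coordinates and then specialized. The minus sign
  reflects that the third vector is timelike.\<close>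

lemma lorentz_frame_expansion:
  assumes "lorentz a a = 1" "lorentz n n = 1" "lorentz n a = 0"
  shows "v = lorentz v a *\<^sub>R a + lorentz v n *\<^sub>R n - lorentz v (lorentz_cross a n) *\<^sub>R lorentz_cross a n"
proof -
  have "(lorentz a a * lorentz n n - lorentz a n ^ 2) *\<^sub>R v =
    (lorentz v a * lorentz n n - lorentz v n * lorentz a n) *\<^sub>R a
    + (lorentz v n * lorentz a a - lorentz v a * lorentz a n) *\<^sub>R n
    - lorentz v (lorentz_cross a n) *\<^sub>R lorentz_cross a n" (is "?l = ?r")
  proof -
    have "?l $ i = ?r $ i" for i
      using index3[of i] by (elim disjE) (simp_all add: lorentz_def lorentz_cross_def algebra_simps power2_eq_square)
    then show ?thesis by (simp add: vec_eq_iff)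
  qed
  then show ?thesis using assms by (simp add: lorentz_commute[of a n])
qed

lemma partial_s_eq:
  assumes "f differentiable (at p)"
  shows "partial_s f p = frechet_derivative f (at p) (1, 0)"
proof -
  obtain s t where p: "p = (s, t)" by force
  have D: "(f has_derivative frechet_derivative f (at p)) (at p)" using assms by (rule has_derivative_frechet)
  have "((\<lambda>x. f (x, t)) has_derivative (\<lambda>h. frechet_derivative f (at p) (h, 0))) (at s)"
    unfolding p by (rule has_derivative_slice[OF D[unfolded p]])
  moreover have "(\<lambda>h. frechet_derivative f (at p) (h, 0)) = (\<lambda>h. h *\<^sub>R frechet_derivative f (at p) (1, 0))"
  proof
    show "frechet_derivative f (at p) (h, 0) = h *\<^sub>R frechet_derivative f (at p) (1, 0)" for h
      using linear_scale[OF has_derivative_linear[OF D], of h "(1, 0)"] by simp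
  qed
  ultimately have "((\<lambda>x. f (x, t)) has_vector_derivative frechet_derivative f (at p) (1, 0)) (at s)"
    unfolding has_vector_derivative_def by (simp only:)
  then show ?thesis by (simp add: p partial_s_def vector_derivative_at)
qed

lemma partial_t_eq:
  assumes "f differentiable (at p)"
  shows "partial_t f p = frechet_derivative f (at p) (0, 1)"
proof -
  obtain s t where p: "p = (s, t)" by force
  have "((\<lambda>x. f (s, x)) has_vector_derivative frechet_derivative f (at p) (0, 1)) (at t)"
    unfolding p by (rule has_vector_derivative_slice_snd[OF has_derivative_frechet[OF assms[unfolded p]]])
  then show ?thesis by (simp add: p partial_t_def vector_derivative_at)
qed

section \<open>The moving frame of a world sheet\<close>

locale framed_world_sheet =
  fixes J I :: "real set" and \<Gamma> n :: "real \<times> real \<Rightarrow> real^3"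
  assumes world_sheet: "world_sheet J I \<Gamma>"
    and arc_length: "arc_length_parametrized J I \<Gamma>"
    and normal: "unit_pseudo_normal_field J I \<Gamma> n"
begin

text \<open>Classically \<open>a\<close>, \<open>b\<close> and \<open>a'\<close> are the partial
  derivatives of \<open>\<Gamma>\<close> in s, in t, and twice in s. The vector \<open>c\<close> is
  smooth by construction and turns out to be \<open>nT\<close> up to sign.\<close>

definition "a p = frechet_derivative \<Gamma> (at p) (1, 0)"
definition "b p = frechet_derivative \<Gamma> (at p) (0, 1)"
definition "a' p = frechet_derivative a (at p) (1, 0)"
definition "c p = lorentz_cross (a p) (n p)"

lemma open_domain: "open (J \<times> I)" and smooth_\<Gamma>: "smooth_on (J \<times> I) \<Gamma>" and smooth_n: "smooth_on (J \<times> I) n"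
  using world_sheet normal
  by (auto simp: world_sheet_def open_interval_def smooth_embedding_def unit_pseudo_normal_field_def open_Times)

lemma smooth_a: "smooth_on (J \<times> I) a"
  unfolding a_def[abs_def] by (rule smooth_on_frechet_derivative[OF smooth_\<Gamma>])

lemma smooth_c: "smooth_on (J \<times> I) c"
  unfolding c_def[abs_def] lorentz_cross_def
  by (intro smooth_on_vec3 smooth_on_uminus smooth_on_diff smooth_on_mult smooth_on_vec_nth smooth_a smooth_n open_domain)

lemma derivative_\<Gamma>:
  assumes "p \<in> J \<times> I"
  shows "frechet_derivative \<Gamma> (at p) (\<sigma>, \<tau>) = \<sigma> *\<^sub>R a p + \<tau> *\<^sub>R b p"
proof -
  have lin: "linear (frechet_derivative \<Gamma> (at p))"
    using has_derivative_linear[OF smooth_on_has_derivative[OF smooth_\<Gamma> assms]] .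
  have "(\<sigma>, \<tau>) = \<sigma> *\<^sub>R (1, 0) + \<tau> *\<^sub>R (0, 1)" by simp
  then show ?thesis unfolding a_def b_def by (simp only: linear_add[OF lin] linear_scale[OF lin])
qed

lemma partial_s_\<Gamma>: "p \<in> J \<times> I \<Longrightarrow> partial_s \<Gamma> p = a p"
  using partial_s_eq[OF smooth_on_differentiable[OF smooth_\<Gamma>]] by (simp add: a_def)

lemma tangent_plane_iff: "p \<in> J \<times> I \<Longrightarrow> v \<in> tangent_plane \<Gamma> p \<longleftrightarrow> (\<exists>\<sigma> \<tau>. v = \<sigma> *\<^sub>R a p + \<tau> *\<^sub>R b p)"
  unfolding tangent_plane_def using derivative_\<Gamma> by (auto simp: image_iff split_paired_Ex)

lemma frame:
  assumes "p \<in> J \<times> I"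
  shows "lorentz (a p) (a p) = 1" "lorentz (n p) (n p) = 1" "lorentz (n p) (a p) = 0" "lorentz (n p) (b p) = 0"
    "lorentz (c p) (a p) = 0" "lorentz (c p) (n p) = 0" "lorentz (c p) (c p) = -1"
proof -
  have "lorentz (partial_s \<Gamma> p) (partial_s \<Gamma> p) = 1"
    using arc_length assms unfolding arc_length_parametrized_def by blast
  then show 1: "lorentz (a p) (a p) = 1" by (simp only: partial_s_\<Gamma>[OF assms])
  have "a p \<in> tangent_plane \<Gamma> p" "b p \<in> tangent_plane \<Gamma> p"
    by (auto simp: a_def b_def tangent_plane_def)
  then show 2: "lorentz (n p) (n p) = 1" "lorentz (n p) (a p) = 0" "lorentz (n p) (b p) = 0"
    using normal assms by (auto simp: unit_pseudo_normal_field_def)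
  show "lorentz (c p) (a p) = 0" "lorentz (c p) (n p) = 0" "lorentz (c p) (c p) = -1"
    using 1 2 by (simp_all add: c_def lorentz_lorentz_cross lorentz_commute[of "a p" "n p"])
qed

lemma expansion:
  "p \<in> J \<times> I \<Longrightarrow> v = lorentz v (a p) *\<^sub>R a p + lorentz v (n p) *\<^sub>R n p - lorentz v (c p) *\<^sub>R c p"
  unfolding c_def by (rule lorentz_frame_expansion) (rule frame; assumption)+

text \<open>Otherwise \<open>b p\<close> would be a multiple of \<open>a p\<close>, against
  injectivity of the derivative of \<open>\<Gamma>\<close>.\<close>

lemma lorentz_b_c:
  assumes p: "p \<in> J \<times> I"
  shows "lorentz (b p) (c p) \<noteq> 0"
proof
  assume z: "lorentz (b p) (c p) = 0"
  have "b p = lorentz (b p) (a p) *\<^sub>R a p"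
    using expansion[OF p, of "b p"] z frame(4)[OF p] by (simp add: lorentz_commute)
  then have "frechet_derivative \<Gamma> (at p) (0, 1) = frechet_derivative \<Gamma> (at p) (lorentz (b p) (a p), 0)"
    using derivative_\<Gamma>[OF p, of 0 1] derivative_\<Gamma>[OF p, of "lorentz (b p) (a p)" 0] by simp
  moreover have "inj (frechet_derivative \<Gamma> (at p))"
    using world_sheet p by (auto simp: world_sheet_def smooth_embedding_def)
  ultimately show False by (auto dest: injD)
qed

lemma c_0_neq_0:
  assumes "p \<in> J \<times> I"
  shows "c p $ 0 \<noteq> 0"
proof
  assume "c p $ 0 = 0"
  then have "(c p $ 1)\<^sup>2 + (c p $ 2)\<^sup>2 = -1" using frame(7)[OF assms] by (simp add: lorentz_def power2_eq_square)
  then show False using zero_le_power2[of "c p $ 1"] zero_le_power2[of "c p $ 2"] by linarith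
qed

text \<open>Within the tangent plane the vectors pseudo-orthogonal to \<open>a p\<close> form the
  line through \<open>c p\<close>. Unit length leaves two of them, and future directed means that
  component 0 is positive.\<close>

lemma nT_eq:
  assumes p: "p \<in> J \<times> I"
  shows "nT \<Gamma> p = sgn (c p $ 0) *\<^sub>R c p"
  unfolding nT_def partial_s_\<Gamma>[OF p]
proof (rule the_equality)
  define w where "w = b p - lorentz (b p) (a p) *\<^sub>R a p"
  have "w = - lorentz (b p) (c p) *\<^sub>R c p"
    using expansion[OF p, of "b p"] frame(4)[OF p] by (simp add: w_def lorentz_commute algebra_simps)
  then have cw: "c p = (- 1 / lorentz (b p) (c p)) *\<^sub>R w" using lorentz_b_c[OF p] by simp
  have "\<exists>\<sigma> \<tau>. r *\<^sub>R c p = \<sigma> *\<^sub>R a p + \<tau> *\<^sub>R b p" for r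
    by (intro exI[of _ "r / lorentz (b p) (c p) * lorentz (b p) (a p)"] exI[of _ "- r / lorentz (b p) (c p)"],
        subst cw) (simp add: w_def algebra_simps)
  then have "sgn (c p $ 0) *\<^sub>R c p \<in> tangent_plane \<Gamma> p" using tangent_plane_iff[OF p] by blast
  moreover have "sgn (c p $ 0) * sgn (c p $ 0) = 1" using c_0_neq_0[OF p] by (simp add: sgn_if)
  moreover have "lorentz v (axis 0 1) = - v $ 0" for v by (simp add: lorentz_def axis_def)
  moreover have "0 < sgn (c p $ 0) * c p $ 0" using c_0_neq_0[OF p] by (simp add: sgn_if)
  ultimately show "sgn (c p $ 0) *\<^sub>R c p \<in> tangent_plane \<Gamma> p \<and> lorentz (sgn (c p $ 0) *\<^sub>R c p) (a p) = 0 \<and>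
      lorentz (sgn (c p $ 0) *\<^sub>R c p) (sgn (c p $ 0) *\<^sub>R c p) = - 1 \<and> future_directed (sgn (c p $ 0) *\<^sub>R c p)"
    using frame[OF p] by (simp add: future_directed_def timelike_def lorentz_simps)
next
  fix v assume v: "v \<in> tangent_plane \<Gamma> p \<and> lorentz v (a p) = 0 \<and> lorentz v v = - 1 \<and> future_directed v"
  then have "lorentz v (n p) = 0" using normal p by (auto simp: unit_pseudo_normal_field_def lorentz_commute)
  then have vc: "v = (- lorentz v (c p)) *\<^sub>R c p" using expansion[OF p, of v] v by simp
  define r where "r = - lorentz v (c p)"
  have v': "v = r *\<^sub>R c p" using vc by (simp add: r_def)
  have "r * r = 1" using v frame(7)[OF p] unfolding v' by (simp add: lorentz_simps)
  then have r: "r = 1 \<or> r = - 1" by (simp add: square_eq_1_iff)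
  have "0 < r * c p $ 0" using v unfolding v' by (simp add: future_directed_def lorentz_def axis_def)
  then have "r = sgn (c p $ 0)" using r by (auto simp: sgn_if)
  then show "v = sgn (c p $ 0) *\<^sub>R c p" using v' by simp
qed

text \<open>The component \<open>c p $ 0\<close> has no zeros, so its sign is locally
  constant.\<close>

lemma smooth_nT: "smooth_on (J \<times> I) (nT \<Gamma>)"
proof (rule smooth_on_local)
  fix p assume p: "p \<in> J \<times> I"
  define U where "U = J \<times> I \<inter> (\<lambda>q. c q $ 0 * c p $ 0) -` {0<..}"
  have "continuous_on (J \<times> I) (\<lambda>q. c q $ 0 * c p $ 0)"
    by (intro smooth_on_imp_continuous_on smooth_on_mult smooth_on_vec_nth smooth_c open_domain) simp
  then have U: "open U" unfolding U_def by (intro continuous_open_preimage open_domain) auto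
  moreover have "p \<in> U" using p c_0_neq_0[OF p] by (auto simp: U_def zero_less_mult_iff linorder_neq_iff)
  moreover have "smooth_on U (nT \<Gamma>)"
  proof (rule smooth_on_cong[OF U])
    show "sgn (c p $ 0) *\<^sub>R c q = nT \<Gamma> q" if "q \<in> U" for q
      using that nT_eq[of q] by (auto simp: U_def sgn_if zero_less_mult_iff)
    show "smooth_on U (\<lambda>q. sgn (c p $ 0) *\<^sub>R c q)"
      by (intro smooth_on_scaleR smooth_on_const U smooth_on_subset[OF smooth_c]) (simp add: U_def)
  qed
  ultimately show "\<exists>U. open U \<and> p \<in> U \<and> smooth_on U (nT \<Gamma>)" by blast
qed

lemma nT_frame:
  assumes p: "p \<in> J \<times> I"
  shows "lorentz (nT \<Gamma> p) (a p) = 0" "lorentz (nT \<Gamma> p) (n p) = 0" "lorentz (nT \<Gamma> p) (nT \<Gamma> p) = - 1"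
    "lorentz (b p) (nT \<Gamma> p) \<noteq> 0" "v = lorentz v (a p) *\<^sub>R a p + lorentz v (n p) *\<^sub>R n p - lorentz v (nT \<Gamma> p) *\<^sub>R nT \<Gamma> p"
proof -
  have s: "sgn (c p $ 0) * sgn (c p $ 0) = 1" "sgn (c p $ 0) \<noteq> 0" using c_0_neq_0[OF p] by (simp_all add: sgn_if)
  show "lorentz (nT \<Gamma> p) (a p) = 0" "lorentz (nT \<Gamma> p) (n p) = 0" "lorentz (nT \<Gamma> p) (nT \<Gamma> p) = - 1"
    "lorentz (b p) (nT \<Gamma> p) \<noteq> 0"
    using frame[OF p] s lorentz_b_c[OF p] by (simp_all add: nT_eq[OF p] lorentz_simps)
  have "lorentz v (nT \<Gamma> p) *\<^sub>R nT \<Gamma> p = (sgn (c p $ 0) * sgn (c p $ 0)) *\<^sub>R lorentz v (c p) *\<^sub>R c p"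
    by (simp only: nT_eq[OF p] lorentz_simps scaleR_scaleR mult_ac)
  then show "v = lorentz v (a p) *\<^sub>R a p + lorentz v (n p) *\<^sub>R n p - lorentz v (nT \<Gamma> p) *\<^sub>R nT \<Gamma> p"
    using expansion[OF p, of v] s(1) by simp
qed

text \<open>Differentiating the orthogonality of nT + \<epsilon> n and \<open>a\<close> in s moves
  the derivative from the normal onto \<open>a\<close>.\<close>

lemma kappa_eq:
  assumes p: "p \<in> J \<times> I"
  shows "kappa \<epsilon> \<Gamma> n p = lorentz (nT \<Gamma> p + \<epsilon> *\<^sub>R n p) (a' p)"
proof -
  define m where "m q = nT \<Gamma> q + \<epsilon> *\<^sub>R n q" for q
  have smm: "smooth_on (J \<times> I) m"
    unfolding m_def by (intro smooth_on_add smooth_on_scaleR smooth_on_const smooth_nT smooth_n open_domain)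
  note dm = smooth_on_has_derivative[OF smm p]
  note da = smooth_on_has_derivative[OF smooth_a p]
  have "((\<lambda>q. lorentz (m q) (a q)) has_derivative
      (\<lambda>w. lorentz (m p) (frechet_derivative a (at p) w) + lorentz (frechet_derivative m (at p) w) (a p))) (at p)"
    by (rule bounded_bilinear.FDERIV[OF bounded_bilinear_lorentz dm da])
  moreover have "((\<lambda>q. lorentz (m q) (a q)) has_derivative (\<lambda>w. 0)) (at p)"
    by (rule has_derivative_transform_within_open[OF has_derivative_const open_domain p])
      (simp add: m_def lorentz_simps nT_frame frame)
  ultimately have "(\<lambda>w. lorentz (m p) (frechet_derivative a (at p) w) + lorentz (frechet_derivative m (at p) w) (a p)) = (\<lambda>w. 0)"
    by (rule has_derivative_unique)
  from fun_cong[OF this, of "(1, 0)"]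
  have "lorentz (m p) (a' p) + lorentz (partial_s m p) (a p) = 0"
    using partial_s_eq[OF smooth_on_differentiable[OF smm p]] by (simp add: a'_def)
  then show ?thesis by (simp add: kappa_def partial_s_\<Gamma>[OF p] m_def[abs_def])
qed

definition "sheet \<epsilon> p l = \<epsilon> * lorentz (n p) (l - \<Gamma> p) - lorentz (nT \<Gamma> p) (l - \<Gamma> p)"

text \<open>Both equations also hold where the curvature in question is 0: division by zero then
  places the focal point at \<open>\<Gamma> p\<close>, where \<open>sheet\<close> vanishes.\<close>

lemma sheet_focal_point:
  assumes "p \<in> J \<times> I" "\<epsilon> \<in> {1, - 1}"
  shows "sheet \<epsilon> p (focal_point \<epsilon> \<Gamma> n p) = 2 / kappa \<epsilon> \<Gamma> n p" "sheet \<epsilon> p (focal_point (- \<epsilon>) \<Gamma> n p) = 0"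
  using assms frame[OF assms(1)] nT_frame[OF assms(1)]
  by (auto simp: sheet_def focal_point_def lorentz_simps lorentz_commute[of "n p" "nT \<Gamma> p"])

text \<open>The sheets of the two signs are told apart by \<open>sheet\<close>, which vanishes on the opposite sheet.\<close>

lemma focal_point_iff:
  assumes p: "p \<in> J \<times> I" and \<epsilon>: "\<epsilon> \<in> {1, - 1}" and sh: "sheet \<epsilon> p l \<noteq> 0"
  shows "kappa \<epsilon> \<Gamma> n p \<noteq> 0 \<and> l = focal_point \<epsilon> \<Gamma> n p \<longleftrightarrow>
    lorentz (\<Gamma> p - l) (\<Gamma> p - l) = 0 \<and> lorentz (\<Gamma> p - l) (a p) = 0 \<and> lorentz (\<Gamma> p - l) (a' p) = - 1" (is "?L \<longleftrightarrow> ?R")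
proof
  note f = frame[OF p] nT_frame(1-3)[OF p] kappa_eq[OF p] lorentz_commute[of "n p" "nT \<Gamma> p"]
  assume ?L
  then have k: "kappa \<epsilon> \<Gamma> n p \<noteq> 0" and l: "\<Gamma> p - l = - (1 / kappa \<epsilon> \<Gamma> n p) *\<^sub>R (nT \<Gamma> p + \<epsilon> *\<^sub>R n p)"
    by (simp_all add: focal_point_def)
  have "lorentz (nT \<Gamma> p + \<epsilon> *\<^sub>R n p) (nT \<Gamma> p + \<epsilon> *\<^sub>R n p) = 0" "lorentz (nT \<Gamma> p + \<epsilon> *\<^sub>R n p) (a p) = 0"
    using f \<epsilon> by (auto simp: lorentz_simps)
  moreover have "lorentz (\<Gamma> p - l) (a' p) = - (1 / kappa \<epsilon> \<Gamma> n p) * kappa \<epsilon> \<Gamma> n p"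
    unfolding l kappa_eq[OF p] by (simp only: lorentz_simps)
  ultimately show ?R using k unfolding l by (simp add: lorentz_simps(5-8))
next
  assume R: ?R
  define u where "u = l - \<Gamma> p"
  define r where "r = lorentz u (n p)"
  define \<tau> where "\<tau> = lorentz u (nT \<Gamma> p)"
  have g: "\<Gamma> p - l = - u" by (simp add: u_def)
  have u: "lorentz u u = 0" "lorentz u (a p) = 0" "lorentz u (a' p) = 1"
    using R unfolding g by (simp_all add: lorentz_simps)
  have e: "u = r *\<^sub>R n p - \<tau> *\<^sub>R nT \<Gamma> p" using nT_frame(5)[OF p, of u] u(2) by (simp add: r_def \<tau>_def)
  have "lorentz u u = r * r - \<tau> * \<tau>"
    using lorentz_simps(4)[of u "r *\<^sub>R n p" "\<tau> *\<^sub>R nT \<Gamma> p"] unfolding e[symmetric]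
    by (simp add: lorentz_simps(8) r_def \<tau>_def)
  \<comment> \<open>A lightlike vector in the normal plane of the curve lies on one of two lines;
    \<open>sh\<close> excludes the line of the opposite sign.\<close>
  then have "(r - \<tau>) * (r + \<tau>) = 0" using u(1) by (simp add: algebra_simps)
  moreover have "\<epsilon> * r - \<tau> \<noteq> 0"
    using sh by (simp add: sheet_def u_def r_def \<tau>_def lorentz_commute)
  ultimately have "\<tau> = - \<epsilon> * r" using \<epsilon> by auto
  moreover have "\<epsilon> * \<epsilon> = 1" using \<epsilon> by auto
  ultimately have um: "u = (\<epsilon> * r) *\<^sub>R (nT \<Gamma> p + \<epsilon> *\<^sub>R n p)"
    unfolding e by (simp add: algebra_simps)
  have "\<epsilon> * r * kappa \<epsilon> \<Gamma> n p = 1"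
    using u(3) unfolding um kappa_eq[OF p] by (simp only: lorentz_simps(7) lorentz_simps(11))
  then have k: "kappa \<epsilon> \<Gamma> n p \<noteq> 0" "\<epsilon> * r = 1 / kappa \<epsilon> \<Gamma> n p" by (auto simp: eq_divide_eq)
  have "l = \<Gamma> p + u" by (simp add: u_def)
  then show ?L using k(1) unfolding um k(2) by (simp add: focal_point_def)
qed

section \<open>Derivatives of the distance-squared function\<close>

lemma smooth_dist_sq: "smooth_on ((J \<times> I) \<times> UNIV) (\<lambda>z. dist_sq \<Gamma> (fst z) (snd z))"
proof -
  have o: "open ((J \<times> I) \<times> (UNIV :: (real^3) set))" by (intro open_Times open_UNIV open_domain[THEN open_Times[OF _ open_UNIV]] open_domain)
  have "smooth_on ((J \<times> I) \<times> (UNIV :: (real^3) set)) (\<lambda>z. \<Gamma> (fst z))"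
    by (rule smooth_on_compose[OF smooth_\<Gamma> o open_domain]) (auto intro!: smooth_on_fst smooth_on_id o)
  then show ?thesis unfolding dist_sq_def by (intro smooth_on_lorentz smooth_on_diff smooth_on_snd smooth_on_id o)
qed

lemma derivative_dist_sq:
  assumes p: "p \<in> J \<times> I"
  shows "frechet_derivative (\<lambda>z. dist_sq \<Gamma> (fst z) (snd z)) (at (p, l)) (w, v) =
    2 * lorentz (\<Gamma> p - l) (frechet_derivative \<Gamma> (at p) w - v)"
proof -
  have "((\<lambda>z. \<Gamma> (fst z)) has_derivative (\<lambda>w. frechet_derivative \<Gamma> (at p) (fst w))) (at (p, l))"
    by (rule has_derivative_compose[of fst fst]) (auto intro!: derivative_eq_intros smooth_on_has_derivative[OF smooth_\<Gamma> p])
  from has_derivative_diff[OF this has_derivative_snd[OF has_derivative_ident]]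
  have d: "((\<lambda>z. \<Gamma> (fst z) - snd z) has_derivative (\<lambda>w. frechet_derivative \<Gamma> (at p) (fst w) - snd w)) (at (p, l))" .
  have "((\<lambda>z. dist_sq \<Gamma> (fst z) (snd z)) has_derivative (\<lambda>w. lorentz (\<Gamma> p - l) (frechet_derivative \<Gamma> (at p) (fst w) - snd w)
     + lorentz (frechet_derivative \<Gamma> (at p) (fst w) - snd w) (\<Gamma> p - l))) (at (p, l))"
    using bounded_bilinear.FDERIV[OF bounded_bilinear_lorentz d d] by (simp add: dist_sq_def)
  from frechet_derivative_eqI[OF this] show ?thesis by (simp add: lorentz_commute[of _ "\<Gamma> p - l"])
qed

text \<open>The summand 1 is \<open>lorentz (a p) (a p)\<close>, by the arc-length parametrization.
  Vanishing of this second derivative is thereby the last focal equation in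
  \<open>focal_point_iff\<close>.\<close>

lemma dist_sq_ss:
  assumes p: "p \<in> J \<times> I"
  shows "frechet_derivative (\<lambda>z. frechet_derivative (\<lambda>z. dist_sq \<Gamma> (fst z) (snd z)) (at z) ((1, 0), 0)) (at (p, l)) ((1, 0), 0) =
    2 * (lorentz (\<Gamma> p - l) (a' p) + 1)"
proof -
  have o: "open ((J \<times> I) \<times> (UNIV :: (real^3) set))" by (intro open_Times open_UNIV open_domain)
  have c: "((\<lambda>z. f (fst z)) has_derivative (\<lambda>w. frechet_derivative f (at p) (fst w))) (at (p, l))"
    if "smooth_on (J \<times> I) f" for f :: "real \<times> real \<Rightarrow> real^3"
    by (rule has_derivative_compose[of fst fst]) (auto intro!: derivative_eq_intros smooth_on_has_derivative[OF that p])
  note d = bounded_bilinear.FDERIV[OF bounded_bilinear_lorentz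
      has_derivative_diff[OF c[OF smooth_\<Gamma>] has_derivative_snd[OF has_derivative_ident]] c[OF smooth_a]]
  have "((\<lambda>z. 2 * lorentz (\<Gamma> (fst z) - snd z) (a (fst z))) has_derivative
     (\<lambda>w. 2 * (lorentz (\<Gamma> p - l) (frechet_derivative a (at p) (fst w)) +
        lorentz (frechet_derivative \<Gamma> (at p) (fst w) - snd w) (a p)))) (at (p, l))"
    using has_derivative_mult_right[OF d, of 2] by simp
  then have "((\<lambda>z. frechet_derivative (\<lambda>z. dist_sq \<Gamma> (fst z) (snd z)) (at z) ((1, 0), 0)) has_derivative
     (\<lambda>w. 2 * (lorentz (\<Gamma> p - l) (frechet_derivative a (at p) (fst w)) +
        lorentz (frechet_derivative \<Gamma> (at p) (fst w) - snd w) (a p)))) (at (p, l))"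
  proof (rule has_derivative_transform_within_open[OF _ o])
    show "(p, l) \<in> (J \<times> I) \<times> UNIV" using p by simp
    show "2 * lorentz (\<Gamma> (fst z) - snd z) (a (fst z)) = frechet_derivative (\<lambda>z. dist_sq \<Gamma> (fst z) (snd z)) (at z) ((1, 0), 0)"
      if "z \<in> (J \<times> I) \<times> UNIV" for z
      using derivative_dist_sq[of "fst z" "snd z" "(1, 0)" 0] that by (simp add: a_def mem_Times_iff)
  qed
  from frechet_derivative_eqI[OF this] show ?thesis
    using frame(1)[OF p] derivative_\<Gamma>[OF p, of 1 0] by (simp add: a'_def)
qed

lemma dist_sq_partials:
  assumes p: "p \<in> J \<times> I"
  shows "partial_s (\<lambda>q. dist_sq \<Gamma> q l) p = 2 * lorentz (\<Gamma> p - l) (a p)"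
    "partial_t (\<lambda>q. dist_sq \<Gamma> q l) p = 2 * lorentz (\<Gamma> p - l) (b p)"
    "(\<Sum>j\<in>UNIV. d $ j * partial_lambda (dist_sq \<Gamma>) j p l) = - 2 * lorentz (\<Gamma> p - l) d"
proof -
  have D: "((\<lambda>z. dist_sq \<Gamma> (fst z) (snd z)) has_derivative (\<lambda>w. 2 * lorentz (\<Gamma> p - l) (frechet_derivative \<Gamma> (at p) (fst w) - snd w))) (at (p, l))"
  proof -
    have "((\<lambda>z. dist_sq \<Gamma> (fst z) (snd z)) has_derivative frechet_derivative (\<lambda>z. dist_sq \<Gamma> (fst z) (snd z)) (at (p, l))) (at (p, l))"
      by (rule smooth_on_has_derivative[OF smooth_dist_sq]) (simp add: p)
    moreover have "frechet_derivative (\<lambda>z. dist_sq \<Gamma> (fst z) (snd z)) (at (p, l)) =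
        (\<lambda>w. 2 * lorentz (\<Gamma> p - l) (frechet_derivative \<Gamma> (at p) (fst w) - snd w))"
      using derivative_dist_sq[OF p, of l] by (auto simp: fun_eq_iff)
    ultimately show ?thesis by simp
  qed
  from has_derivative_slice[OF D]
  have 1: "((\<lambda>q. dist_sq \<Gamma> q l) has_derivative (\<lambda>w. 2 * lorentz (\<Gamma> p - l) (frechet_derivative \<Gamma> (at p) w))) (at p)" by simp
  then have "(\<lambda>q. dist_sq \<Gamma> q l) differentiable (at p)" by (auto simp: differentiable_def)
  from partial_s_eq[OF this] partial_t_eq[OF this]
  show "partial_s (\<lambda>q. dist_sq \<Gamma> q l) p = 2 * lorentz (\<Gamma> p - l) (a p)"
    "partial_t (\<lambda>q. dist_sq \<Gamma> q l) p = 2 * lorentz (\<Gamma> p - l) (b p)"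
    unfolding frechet_derivative_eqI[OF 1] by (simp_all add: a_def b_def)
  have "((\<lambda>l. \<Gamma> p - l) has_derivative (\<lambda>w. - w)) (at l)" by (auto intro!: derivative_eq_intros)
  from bounded_bilinear.FDERIV[OF bounded_bilinear_lorentz this this]
  have 2: "(dist_sq \<Gamma> p has_derivative (\<lambda>w. lorentz (\<Gamma> p - l) (- w) + lorentz (- w) (\<Gamma> p - l))) (at l)"
    by (simp add: dist_sq_def[abs_def])
  have "(\<Sum>j\<in>UNIV. d $ j * partial_lambda (dist_sq \<Gamma>) j p l) = (\<Sum>j\<in>UNIV. d $ j * (- 2 * lorentz (\<Gamma> p - l) (axis j 1)))"
    unfolding partial_lambda_def frechet_derivative_eqI[OF 2]
    by (simp add: lorentz_simps(5,6) lorentz_commute[of _ "\<Gamma> p - l"])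
  also have "\<dots> = - 2 * lorentz (\<Gamma> p - l) (\<Sum>j\<in>UNIV. d $ j *\<^sub>R axis j 1)"
    by (simp only: bounded_bilinear.sum_right[OF bounded_bilinear_lorentz] sum_distrib_left lorentz_simps(8) lorentz_simps(11) mult.left_commute)
  also have "(\<Sum>j\<in>UNIV. d $ j *\<^sub>R axis j 1) = d"
    using basis_expansion[of d] by (simp add: scalar_mult_eq_scaleR)
  finally show "(\<Sum>j\<in>UNIV. d $ j * partial_lambda (dist_sq \<Gamma>) j p l) = - 2 * lorentz (\<Gamma> p - l) d" .
qed

end

theorem corollary9p5:
  fixes J I :: "real set" and \<Gamma> nS :: "real \<times> real \<Rightarrow> real^3"
    and s0 t0 \<epsilon> :: real and x :: "real^3"
  assumes "world_sheet J I \<Gamma>"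
    and "arc_length_parametrized J I \<Gamma>"
    and "unit_pseudo_normal_field J I \<Gamma> nS"
    and "SPplus_Legendrian_stable J I \<Gamma>"
    and "s0 \<in> J" and "t0 \<in> I" and "\<epsilon> \<in> {1, - 1}"
    and "kappa \<epsilon> \<Gamma> nS (s0, t0) \<noteq> 0" and "x = focal_point \<epsilon> \<Gamma> nS (s0, t0)"
  shows "\<exists>J0 I0. open_interval J0 \<and> s0 \<in> J0 \<and> J0 \<subseteq> J \<and> open_interval I0 \<and> t0 \<in> I0 \<and> I0 \<subseteq> I \<and>
           (\<forall>J1 I1. open_interval J1 \<and> s0 \<in> J1 \<and> J1 \<subseteq> J0 \<and>
                    open_interval I1 \<and> t0 \<in> I1 \<and> I1 \<subseteq> I0 \<and>
                    singular_point (total_BR_caustic J1 I1 \<Gamma> nS) x \<longrightarrow>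
              locally_diffeomorphic (total_BR_caustic J1 I1 \<Gamma> nS) x cuspidal_edge 0 \<or>
              locally_diffeomorphic (total_BR_caustic J1 I1 \<Gamma> nS) x swallowtail 0)"
proof -
  interpret framed_world_sheet J I \<Gamma> nS by unfold_locales fact+
  define p0 where "p0 = (s0, t0)"
  have p0: "p0 \<in> J \<times> I" "(s0, t0) \<in> J \<times> I" using assms(5,6) by (simp_all add: p0_def)
  have k: "kappa \<epsilon> \<Gamma> nS p0 \<noteq> 0" "x = focal_point \<epsilon> \<Gamma> nS p0" using assms(8,9) by (simp_all add: p0_def)
  have sh0: "sheet \<epsilon> p0 x \<noteq> 0" using sheet_focal_point(1)[OF p0(1) assms(7)] k by simp
  have focal: "lorentz (\<Gamma> p0 - x) (\<Gamma> p0 - x) = 0" "lorentz (\<Gamma> p0 - x) (a p0) = 0" "lorentz (\<Gamma> p0 - x) (a' p0) = - 1"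
    using focal_point_iff[OF p0(1) assms(7) sh0] k by auto
  have gx: "\<Gamma> p0 - x = (- 1 / kappa \<epsilon> \<Gamma> nS p0) *\<^sub>R (nT \<Gamma> p0 + \<epsilon> *\<^sub>R nS p0)"
    unfolding k(2) focal_point_def by simp
  \<comment> \<open>The vector from the focal point to the curve is a multiple of nT + \<epsilon>
    nS, and nS is orthogonal to the sheet. Thus the derivative of \<open>G\<close> in t is nonzero
    because nT is not orthogonal to \<open>b\<close>.\<close>
  have "lorentz (\<Gamma> p0 - x) (b p0) = (- 1 / kappa \<epsilon> \<Gamma> nS p0) * lorentz (nT \<Gamma> p0) (b p0)"
    unfolding gx using frame(4)[OF p0(1)] by (simp add: lorentz_simps(1) lorentz_simps(5) lorentz_simps(7))
  then have b0: "lorentz (\<Gamma> p0 - x) (b p0) \<noteq> 0"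
    using k(1) nT_frame(4)[OF p0(1)] by (simp add: lorentz_commute)
  have "x \<noteq> \<Gamma> p0" using focal(3) by (auto simp: lorentz_simps(9))
  then have "(p0, x) \<in> Sigma_star J I \<Gamma>"
    using p0(1) focal(1,2) dist_sq_partials(1)[OF p0(1), of x] by (simp add: Sigma_star_def dist_sq_def)
  then have versal: "inf_SPplus_K_versal (dist_sq \<Gamma>) p0 x"
    using assms(4) unfolding SPplus_Legendrian_stable_def by blast
  define G where "G z = dist_sq \<Gamma> (fst z) (snd z)" for z
  note Gdef = G_def[abs_def, symmetric]
  note DG = derivative_dist_sq[unfolded Gdef] and Gss = dist_sq_ss[unfolded Gdef] and smG = smooth_dist_sq[unfolded Gdef]
  have Gs: "frechet_derivative G (at (p, l)) ((1, 0), 0) = 2 * lorentz (\<Gamma> p - l) (a p)" if "p \<in> J \<times> I" for p l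
    unfolding DG[OF that] by (simp add: a_def)
  have Gt: "frechet_derivative G (at (p, l)) ((0, 1), 0) = 2 * lorentz (\<Gamma> p - l) (b p)" if "p \<in> J \<times> I" for p l
    unfolding DG[OF that] by (simp add: b_def)
  have Gl: "frechet_derivative G (at (p, l)) ((0, 0), d) = - 2 * lorentz (\<Gamma> p - l) d" if "p \<in> J \<times> I" for p l d
    unfolding DG[OF that] using derivative_\<Gamma>[OF that, of 0 0] by (simp add: lorentz_simps(6))
  have ver: "\<exists>a b c d. smooth_near (s0, t0) a \<and>
      (\<forall>\<^sub>F p in nhds (s0, t0). H p = a p * frechet_derivative G (at (p, x)) ((1, 0), 0) + b p * G (p, x)
         + c * frechet_derivative G (at (p, x)) ((0, 1), 0) + frechet_derivative G (at (p, x)) ((0, 0), d))"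
    if H: "smooth_near (s0, t0) H" for H
  proof -
    obtain \<alpha> \<beta> c d where v: "smooth_near p0 \<alpha>" "\<forall>\<^sub>F p in nhds p0. H p = \<alpha> p * partial_s (\<lambda>q. dist_sq \<Gamma> q x) p + \<beta> p * dist_sq \<Gamma> p x
                  + c * partial_t (\<lambda>q. dist_sq \<Gamma> q x) p + (\<Sum>j\<in>UNIV. d $ j * partial_lambda (dist_sq \<Gamma>) j p x)"
      using versal H unfolding inf_SPplus_K_versal_def p0_def[symmetric] by meson
    have "\<forall>\<^sub>F p in nhds p0. p \<in> J \<times> I" using open_domain p0(1) by (rule eventually_nhds_in_open)
    with v(2) have "\<forall>\<^sub>F p in nhds p0. H p = \<alpha> p * frechet_derivative G (at (p, x)) ((1, 0), 0) + \<beta> p * G (p, x)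
         + c * frechet_derivative G (at (p, x)) ((0, 1), 0) + frechet_derivative G (at (p, x)) ((0, 0), d)"
    proof eventually_elim
      case (elim p)
      show ?case unfolding elim(1) dist_sq_partials[OF elim(2)] Gs[OF elim(2)] Gt[OF elim(2)] Gl[OF elim(2)]
        by (simp add: G_def)
    qed
    then show ?thesis using v(1) unfolding p0_def by (intro exI conjI)
  qed
  have z: "G ((s0, t0), x) = 0" "frechet_derivative G (at ((s0, t0), x)) ((1, 0), 0) = 0"
    "frechet_derivative (\<lambda>z. frechet_derivative G (at z) ((1, 0), 0)) (at ((s0, t0), x)) ((1, 0), 0) = 0"
    "frechet_derivative G (at ((s0, t0), x)) ((0, 1), 0) \<noteq> 0"
    using focal b0 Gs[OF p0(2)] Gt[OF p0(2)] Gss[OF p0(2)] by (simp_all add: G_def dist_sq_def flip: p0_def)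
  obtain \<eta> where \<eta>: "0 < \<eta>" and env: "\<And>J1 I1. open J1 \<Longrightarrow> s0 \<in> J1 \<Longrightarrow> J1 \<subseteq> ball s0 \<eta> \<Longrightarrow> open I1 \<Longrightarrow> t0 \<in> I1 \<Longrightarrow> I1 \<subseteq> ball t0 \<eta> \<Longrightarrow>
      \<exists>V. open V \<and> x \<in> V \<and> (\<forall>Y C. open Y \<and> x \<in> Y \<and> Y \<subseteq> V \<and> (\<forall>l\<in>Y. l \<in> C \<longleftrightarrow>
         (\<exists>p\<in>J1 \<times> I1. G (p, l) = 0 \<and> frechet_derivative G (at (p, l)) ((1, 0), 0) = 0 \<and>
            frechet_derivative (\<lambda>z. frechet_derivative G (at z) ((1, 0), 0)) (at (p, l)) ((1, 0), 0) = 0)) \<longrightarrow>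
        regular_surface_near C x \<or> locally_diffeomorphic C x cuspidal_edge 0 \<or> locally_diffeomorphic C x swallowtail 0)"
    by (rule versal_envelope[OF open_domain p0(2) smG z ver]) (assumption | rule that)+
  have od: "open ((J \<times> I) \<times> (UNIV :: (real^3) set))" by (intro open_Times open_UNIV open_domain)
  have sm1: "smooth_on ((J \<times> I) \<times> (UNIV :: (real^3) set)) (\<lambda>z. f (fst z))" if "smooth_on (J \<times> I) f" for f :: "real \<times> real \<Rightarrow> real^3"
    by (rule smooth_on_compose[OF that od open_domain]) (auto intro!: smooth_on_fst smooth_on_id od)
  have "continuous_on ((J \<times> I) \<times> UNIV) (\<lambda>z. sheet \<epsilon> (fst z) (snd z))"
    unfolding sheet_def
    by (intro smooth_on_imp_continuous_on smooth_on_diff smooth_on_mult smooth_on_const smooth_on_lorentz sm1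
        smooth_n smooth_nT smooth_\<Gamma> smooth_on_snd smooth_on_id od)
  \<comment> \<open>Near \<open>(p0, x)\<close> the function \<open>sheet\<close> stays nonzero, so
    over nearby parameters no focal point of the opposite sign comes close to
    \<open>x\<close>.\<close>
  then have "open ((J \<times> I) \<times> UNIV \<inter> (\<lambda>z. sheet \<epsilon> (fst z) (snd z)) -` (- {0}))"
    by (rule continuous_open_preimage[OF _ od]) auto
  moreover have "(p0, x) \<in> (J \<times> I) \<times> UNIV \<inter> (\<lambda>z. sheet \<epsilon> (fst z) (snd z)) -` (- {0})" using p0(1) sh0 by simp
  ultimately obtain A B where AB: "open A" "open B" "(p0, x) \<in> A \<times> B"
      "A \<times> B \<subseteq> (J \<times> I) \<times> UNIV \<inter> (\<lambda>z. sheet \<epsilon> (fst z) (snd z)) -` (- {0})"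
    by (rule open_prod_elim)
  have "(s0, t0) \<in> A" using AB(3) by (simp add: p0_def)
  with AB(1) obtain A1 A2 where A12: "open A1" "open A2" "(s0, t0) \<in> A1 \<times> A2" "A1 \<times> A2 \<subseteq> A"
    by (rule open_prod_elim)
  obtain r1 r2 where r12: "0 < r1" "ball s0 r1 \<subseteq> A1" "0 < r2" "ball t0 r2 \<subseteq> A2"
    using openE[OF A12(1), of s0] openE[OF A12(2), of t0] A12(3) by (metis mem_Sigma_iff)
  define r where "r = min \<eta> (min r1 r2)"
  have r: "0 < r" "ball s0 r \<subseteq> ball s0 \<eta>" "ball t0 r \<subseteq> ball t0 \<eta>" "ball s0 r \<subseteq> A1" "ball t0 r \<subseteq> A2"
    using \<eta> r12 by (auto simp: r_def)
  have oi: "open_interval (ball c r)" for c :: real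
    using r(1) by (auto simp: open_interval_def is_interval_convex_1)
  have AD: "A \<subseteq> J \<times> I" using AB(3,4) by auto
  have sh: "sheet \<epsilon> p l \<noteq> 0" if "p \<in> A" "l \<in> B" for p l using that AB(4) by auto
  have sub: "ball s0 r \<times> ball t0 r \<subseteq> A" using r(4,5) A12(4) by blast
  have "s0 \<in> ball s0 r" "t0 \<in> ball t0 r" using r(1) by simp_all
  with sub AD have sJI: "ball s0 r \<subseteq> J" "ball t0 r \<subseteq> I" by blast+
  have main: "locally_diffeomorphic (total_BR_caustic J1 I1 \<Gamma> nS) x cuspidal_edge 0 \<or>
              locally_diffeomorphic (total_BR_caustic J1 I1 \<Gamma> nS) x swallowtail 0"
    if J1: "open_interval J1" "s0 \<in> J1" "J1 \<subseteq> ball s0 r" and I1: "open_interval I1" "t0 \<in> I1" "I1 \<subseteq> ball t0 r"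
      and sing: "singular_point (total_BR_caustic J1 I1 \<Gamma> nS) x" for J1 I1
  proof -
    define C where "C = total_BR_caustic J1 I1 \<Gamma> nS"
    have JIA: "J1 \<times> I1 \<subseteq> A" using J1(3) I1(3) sub by blast
    \<comment> \<open>Close to \<open>x\<close> the caustic consists of focal points of sign
      \<open>\<epsilon>\<close> alone, and these are described by the envelope equations for
      \<open>G\<close>.\<close>
    have mC: "l \<in> C \<longleftrightarrow> (\<exists>p\<in>J1 \<times> I1. G (p, l) = 0 \<and> frechet_derivative G (at (p, l)) ((1, 0), 0) = 0 \<and>
            frechet_derivative (\<lambda>z. frechet_derivative G (at z) ((1, 0), 0)) (at (p, l)) ((1, 0), 0) = 0)"
      if l: "l \<in> B" for l
    proof -
      have "l \<in> C \<longleftrightarrow> (\<exists>p\<in>J1 \<times> I1. (kappa 1 \<Gamma> nS p \<noteq> 0 \<and> l = focal_point 1 \<Gamma> nS p) \<or>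
          (kappa (- 1) \<Gamma> nS p \<noteq> 0 \<and> l = focal_point (- 1) \<Gamma> nS p))"
        unfolding C_def total_BR_caustic_def lightlike_focal_set_def by blast
      also have "\<dots> \<longleftrightarrow> (\<exists>p\<in>J1 \<times> I1. G (p, l) = 0 \<and> frechet_derivative G (at (p, l)) ((1, 0), 0) = 0 \<and>
            frechet_derivative (\<lambda>z. frechet_derivative G (at z) ((1, 0), 0)) (at (p, l)) ((1, 0), 0) = 0)"
      proof (rule bex_cong[OF refl])
        fix p assume "p \<in> J1 \<times> I1"
        then have pA: "p \<in> A" using JIA by blast
        then have pD: "p \<in> J \<times> I" using AD by blast
        have "l \<noteq> focal_point (- \<epsilon>) \<Gamma> nS p" using sh[OF pA l] sheet_focal_point(2)[OF pD assms(7)] by auto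
        then have "(kappa 1 \<Gamma> nS p \<noteq> 0 \<and> l = focal_point 1 \<Gamma> nS p) \<or> (kappa (- 1) \<Gamma> nS p \<noteq> 0 \<and> l = focal_point (- 1) \<Gamma> nS p)
           \<longleftrightarrow> kappa \<epsilon> \<Gamma> nS p \<noteq> 0 \<and> l = focal_point \<epsilon> \<Gamma> nS p" using assms(7) by auto
        also have "\<dots> \<longleftrightarrow> lorentz (\<Gamma> p - l) (\<Gamma> p - l) = 0 \<and> lorentz (\<Gamma> p - l) (a p) = 0 \<and> lorentz (\<Gamma> p - l) (a' p) = - 1"
          by (rule focal_point_iff[OF pD assms(7) sh[OF pA l]])
        also have "\<dots> \<longleftrightarrow> G (p, l) = 0 \<and> frechet_derivative G (at (p, l)) ((1, 0), 0) = 0 \<and>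
            frechet_derivative (\<lambda>z. frechet_derivative G (at z) ((1, 0), 0)) (at (p, l)) ((1, 0), 0) = 0"
          unfolding Gs[OF pD] Gss[OF pD] by (auto simp: G_def dist_sq_def)
        finally show "(kappa 1 \<Gamma> nS p \<noteq> 0 \<and> l = focal_point 1 \<Gamma> nS p) \<or> (kappa (- 1) \<Gamma> nS p \<noteq> 0 \<and> l = focal_point (- 1) \<Gamma> nS p)
          \<longleftrightarrow> G (p, l) = 0 \<and> frechet_derivative G (at (p, l)) ((1, 0), 0) = 0 \<and>
            frechet_derivative (\<lambda>z. frechet_derivative G (at z) ((1, 0), 0)) (at (p, l)) ((1, 0), 0) = 0" .
      qed
      finally show ?thesis .
    qed
    have J1': "open J1" "J1 \<subseteq> ball s0 \<eta>" "open I1" "I1 \<subseteq> ball t0 \<eta>"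
      using J1 I1 r(2,3) by (auto simp: open_interval_def)
    obtain V where V: "open V" "x \<in> V" and con: "\<forall>Y C. open Y \<and> x \<in> Y \<and> Y \<subseteq> V \<and> (\<forall>l\<in>Y. l \<in> C \<longleftrightarrow>
         (\<exists>p\<in>J1 \<times> I1. G (p, l) = 0 \<and> frechet_derivative G (at (p, l)) ((1, 0), 0) = 0 \<and>
            frechet_derivative (\<lambda>z. frechet_derivative G (at z) ((1, 0), 0)) (at (p, l)) ((1, 0), 0) = 0)) \<longrightarrow>
        regular_surface_near C x \<or> locally_diffeomorphic C x cuspidal_edge 0 \<or> locally_diffeomorphic C x swallowtail 0"
      using env[OF J1'(1) J1(2) J1'(2,3) I1(2) J1'(4)] by (elim exE conjE) (rule that)
    have "regular_surface_near C x \<or> locally_diffeomorphic C x cuspidal_edge 0 \<or> locally_diffeomorphic C x swallowtail 0"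
    proof (rule con[THEN spec, THEN spec, THEN mp], intro conjI ballI)
      show "open (V \<inter> B)" "x \<in> V \<inter> B" "V \<inter> B \<subseteq> V" using V AB by auto
    qed (rule mC, simp)
    then show ?thesis using sing unfolding C_def singular_point_def by blast
  qed
  show ?thesis
    by (intro exI[of _ "ball s0 r"] exI[of _ "ball t0 r"] conjI allI impI oi sJI main)
      (use r(1) in \<open>simp_all\<close>)
qed

end
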